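(* Let $K$ be either a number field or a finite separable extension of $\mathbb{F}_p(t)$ (for some prime $p$), and let $\mathcal{O}_K$ be its ring of integers (in the function field case, the integral closure of $\mathbb{F}_p[t]$ in $K$). Let $S$ be a cofinite set of prime ideals of $\mathcal{O}_K$, and let $$\mathcal{O}_{K,S}=\{x\in K : \operatorname{ord}_{\mathfrak{p}}(x)\ge 0 \text{ for every nonzero prime } \mathfrak{p}\text{ of }\mathcal{O}_K \text{ with } \mathfrak{p}\notin S\}.$$ Then the existential theory of $\mathcal{O}_{K,S}$ in the language $\mathcal{L}_{\mathrm{div}}=\{=,0,1,+,\mid\}$ is decidable; that is, there is an algorithm which, given an existential $\mathcal{L}_{\mathrm{div}}$-sentence, decides whether it holds in $(\mathcal{O}_{K,S},0,1,+,\mid)$.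
   Context: The symbol $\mid$ is interpreted as divisibility in the ring $\mathcal{O}_{K,S}$: $x\mid y$ iff there is $z\in\mathcal{O}_{K,S}$ with $xz=y$. The places at infinity (archimedean places for number fields, the places above the infinite place of $\mathbb{F}_p(t)$ for function fields) impose no condition on $\mathcal{O}_{K,S}$. *)

theory Defs
  imports
    "HOL-Computational_Algebra.Polynomial"
    "HOL-Algebra.Ideal_Product"
    "HOL-Library.Extended"
    "HOL-Library.Nat_Bijection"
begin

section \<open>Global fields and their rings of integers\<close>

text \<open>
  The field \<open>K\<close> is the universe of a type of class \<open>field\<close>. In such a type,
  \<open>\<int>\<close> is the range of \<open>of_int\<close>: a copy of the integers if the characteristic is 0, and
  the prime field \<open>F\<^sub>p\<close> if the characteristic is \<open>p\<close>. The subrings of \<open>K\<close> over which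
  integers are taken are \<open>\<int>\<close> and \<open>F\<^sub>p[t]\<close>, the latter being \<open>polys_in t\<close>.
\<close>

definition polys_over :: "'a::field set \<Rightarrow> 'a poly set" where
  "polys_over A = {f. \<forall>i. coeff f i \<in> A}"

definition polys_in :: "'a::field \<Rightarrow> 'a set" where
  "polys_in t = {poly f t | f. f \<in> polys_over \<int>}"

definition fractions :: "'a::field set \<Rightarrow> 'a set" where
  "fractions A = {a / b | a b. a \<in> A \<and> b \<in> A \<and> b \<noteq> 0}"

definition finite_over :: "'a::field set \<Rightarrow> bool" where
  "finite_over F \<longleftrightarrow>
     (\<exists>B. finite B \<and> (\<forall>x. \<exists>c. (\<forall>b\<in>B. c b \<in> F) \<and> x = (\<Sum>b\<in>B. c b * b)))"

definition minimal_poly :: "'a::field set \<Rightarrow> 'a \<Rightarrow> 'a poly \<Rightarrow> bool" where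
  "minimal_poly F x f \<longleftrightarrow>
     f \<in> polys_over F \<and> lead_coeff f = 1 \<and> poly f x = 0 \<and>
     (\<forall>g \<in> polys_over F. g \<noteq> 0 \<and> poly g x = 0 \<longrightarrow> degree f \<le> degree g)"

text \<open>
  Coprimality of \<open>f\<close> and its derivative is meant in \<open>K[X]\<close>. This is the same as coprimality
  in \<open>F[X]\<close>, and says that \<open>f\<close> has no repeated root in an algebraic closure.
\<close>

definition separable_over :: "'a::field set \<Rightarrow> bool" where
  "separable_over F \<longleftrightarrow> (\<forall>x. \<exists>f. minimal_poly F x f \<and> coprime f (pderiv f))"

definition number_field :: "'a::field itself \<Rightarrow> bool" where
  "number_field _ \<longleftrightarrow> CHAR('a) = 0 \<and> finite_over (fractions (\<int> :: 'a set))"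

text \<open>\<open>K\<close> is a finite separable extension of \<open>F\<^sub>p(t)\<close>, with \<open>t\<close> transcendental over \<open>F\<^sub>p\<close>.\<close>

definition function_field :: "'a::field \<Rightarrow> bool" where
  "function_field t \<longleftrightarrow>
     prime CHAR('a) \<and>
     (\<forall>f \<in> polys_over \<int>. poly f t = 0 \<longrightarrow> f = 0) \<and>
     finite_over (fractions (polys_in t)) \<and>
     separable_over (fractions (polys_in t))"

definition integral_closure :: "'a::field set \<Rightarrow> 'a set" where
  "integral_closure A = {x. \<exists>f \<in> polys_over A. lead_coeff f = 1 \<and> poly f x = 0}"

definition ring_of_integers :: "'a::field set \<Rightarrow> 'a ring" where
  "ring_of_integers A =
     \<lparr>carrier = integral_closure A, monoid.mult = (*), one = 1, ring.zero = 0, add = (+)\<rparr>"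


section \<open>Orders at primes and \<open>S\<close>-integers\<close>

text \<open>
  For \<open>x \<noteq> 0\<close> in the ring of integers, the exponent of \<open>P\<close> in the factorization of the
  ideal \<open>(x)\<close> is the largest \<open>n\<close> such that \<open>P\<^sup>n\<close> divides, i.e. contains, \<open>(x)\<close>.
  Powers are taken in the multiplicative monoid of ideals.
\<close>

definition ord_int :: "'a::field set \<Rightarrow> 'a set \<Rightarrow> 'a \<Rightarrow> nat" where
  "ord_int A P x = (GREATEST n. x \<in> P [^]\<^bsub>ideals_set (ring_of_integers A)\<^esub> (n::nat))"

definition ord_at :: "'a::field set \<Rightarrow> 'a set \<Rightarrow> 'a \<Rightarrow> int extended" where
  "ord_at A P x =
     (if x = 0 then Pinf
      else Fin (THE n. \<exists>a b. a \<in> integral_closure A \<and> b \<in> integral_closure A \<and>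
                  a \<noteq> 0 \<and> b \<noteq> 0 \<and> x = a / b \<and>
                  n = int (ord_int A P a) - int (ord_int A P b)))"

definition prime_ideals :: "'a::field set \<Rightarrow> 'a set set" where
  "prime_ideals A = {P. primeideal P (ring_of_integers A)}"

definition S_integers :: "'a::field set \<Rightarrow> 'a set set \<Rightarrow> 'a set" where
  "S_integers A S = {x. \<forall>P \<in> prime_ideals A. P \<noteq> {0} \<and> P \<notin> S \<longrightarrow> 0 \<le> ord_at A P x}"


section \<open>The language of divisibility\<close>

datatype tm = TZero | TOne | TVar nat | TAdd tm tm

datatype fm =
    Eq tm tm
  | Divides tm tm
  | Neg fm
  | And fm fm
  | Or fm fm
  | Exists nat fm
  | Forall nat fm

fun tm_val :: "(nat \<Rightarrow> 'a::field) \<Rightarrow> tm \<Rightarrow> 'a" where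
  "tm_val e TZero = 0"
| "tm_val e TOne = 1"
| "tm_val e (TVar i) = e i"
| "tm_val e (TAdd s t) = tm_val e s + tm_val e t"

text \<open>Truth in the structure with domain \<open>R\<close>, a subring of a field.\<close>

fun sat :: "'a::field set \<Rightarrow> (nat \<Rightarrow> 'a) \<Rightarrow> fm \<Rightarrow> bool" where
  "sat R e (Eq s t) \<longleftrightarrow> tm_val e s = tm_val e t"
| "sat R e (Divides s t) \<longleftrightarrow> (\<exists>z\<in>R. tm_val e s * z = tm_val e t)"
| "sat R e (Neg p) \<longleftrightarrow> \<not> sat R e p"
| "sat R e (And p q) \<longleftrightarrow> sat R e p \<and> sat R e q"
| "sat R e (Or p q) \<longleftrightarrow> sat R e p \<or> sat R e q"
| "sat R e (Exists i p) \<longleftrightarrow> (\<exists>x\<in>R. sat R (e(i := x)) p)"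
| "sat R e (Forall i p) \<longleftrightarrow> (\<forall>x\<in>R. sat R (e(i := x)) p)"

fun tm_vars :: "tm \<Rightarrow> nat set" where
  "tm_vars TZero = {}"
| "tm_vars TOne = {}"
| "tm_vars (TVar i) = {i}"
| "tm_vars (TAdd s t) = tm_vars s \<union> tm_vars t"

fun free_vars :: "fm \<Rightarrow> nat set" where
  "free_vars (Eq s t) = tm_vars s \<union> tm_vars t"
| "free_vars (Divides s t) = tm_vars s \<union> tm_vars t"
| "free_vars (Neg p) = free_vars p"
| "free_vars (And p q) = free_vars p \<union> free_vars q"
| "free_vars (Or p q) = free_vars p \<union> free_vars q"
| "free_vars (Exists i p) = free_vars p - {i}"
| "free_vars (Forall i p) = free_vars p - {i}"

fun quantifier_free :: "fm \<Rightarrow> bool" where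
  "quantifier_free (Eq s t) \<longleftrightarrow> True"
| "quantifier_free (Divides s t) \<longleftrightarrow> True"
| "quantifier_free (Neg p) \<longleftrightarrow> quantifier_free p"
| "quantifier_free (And p q) \<longleftrightarrow> quantifier_free p \<and> quantifier_free q"
| "quantifier_free (Or p q) \<longleftrightarrow> quantifier_free p \<and> quantifier_free q"
| "quantifier_free (Exists i p) \<longleftrightarrow> False"
| "quantifier_free (Forall i p) \<longleftrightarrow> False"

inductive existential :: "fm \<Rightarrow> bool" where
  "quantifier_free p \<Longrightarrow> existential p"
| "existential p \<Longrightarrow> existential (Exists i p)"

definition existential_sentence :: "fm \<Rightarrow> bool" where
  "existential_sentence p \<longleftrightarrow> existential p \<and> free_vars p = {}"

text \<open>The choice of assignment is immaterial, as sentences have no free variables.\<close>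

definition holds_in :: "'a::field set \<Rightarrow> fm \<Rightarrow> bool" where
  "holds_in R p \<longleftrightarrow> sat R (\<lambda>_. 0) p"

fun tm_code :: "tm \<Rightarrow> nat" where
  "tm_code TZero = prod_encode (0, 0)"
| "tm_code TOne = prod_encode (1, 0)"
| "tm_code (TVar i) = prod_encode (2, i)"
| "tm_code (TAdd s t) = prod_encode (3, prod_encode (tm_code s, tm_code t))"

fun fm_code :: "fm \<Rightarrow> nat" where
  "fm_code (Eq s t) = prod_encode (0, prod_encode (tm_code s, tm_code t))"
| "fm_code (Divides s t) = prod_encode (1, prod_encode (tm_code s, tm_code t))"
| "fm_code (Neg p) = prod_encode (2, fm_code p)"
| "fm_code (And p q) = prod_encode (3, prod_encode (fm_code p, fm_code q))"
| "fm_code (Or p q) = prod_encode (4, prod_encode (fm_code p, fm_code q))"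
| "fm_code (Exists i p) = prod_encode (5, prod_encode (i, fm_code p))"
| "fm_code (Forall i p) = prod_encode (6, prod_encode (i, fm_code p))"

lemma inj_tm_code: "inj tm_code"
proof (rule injI)
  show "tm_code s = tm_code t \<Longrightarrow> s = t" for s t
    by (induction s arbitrary: t; case_tac t) auto
qed

lemma inj_fm_code: "inj fm_code"
proof (rule injI)
  show "fm_code p = fm_code q \<Longrightarrow> p = q" for p q
    by (induction p arbitrary: q; case_tac q) (auto dest: injD[OF inj_tm_code])
qed


section \<open>Algorithms\<close>

text \<open>
  Algorithms are programs for partial recursive functions: zero, successor, projections,
  composition, primitive recursion and unbounded minimization. \<open>computes f xs y\<close> says that
  program \<open>f\<close> halts on input \<open>xs\<close> with output \<open>y\<close>. Arities are not tracked: a program is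
  stuck when an argument it needs is missing, and ignores arguments it does not need.
\<close>

datatype recf =
    Zero_fn
  | Succ_fn
  | Proj nat
  | Comp recf "recf list"
  | Prim_rec recf recf
  | Minimize recf

inductive computes :: "recf \<Rightarrow> nat list \<Rightarrow> nat \<Rightarrow> bool" where
  zero: "computes Zero_fn xs 0"
| succ: "computes Succ_fn (x # xs) (Suc x)"
| proj: "i < length xs \<Longrightarrow> computes (Proj i) xs (xs ! i)"
| comp: "list_all2 (\<lambda>g y. computes g xs y) gs ys \<Longrightarrow> computes f ys z \<Longrightarrow>
           computes (Comp f gs) xs z"
| rec_0: "computes f xs y \<Longrightarrow> computes (Prim_rec f g) (0 # xs) y"
| rec_Suc: "computes (Prim_rec f g) (n # xs) y \<Longrightarrow> computes g (n # y # xs) z \<Longrightarrow>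
           computes (Prim_rec f g) (Suc n # xs) z"
| minimize: "computes f (n # xs) 0 \<Longrightarrow> (\<forall>m<n. \<exists>y. computes f (m # xs) (Suc y)) \<Longrightarrow>
           computes (Minimize f) xs n"

lemma computes_deterministic:
  assumes "computes f xs y" "computes f xs z"
  shows "y = z"
  using assms
proof (induction arbitrary: z rule: computes.induct)
  case (comp xs gs ys f w)
  from comp.prems obtain ys' where ys': "list_all2 (\<lambda>g y. computes g xs y) gs ys'"
    "computes f ys' z" by cases auto
  have "ys = ys'"
    using comp.IH(1) ys'(1) by (auto simp: list_all2_conv_all_nth intro!: nth_equalityI)
  with ys'(2) comp.IH(2) show ?case by blast
next
  case (minimize f n xs)
  from minimize.prems have z: "computes f (z # xs) 0" "\<forall>m<z. \<exists>y. computes f (m # xs) (Suc y)"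
    by (cases, auto)+
  have "\<not> z < n" using minimize.IH(2) z(1) by blast
  moreover have "\<not> n < z" using minimize.IH(1) z(2) by blast
  ultimately show ?case by simp
next
  case (rec_Suc f g n xs y w)
  from rec_Suc.prems obtain y' where "computes (Prim_rec f g) (n # xs) y'"
    "computes g (n # y' # xs) z" by cases auto
  with rec_Suc.IH show ?case by blast
next
  case (zero xs)
  then show ?case by cases auto
next
  case (succ x xs)
  then show ?case by cases auto
next
  case (proj i xs)
  from proj.prems show ?case by cases auto
next
  case (rec_0 f xs y g)
  from rec_0.prems have "computes f xs z" by cases auto
  with rec_0.IH show ?case by blast
qed

definition existential_theory_decidable :: "'a::field set \<Rightarrow> bool" where
  "existential_theory_decidable R \<longleftrightarrow>
     (\<exists>f. \<forall>p. existential_sentence p \<longrightarrow>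
        computes f [fm_code p] (if holds_in R p then 1 else 0))"

end

theory Submission
  imports Defs "HOL-Library.Function_Algebras" "HOL-Computational_Algebra.Primes"
begin

text \<open>
  The ring is the intersection of finitely many discrete valuation rings of \<open>K\<close>, so
  divisibility is a conjunction of comparisons of valuations, and an existential sentence asks
  for a tuple whose integral linear forms vanish or are ordered by the valuations in a prescribed
  way. At each place, \<open>K\<close> is compared with a computable module of integer sequences having the
  same residue field and ramification. In a back-and-forth argument, a new element is determined,
  as far as the forms are concerned, by its nearest center (a form in the old elements), its
  distance to that center and a residue class; so it can be matched in the other module if
  differences of valuations agree up to some bound, and with entries bounded by a computable
  function. In the direction back to \<open>K\<close>, weak approximation glues the places. Hence a bounded
  search among sequences decides the sentence.

  That the orders at primes are valuations rests on the finiteness of the ring of integers modulo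
  a prime element of the base ring. It yields an element that generates the inverse of the prime ideal
  locally, and replaces the finite generation of ideals in the proof that the ring is a Dedekind domain.
\<close>

section \<open>Computable functions\<close>

text \<open>No computable presentation of \<open>K\<close> is given, so the program never computes
  in \<open>K\<close>: it knows only the number of places and the triples \<open>p\<close>,
  \<open>e\<close>, \<open>f\<close>, built into it as constants; matching with \<open>K\<close>
  occurs in the correctness proof alone. Two obstacles shape the bookkeeping. First, integers cannot
  be inverted among sequences and only a bounded amount of agreement can be maintained. So tuples
  count up to a common factor, and every added element costs height and tolerance: to keep the forms
  of height \<open>H\<close>, those of height \<open>2 * (fact H * H)\<close> must agree before the
  step, since two centers of height at most \<open>fact H * H\<close> get subtracted. Secondly, a
  linear relation in \<open>K\<close> holds at all places at once, while sequences at different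
  places are unrelated. Uniformity of relations must therefore be demanded of the candidates, for
  forms of larger height than those of the formula; and the direction from \<open>K\<close> to
  sequences has to be run at that larger height. When \<open>S\<close> contains all nonzero primes,
  the ring is \<open>K\<close> itself, and a single trivial place stands in for the
  valuations.\<close>

definition computable_list :: "nat \<Rightarrow> (nat list \<Rightarrow> nat) \<Rightarrow> bool" where
  "computable_list k f \<longleftrightarrow> (\<exists>r. \<forall>xs. length xs = k \<longrightarrow> computes r xs (f xs))"

lemma computable_list_cong:
  assumes "computable_list k f" "\<And>xs. length xs = k \<Longrightarrow> f xs = g xs"
  shows "computable_list k g"
  using assms unfolding computable_list_def by metis

lemma computable_list_proj: "i < k \<Longrightarrow> computable_list k (\<lambda>xs. xs ! i)"
  unfolding computable_list_def by (metis computes.proj)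

lemma computable_list_compose:
  assumes f: "computable_list (length gs) f" and gs: "\<And>g. g \<in> set gs \<Longrightarrow> computable_list k g"
  shows "computable_list k (\<lambda>xs. f (map (\<lambda>g. g xs) gs))"
proof -
  from f obtain rf where rf: "\<And>xs. length xs = length gs \<Longrightarrow> computes rf xs (f xs)"
    unfolding computable_list_def by blast
  from gs obtain rg where rg: "\<And>g xs. g \<in> set gs \<Longrightarrow> length xs = k \<Longrightarrow> computes (rg g) xs (g xs)"
    unfolding computable_list_def by metis
  have "computes (Comp rf (map rg gs)) xs (f (map (\<lambda>g. g xs) gs))" if "length xs = k" for xs
    by (rule computes.comp[of xs _ "map (\<lambda>g. g xs) gs"])
       (use that rf rg in \<open>auto simp: list_all2_conv_all_nth\<close>)
  then show ?thesis unfolding computable_list_def by blast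
qed

lemma computable_list_compose1:
  "computable_list 1 f \<Longrightarrow> computable_list k g \<Longrightarrow> computable_list k (\<lambda>xs. f [g xs])"
  using computable_list_compose[of "[g]" f k] by simp

lemma computable_list_Suc: "computable_list k f \<Longrightarrow> computable_list k (\<lambda>xs. Suc (f xs))"
proof -
  have "computable_list 1 (\<lambda>xs. Suc (hd xs))"
    unfolding computable_list_def
    by (intro exI[of _ Succ_fn]) (auto simp: length_Suc_conv intro: computes.succ)
  then show "computable_list k f \<Longrightarrow> ?thesis" using computable_list_compose1 by fastforce
qed

lemma computable_list_const: "computable_list k (\<lambda>_. c)"
proof (induction c)
  case 0
  show ?case unfolding computable_list_def by (metis computes.zero)
qed (rule computable_list_Suc)

text \<open>The recursion argument is the head and the parameters are the tail, as in
  \<open>Prim_rec\<close>; \<open>computable_list_rec\<close> then allows any computable number of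
  steps.\<close>

lemma computable_list_rec_raw:
  assumes "computable_list k f" "computable_list (Suc (Suc k)) g"
  shows "computable_list (Suc k) (\<lambda>xs. rec_nat (f (tl xs)) (\<lambda>n y. g (n # y # tl xs)) (hd xs))"
proof -
  from assms obtain rf rg where rf: "\<And>xs. length xs = k \<Longrightarrow> computes rf xs (f xs)"
    and rg: "\<And>xs. length xs = Suc (Suc k) \<Longrightarrow> computes rg xs (g xs)"
    unfolding computable_list_def by blast
  have "computes (Prim_rec rf rg) (n # xs) (rec_nat (f xs) (\<lambda>n y. g (n # y # xs)) n)"
    if "length xs = k" for n xs
  proof (induction n)
    case 0
    show ?case using rf that by (auto intro: computes.rec_0)
  next
    case (Suc n)
    show ?case using computes.rec_Suc[OF Suc] rg that by auto
  qed
  then show ?thesis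
    unfolding computable_list_def by (intro exI[of _ "Prim_rec rf rg"]) (auto simp: length_Suc_conv)
qed

lemma computable_list_rec:
  assumes "computable_list k f" "computable_list (Suc (Suc k)) g" "computable_list k h"
  shows "computable_list k (\<lambda>xs. rec_nat (f xs) (\<lambda>n y. g (n # y # xs)) (h xs))"
proof -
  let ?gs = "h # map (\<lambda>i xs. xs ! i) [0..<k]"
  have "computable_list k (\<lambda>xs. (\<lambda>ys. rec_nat (f (tl ys)) (\<lambda>n y. g (n # y # tl ys)) (hd ys))
      (map (\<lambda>g. g xs) ?gs))"
    by (rule computable_list_compose)
       (use computable_list_rec_raw[OF assms(1,2)] assms(3) computable_list_proj in auto)
  moreover have "map (\<lambda>i. xs ! i) [0..<length xs] = xs" for xs :: "nat list"
    by (rule map_nth)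
  ultimately show ?thesis by (elim computable_list_cong) (auto simp: comp_def)
qed

lemma computable_list_add:
  assumes "computable_list k f" "computable_list k g"
  shows "computable_list k (\<lambda>xs. f xs + g xs)"
proof -
  have "computable_list k (\<lambda>xs. rec_nat (f xs) (\<lambda>n y. (\<lambda>zs. Suc (zs ! 1)) (n # y # xs)) (g xs))"
    by (intro computable_list_rec assms computable_list_Suc computable_list_proj) simp
  moreover have "rec_nat a (\<lambda>n y. Suc y) b = a + b" for a b by (induction b) auto
  ultimately show ?thesis by simp
qed

lemma computable_list_pred:
  assumes "computable_list k f"
  shows "computable_list k (\<lambda>xs. f xs - 1)"
proof -
  have "computable_list k (\<lambda>xs. rec_nat 0 (\<lambda>n y. (\<lambda>zs. zs ! 0) (n # y # xs)) (f xs))"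
    by (intro computable_list_rec assms computable_list_const computable_list_proj) simp
  moreover have "rec_nat 0 (\<lambda>n y. n) b = b - 1" for b :: nat by (induction b) auto
  ultimately show ?thesis by simp
qed

lemma computable_list_diff:
  assumes "computable_list k f" "computable_list k g"
  shows "computable_list k (\<lambda>xs. f xs - g xs)"
proof -
  have "computable_list k (\<lambda>xs. rec_nat (f xs) (\<lambda>n y. (\<lambda>zs. zs ! 1 - 1) (n # y # xs)) (g xs))"
    by (intro computable_list_rec assms computable_list_pred computable_list_proj) simp
  moreover have "rec_nat a (\<lambda>n y. y - 1) b = a - b" for a b :: nat by (induction b) auto
  ultimately show ?thesis by simp
qed

text \<open>Case distinction as primitive recursion: the start value is \<open>f\<close>, and every
  later step discards the previous value and returns \<open>g\<close>.\<close>

lemma computable_list_if: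
  assumes "computable_list k c" "computable_list k f" "computable_list k g"
  shows "computable_list k (\<lambda>xs. if c xs = 0 then f xs else g xs)"
proof -
  have g: "computable_list (Suc (Suc k)) (\<lambda>zs. g (tl (tl zs)))"
  proof -
    have "computable_list (Suc (Suc k)) (\<lambda>zs. g (map (\<lambda>h. h zs) (map (\<lambda>i zs. zs ! Suc (Suc i)) [0..<k])))"
      by (rule computable_list_compose) (use assms(3) in \<open>auto intro!: computable_list_proj\<close>)
    moreover have "map (\<lambda>h. h zs) (map (\<lambda>i zs. zs ! Suc (Suc i)) [0..<k]) = tl (tl zs)"
      if "length zs = Suc (Suc k)" for zs :: "nat list"
      using that by (auto intro!: nth_equalityI simp: nth_tl)
    ultimately show ?thesis by (elim computable_list_cong) metis
  qed
  have "computable_list k (\<lambda>xs. rec_nat (f xs) (\<lambda>n y. (\<lambda>zs. g (tl (tl zs))) (n # y # xs)) (c xs))"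
    by (intro computable_list_rec assms g)
  moreover have "rec_nat a (\<lambda>n y. b) m = (if m = 0 then a else b)" for a b :: nat and m by (cases m) auto
  ultimately show ?thesis by simp
qed

text \<open>
  From here on only unary functions are used; further arguments are packed with
  \<open>prod_encode\<close>, so that a variable in scope becomes an iterated projection of the argument.
\<close>

definition pfst :: "nat \<Rightarrow> nat" where "pfst n = fst (prod_decode n)"
definition psnd :: "nat \<Rightarrow> nat" where "psnd n = snd (prod_decode n)"
definition pair :: "nat \<Rightarrow> nat \<Rightarrow> nat" where "pair a b = prod_encode (a, b)"

lemma pfst_pair [simp]: "pfst (pair a b) = a"
  and psnd_pair [simp]: "psnd (pair a b) = b"
  and pair_pfst_psnd [simp]: "pair (pfst n) (psnd n) = n"
  by (simp_all add: pfst_def psnd_def pair_def)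

definition computable :: "(nat \<Rightarrow> nat) \<Rightarrow> bool" where
  "computable f \<longleftrightarrow> (\<exists>r. \<forall>x. computes r [x] (f x))"

lemma computable_iff_list: "computable f \<longleftrightarrow> computable_list 1 (\<lambda>xs. f (hd xs))"
proof -
  have "(\<forall>xs::nat list. length xs = 1 \<longrightarrow> computes r xs (f (hd xs))) \<longleftrightarrow> (\<forall>x. computes r [x] (f x))" for r
    by (auto simp: length_Suc_conv)
  then show ?thesis unfolding computable_def computable_list_def by simp
qed

lemma computable_id : "computable (\<lambda>x. x)"
  unfolding computable_iff_list
  by (rule computable_list_cong[OF computable_list_proj[of 0 1]]) (auto simp: length_Suc_conv)

lemma computable_const : "computable (\<lambda>x. c)"
  unfolding computable_iff_list by (rule computable_list_const)

lemma computable_compose: "computable f \<Longrightarrow> computable g \<Longrightarrow> computable (\<lambda>x. f (g x))"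
  unfolding computable_iff_list using computable_list_compose1[of "\<lambda>xs. f (hd xs)" 1] by fastforce

lemma computable_Suc : "computable f \<Longrightarrow> computable (\<lambda>x. Suc (f x))"
  unfolding computable_iff_list by (rule computable_list_Suc)

lemma computable_add : "computable f \<Longrightarrow> computable g \<Longrightarrow> computable (\<lambda>x. f x + g x)"
  unfolding computable_iff_list by (rule computable_list_add)

lemma computable_diff : "computable f \<Longrightarrow> computable g \<Longrightarrow> computable (\<lambda>x. f x - g x)"
  unfolding computable_iff_list by (rule computable_list_diff)

section \<open>Computability of the pairing function and its projections\<close>

lemma computable_list_triangle:
  assumes "computable_list k f"
  shows "computable_list k (\<lambda>xs. triangle (f xs))"
proof -
  have "computable_list k (\<lambda>xs. rec_nat 0 (\<lambda>n y. (\<lambda>zs. zs ! 1 + Suc (zs ! 0)) (n # y # xs)) (f xs))"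
    by (intro computable_list_rec assms computable_list_add computable_list_Suc computable_list_const
        computable_list_proj) auto
  moreover have "rec_nat 0 (\<lambda>n y. y + Suc n) b = triangle b" for b by (induction b) auto
  ultimately show ?thesis by simp
qed

lemma computable_list_pair:
  "computable_list k f \<Longrightarrow> computable_list k g \<Longrightarrow> computable_list k (\<lambda>xs. pair (f xs) (g xs))"
  unfolding pair_def prod_encode_def
  by (auto intro!: computable_list_triangle computable_list_add)

lemma computable_pair:
  "computable f \<Longrightarrow> computable g \<Longrightarrow> computable (\<lambda>x. pair (f x) (g x))"
  unfolding computable_iff_list by (rule computable_list_pair)

text \<open>The index of the diagonal of the Cantor pairing on which \<open>n\<close> lies.
  Diagonals begin at the triangular numbers, so both projections can be read off from the index, and
  the index itself is computable by recursion on \<open>n\<close>.\<close>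

definition pair_sum :: "nat \<Rightarrow> nat" where "pair_sum n = pfst n + psnd n"

lemma triangle_pair_sum: "n = triangle (pair_sum n) + pfst n"
  using pair_pfst_psnd[of n] unfolding pair_def prod_encode_def pair_sum_def by simp

lemma triangle_mono: "a \<le> b \<Longrightarrow> triangle a \<le> triangle b"
  by (induction rule: dec_induct) auto

lemma pair_sum_eqI:
  assumes "triangle s \<le> n" "n < triangle (Suc s)"
  shows "pair_sum n = s"
proof (rule ccontr)
  have n: "n = triangle (pair_sum n) + pfst n" "pfst n \<le> pair_sum n"
    using triangle_pair_sum[of n] by (auto simp: pair_sum_def)
  assume "pair_sum n \<noteq> s"
  then consider "Suc s \<le> pair_sum n" | "Suc (pair_sum n) \<le> s" by linarith
  then show False
    using n assms triangle_mono[of "Suc s" "pair_sum n"] triangle_mono[of "Suc (pair_sum n)" s]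
    by cases auto
qed

text \<open>The condition is \<open>Suc n = triangle (Suc s)\<close>, the moment when the next
  diagonal is entered, written as the vanishing of a sum of truncated differences to suit
  \<open>computable_list_if\<close>.\<close>

definition pair_sum_step :: "nat \<Rightarrow> nat \<Rightarrow> nat" where
  "pair_sum_step n s =
    (if (Suc n - triangle (Suc s)) + (triangle (Suc s) - Suc n) = 0 then Suc s else s)"

lemma pair_sum_rec: "pair_sum n = rec_nat 0 pair_sum_step n"
proof (induction n)
  case 0
  show ?case by (auto intro: pair_sum_eqI)
next
  case (Suc n)
  let ?s = "pair_sum n"
  have n: "n = triangle ?s + pfst n" "pfst n \<le> ?s"
    using triangle_pair_sum[of n] by (auto simp: pair_sum_def)
  have "pair_sum (Suc n) = pair_sum_step n ?s"
  proof (cases "Suc n = triangle (Suc ?s)")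
    case True
    then have "pair_sum (Suc n) = Suc ?s" by (intro pair_sum_eqI) auto
    then show ?thesis using True by (simp add: pair_sum_step_def)
  next
    case False
    have "pair_sum (Suc n) = ?s" using False n by (intro pair_sum_eqI) auto
    then show ?thesis using False by (auto simp: pair_sum_step_def)
  qed
  then show ?case by (simp add: Suc.IH)
qed

lemma computable_list_pair_sum: "computable_list 1 (\<lambda>xs. pair_sum (hd xs))"
proof -
  have "computable_list 1 (\<lambda>xs. rec_nat 0 (\<lambda>n y. (\<lambda>zs.
      if (Suc (zs ! 0) - triangle (Suc (zs ! 1))) + (triangle (Suc (zs ! 1)) - Suc (zs ! 0)) = 0
      then Suc (zs ! 1) else zs ! 1) (n # y # xs)) (xs ! 0))"
    by (intro computable_list_rec computable_list_if computable_list_add computable_list_Suc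
        computable_list_const computable_list_proj computable_list_diff computable_list_triangle) auto
  moreover have "(\<lambda>n y. (\<lambda>zs. if (Suc (zs ! 0) - triangle (Suc (zs ! 1))) + (triangle (Suc (zs ! 1)) - Suc (zs ! 0)) = 0
      then Suc (zs ! 1) else zs ! 1) (n # y # xs)) = pair_sum_step" for xs
    by (intro ext) (simp add: pair_sum_step_def)
  ultimately show ?thesis
    by (elim computable_list_cong) (simp only: pair_sum_rec, auto simp: length_Suc_conv)
qed

lemma computable_pfst : "computable f \<Longrightarrow> computable (\<lambda>x. pfst (f x))"
  and computable_psnd : "computable f \<Longrightarrow> computable (\<lambda>x. psnd (f x))"
proof -
  have s: "computable pair_sum" unfolding computable_iff_list by (rule computable_list_pair_sum)
  have t: "computable triangle"
    unfolding computable_iff_list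
    by (intro computable_list_triangle computable_id[unfolded computable_iff_list])
  have 1: "pfst n = n - triangle (pair_sum n)" for n using triangle_pair_sum[of n] by simp
  have "computable (\<lambda>x. x - triangle (pair_sum x))"
    by (intro computable_diff computable_id computable_compose[OF t] computable_compose[OF s])
  then have c1: "computable pfst" by (simp flip: 1)
  have 2: "psnd n = pair_sum n - pfst n" for n by (simp add: pair_sum_def)
  have "computable (\<lambda>x. pair_sum x - pfst x)"
    by (intro computable_diff computable_compose[OF s] computable_compose[OF c1] computable_id)
  then have c2: "computable psnd" by (simp flip: 2)
  show "computable f \<Longrightarrow> computable (\<lambda>x. pfst (f x))" "computable f \<Longrightarrow> computable (\<lambda>x. psnd (f x))"
    by (auto intro: computable_compose c1 c2)
qed

definition computable2 :: "(nat \<Rightarrow> nat \<Rightarrow> nat) \<Rightarrow> bool" where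
  "computable2 F \<longleftrightarrow> computable (\<lambda>z. F (pfst z) (psnd z))"

definition computable3 :: "(nat \<Rightarrow> nat \<Rightarrow> nat \<Rightarrow> nat) \<Rightarrow> bool" where
  "computable3 F \<longleftrightarrow> computable (\<lambda>z. F (pfst z) (pfst (psnd z)) (psnd (psnd z)))"

lemma computable2D: "computable2 F \<Longrightarrow> computable f \<Longrightarrow> computable g \<Longrightarrow> computable (\<lambda>x. F (f x) (g x))"
  unfolding computable2_def
  using computable_compose[of "\<lambda>z. F (pfst z) (psnd z)" "\<lambda>x. pair (f x) (g x)"] by (simp add: computable_pair)

lemma computable3D:
  "computable3 F \<Longrightarrow> computable f \<Longrightarrow> computable g \<Longrightarrow> computable h \<Longrightarrow>
    computable (\<lambda>x. F (f x) (g x) (h x))"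
  unfolding computable3_def
  using computable_compose[of "\<lambda>z. F (pfst z) (pfst (psnd z)) (psnd (psnd z))"
      "\<lambda>x. pair (f x) (pair (g x) (h x))"] by (simp add: computable_pair)

lemma computable_rec:
  assumes "computable3 h" "computable f" "computable g"
  shows "computable (\<lambda>x. rec_nat (f x) (\<lambda>k r. h k r x) (g x))"
proof -
  let ?h = "\<lambda>zs. pair (zs ! 0) (pair (zs ! 1) (zs ! 2))"
  have h: "computable_list (Suc (Suc 1)) (\<lambda>zs. h (zs ! 0) (zs ! 1) (zs ! 2))"
    using computable_list_compose1[OF assms(1)[unfolded computable3_def computable_iff_list], of "Suc (Suc 1)" ?h]
    by (simp add: computable_list_pair computable_list_proj)
  show ?thesis
    unfolding computable_iff_list
    using computable_list_rec[OF assms(2)[unfolded computable_iff_list] h assms(3)[unfolded computable_iff_list]]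
    by (elim computable_list_cong) (auto simp: length_Suc_conv)
qed

lemma computable_if:
  assumes "computable c" "computable f" "computable g"
  shows "computable (\<lambda>x. if c x = 0 then f x else g x)"
  using assms unfolding computable_iff_list by (rule computable_list_if)

lemmas computable_intros = computable_id computable_Suc computable_add computable_diff
  computable_pair computable_pfst computable_psnd computable_const

lemma computable_mult:
  assumes "computable f" "computable g"
  shows "computable (\<lambda>x. f x * g x)"
proof -
  have "computable (\<lambda>x. rec_nat 0 (\<lambda>k r. (\<lambda>k r x. r + f x) k r x) (g x))"
    by (intro computable_rec assms) (auto simp: computable3_def intro!: computable_intros assms computable_compose[OF assms(1)])
  moreover have "rec_nat 0 (\<lambda>k r. r + a) b = a * b" for a b :: nat by (induction b) auto
  ultimately show ?thesis by simp
qed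

lemma computable_sum:
  assumes "computable2 F" "computable g"
  shows "computable (\<lambda>x. \<Sum>k<g x. F k x)"
proof -
  have "computable (\<lambda>x. rec_nat 0 (\<lambda>k r. (\<lambda>k r x. r + F k x) k r x) (g x))"
    by (intro computable_rec assms) (auto simp: computable3_def intro!: computable_intros computable_mult assms computable2D[OF assms(1)])
  moreover have "rec_nat 0 (\<lambda>k r. r + F k x) b = (\<Sum>k<b. F k x)" for b x by (induction b) auto
  ultimately show ?thesis by simp
qed

lemma computable_power:
  assumes "computable f" "computable g"
  shows "computable (\<lambda>x. f x ^ g x)"
proof -
  have "computable (\<lambda>x. rec_nat 1 (\<lambda>k r. (\<lambda>k r x. f x * r) k r x) (g x))"
    by (intro computable_rec assms) (auto simp: computable3_def intro!: computable_intros computable_mult assms computable_compose[OF assms(1)])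
  moreover have "rec_nat 1 (\<lambda>k r. a * r) b = a ^ b" for a b :: nat by (induction b) auto
  ultimately show ?thesis by simp
qed

lemma computable_fact:
  assumes "computable f"
  shows "computable (\<lambda>x. fact (f x))"
proof -
  have "computable (\<lambda>x. rec_nat 1 (\<lambda>k r. (\<lambda>k r x. Suc k * r) k r x) (f x))"
    by (intro computable_rec assms) (auto simp: computable3_def intro!: computable_intros computable_mult assms)
  moreover have "rec_nat 1 (\<lambda>k r. Suc k * r) b = fact b" for b :: nat by (induction b) auto
  ultimately show ?thesis by simp
qed

lemmas computable_intros' = computable_intros computable_mult computable_power computable_fact

section \<open>Decidable predicates and bounded quantifiers\<close>

definition decidable :: "(nat \<Rightarrow> bool) \<Rightarrow> bool" where
  "decidable P \<longleftrightarrow> computable (\<lambda>x. of_bool (P x))"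

definition decidable2 :: "(nat \<Rightarrow> nat \<Rightarrow> bool) \<Rightarrow> bool" where
  "decidable2 P \<longleftrightarrow> decidable (\<lambda>z. P (pfst z) (psnd z))"

definition decidable3 :: "(nat \<Rightarrow> nat \<Rightarrow> nat \<Rightarrow> bool) \<Rightarrow> bool" where
  "decidable3 P \<longleftrightarrow> decidable (\<lambda>z. P (pfst z) (pfst (psnd z)) (psnd (psnd z)))"

lemma decidable_compose: "decidable P \<Longrightarrow> computable f \<Longrightarrow> decidable (\<lambda>x. P (f x))"
  unfolding decidable_def by (rule computable_compose)

lemma decidable_const : "decidable (\<lambda>x. b)"
  unfolding decidable_def by (rule computable_const)

lemma decidable_not : "decidable P \<Longrightarrow> decidable (\<lambda>x. \<not> P x)"
proof -
  have "of_bool (\<not> b) = 1 - (of_bool b :: nat)" for b by simp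
  then show "decidable P \<Longrightarrow> ?thesis"
    unfolding decidable_def by (simp only:) (intro computable_diff computable_const)
qed

lemma decidable_conj : "decidable P \<Longrightarrow> decidable Q \<Longrightarrow> decidable (\<lambda>x. P x \<and> Q x)"
  unfolding decidable_def by (simp add: of_bool_conj computable_mult)

lemma decidable_disj:
  assumes "decidable P" "decidable Q"
  shows "decidable (\<lambda>x. P x \<or> Q x)"
proof -
  have "decidable (\<lambda>x. \<not> (\<not> P x \<and> \<not> Q x))" by (intro decidable_not decidable_conj assms)
  then show ?thesis by simp
qed

lemma decidable_imp:
  assumes "decidable P" "decidable Q"
  shows "decidable (\<lambda>x. P x \<longrightarrow> Q x)"
proof -
  have "decidable (\<lambda>x. \<not> P x \<or> Q x)" by (intro decidable_not decidable_disj assms)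
  then show ?thesis unfolding imp_conv_disj .
qed

lemma decidable_le:
  assumes "computable f" "computable g"
  shows "decidable (\<lambda>x. f x \<le> g x)"
proof -
  have "computable (\<lambda>x. 1 - (f x - g x))" by (intro computable_intros assms)
  moreover have "1 - (a - b) = of_bool (a \<le> b)" for a b :: nat by auto
  ultimately show ?thesis by (simp add: decidable_def)
qed

lemma decidable_less : "computable f \<Longrightarrow> computable g \<Longrightarrow> decidable (\<lambda>x. f x < g x)"
  using decidable_not[OF decidable_le[of g f]] by (simp add: not_le)

lemma decidable_eq:
  fixes f g :: "nat \<Rightarrow> nat"
  assumes "computable f" "computable g"
  shows "decidable (\<lambda>x. f x = g x)"
proof -
  have "decidable (\<lambda>x. f x \<le> g x \<and> g x \<le> f x)" by (intro decidable_conj decidable_le assms)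
  then show ?thesis by (simp add: eq_iff)
qed

lemma computable_If:
  assumes "decidable P" "computable f" "computable g"
  shows "computable (\<lambda>x. if P x then f x else g x)"
proof -
  have "computable (\<lambda>x. if of_bool (P x) = (0::nat) then g x else f x)"
    using assms unfolding decidable_def by (intro computable_if)
  moreover have "(if of_bool b = (0::nat) then c else a) = (if b then a else c)" for b and a c :: nat by simp
  ultimately show ?thesis by simp
qed

lemma decidable_Ex:
  assumes "decidable2 P" "computable g"
  shows "decidable (\<lambda>x. \<exists>k<g x. P k x)"
proof -
  have "decidable (\<lambda>x. 0 < (\<Sum>k<g x. (\<lambda>k x. of_bool (P k x)) k x :: nat))"
    using assms
    by (intro decidable_less computable_const computable_sum)
       (auto simp: computable2_def decidable2_def decidable_def)
  moreover have "0 < (\<Sum>k<b. of_bool (Q k) :: nat) \<longleftrightarrow> (\<exists>k<b. Q k)" 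
    for b :: nat and Q
    by (subst neq0_conv[symmetric], subst sum_eq_0_iff) auto
  ultimately show ?thesis by simp
qed

lemma decidable_All:
  assumes "decidable2 P" "computable g"
  shows "decidable (\<lambda>x. \<forall>k<g x. P k x)"
proof -
  have "decidable2 (\<lambda>k x. \<not> P k x)" using assms(1) unfolding decidable2_def by (rule decidable_not)
  from decidable_not[OF decidable_Ex[OF this assms(2)]] show ?thesis by simp
qed

lemma decidable_list_all:
  "(\<And>i. i \<in> set is \<Longrightarrow> decidable (P i)) \<Longrightarrow> decidable (\<lambda>x. \<forall>i\<in>set is. P i x)"
  by (induction "is") (auto intro: decidable_const decidable_conj)

lemma computable_div:
  assumes "computable f" "computable g"
  shows "computable (\<lambda>x. f x div g x)"
proof -
  \<comment> \<open>The quotient counts the \<open>k\<close> with \<open>Suc k * b \<le> a\<close>;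
    the conjunct on positivity yields the value 0 for division by 0.\<close>
  have "computable (\<lambda>x. \<Sum>k<f x. (\<lambda>k x. of_bool (0 < g x \<and> Suc k * g x \<le> f x)) k x :: nat)"
  proof (rule computable_sum)
    have "decidable (\<lambda>z. 0 < g (psnd z) \<and> Suc (pfst z) * g (psnd z) \<le> f (psnd z))"
      by (intro decidable_conj decidable_less decidable_le computable_const computable_mult computable_Suc
          computable_pfst computable_compose[OF assms(1)] computable_compose[OF assms(2)] computable_psnd computable_id)
    then show "computable2 (\<lambda>k x. of_bool (0 < g x \<and> Suc k * g x \<le> f x))"
      by (simp add: computable2_def decidable_def)
  qed (rule assms)
  moreover have "(\<Sum>k<a. of_bool (0 < b \<and> Suc k * b \<le> a) :: nat) = a div b" for a b :: nat
  proof (cases "b = 0")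
    case False
    have "(\<Sum>k<a. of_bool (0 < b \<and> Suc k * b \<le> a) :: nat) = card {k\<in>{..<a}. 0 < b \<and> Suc k * b \<le> a}"
      by (simp add: Collect_conj_eq lessThan_def)
    also have "{k\<in>{..<a}. 0 < b \<and> Suc k * b \<le> a} = {..<a div b}"
    proof -
      have "k < a" if "Suc k * b \<le> a" for k
        using that False by (cases b) auto
      moreover have "Suc k * b \<le> a \<longleftrightarrow> k < a div b" for k
        using less_eq_div_iff_mult_less_eq[of b "Suc k" a] False by auto
      ultimately show ?thesis using False by auto
    qed
    finally show ?thesis by simp
  qed simp
  ultimately show ?thesis by simp
qed

lemma computable_mod:
  "computable f \<Longrightarrow> computable g \<Longrightarrow> computable (\<lambda>x. f x mod g x)"
  by (subst minus_div_mult_eq_mod[symmetric]) (intro computable_intros' computable_div)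

lemma decidable_dvd : "computable f \<Longrightarrow> computable g \<Longrightarrow> decidable (\<lambda>x. f x dvd g x)"
  by (subst dvd_eq_mod_eq_0) (intro decidable_eq computable_mod computable_const)

section \<open>Linear forms in valued modules\<close>

text \<open>\<open>B g x\<close> stands for v(x) \<ge> g, \<open>NZ m\<close> for the integer
  \<open>m\<close> being nonzero in the field, \<open>\<nu> m\<close> for v(m). Balls avoid an
  infinite value. Elements of all balls need not be 0, because the sequences used later have
  coordinates that do not count.\<close>

locale valued_module = Modules.module sc
  for sc :: "int \<Rightarrow> 'b::ab_group_add \<Rightarrow> 'b" +
  fixes B :: "int \<Rightarrow> 'b \<Rightarrow> bool" and NZ :: "int \<Rightarrow> bool" and \<nu> :: "int \<Rightarrow> int"
  assumes B_0 [simp]: "B g 0"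
    and B_diff: "B g x \<Longrightarrow> B g y \<Longrightarrow> B g (x - y)"
    and B_antimono: "B h x \<Longrightarrow> g \<le> h \<Longrightarrow> B g x"
    and B_exists: "\<exists>g. B g x"
    and B_scale: "NZ m \<Longrightarrow> B (g + \<nu> m) (sc m x) \<longleftrightarrow> B g x"
    and B_scale_not_NZ: "\<not> NZ m \<Longrightarrow> B g (sc m x)"
begin

lemma B_minus: "B g (- x) \<longleftrightarrow> B g x"
  using B_diff[of g 0 x] B_diff[of g 0 "- x"] by auto

lemma B_add: "B g x \<Longrightarrow> B g y \<Longrightarrow> B g (x + y)"
  using B_diff[of g x "- y"] B_minus[of g y] by simp

lemma B_diff_commute: "B g (x - y) \<longleftrightarrow> B g (y - x)"
  using B_minus[of g "x - y"] by simp

lemma B_cong: "B g (x - y) \<Longrightarrow> B g x \<longleftrightarrow> B g y"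
  using B_add[of g "x - y" y] B_diff[of g x "x - y"] by auto

definition Z :: "'b \<Rightarrow> bool" where "Z x \<longleftrightarrow> (\<forall>g. B g x)"

lemma Z_cong: "Z (x - y) \<Longrightarrow> B g x \<longleftrightarrow> B g y"
  using B_cong unfolding Z_def by blast

definition val :: "'b \<Rightarrow> int" where "val x = (THE g. B g x \<and> \<not> B (g + 1) x)"

lemma B_iff_le_val:
  assumes "\<not> Z x"
  shows "B g x \<longleftrightarrow> g \<le> val x"
proof -
  obtain g0 where g0: "B g0 x" using B_exists by blast
  obtain h where h: "\<not> B h x" using assms unfolding Z_def by blast
  have *: "\<exists>g\<ge>g0. B g x \<and> \<not> B (g + 1) x"
  proof (rule ccontr)
    assume c: "\<not> ?thesis"
    have "B (g0 + int n) x" for n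
      by (induction n) (use g0 c in \<open>auto simp: algebra_simps\<close>)
    then have "B h x" by (rule B_antimono[of "g0 + int (nat (h - g0))"]) linarith
    with h show False by blast
  qed
  then obtain g1 where g1: "B g1 x" "\<not> B (g1 + 1) x" by blast
  have "val x = g1"
    unfolding val_def
  proof (rule the_equality)
    show "g = g1" if "B g x \<and> \<not> B (g + 1) x" for g
      using that g1 B_antimono[of g x "g1 + 1"] B_antimono[of g1 x "g + 1"] by linarith
  qed (use g1 in blast)
  then show ?thesis using g1 B_antimono[of g1 x g] B_antimono[of g x "g1 + 1"] by linarith
qed

lemma val_eqI: "B g x \<Longrightarrow> \<not> B (g + 1) x \<Longrightarrow> val x = g"
  using B_iff_le_val[of x g] B_iff_le_val[of x "g + 1"] by (force simp: Z_def)

text \<open>\<open>leq c x y\<close> says \<open>v(x) + c \<le> v(y)\<close>; it is phrased by balls so as to make sense at 0.\<close>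

definition leq :: "int \<Rightarrow> 'b \<Rightarrow> 'b \<Rightarrow> bool" where
  "leq c x y \<longleftrightarrow> (\<forall>g. B g x \<longrightarrow> B (g + c) y)"

lemma leq_zero_left: "leq c 0 y \<longleftrightarrow> Z y"
  unfolding leq_def Z_def using B_0 by (metis diff_add_cancel)

lemma leq_iff:
  "leq c x y \<longleftrightarrow> Z y \<or> (\<not> Z x \<and> val x + c \<le> val y)"
proof (cases "Z x \<or> Z y")
  case True
  then show ?thesis unfolding leq_def Z_def by (metis diff_add_cancel)
next
  case False
  then have "leq c x y \<longleftrightarrow> (\<forall>g\<le>val x. g + c \<le> val y)" unfolding leq_def by (simp add: B_iff_le_val)
  also have "\<dots> \<longleftrightarrow> val x + c \<le> val y" by force
  finally show ?thesis using False by simp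
qed

text \<open>Multiplying \<open>x\<close> and \<open>y\<close> by scalars of different valuations
  shifts their balls by different amounts \<open>k\<close> and \<open>l\<close>; the difference
  moves into the constant.\<close>

lemma leq_shift:
  assumes "\<And>g. B (g + j) x \<longleftrightarrow> B (g + k) x'" "\<And>g. B (g + j) y \<longleftrightarrow> B (g + l) y'"
  shows "leq c x y \<longleftrightarrow> leq (c + l - k) x' y'"
proof -
  have "leq c x y \<longleftrightarrow> (\<forall>g. B (g + j) x \<longrightarrow> B (g + j + c) y)"
    unfolding leq_def by (metis diff_add_cancel)
  also have "\<dots> \<longleftrightarrow> (\<forall>g. B (g + k) x' \<longrightarrow> B (g + c + l) y')"
    using assms(1) assms(2)[of "_ + c"] by (simp add: algebra_simps)
  also have "\<dots> \<longleftrightarrow> (\<forall>g. B g x' \<longrightarrow> B (g - k + c + l) y')"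
    by (metis add_diff_cancel diff_add_cancel)
  finally show ?thesis unfolding leq_def by (simp add: algebra_simps)
qed

definition lin :: "nat \<Rightarrow> (nat \<Rightarrow> int) \<Rightarrow> (nat \<Rightarrow> 'b) \<Rightarrow> 'b" where
  "lin m f x = (\<Sum>j<m. sc (f j) (x j))"

lemma lin_add: "lin m (\<lambda>j. f j + g j) x = lin m f x + lin m g x"
  by (simp add: lin_def scale_left_distrib sum.distrib)

lemma lin_diff: "lin m (\<lambda>j. f j - g j) x = lin m f x - lin m g x"
  by (simp add: lin_def scale_left_diff_distrib sum_subtractf)

lemma lin_scale: "lin m (\<lambda>j. k * f j) x = sc k (lin m f x)"
  by (simp add: lin_def scale_sum_right)

lemma lin_zero: "lin m (\<lambda>_. 0) x = 0"
  by (simp add: lin_def)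

lemma lin_scale_right: "lin m f (\<lambda>j. sc k (x j)) = sc k (lin m f x)"
  by (simp add: lin_def scale_sum_right mult.commute)

lemma lin_cong: "(\<And>j. j < m \<Longrightarrow> f j = g j) \<Longrightarrow> (\<And>j. j < m \<Longrightarrow> x j = y j) \<Longrightarrow> lin m f x = lin m g y"
  by (simp add: lin_def)

lemma lin_Suc: "lin (Suc m) f (x(m := y)) = lin m f x + sc (f m) y"
  by (simp add: lin_def)

end

text \<open>Integral linear forms in \<open>m\<close> variables of height at most \<open>H\<close>.
  Extension by 0 makes a form in fewer variables a form in more.\<close>

definition forms :: "nat \<Rightarrow> nat \<Rightarrow> (nat \<Rightarrow> int) set" where
  "forms m H = {f. (\<forall>j. \<bar>f j\<bar> \<le> int H) \<and> (\<forall>j\<ge>m. f j = 0)}"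

lemma finite_forms: "finite (forms m H)"
proof (rule finite_subset)
  show "finite {f. \<forall>j. (j \<in> {..<m} \<longrightarrow> f j \<in> {- int H..int H}) \<and> (j \<notin> {..<m} \<longrightarrow> f j = 0)}"
    by (rule finite_set_of_finite_funs) auto
qed (auto simp: forms_def abs_le_iff minus_le_iff)

lemma zero_in_forms: "(\<lambda>_. 0) \<in> forms m H"
  by (simp add: forms_def)

lemma forms_mono: "H \<le> H' \<Longrightarrow> forms m H \<subseteq> forms m H'"
  unfolding forms_def using order_trans of_nat_mono by blast

lemma forms_diff: "f \<in> forms m H \<Longrightarrow> g \<in> forms m H' \<Longrightarrow> (\<lambda>j. f j - g j) \<in> forms m (H + H')"
proof -
  assume "f \<in> forms m H" "g \<in> forms m H'"
  then have "\<bar>f j - g j\<bar> \<le> int H + int H'" for j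
    unfolding forms_def by (intro order_trans[OF abs_triangle_ineq4] add_mono) auto
  with \<open>f \<in> _\<close> \<open>g \<in> _\<close> show ?thesis unfolding forms_def by simp
qed

lemma forms_restrict: "f \<in> forms (Suc m) H \<Longrightarrow> (\<lambda>j. if j < m then f j else 0) \<in> forms m H"
  by (auto simp: forms_def)

text \<open>One-point extension among integers. With tolerance \<open>2 * C + 1\<close> for the old
  points, a gap that contains \<gamma> at distance more than \<open>C\<close> from both ends
  corresponds to a gap of width at least \<open>2 * C + 2\<close>. The last conclusion bounds
  \<gamma>' from above; the computable bound on new sequences comes from it.\<close>

lemma match_int:
  fixes \<alpha> \<alpha>' :: "'i \<Rightarrow> int" and \<gamma> :: int and C :: nat
  assumes I: "finite I" "I \<noteq> {}"
    and sim: "\<And>i j c. i \<in> I \<Longrightarrow> j \<in> I \<Longrightarrow> \<bar>c\<bar> \<le> 2 * int C + 1 \<Longrightarrow> \<alpha> i + c \<le> \<alpha> j \<longleftrightarrow> \<alpha>' i + c \<le> \<alpha>' j"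
  obtains \<gamma>' where
    "\<And>i c. i \<in> I \<Longrightarrow> \<bar>c\<bar> \<le> int C \<Longrightarrow> \<alpha> i + c \<le> \<gamma> \<longleftrightarrow> \<alpha>' i + c \<le> \<gamma>'"
    "\<And>i c. i \<in> I \<Longrightarrow> \<bar>c\<bar> \<le> int C \<Longrightarrow> \<gamma> + c \<le> \<alpha> i \<longleftrightarrow> \<gamma>' + c \<le> \<alpha>' i"
    "\<exists>i\<in>I. \<gamma>' \<le> \<alpha>' i + int C + 1"
proof -
  consider (near) i where "i \<in> I" "\<bar>\<gamma> - \<alpha> i\<bar> \<le> int C"
    | (far) "\<forall>i\<in>I. \<bar>\<gamma> - \<alpha> i\<bar> > int C" by force
  then show ?thesis
  proof cases
    case near
    show ?thesis
    proof (rule that[of "\<alpha>' i + (\<gamma> - \<alpha> i)"])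
      fix k c assume k: "k \<in> I" "\<bar>c\<bar> \<le> int C"
      show "\<alpha> k + c \<le> \<gamma> \<longleftrightarrow> \<alpha>' k + c \<le> \<alpha>' i + (\<gamma> - \<alpha> i)"
        using sim[OF k(1) near(1), of "c - (\<gamma> - \<alpha> i)"] near k(2) by linarith
      show "\<gamma> + c \<le> \<alpha> k \<longleftrightarrow> \<alpha>' i + (\<gamma> - \<alpha> i) + c \<le> \<alpha>' k"
        using sim[OF near(1) k(1), of "c + (\<gamma> - \<alpha> i)"] near k(2) by linarith
    qed (use near in force)
  next
    case far
    let ?L = "{i\<in>I. \<alpha> i < \<gamma>}"
    show ?thesis
    proof (cases "?L = {}")
      case True
      obtain j where j: "j \<in> I" "\<And>i. i \<in> I \<Longrightarrow> \<alpha> j \<le> \<alpha> i"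
        using arg_min_if_finite(1)[OF I, of \<alpha>] arg_min_least[OF I, of _ \<alpha>] by metis
      have k: "\<alpha>' j \<le> \<alpha>' k \<and> \<gamma> + int C < \<alpha> k" if "k \<in> I" for k
        using sim[OF j(1) that, of 0] j(2)[OF that] far that True by force
      \<comment> \<open>All old points lie more than \<open>C\<close> above \<gamma>, so a value
        more than \<open>C\<close> below the least \<open>\<alpha>' j\<close> is right.\<close>
      show ?thesis
      proof (rule that[of "\<alpha>' j - int C - 1"])
        fix i c assume i: "i \<in> I" "\<bar>c\<bar> \<le> int C"
        show "\<alpha> i + c \<le> \<gamma> \<longleftrightarrow> \<alpha>' i + c \<le> \<alpha>' j - int C - 1" using k[OF i(1)] i(2) by linarith
        show "\<gamma> + c \<le> \<alpha> i \<longleftrightarrow> \<alpha>' j - int C - 1 + c \<le> \<alpha>' i" using k[OF i(1)] i(2) by linarith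
      qed (use j in force)
    next
      case False
      obtain j where j: "j \<in> ?L" "\<And>i. i \<in> ?L \<Longrightarrow> \<alpha> i \<le> \<alpha> j"
      proof -
        have "finite (\<alpha> ` ?L)" "\<alpha> ` ?L \<noteq> {}" using I False by auto
        then have "Max (\<alpha> ` ?L) \<in> \<alpha> ` ?L" by (rule Max_in)
        then obtain j where j: "Max (\<alpha> ` ?L) = \<alpha> j" "j \<in> ?L" by (rule imageE)
        show ?thesis
        proof (rule that[OF j(2)])
          show "\<alpha> i \<le> \<alpha> j" if "i \<in> ?L" for i
            unfolding j(1)[symmetric] using \<open>finite (\<alpha> ` ?L)\<close> that by (intro Max_ge imageI)
        qed
      qed
      have lo: "\<alpha>' k \<le> \<alpha>' j \<and> \<alpha> k + int C < \<gamma>" if "k \<in> ?L" for k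
        using sim[of k j 0] j(1) j(2)[OF that] far that by force
      have hi: "\<alpha>' j + (2 * int C + 2) \<le> \<alpha>' k \<and> \<gamma> + int C < \<alpha> k" if "k \<in> I - ?L" for k
      proof -
        have "\<gamma> + int C < \<alpha> k" using far that by force
        moreover have "\<alpha> j + int C < \<gamma>" using far j(1) by force
        moreover have "\<alpha> k + (- 2 * int C - 1) \<le> \<alpha> j \<longleftrightarrow> \<alpha>' k + (- 2 * int C - 1) \<le> \<alpha>' j"
          using that j(1) by (intro sim) auto
        ultimately show ?thesis by linarith
      qed
      \<comment> \<open>\<open>C + 1\<close> above the largest point \<open>j\<close> below \<gamma>
        is out of its reach, and by \<open>hi\<close> still at least \<open>C + 1\<close> below all
        the points above.\<close>
      show ?thesis
      proof (rule that[of "\<alpha>' j + int C + 1"])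
        fix i c assume i: "i \<in> I" "\<bar>c\<bar> \<le> int C"
        show "\<alpha> i + c \<le> \<gamma> \<longleftrightarrow> \<alpha>' i + c \<le> \<alpha>' j + int C + 1"
          using lo[of i] hi[of i] i by (cases "i \<in> ?L") auto
        show "\<gamma> + c \<le> \<alpha> i \<longleftrightarrow> \<alpha>' j + int C + 1 + c \<le> \<alpha>' i"
          using lo[of i] hi[of i] i by (cases "i \<in> ?L") auto
      qed (use j in force)
    qed
  qed
qed

section \<open>Extending a partial match between two valued modules\<close>

locale valued_module_pair =
  S: valued_module sc B NZ \<nu> + T: valued_module sc' B' NZ \<nu>
  for sc :: "int \<Rightarrow> 'b::ab_group_add \<Rightarrow> 'b" and B
    and sc' :: "int \<Rightarrow> 'c::ab_group_add \<Rightarrow> 'c" and B' and NZ \<nu>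
begin

text \<open>For elements outside the intersection of all balls, differences of valuations between
  \<open>- C\<close> and \<open>C\<close> coincide, and of larger ones only the sign is
  preserved.\<close>

definition sim :: "nat \<Rightarrow> ('b \<times> 'c) set \<Rightarrow> bool" where
  "sim C P \<longleftrightarrow> (\<forall>u u' w w' c. (u, u') \<in> P \<longrightarrow> (w, w') \<in> P \<longrightarrow> \<bar>c\<bar> \<le> int C \<longrightarrow>
     S.leq c u w \<longleftrightarrow> T.leq c u' w')"

definition graph :: "nat \<Rightarrow> nat \<Rightarrow> (nat \<Rightarrow> 'b) \<Rightarrow> (nat \<Rightarrow> 'c) \<Rightarrow> ('b \<times> 'c) set" where
  "graph m H x x' = {(S.lin m f x, T.lin m f x') | f. f \<in> forms m H}"

text \<open>Each form in the old tuple is a possible center of a ball around the new element; the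
  pairs are the displacements from these centers.\<close>

definition centers :: "nat \<Rightarrow> nat \<Rightarrow> (nat \<Rightarrow> 'b) \<Rightarrow> (nat \<Rightarrow> 'c) \<Rightarrow> 'b \<Rightarrow> 'c \<Rightarrow> ('b \<times> 'c) set" where
  "centers m G x x' y y' = {(y - S.lin m s x, y' - T.lin m s x') | s. s \<in> forms m G}"

lemma simD: "sim C P \<Longrightarrow> (u, u') \<in> P \<Longrightarrow> (w, w') \<in> P \<Longrightarrow> \<bar>c\<bar> \<le> int C \<Longrightarrow> S.leq c u w \<longleftrightarrow> T.leq c u' w'"
  unfolding sim_def by blast

lemma sim_mono: "sim C P \<Longrightarrow> D \<le> C \<Longrightarrow> Q \<subseteq> P \<Longrightarrow> sim D Q"
  unfolding sim_def by (meson order_trans of_nat_mono subsetD)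

lemma graph_mono: "H \<le> H' \<Longrightarrow> graph m H x x' \<subseteq> graph m H' x x'"
  unfolding graph_def using forms_mono by blast

lemma sim_graph_Z:
  assumes "sim C (graph m H x x')" "f \<in> forms m H"
  shows "S.Z (S.lin m f x) \<longleftrightarrow> T.Z (T.lin m f x')"
proof -
  have "(S.lin m (\<lambda>_. 0) x, T.lin m (\<lambda>_. 0) x') \<in> graph m H x x'"
    unfolding graph_def using zero_in_forms by blast
  moreover have "(S.lin m f x, T.lin m f x') \<in> graph m H x x'"
    unfolding graph_def using assms by blast
  ultimately have "S.leq 0 (S.lin m (\<lambda>_. 0) x) (S.lin m f x) \<longleftrightarrow> T.leq 0 (T.lin m (\<lambda>_. 0) x') (T.lin m f x')"
    using simD[OF assms(1)] by simp
  then show ?thesis by (simp add: S.lin_zero T.lin_zero S.leq_zero_left T.leq_zero_left)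
qed

text \<open>
  If \<open>a\<close> is a multiple of the coefficient \<open>b\<close> of \<open>y\<close>, say \<open>a = b k\<close>, then \<open>k (b y + t) = a y + k t\<close>.
  So forms in the longer tuple reduce to differences of \<open>a y\<close> and forms in the shorter one. The
  other tuple is rescaled by \<open>a\<close>, because one cannot divide by \<open>a\<close> there.
\<close>

lemma sim_graph_Suc:
  assumes sim: "sim (C + nat (\<nu> a)) (graph m H x x' \<union> centers m G x x' (sc a y) y')"
    and a: "a > 0" "NZ a" "\<And>b. NZ b \<Longrightarrow> \<bar>b\<bar> \<le> int H \<Longrightarrow> b dvd a"
    and NZ_mult: "\<And>b k. NZ (b * k) \<longleftrightarrow> NZ b \<and> NZ k" "\<And>b k. NZ (b * k) \<Longrightarrow> \<nu> (b * k) = \<nu> b + \<nu> k"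
    and \<nu>_ge_0: "\<And>b. NZ b \<Longrightarrow> 0 \<le> \<nu> b"
    and G: "int G = a * int H"
  shows "sim C (graph (Suc m) H (x(m := y)) ((\<lambda>j. sc' a (x' j))(m := y')))"
proof -
  let ?P = "graph m H x x' \<union> centers m G x x' (sc a y) y'"
  let ?x' = "(\<lambda>j. sc' a (x' j))(m := y')"
  have key: "\<exists>u u' k. (u, u') \<in> ?P \<and> 0 \<le> k \<and> k \<le> \<nu> a \<and>
      (\<forall>g. B g (S.lin (Suc m) f (x(m := y))) \<longleftrightarrow> B (g + k) u) \<and>
      (\<forall>g. B' (g + \<nu> a) (T.lin (Suc m) f ?x') \<longleftrightarrow> B' (g + k) u')" if f: "f \<in> forms (Suc m) H" for f
  proof -
    define h where "h = (\<lambda>j. if j < m then f j else 0)"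
    have h: "h \<in> forms m H" unfolding h_def by (rule forms_restrict[OF f])
    have lin: "S.lin (Suc m) f (x(m := y)) = S.lin m h x + sc (f m) y"
      "T.lin (Suc m) f ?x' = sc' a (T.lin m h x') + sc' (f m) y'"
      by (auto simp: S.lin_Suc T.lin_Suc h_def T.lin_scale_right[symmetric] intro!: S.lin_cong T.lin_cong)
    show ?thesis
    proof (cases "NZ (f m)")
      case False
      have "B g (S.lin m h x + sc (f m) y) \<longleftrightarrow> B g (S.lin m h x)" for g
        by (rule S.B_cong) (simp add: S.B_scale_not_NZ False)
      moreover have "B' (g + \<nu> a) (sc' a (T.lin m h x') + sc' (f m) y') \<longleftrightarrow> B' g (T.lin m h x')" for g
      proof -
        have "B' (g + \<nu> a) (sc' a (T.lin m h x') + sc' (f m) y') \<longleftrightarrow> B' (g + \<nu> a) (sc' a (T.lin m h x'))"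
          by (rule T.B_cong) (simp add: T.B_scale_not_NZ False)
        then show ?thesis by (simp add: T.B_scale a)
      qed
      moreover have "(S.lin m h x, T.lin m h x') \<in> ?P" unfolding graph_def using h by blast
      ultimately show ?thesis unfolding lin using \<nu>_ge_0[OF a(2)]
        by (intro exI[of _ "S.lin m h x"] exI[of _ "T.lin m h x'"] exI[of _ 0]) auto
    next
      case True
      have "\<bar>f m\<bar> \<le> int H" using f unfolding forms_def by blast
      then obtain k where k: "a = f m * k" using a(3)[OF True] by (auto elim: dvdE)
      then have NZk: "NZ k" and nua: "\<nu> a = \<nu> (f m) + \<nu> k" using a(2) NZ_mult by auto
      have ka: "\<bar>k\<bar> \<le> a" using dvd_imp_le_int[of a k] a(1) dvd_triv_right[of k "f m"] by (simp add: k[symmetric])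
      define s where "s = (\<lambda>j. - k * h j)"
      have s: "s \<in> forms m G"
      proof -
        have "\<bar>k\<bar> * \<bar>h j\<bar> \<le> a * int H" for j
          using ka h a(1) unfolding forms_def by (intro mult_mono) auto
        then show ?thesis using h G unfolding s_def forms_def by (auto simp: abs_mult)
      qed
      have 1: "sc k (S.lin m h x + sc (f m) y) = sc a y - S.lin m s x"
        unfolding s_def S.lin_scale k by (simp add: S.scale_right_distrib mult.commute)
      have 2: "sc' a (T.lin m h x') + sc' (f m) y' = sc' (f m) (y' - T.lin m s x')"
        unfolding s_def T.lin_scale k by (simp add: T.scale_right_diff_distrib T.scale_right_distrib)
      have "B g (S.lin m h x + sc (f m) y) \<longleftrightarrow> B (g + \<nu> k) (sc a y - S.lin m s x)" for g
        unfolding 1[symmetric] by (simp add: S.B_scale NZk)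
      moreover have "B' (g + \<nu> a) (sc' a (T.lin m h x') + sc' (f m) y') \<longleftrightarrow> B' (g + \<nu> k) (y' - T.lin m s x')" for g
        unfolding 2 nua using T.B_scale[OF True, of "g + \<nu> k" "y' - T.lin m s x'"] by (simp only: ac_simps)
      moreover have "(sc a y - S.lin m s x, y' - T.lin m s x') \<in> ?P" unfolding centers_def using s by blast
      ultimately show ?thesis unfolding lin using \<nu>_ge_0[OF NZk] \<nu>_ge_0[OF True] nua
        by (intro exI[of _ "sc a y - S.lin m s x"] exI[of _ "y' - T.lin m s x'"] exI[of _ "\<nu> k"]) auto
    qed
  qed
  show ?thesis
    unfolding sim_def
  proof (intro allI impI)
    fix u u' w w' and c :: int
    assume u: "(u, u') \<in> graph (Suc m) H (x(m := y)) ?x'" and w: "(w, w') \<in> graph (Suc m) H (x(m := y)) ?x'"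
      and c: "\<bar>c\<bar> \<le> int C"
    from u obtain f where f: "f \<in> forms (Suc m) H" "u = S.lin (Suc m) f (x(m := y))" "u' = T.lin (Suc m) f ?x'"
      unfolding graph_def by blast
    from w obtain h where h: "h \<in> forms (Suc m) H" "w = S.lin (Suc m) h (x(m := y))" "w' = T.lin (Suc m) h ?x'"
      unfolding graph_def by blast
    from key[OF f(1), folded f(2,3)] obtain u1 u1' k where 1: "(u1, u1') \<in> ?P" "0 \<le> k" "k \<le> \<nu> a"
      "\<forall>g. B g u \<longleftrightarrow> B (g + k) u1" "\<forall>g. B' (g + \<nu> a) u' \<longleftrightarrow> B' (g + k) u1'"
      by (elim exE conjE)
    from key[OF h(1), folded h(2,3)] obtain w1 w1' l where 2: "(w1, w1') \<in> ?P" "0 \<le> l" "l \<le> \<nu> a"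
      "\<forall>g. B g w \<longleftrightarrow> B (g + l) w1" "\<forall>g. B' (g + \<nu> a) w' \<longleftrightarrow> B' (g + l) w1'"
      by (elim exE conjE)
    have "S.leq c u w \<longleftrightarrow> S.leq (c + l - k) u1 w1" using 1 2 by (intro S.leq_shift[of 0]) auto
    also have "\<dots> \<longleftrightarrow> T.leq (c + l - k) u1' w1'" by (rule simD[OF sim 1(1) 2(1)]) (use 1 2 c in auto)
    also have "\<dots> \<longleftrightarrow> T.leq c u' w'" using 1 2 by (intro T.leq_shift[symmetric]) auto
    finally show "S.leq c u w \<longleftrightarrow> T.leq c u' w'" .
  qed
qed

text \<open>The same form \<open>s0\<close> serves in the other tuple: up to null elements, every
  displacement becomes the form \<open>s0 - s\<close>, whose height is at most
  \<open>2 * G\<close>.\<close>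

lemma sim_centers_Z:
  assumes sim: "sim C (graph m (2 * G) x x')" and s0: "s0 \<in> forms m G"
    and Z: "S.Z (Y - S.lin m s0 x)" "T.Z (Y' - T.lin m s0 x')"
  shows "sim C (graph m (2 * G) x x' \<union> centers m G x x' Y Y')"
proof -
  let ?P = "graph m (2 * G) x x'"
  have key: "\<exists>u1 u1'. (u1, u1') \<in> ?P \<and> (\<forall>g. B g u \<longleftrightarrow> B g u1) \<and> (\<forall>g. B' g u' \<longleftrightarrow> B' g u1')"
    if uu: "(u, u') \<in> ?P \<union> centers m G x x' Y Y'" for u u'
  proof (cases "(u, u') \<in> ?P")
    case False
    then obtain s where s: "s \<in> forms m G" and u: "u = Y - S.lin m s x" "u' = Y' - T.lin m s x'"
      using uu unfolding centers_def by blast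
    define t where "t = (\<lambda>j. s0 j - s j)"
    have "t \<in> forms m (2 * G)" unfolding t_def using forms_diff[OF s0 s] by (simp add: mult_2)
    then have "(S.lin m t x, T.lin m t x') \<in> ?P" unfolding graph_def by blast
    moreover have "B g u \<longleftrightarrow> B g (S.lin m t x)" for g
      by (rule S.Z_cong) (use Z in \<open>simp add: t_def u S.lin_diff\<close>)
    moreover have "B' g u' \<longleftrightarrow> B' g (T.lin m t x')" for g
      by (rule T.Z_cong) (use Z in \<open>simp add: t_def u T.lin_diff\<close>)
    ultimately show ?thesis by blast
  qed blast
  show ?thesis
    unfolding sim_def
  proof (intro allI impI)
    fix u u' w w' and c :: int
    assume "(u, u') \<in> ?P \<union> centers m G x x' Y Y'" "(w, w') \<in> ?P \<union> centers m G x x' Y Y'"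
      and c: "\<bar>c\<bar> \<le> int C"
    then obtain u1 u1' w1 w1' where 1: "(u1, u1') \<in> ?P" "(w1, w1') \<in> ?P"
      "\<And>g. B g u \<longleftrightarrow> B g u1" "\<And>g. B' g u' \<longleftrightarrow> B' g u1'" "\<And>g. B g w \<longleftrightarrow> B g w1" "\<And>g. B' g w' \<longleftrightarrow> B' g w1'"
      using key by metis
    then show "S.leq c u w \<longleftrightarrow> T.leq c u' w'" using simD[OF sim 1(1,2) c] by (simp add: S.leq_def T.leq_def)
  qed
qed

end

lemma greedy_representatives:
  assumes "finite A" "\<And>a. a \<in> A \<Longrightarrow> R a a" "\<And>a b. R a b \<Longrightarrow> R b a"
  shows "\<exists>T\<subseteq>A. (\<forall>a\<in>T. \<forall>b\<in>T. a \<noteq> b \<longrightarrow> \<not> R a b) \<and> (\<forall>a\<in>A. \<exists>b\<in>T. R a b)"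
  using assms(1,2)
proof (induction A)
  case (insert x A)
  then obtain T where T: "T \<subseteq> A" "\<forall>a\<in>T. \<forall>b\<in>T. a \<noteq> b \<longrightarrow> \<not> R a b" "\<forall>a\<in>A. \<exists>b\<in>T. R a b" by auto
  show ?case
  proof (cases "\<exists>b\<in>T. R x b")
    case True
    then show ?thesis using T by (intro exI[of _ T]) auto
  next
    case False
    have "\<not> R a b" if "a \<in> insert x T" "b \<in> insert x T" "a \<noteq> b" for a b
      using that T(2) False assms(3) by (elim insertE) auto
    moreover have "\<exists>b\<in>insert x T. R a b" if "a \<in> insert x A" for a
      using that T(3) insert.prems by (elim insertE) auto
    moreover have "insert x T \<subseteq> insert x A" using T(1) by auto
    ultimately show ?thesis by meson
  qed
qed (intro exI[of _ "{}"], simp)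

context valued_module
begin

text \<open>Representatives of distinct classes in the quotient of two consecutive balls, which is a
  copy of the residue field when the valuation is discrete.\<close>

definition incongruent :: "int \<Rightarrow> 'b set \<Rightarrow> bool" where
  "incongruent g X \<longleftrightarrow> (\<forall>x\<in>X. B g x) \<and> (\<forall>x\<in>X. \<forall>y\<in>X. x \<noteq> y \<longrightarrow> \<not> B (g + 1) (x - y))"

end

context valued_module_pair
begin

text \<open>At the valuation \<gamma> of the displacement from the nearest centers, the residue
  class of the new element has to avoid the classes of all these centers. Counting is enough:
  \<open>Y\<close> and the nearest centers together occupy one class more than the centers alone, so
  if the other side offers as many classes, one of them is free. That it does is the assumption
  \<open>reps\<close>, which receives all that is known about the matched valuation
  \<open>g'\<close>, so that it can also control the size of the representatives. A whole ball of
  \<open>Y'\<close> is admissible, which leaves room for approximation.\<close>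

lemma sim_centers_not_Z:
  assumes sim: "sim (2 * C + 1) (graph m (2 * G) x x')"
    and nz: "\<And>s. s \<in> forms m G \<Longrightarrow> \<not> S.Z (Y - S.lin m s x)"
    and t0: "t0 \<in> forms m (2 * G)" "\<not> S.Z (S.lin m t0 x)"
    and reps: "\<And>g g' X t. (\<And>t. t \<in> forms m (2 * G) \<Longrightarrow> \<not> S.Z (S.lin m t x) \<Longrightarrow>
         (S.val (S.lin m t x) \<le> g \<longleftrightarrow> T.val (T.lin m t x') \<le> g') \<and>
         (g \<le> S.val (S.lin m t x) \<longleftrightarrow> g' \<le> T.val (T.lin m t x'))) \<Longrightarrow>
       (\<And>s. s \<in> forms m G \<Longrightarrow> S.val (Y - S.lin m s x) \<le> g) \<Longrightarrow>
       t \<in> forms m (2 * G) \<Longrightarrow> \<not> T.Z (T.lin m t x') \<Longrightarrow> g' \<le> T.val (T.lin m t x') + int C + 1 \<Longrightarrow>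
       finite X \<Longrightarrow> S.incongruent g X \<Longrightarrow> card X \<le> card (forms m G) + 1 \<Longrightarrow>
       \<exists>X'\<subseteq>R. finite X' \<and> T.incongruent g' X' \<and> card X' = card X"
  shows "\<exists>s\<in>forms m G. \<exists>z\<in>R. \<exists>g'. \<forall>Y'. B' g' (Y' - (T.lin m s x' + z)) \<longrightarrow>
           sim C (graph m (2 * G) x x' \<union> centers m G x x' Y Y')"
proof -
  let ?P = "graph m (2 * G) x x'"
  define I where "I = {t \<in> forms m (2 * G). \<not> S.Z (S.lin m t x)}"
  define \<alpha> where "\<alpha> = (\<lambda>t. S.val (S.lin m t x))"
  define \<alpha>' where "\<alpha>' = (\<lambda>t. T.val (T.lin m t x'))"
  have ZZ: "S.Z (S.lin m t x) \<longleftrightarrow> T.Z (T.lin m t x')" if "t \<in> forms m (2 * G)" for t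
    using sim_graph_Z[OF sim that] .
  have inP: "(S.lin m t x, T.lin m t x') \<in> ?P" if "t \<in> forms m (2 * G)" for t
    using that unfolding graph_def by blast
  have finI: "finite I" unfolding I_def using finite_forms by simp
  have "I \<noteq> {}" unfolding I_def using t0 by blast
  define F where "F = forms m G"
  have finF: "finite F" unfolding F_def by (rule finite_forms)
  have "F \<noteq> {}" unfolding F_def using zero_in_forms by blast
  define \<gamma> where "\<gamma> = Max ((\<lambda>s. S.val (Y - S.lin m s x)) ` F)"
  have "\<gamma> \<in> (\<lambda>s. S.val (Y - S.lin m s x)) ` F"
    unfolding \<gamma>_def using finF \<open>F \<noteq> {}\<close> by (intro Max_in) auto
  then obtain s0 where s0: "s0 \<in> F" "S.val (Y - S.lin m s0 x) = \<gamma>" by auto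
  have le_\<gamma>: "S.val (Y - S.lin m s x) \<le> \<gamma>" if "s \<in> F" for s
    unfolding \<gamma>_def using finF that by (intro Max_ge) auto
  obtain \<gamma>' where
    m1: "\<And>i c. i \<in> I \<Longrightarrow> \<bar>c\<bar> \<le> int C \<Longrightarrow> \<alpha> i + c \<le> \<gamma> \<longleftrightarrow> \<alpha>' i + c \<le> \<gamma>'" and
    m2: "\<And>i c. i \<in> I \<Longrightarrow> \<bar>c\<bar> \<le> int C \<Longrightarrow> \<gamma> + c \<le> \<alpha> i \<longleftrightarrow> \<gamma>' + c \<le> \<alpha>' i" and
    m3: "\<exists>i\<in>I. \<gamma>' \<le> \<alpha>' i + int C + 1"
  proof (rule match_int[of I C \<alpha> \<alpha>' \<gamma>])
    show "\<alpha> i + c \<le> \<alpha> j \<longleftrightarrow> \<alpha>' i + c \<le> \<alpha>' j" if "i \<in> I" "j \<in> I" "\<bar>c\<bar> \<le> 2 * int C + 1" for i j c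
    proof -
      have i: "i \<in> forms m (2 * G)" "\<not> S.Z (S.lin m i x)" and j: "j \<in> forms m (2 * G)" "\<not> S.Z (S.lin m j x)"
        using that unfolding I_def by auto
      have "S.leq c (S.lin m i x) (S.lin m j x) \<longleftrightarrow> T.leq c (T.lin m i x') (T.lin m j x')"
        using simD[OF sim inP[OF i(1)] inP[OF j(1)]] that(3) by simp
      then show ?thesis
        using i j ZZ[OF i(1)] ZZ[OF j(1)] unfolding S.leq_iff T.leq_iff \<alpha>_def \<alpha>'_def by simp
    qed
  qed (use finI \<open>I \<noteq> {}\<close> in auto)
  have B1: "B (\<gamma> + 1) (S.lin m t x) \<longleftrightarrow> B' (\<gamma>' + 1) (T.lin m t x')"
    and B0: "B \<gamma> (S.lin m t x) \<longleftrightarrow> B' \<gamma>' (T.lin m t x')" if t: "t \<in> forms m (2 * G)" for t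
  proof -
    have "(B (\<gamma> + 1) (S.lin m t x) \<longleftrightarrow> B' (\<gamma>' + 1) (T.lin m t x')) \<and>
        (B \<gamma> (S.lin m t x) \<longleftrightarrow> B' \<gamma>' (T.lin m t x'))"
    proof (cases "S.Z (S.lin m t x)")
      case True
      then show ?thesis using ZZ[OF t] by (simp add: S.Z_def T.Z_def)
    next
      case False
      then have "t \<in> I" unfolding I_def using t by simp
      then show ?thesis
        using m1[of t 0] m2[of t 0] False ZZ[OF t]
        unfolding \<alpha>_def \<alpha>'_def by (auto simp: S.B_iff_le_val T.B_iff_le_val)
    qed
    then show "B (\<gamma> + 1) (S.lin m t x) \<longleftrightarrow> B' (\<gamma>' + 1) (T.lin m t x')"
      "B \<gamma> (S.lin m t x) \<longleftrightarrow> B' \<gamma>' (T.lin m t x')" by auto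
  qed
  have diffF: "(\<lambda>j. s j - t j) \<in> forms m (2 * G)" if "s \<in> F" "t \<in> F" for s t
    using forms_diff[of s m G t G] that unfolding F_def by (simp add: mult_2)
  \<comment> \<open>\<open>A\<close> consists of the nearest centers; \<open>T\<close> below keeps
    one for each class at level \<gamma>, with \<open>s0\<close> as origin.\<close>
  define A where "A = {s \<in> F. S.val (Y - S.lin m s x) = \<gamma>}"
  define d where "d = (\<lambda>s. S.lin m s x - S.lin m s0 x)"
  define d' where "d' = (\<lambda>s. T.lin m s x' - T.lin m s0 x')"
  have BA: "B \<gamma> (Y - S.lin m s x)" "\<not> B (\<gamma> + 1) (Y - S.lin m s x)" if "s \<in> A" for s
    using that nz[of s] unfolding A_def F_def by (auto simp: S.B_iff_le_val)
  have s0A: "s0 \<in> A" unfolding A_def using s0 by simp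
  have dd: "B (\<gamma> + 1) (d s - d t) \<longleftrightarrow> B' (\<gamma>' + 1) (d' s - d' t)" if "s \<in> F" "t \<in> F" for s t
    using B1[OF diffF[OF that]] by (simp add: d_def d'_def S.lin_diff T.lin_diff)
  have "finite A" unfolding A_def using finF by simp
  obtain T where T: "T \<subseteq> A" "\<forall>a\<in>T. \<forall>b\<in>T. a \<noteq> b \<longrightarrow> \<not> B (\<gamma> + 1) (d a - d b)"
    "\<forall>a\<in>A. \<exists>b\<in>T. B (\<gamma> + 1) (d a - d b)"
    using greedy_representatives[OF \<open>finite A\<close>, of "\<lambda>a b. B (\<gamma> + 1) (d a - d b)"]
    by (auto simp: S.B_diff_commute)
  have finT: "finite T" using T(1) \<open>finite A\<close> finite_subset by blast
  \<comment> \<open>\<open>Y\<close> adds a class to those of \<open>T\<close>, as no nearest center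
    agrees with \<open>Y\<close> beyond \<gamma>.\<close>
  define X where "X = insert (Y - S.lin m s0 x) (d ` T)"
  have Yd: "Y - S.lin m s0 x - d s = Y - S.lin m s x" for s by (simp add: d_def)
  have Bd: "B \<gamma> (d s)" if "s \<in> A" for s
    using S.B_diff[OF BA(1)[OF s0A] BA(1)[OF that]] by (simp add: d_def)
  have far: "\<not> B (\<gamma> + 1) (Y - S.lin m s0 x - d s)" if "s \<in> T" for s
    unfolding Yd using BA(2) T(1) that by blast
  have notin: "Y - S.lin m s0 x \<notin> d ` T" using far by force
  have injd: "inj_on d T" using T(2) by (force simp: inj_on_def)
  have cardX: "card X = card T + 1"
    unfolding X_def using notin finT injd by (simp add: card_image)
  have incX: "S.incongruent \<gamma> X"
    unfolding S.incongruent_def X_def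
    using BA(1)[OF s0A] Bd T(1,2) far by (auto simp: S.B_diff_commute[of _ "d _" "Y - _"])
  obtain i where i: "i \<in> I" "\<gamma>' \<le> \<alpha>' i + int C + 1" using m3 by blast
  have "\<exists>X'\<subseteq>R. finite X' \<and> T.incongruent \<gamma>' X' \<and> card X' = card X"
  proof (rule reps[of \<gamma> \<gamma>' i X])
    fix t assume "t \<in> forms m (2 * G)" "\<not> S.Z (S.lin m t x)"
    then have "t \<in> I" unfolding I_def by simp
    then show "(S.val (S.lin m t x) \<le> \<gamma>) = (T.val (T.lin m t x') \<le> \<gamma>') \<and>
      (\<gamma> \<le> S.val (S.lin m t x)) = (\<gamma>' \<le> T.val (T.lin m t x'))"
      using m1[of t 0] m2[of t 0] unfolding \<alpha>_def \<alpha>'_def by simp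
  next
    show "S.val (Y - S.lin m s x) \<le> \<gamma>" if "s \<in> forms m G" for s using le_\<gamma> that unfolding F_def .
    show "i \<in> forms m (2 * G)" "\<not> T.Z (T.lin m i x')" using i ZZ unfolding I_def by auto
    show "\<gamma>' \<le> T.val (T.lin m i x') + int C + 1" using i unfolding \<alpha>'_def by simp
    show "finite X" "S.incongruent \<gamma> X" unfolding X_def using finT incX X_def by auto
    show "card X \<le> card (forms m G) + 1"
      unfolding cardX using T(1) card_mono[OF finF, of T] unfolding A_def F_def by auto
  qed
  then obtain X' where X': "X' \<subseteq> R" "finite X'" "T.incongruent \<gamma>' X'" "card X' = card T + 1"
    unfolding cardX by blast
  \<comment> \<open>Otherwise every element of \<open>X'\<close> would be congruent to some
    \<open>d' s\<close> with \<open>s\<close> in \<open>T\<close>, injectively, although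
    \<open>X'\<close> has one element more than \<open>T\<close>.\<close>
  have "\<exists>z\<in>X'. \<forall>s\<in>T. \<not> B' (\<gamma>' + 1) (z - d' s)"
  proof (rule ccontr)
    assume "\<not> ?thesis"
    then obtain h where h: "\<And>z. z \<in> X' \<Longrightarrow> h z \<in> T \<and> B' (\<gamma>' + 1) (z - d' (h z))" by metis
    have "inj_on h X'"
    proof (rule inj_onI, rule ccontr)
      fix z w assume zw: "z \<in> X'" "w \<in> X'" "h z = h w" "z \<noteq> w"
      have "B' (\<gamma>' + 1) ((z - d' (h z)) - (w - d' (h w)))"
        by (rule T.B_diff[OF conjunct2[OF h[OF zw(1)]] conjunct2[OF h[OF zw(2)]]])
      then have "B' (\<gamma>' + 1) (z - w)" by (simp add: zw(3))
      then show False using zw X'(3) unfolding T.incongruent_def by blast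
    qed
    then have "card X' \<le> card T" using h finT by (intro card_inj_on_le) auto
    then show False using X'(4) by simp
  qed
  then obtain z where z: "z \<in> X'" "\<And>s. s \<in> T \<Longrightarrow> \<not> B' (\<gamma>' + 1) (z - d' s)" by blast
  have Bz: "B' \<gamma>' z" using z(1) X'(3) unfolding T.incongruent_def by blast
  have zA: "\<not> B' (\<gamma>' + 1) (z - d' s)" if s: "s \<in> A" for s
  proof
    assume *: "B' (\<gamma>' + 1) (z - d' s)"
    obtain b where b: "b \<in> T" "B (\<gamma> + 1) (d s - d b)" using T(3) s by blast
    then have "B' (\<gamma>' + 1) (d' s - d' b)" using dd[of s b] s T(1) unfolding A_def by auto
    from T.B_add[OF * this] show False using z(2)[OF b(1)] by simp
  qed
  have "sim C (?P \<union> centers m G x x' Y Y')" if Y': "B' (\<gamma>' + 1) (Y' - (T.lin m s0 x' + z))" for Y'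
  proof -
    have YB: "B' \<gamma>' (Y' - T.lin m s0 x')"
      using T.B_add[OF T.B_antimono[OF Y', of \<gamma>'] Bz] by (simp add: algebra_simps)
    \<comment> \<open>The displacement from a nearest center has valuation exactly \<gamma>, and
      \<gamma>' on the other side. From any other center \<open>s\<close>, the difference of
      \<open>s0\<close> and \<open>s\<close> dominates, so a form of height \<open>2 * G\<close>
      replaces the displacement.\<close>
    have key: "(\<exists>u1 u1'. (u1, u1') \<in> ?P \<and> (\<forall>g. B g u \<longleftrightarrow> B g u1) \<and> (\<forall>g. B' g u' \<longleftrightarrow> B' g u1')) \<or>
      (\<not> S.Z u \<and> S.val u = \<gamma> \<and> \<not> T.Z u' \<and> T.val u' = \<gamma>')"
      if uu: "(u, u') \<in> ?P \<union> centers m G x x' Y Y'" for u u'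
    proof (cases "(u, u') \<in> ?P")
      case False
      then obtain s where s: "s \<in> F" and u: "u = Y - S.lin m s x" "u' = Y' - T.lin m s x'"
        using uu unfolding centers_def F_def by blast
      show ?thesis
      proof (cases "s \<in> A")
        case True
        have "B' \<gamma>' (d' s)"
          using Bd[OF True] B0[OF diffF[OF s s0(1)]] by (simp add: d_def d'_def S.lin_diff T.lin_diff)
        with YB have 1: "B' \<gamma>' u'"
          using T.B_diff[of \<gamma>' "Y' - T.lin m s0 x'" "d' s"] by (simp add: u d'_def)
        have "B' (\<gamma>' + 1) (u' - (z - d' s))" using Y' by (simp add: u d'_def algebra_simps)
        then have 2: "\<not> B' (\<gamma>' + 1) u'" using zA[OF True] T.B_cong by blast
        have "T.val u' = \<gamma>'" "\<not> T.Z u'" using T.val_eqI[OF 1 2] 2 unfolding T.Z_def by auto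
        moreover have "S.val u = \<gamma>" "\<not> S.Z u" using True nz[of s] u unfolding A_def F_def by auto
        ultimately show ?thesis by blast
      next
        case A: False
        define t where "t = (\<lambda>j. s0 j - s j)"
        have t: "t \<in> forms m (2 * G)" unfolding t_def by (rule diffF[OF s0(1) s])
        have lint: "S.lin m t x = S.lin m s0 x - S.lin m s x" "T.lin m t x' = T.lin m s0 x' - T.lin m s x'"
          by (simp_all add: t_def S.lin_diff T.lin_diff)
        have "S.val u < \<gamma>" using A s le_\<gamma>[OF s] u unfolding A_def by auto
        then have nB: "\<not> B \<gamma> u" using nz[of s] s u unfolding F_def by (simp add: S.B_iff_le_val)
        have "B g u \<longleftrightarrow> B g (S.lin m t x)" if "g \<le> \<gamma>" for g
          by (rule S.B_cong) (use S.B_antimono[OF BA(1)[OF s0A] that] in \<open>simp add: u lint\<close>)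
        then have 1: "\<forall>g. B g u \<longleftrightarrow> B g (S.lin m t x)" using nB S.B_antimono by (metis linear)
        then have "\<not> B' \<gamma>' (T.lin m t x')" using nB B0[OF t] by blast
        moreover have "B' g u' \<longleftrightarrow> B' g (T.lin m t x')" if "g \<le> \<gamma>'" for g
          by (rule T.B_cong) (use T.B_antimono[OF YB that] in \<open>simp add: u lint\<close>)
        ultimately have "\<forall>g. B' g u' \<longleftrightarrow> B' g (T.lin m t x')" using T.B_antimono by (metis linear)
        with 1 inP[OF t] show ?thesis by blast
      qed
    qed blast
    have graph_cases: "S.Z u \<longleftrightarrow> T.Z u'" "\<not> S.Z u \<Longrightarrow> \<exists>i\<in>I. S.val u = \<alpha> i \<and> T.val u' = \<alpha>' i"
      if uP: "(u, u') \<in> ?P" for u u'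
    proof -
      obtain t where t: "t \<in> forms m (2 * G)" "u = S.lin m t x" "u' = T.lin m t x'"
        using uP unfolding graph_def by blast
      show "S.Z u \<longleftrightarrow> T.Z u'" using ZZ[OF t(1)] t by simp
      show "\<exists>i\<in>I. S.val u = \<alpha> i \<and> T.val u' = \<alpha>' i" if "\<not> S.Z u"
        using that t unfolding I_def \<alpha>_def \<alpha>'_def by blast
    qed
    have leq: "S.leq c u w \<longleftrightarrow> T.leq c u' w'"
      if u: "(u, u') \<in> ?P \<or> (\<not> S.Z u \<and> S.val u = \<gamma> \<and> \<not> T.Z u' \<and> T.val u' = \<gamma>')"
        and w: "(w, w') \<in> ?P \<or> (\<not> S.Z w \<and> S.val w = \<gamma> \<and> \<not> T.Z w' \<and> T.val w' = \<gamma>')"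
        and c: "\<bar>c\<bar> \<le> int C" for u u' w w' c
    proof (cases "(u, u') \<in> ?P")
      case True
      show ?thesis
      proof (cases "(w, w') \<in> ?P")
        case w: True
        from simD[OF sim True w, of c] c show ?thesis by simp
      next
        case False
        then have w': "\<not> S.Z w" "S.val w = \<gamma>" "\<not> T.Z w'" "T.val w' = \<gamma>'" using w by auto
        show ?thesis
        proof (cases "S.Z u")
          case Zu: True
          then show ?thesis using graph_cases(1)[OF True] w' by (simp add: S.leq_iff T.leq_iff)
        next
          case Zu: False
          obtain i where i: "i \<in> I" "S.val u = \<alpha> i" "T.val u' = \<alpha>' i"
            using graph_cases(2)[OF True Zu] by blast
          show ?thesis
            using Zu graph_cases(1)[OF True] w' m1[OF i(1) c] i by (simp add: S.leq_iff T.leq_iff)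
        qed
      qed
    next
      case False
      then have u': "\<not> S.Z u" "S.val u = \<gamma>" "\<not> T.Z u'" "T.val u' = \<gamma>'" using u by auto
      show ?thesis
      proof (cases "(w, w') \<in> ?P")
        case True
        show ?thesis
        proof (cases "S.Z w")
          case Zu: True
          then show ?thesis using graph_cases(1)[OF True] by (simp add: S.leq_iff T.leq_iff)
        next
          case Zu: False
          obtain i where i: "i \<in> I" "S.val w = \<alpha> i" "T.val w' = \<alpha>' i"
            using graph_cases(2)[OF True Zu] by blast
          show ?thesis
            using Zu graph_cases(1)[OF True] u' m2[OF i(1) c] i by (simp add: S.leq_iff T.leq_iff)
        qed
      next
        case False
        then show ?thesis using w u' by (simp add: S.leq_iff T.leq_iff)
      qed
    qed
    show ?thesis
      unfolding sim_def
    proof (intro allI impI)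
      fix u u' w w' and c :: int
      assume u: "(u, u') \<in> ?P \<union> centers m G x x' Y Y'" and w: "(w, w') \<in> ?P \<union> centers m G x x' Y Y'"
        and c: "\<bar>c\<bar> \<le> int C"
      have norm: "\<exists>u1 u1'. ((u1, u1') \<in> ?P \<or> (\<not> S.Z u1 \<and> S.val u1 = \<gamma> \<and> \<not> T.Z u1' \<and> T.val u1' = \<gamma>')) \<and>
        (\<forall>g. B g u \<longleftrightarrow> B g u1) \<and> (\<forall>g. B' g u' \<longleftrightarrow> B' g u1')"
        if "(u, u') \<in> ?P \<union> centers m G x x' Y Y'" for u u'
        using key[OF that] by blast
      obtain u1 u1' where u1: "(u1, u1') \<in> ?P \<or> (\<not> S.Z u1 \<and> S.val u1 = \<gamma> \<and> \<not> T.Z u1' \<and> T.val u1' = \<gamma>')"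
        "\<forall>g. B g u \<longleftrightarrow> B g u1" "\<forall>g. B' g u' \<longleftrightarrow> B' g u1'" using norm[OF u] by (elim exE conjE)
      obtain w1 w1' where w1: "(w1, w1') \<in> ?P \<or> (\<not> S.Z w1 \<and> S.val w1 = \<gamma> \<and> \<not> T.Z w1' \<and> T.val w1' = \<gamma>')"
        "\<forall>g. B g w \<longleftrightarrow> B g w1" "\<forall>g. B' g w' \<longleftrightarrow> B' g w1'" using norm[OF w] by (elim exE conjE)
      show "S.leq c u w \<longleftrightarrow> T.leq c u' w'"
        using leq[OF u1(1) w1(1) c] u1(2,3) w1(2,3) by (simp add: S.leq_def T.leq_def)
    qed
  qed
  moreover have "s0 \<in> forms m G" "z \<in> R" using s0 z X'(1) unfolding F_def by auto
  ultimately show ?thesis by blast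
qed

end

section \<open>Sequences of integers as a valued module\<close>

text \<open>
  The model for a place with residue field of order \<open>p ^ f\<close> and ramification index \<open>e\<close>: the
  coordinate \<open>d\<close> at \<open>k\<close> stands for \<open>d\<close> times a basis element of valuation \<open>k div f\<close>. Here \<open>e = 0\<close>
  means that \<open>p = 0\<close> in the field, and \<open>e = f = 0\<close> gives the trivial valuation, since \<open>k div 0 = 0\<close>.
\<close>

definition nz :: "nat \<Rightarrow> nat \<Rightarrow> int \<Rightarrow> bool" where
  "nz p e m \<longleftrightarrow> m \<noteq> 0 \<and> \<not> (e = 0 \<and> int p dvd m)"

definition int_val :: "nat \<Rightarrow> nat \<Rightarrow> int \<Rightarrow> int" where
  "int_val p e m = int (e * multiplicity (int p) m)"

text \<open>If \<open>e > 0\<close>, multiplication by \<open>p\<close> raises valuations by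
  \<open>e\<close>, so basis elements of valuations 0 to \<open>e - 1\<close>, \<open>f\<close> of
  each, are enough. If \<open>e = 0\<close>, digits count only modulo \<open>p\<close> and all
  coordinates are needed.\<close>

definition live :: "nat \<Rightarrow> nat \<Rightarrow> nat \<Rightarrow> nat \<Rightarrow> int \<Rightarrow> bool" where
  "live p e f k d \<longleftrightarrow> nz p e d \<and> (e = 0 \<or> k < e * f)"

definition digit_val :: "nat \<Rightarrow> nat \<Rightarrow> nat \<Rightarrow> nat \<Rightarrow> int \<Rightarrow> nat" where
  "digit_val p e f k d = e * multiplicity (int p) d + k div f"

definition seq_ball :: "nat \<Rightarrow> nat \<Rightarrow> nat \<Rightarrow> int \<Rightarrow> (nat \<Rightarrow> int) \<Rightarrow> bool" where
  "seq_ball p e f g c \<longleftrightarrow> (\<forall>k. live p e f k (c k) \<longrightarrow> g \<le> int (digit_val p e f k (c k)))"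

definition seq_scale :: "int \<Rightarrow> (nat \<Rightarrow> int) \<Rightarrow> nat \<Rightarrow> int" where
  "seq_scale m c = (\<lambda>k. m * c k)"

text \<open>At a discrete place \<open>p\<close> is the residue characteristic; at the trivial one
  it is the characteristic of the field and hence possibly 0.\<close>

definition place :: "nat \<Rightarrow> nat \<Rightarrow> nat \<Rightarrow> bool" where
  "place p e f \<longleftrightarrow> (prime p \<and> 0 < f) \<or> (e = 0 \<and> f = 0 \<and> (prime p \<or> p = 0))"

lemma nz_mult: "place p e f \<Longrightarrow> nz p e (a * b) \<longleftrightarrow> nz p e a \<and> nz p e b"
  unfolding nz_def place_def by (auto simp: prime_dvd_mult_iff)

lemma int_val_mult:
  "place p e f \<Longrightarrow> nz p e (a * b) \<Longrightarrow> int_val p e (a * b) = int_val p e a + int_val p e b"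
  unfolding int_val_def nz_def place_def
  by (auto simp: prime_elem_multiplicity_mult_distrib algebra_simps)

lemma nz_diff:
  assumes "nz p e (a - b)"
  shows "nz p e a \<or> nz p e b"
  using assms unfolding nz_def by (auto intro: dvd_diff)

lemma multiplicity_diff_ge:
  fixes a b :: int
  assumes "prime p" "a \<noteq> 0" "b \<noteq> 0" "a \<noteq> b"
  shows "min (multiplicity (int p) a) (multiplicity (int p) b) \<le> multiplicity (int p) (a - b)"
proof (rule multiplicity_geI)
  let ?n = "min (multiplicity (int p) a) (multiplicity (int p) b)"
  have "int p ^ ?n dvd a" "int p ^ ?n dvd b"
    by (rule multiplicity_dvd', simp)+
  then show "int p ^ ?n dvd a - b" by (rule dvd_diff)
qed (use assms in auto)

lemma valued_module_seq:
  assumes pl: "place p e f"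
  shows "valued_module seq_scale (seq_ball p e f) (nz p e) (int_val p e)"
proof (unfold_locales, goal_cases)
  case (1 a x y)
  show ?case by (simp add: seq_scale_def fun_eq_iff algebra_simps)
next
  case (2 a b x)
  show ?case by (simp add: seq_scale_def fun_eq_iff algebra_simps)
next
  case (3 a b x)
  show ?case by (simp add: seq_scale_def fun_eq_iff algebra_simps)
next
  case (4 x)
  show ?case by (simp add: seq_scale_def fun_eq_iff)
next
  case (5 g)
  show ?case by (simp add: seq_ball_def live_def nz_def)
next
  case (6 g x y)
  show ?case
    unfolding seq_ball_def
  proof (intro allI impI)
    fix k assume l: "live p e f k ((x - y) k)"
    then have l': "nz p e (x k - y k)" "e = 0 \<or> k < e * f" unfolding live_def by auto
    have X: "nz p e (x k) \<Longrightarrow> g \<le> int (digit_val p e f k (x k))"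
      and Y: "nz p e (y k) \<Longrightarrow> g \<le> int (digit_val p e f k (y k))"
      using 6 l'(2) unfolding seq_ball_def live_def by blast+
    show "g \<le> int (digit_val p e f k ((x - y) k))"
    proof (cases "e = 0")
      case True
      then show ?thesis using nz_diff[OF l'(1)] X Y unfolding digit_val_def by auto
    next
      case False
      then have p: "prime p" using pl unfolding place_def by auto
      have ne: "x k \<noteq> y k" using l'(1) unfolding nz_def by auto
      consider "x k = 0" | "y k = 0" | "x k \<noteq> 0" "y k \<noteq> 0" by blast
      then show ?thesis
      proof cases
        case 1
        then show ?thesis using Y ne False by (simp add: nz_def digit_val_def multiplicity_cong[of "int p" "- y k" "y k"])
      next
        case 2
        then show ?thesis using X ne False by (simp add: nz_def digit_val_def)
      next
        case 3
        have "min (multiplicity (int p) (x k)) (multiplicity (int p) (y k)) \<le> multiplicity (int p) (x k - y k)"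
          by (rule multiplicity_diff_ge) (use p 3 ne in auto)
        then have "digit_val p e f k (x k) \<le> digit_val p e f k (x k - y k) \<or>
            digit_val p e f k (y k) \<le> digit_val p e f k (x k - y k)"
          unfolding digit_val_def by (auto simp: min_def split: if_splits)
        then show ?thesis using X Y 3 False by (force simp: nz_def)
      qed
    qed
  qed
next
  case (7 h x g)
  then show ?case unfolding seq_ball_def by force
next
  case (8 x)
  show ?case by (intro exI[of _ 0]) (simp add: seq_ball_def)
next
  case (9 m g x)
  have "live p e f k (m * x k) \<longleftrightarrow> live p e f k (x k)" for k
    using 9 nz_mult[OF pl] unfolding live_def by blast
  moreover have "int (digit_val p e f k (m * x k)) = int (digit_val p e f k (x k)) + int_val p e m"
    if "live p e f k (x k)" for k
  proof -
    have "nz p e (m * x k)" using 9 that nz_mult[OF pl] unfolding live_def by blast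
    from int_val_mult[OF pl this] show ?thesis unfolding digit_val_def int_val_def by simp
  qed
  ultimately show ?case unfolding seq_ball_def seq_scale_def by auto
next
  case (10 m g x)
  then show ?case using nz_mult[OF pl] unfolding seq_ball_def seq_scale_def live_def by blast
qed

lemma seq_ball_nonpos: "g \<le> 0 \<Longrightarrow> seq_ball p e f g c"
  unfolding seq_ball_def by force

definition bounded_seq :: "nat \<Rightarrow> (nat \<Rightarrow> int) \<Rightarrow> bool" where
  "bounded_seq M c \<longleftrightarrow> (\<forall>k. \<bar>c k\<bar> \<le> int M) \<and> (\<forall>k\<ge>M. c k = 0)"

lemma bounded_seq_mono: "bounded_seq M c \<Longrightarrow> M \<le> N \<Longrightarrow> bounded_seq N c"
  unfolding bounded_seq_def by (meson le_trans of_nat_mono order_trans)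

lemma multiplicity_le_abs:
  assumes "prime p" "d \<noteq> 0" "\<bar>d\<bar> \<le> int M"
  shows "multiplicity (int p) d \<le> M"
proof -
  let ?n = "multiplicity (int p) d"
  have "int p ^ ?n dvd d" by (rule multiplicity_dvd)
  from dvd_imp_le_int[OF assms(2) this] have "int p ^ ?n \<le> \<bar>d\<bar>" by (simp add: power_abs)
  moreover have "?n < 2 ^ ?n" by (rule less_exp)
  moreover have "(2::nat) ^ ?n \<le> p ^ ?n" using prime_ge_2_nat[OF assms(1)] by (rule power_mono) simp
  ultimately have "int ?n < int M"
    using assms(3) by (metis (mono_tags) le_less_trans less_le_trans of_nat_le_iff of_nat_less_iff of_nat_power)
  then show ?thesis by simp
qed

context
  fixes p e f :: nat
  assumes pl: "place p e f"
begin

interpretation D: valued_module seq_scale "seq_ball p e f" "nz p e" "int_val p e"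
  by (rule valued_module_seq[OF pl])

lemma seq_val_nonneg: "\<not> D.Z c \<Longrightarrow> 0 \<le> D.val c"
  using D.B_iff_le_val[of c 0] seq_ball_nonpos by simp

text \<open>A live entry of absolute value at most \<open>M\<close> contains \<open>p\<close> at
  most \<open>M\<close> times, and its position is below \<open>M\<close>. Since \<gamma>' exceeds
  the valuation of some form by a bounded amount only, this makes \<gamma>' computably
  bounded.\<close>

lemma seq_val_le:
  assumes "\<not> D.Z c" "bounded_seq M c"
  shows "D.val c \<le> int (e * M + M)"
proof -
  obtain k where k: "live p e f k (c k)"
    using assms(1) unfolding D.Z_def seq_ball_def by blast
  have "seq_ball p e f (D.val c) c" using D.B_iff_le_val[OF assms(1)] by simp
  then have "D.val c \<le> int (digit_val p e f k (c k))" using k unfolding seq_ball_def by blast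
  also have "digit_val p e f k (c k) \<le> e * M + M"
  proof -
    have "c k \<noteq> 0" using k unfolding live_def nz_def by blast
    then have "k < M" using assms(2) unfolding bounded_seq_def by (meson not_le)
    then have "k div f \<le> M" using div_le_dividend[of k f] by linarith
    moreover have "e * multiplicity (int p) (c k) \<le> e * M"
    proof (cases "e = 0")
      case False
      then show ?thesis
        using pl assms(2) \<open>c k \<noteq> 0\<close> unfolding place_def bounded_seq_def
        by (intro mult_le_mono2 multiplicity_le_abs) auto
    qed simp
    ultimately show ?thesis unfolding digit_val_def by (rule add_le_mono[rotated])
  qed
  finally show ?thesis by simp
qed

text \<open>With \<open>h = g div e\<close> and \<open>r = g mod e\<close> (so \<open>h = 0\<close>, \<open>r = g\<close> if \<open>e = 0\<close>), the coordinates of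
  valuation exactly \<open>g\<close> are those at \<open>r f, \<dots>, r f + f - 1\<close> that are \<open>p ^ h\<close> times a unit.\<close>

lemma seq_ball_next:
  assumes "prime p" "0 < f" and c: "seq_ball p e f (int g) c"
    and dig: "\<And>l. l < f \<Longrightarrow> int p ^ Suc (g div e) dvd c (g mod e * f + l)"
  shows "seq_ball p e f (int g + 1) c"
  unfolding seq_ball_def
proof (intro allI impI)
  fix k assume l: "live p e f k (c k)"
  then have ge: "g \<le> digit_val p e f k (c k)" using c unfolding seq_ball_def by force
  have "digit_val p e f k (c k) \<noteq> g"
  proof
    assume eq: "digit_val p e f k (c k) = g"
    have nz: "c k \<noteq> 0" using l unfolding live_def nz_def by blast
    have "e = 0 \<or> k div f < e" using l assms(2) unfolding live_def by (auto simp: less_mult_imp_div_less)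
    then have r: "g mod e = k div f" and h: "e = 0 \<or> g div e = multiplicity (int p) (c k)"
      using eq unfolding digit_val_def by auto
    have "int p ^ Suc (g div e) dvd c k"
      using dig[of "k mod f"] assms(2) by (simp add: r)
    then have "e \<noteq> 0 \<Longrightarrow> Suc (g div e) \<le> multiplicity (int p) (c k)"
      using nz assms(1) by (intro multiplicity_geI) auto
    moreover have "e = 0 \<Longrightarrow> int p dvd c k" using \<open>int p ^ Suc (g div e) dvd c k\<close> by simp
    ultimately show False using h l unfolding live_def nz_def by (cases "e = 0") auto
  qed
  with ge show "int g + 1 \<le> int (digit_val p e f k (c k))" by linarith
qed

lemma seq_ball_digit_dvd:
  assumes "prime p" "0 < f" and c: "seq_ball p e f (int g) c" and l: "l < f"
  shows "int p ^ (g div e) dvd c (g mod e * f + l)"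
proof (cases "e = 0 \<or> c (g mod e * f + l) = 0")
  case False
  let ?k = "g mod e * f + l"
  have "?k < e * f"
  proof -
    have "?k < Suc (g mod e) * f" using l by simp
    also have "\<dots> \<le> e * f" using False by (intro mult_le_mono1 Suc_leI mod_less_divisor) auto
    finally show ?thesis .
  qed
  then have "live p e f ?k (c ?k)" using False unfolding live_def nz_def by simp
  then have "g \<le> digit_val p e f ?k (c ?k)" using c unfolding seq_ball_def by force
  also have "\<dots> = e * multiplicity (int p) (c ?k) + g mod e" using l unfolding digit_val_def by simp
  finally have "e * (g div e) \<le> e * multiplicity (int p) (c ?k)"
    using mult_div_mod_eq[of e g] by linarith
  then have "g div e \<le> multiplicity (int p) (c ?k)" using False by simp
  then show ?thesis by (rule multiplicity_dvd')
qed auto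

text \<open>The \<open>f\<close> coordinates of valuation exactly \<open>g\<close>, divided by their
  common power of \<open>p\<close> and reduced modulo \<open>p\<close>, separate the classes. For
  \<open>g < 0\<close> both balls are everything and there is just one class.\<close>

lemma card_incongruent_le:
  assumes "prime p" "0 < f" and X: "D.incongruent g X"
  shows "card X \<le> p ^ f"
proof (cases "g < 0")
  case True
  then have "x = y" if "x \<in> X" "y \<in> X" for x y
    using X that seq_ball_nonpos[of "g + 1" p e f "x - y"] unfolding D.incongruent_def by auto
  then have "card X \<le> 1" using card_le_Suc0_iff_eq by (metis One_nat_def card.infinite zero_le)
  also have "1 \<le> p ^ f" using prime_gt_0_nat[OF assms(1)] by simp
  finally show ?thesis .
next
  case False
  then obtain n where g: "g = int n" by (metis not_less zero_le_imp_eq_int)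
  let ?h = "int p ^ (n div e)" and ?k = "\<lambda>l. n mod e * f + l"
  define \<phi> where "\<phi> = (\<lambda>c::nat \<Rightarrow> int. \<lambda>l\<in>{..<f}. (c (?k l) div ?h) mod int p)"
  have p0: "0 < p" using prime_gt_0_nat[OF assms(1)] .
  have "inj_on \<phi> X"
  proof (rule inj_onI, rule ccontr)
    fix x y assume xy: "x \<in> X" "y \<in> X" "\<phi> x = \<phi> y" "x \<noteq> y"
    have B: "seq_ball p e f (int n) x" "seq_ball p e f (int n) y"
      using X xy unfolding D.incongruent_def g by auto
    have "int p ^ Suc (n div e) dvd (x - y) (?k l)" if l: "l < f" for l
    proof -
      obtain a where a: "x (?k l) = ?h * a" using seq_ball_digit_dvd[OF assms(1,2) B(1) l] by (rule dvdE)
      obtain b where b: "y (?k l) = ?h * b" using seq_ball_digit_dvd[OF assms(1,2) B(2) l] by (rule dvdE)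
      have "\<phi> x l = \<phi> y l" using xy by simp
      then have "a mod int p = b mod int p" using l a b p0 unfolding \<phi>_def by simp
      then have "int p dvd a - b" by (simp add: mod_eq_dvd_iff)
      then have "?h * int p dvd ?h * (a - b)" by (rule mult_dvd_mono[OF dvd_refl])
      moreover have "(x - y) (?k l) = ?h * (a - b)" using a b by (simp add: right_diff_distrib)
      ultimately show ?thesis by (simp only: power_Suc2)
    qed
    then have "seq_ball p e f (int n + 1) (x - y)"
      using seq_ball_next[OF assms(1,2) D.B_diff[OF B]] by blast
    then show False using X xy unfolding D.incongruent_def g by blast
  qed
  moreover have "\<phi> ` X \<subseteq> (\<Pi>\<^sub>E l\<in>{..<f}. {0..<int p})"
    unfolding \<phi>_def by (intro image_subsetI restrict_PiE_iff[THEN iffD2] ballI) (use p0 in simp)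
  ultimately have "card X \<le> card (\<Pi>\<^sub>E l\<in>{..<f}. {0..<int p})"
    by (intro card_inj_on_le) (auto intro: finite_PiE)
  then show ?thesis by (simp add: card_PiE)
qed

text \<open>Digits from 0 to \<open>p - 1\<close> are put at the \<open>f\<close> coordinates of
  valuation \<open>g\<close>. The bound covers size and support: entries are at most
  \<open>p ^ Suc g\<close>, and positions are below \<open>(g + 1) * f\<close> because
  \<open>g mod e \<le> g\<close>.\<close>

lemma incongruent_representatives:
  assumes "prime p" "0 < f" and n: "n \<le> p ^ f"
  shows "\<exists>X. finite X \<and> D.incongruent (int g) X \<and> card X = n \<and>
    (\<forall>c\<in>X. bounded_seq (p ^ Suc g + (g + 1) * f) c)"
proof -
  let ?h = "int p ^ (g div e)" and ?r = "g mod e"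
  have p0: "0 < p" using prime_gt_0_nat[OF assms(1)] .
  define \<psi> where "\<psi> = (\<lambda>\<delta>::nat \<Rightarrow> int. \<lambda>k. if k div f = ?r then ?h * \<delta> (k mod f) else 0)"
  let ?E = "\<Pi>\<^sub>E l\<in>{..<f}. {0..<int p}"
  have coord: "\<psi> \<delta> (?r * f + l) = ?h * \<delta> l" if "l < f" for \<delta> l using that unfolding \<psi>_def by simp
  have nB: "\<not> seq_ball p e f (int g + 1) (\<psi> \<delta> - \<psi> \<delta>')" if d: "\<delta> \<in> ?E" "\<delta>' \<in> ?E" "\<delta> \<noteq> \<delta>'" for \<delta> \<delta>'
  proof
    assume B: "seq_ball p e f (int g + 1) (\<psi> \<delta> - \<psi> \<delta>')"
    obtain l where l: "l < f" "\<delta> l \<noteq> \<delta>' l" using d by (metis PiE_ext lessThan_iff)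
    have "\<delta> l \<in> {0..<int p}" "\<delta>' l \<in> {0..<int p}" using PiE_mem[OF d(1), of l] PiE_mem[OF d(2), of l] l by simp_all
    then have "\<delta> l mod int p = \<delta> l" "\<delta>' l mod int p = \<delta>' l" by auto
    then have nd: "\<not> int p dvd \<delta> l - \<delta>' l" using l(2) by (metis mod_eq_dvd_iff)
    let ?k = "?r * f + l"
    have v: "(\<psi> \<delta> - \<psi> \<delta>') ?k = ?h * (\<delta> l - \<delta>' l)" using l(1) by (simp add: coord right_diff_distrib)
    have ne: "?h * (\<delta> l - \<delta>' l) \<noteq> 0" using l(2) p0 by simp
    have mu: "multiplicity (int p) (?h * (\<delta> l - \<delta>' l)) = g div e"
      using nd assms(1) by (intro multiplicity_eqI) (auto simp: mult.commute)
    have "live p e f ?k ((\<psi> \<delta> - \<psi> \<delta>') ?k)"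
    proof -
      have "e = 0 \<or> ?k < e * f"
      proof (cases "e = 0")
        case False
        have "?k < Suc ?r * f" using l by simp
        also have "\<dots> \<le> e * f" using False by (intro mult_le_mono1 Suc_leI mod_less_divisor) auto
        finally show ?thesis by simp
      qed simp
      moreover have "nz p e (?h * (\<delta> l - \<delta>' l))" using ne nd unfolding nz_def by auto
      ultimately show ?thesis unfolding live_def v by blast
    qed
    then have "int g + 1 \<le> int (digit_val p e f ?k ((\<psi> \<delta> - \<psi> \<delta>') ?k))" using B unfolding seq_ball_def by blast
    also have "digit_val p e f ?k ((\<psi> \<delta> - \<psi> \<delta>') ?k) = g"
      unfolding v digit_val_def mu using l(1) by (simp add: mult_div_mod_eq)
    finally show False by simp
  qed
  have B: "seq_ball p e f (int g) (\<psi> \<delta>)" for \<delta>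
    unfolding seq_ball_def
  proof (intro allI impI)
    fix k assume l: "live p e f k (\<psi> \<delta> k)"
    then have nz: "\<psi> \<delta> k \<noteq> 0" unfolding live_def nz_def by blast
    then have k: "k div f = ?r" "\<psi> \<delta> k = ?h * \<delta> (k mod f)" unfolding \<psi>_def by (auto split: if_splits)
    have "e * (g div e) \<le> e * multiplicity (int p) (\<psi> \<delta> k)"
      using nz assms(1) by (intro mult_le_mono2 multiplicity_geI) (auto simp: k(2))
    then have "e * (g div e) + g mod e \<le> digit_val p e f k (\<psi> \<delta> k)" unfolding digit_val_def k(1) by (rule add_right_mono)
    then show "int g \<le> int (digit_val p e f k (\<psi> \<delta> k))" by (simp only: mult_div_mod_eq of_nat_le_iff)
  qed
  have inj: "inj_on \<psi> ?E"
    by (rule inj_onI) (metis nB D.B_0 diff_self)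
  have "card ?E = p ^ f" by (simp add: card_PiE)
  then obtain E where E: "E \<subseteq> ?E" "card E = n" using n obtain_subset_with_card_n by (metis)
  have finE: "finite E" using E(1) by (rule finite_subset) (auto intro: finite_PiE)
  show ?thesis
  proof (intro exI[of _ "\<psi> ` E"] conjI ballI)
    show "D.incongruent (int g) (\<psi> ` E)" unfolding D.incongruent_def using B nB E(1) by blast
    show "card (\<psi> ` E) = n" using card_image[OF inj_on_subset[OF inj E(1)]] E(2) by simp
    fix c assume "c \<in> \<psi> ` E"
    then obtain \<delta> where \<delta>: "\<delta> \<in> ?E" "c = \<psi> \<delta>" using E(1) by blast
    show "bounded_seq (p ^ Suc g + (g + 1) * f) c"
      unfolding bounded_seq_def
    proof (intro conjI allI impI)
      fix k
      have "\<delta> (k mod f) \<in> {0..<int p}" using PiE_mem[OF \<delta>(1), of "k mod f"] assms(2) by simp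
      then have "\<bar>c k\<bar> \<le> ?h * int p" unfolding \<delta>(2) \<psi>_def by (auto simp: abs_mult)
      also have "\<dots> \<le> int (p ^ Suc g)"
        using power_increasing[of "g div e" g "int p"] p0 div_le_dividend[of g e]
        by (simp add: mult.commute mult_right_mono)
      also have "\<dots> \<le> int (p ^ Suc g + (g + 1) * f)" unfolding of_nat_le_iff by (rule le_add1)
      finally show "\<bar>c k\<bar> \<le> int (p ^ Suc g + (g + 1) * f)" .
      assume "p ^ Suc g + (g + 1) * f \<le> k"
      then have "(g + 1) * f \<le> k" by simp
      then have "g + 1 \<le> k div f" using assms(2) by (simp add: less_eq_div_iff_mult_less_eq)
      then have "k div f \<noteq> ?r" using mod_less_eq_dividend[of g e] by linarith
      then show "c k = 0" unfolding \<delta>(2) \<psi>_def by simp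
    qed
  qed (use finE in auto)
qed

text \<open>Unit vectors serve: under the trivial valuation two sequences are congruent only if they
  differ by a null one, so the number of classes is unlimited.\<close>

lemma trivial_incongruent_representatives:
  assumes "e = 0" "f = 0"
  shows "\<exists>X. finite X \<and> D.incongruent 0 X \<and> card X = n \<and> (\<forall>c\<in>X. bounded_seq (n + 1) c)"
proof -
  define \<delta> where "\<delta> = (\<lambda>j k::nat. if k = j then 1 else 0 :: int)"
  have p: "\<not> int p dvd 1" using pl unfolding place_def by (auto dest: prime_gt_1_nat)
  have nB: "\<not> seq_ball p e f (0 + 1) (\<delta> i - \<delta> j)" if "i \<noteq> j" for i j
    using p that assms unfolding seq_ball_def live_def nz_def digit_val_def \<delta>_def
    by (auto intro!: exI[of _ i])
  have inj: "inj_on \<delta> {..<n}" by (rule inj_onI) (metis nB D.B_0 diff_self)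
  have "D.incongruent 0 (\<delta> ` {..<n})"
    unfolding D.incongruent_def
  proof (intro conjI ballI impI)
    show "\<not> seq_ball p e f (0 + 1) (c - c')" if "c \<in> \<delta> ` {..<n}" "c' \<in> \<delta> ` {..<n}" "c \<noteq> c'" for c c'
    proof -
      from that(1,2) obtain i j where ij: "c = \<delta> i" "c' = \<delta> j" by (elim imageE)
      then have "i \<noteq> j" using that(3) by auto
      then show ?thesis unfolding ij by (rule nB)
    qed
  qed (simp add: seq_ball_nonpos)
  moreover have "bounded_seq (n + 1) (\<delta> j)" if "j < n" for j
    using that unfolding bounded_seq_def \<delta>_def by auto
  ultimately show ?thesis
    using inj by (intro exI[of _ "\<delta> ` {..<n}"]) (auto simp: card_image)
qed

end

lemma card_forms_le: "card (forms m G) \<le> (2 * G + 1) ^ m"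
proof -
  have "inj_on (\<lambda>f. restrict f {..<m}) (forms m G)"
  proof (rule inj_onI, rule ext)
    fix f g :: "nat \<Rightarrow> int" and j
    assume fg: "f \<in> forms m G" "g \<in> forms m G" "restrict f {..<m} = restrict g {..<m}"
    show "f j = g j"
    proof (cases "j < m")
      case True
      then show ?thesis using fun_cong[OF fg(3), of j] by simp
    next
      case False
      then show ?thesis using fg(1,2) by (simp add: forms_def)
    qed
  qed
  moreover have "(\<lambda>f. restrict f {..<m}) ` forms m G \<subseteq> (\<Pi>\<^sub>E j\<in>{..<m}. {- int G..int G})"
    by (intro image_subsetI restrict_PiE_iff[THEN iffD2] ballI) (auto simp: forms_def abs_le_iff minus_le_iff)
  ultimately have "card (forms m G) \<le> card (\<Pi>\<^sub>E j\<in>{..<m}. {- int G..int G})"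
    by (intro card_inj_on_le) (auto intro: finite_PiE)
  also have "\<dots> = (2 * G + 1) ^ m" by (simp add: card_PiE nat_add_distrib nat_mult_distrib)
  finally show ?thesis .
qed

context valued_module_pair
begin

text \<open>Multiples of a single non-null element differ in valuation just as their coefficients
  do, so every height and tolerance is available. Both iterations start here.\<close>

lemma sim_graph_1:
  assumes "\<not> S.Z (x 0)" "\<not> T.Z (x' 0)"
  shows "sim C (graph 1 H x x')"
  unfolding sim_def
proof (intro allI impI)
  fix u u' w w' and c :: int
  assume u: "(u, u') \<in> graph 1 H x x'" and w: "(w, w') \<in> graph 1 H x x'"
  from u obtain a where a: "u = sc a (x 0)" "u' = sc' a (x' 0)" by (auto simp: graph_def S.lin_def T.lin_def)
  from w obtain b where b: "w = sc b (x 0)" "w' = sc' b (x' 0)" by (auto simp: graph_def S.lin_def T.lin_def)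
  have Z: "S.Z (sc m (x 0)) \<longleftrightarrow> \<not> NZ m" "T.Z (sc' m (x' 0)) \<longleftrightarrow> \<not> NZ m"
    and v: "NZ m \<Longrightarrow> S.val (sc m (x 0)) = \<nu> m + S.val (x 0)" "NZ m \<Longrightarrow> T.val (sc' m (x' 0)) = \<nu> m + T.val (x' 0)" for m
  proof -
    have 1: "B g (sc m (x 0)) \<longleftrightarrow> g \<le> \<nu> m + S.val (x 0)" if "NZ m" for g
      using S.B_scale[OF that, of "g - \<nu> m" "x 0"] unfolding S.B_iff_le_val[OF assms(1)] by auto
    have 2: "B' g (sc' m (x' 0)) \<longleftrightarrow> g \<le> \<nu> m + T.val (x' 0)" if "NZ m" for g
      using T.B_scale[OF that, of "g - \<nu> m" "x' 0"] unfolding T.B_iff_le_val[OF assms(2)] by auto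
    show "S.val (sc m (x 0)) = \<nu> m + S.val (x 0)" if "NZ m" by (rule S.val_eqI) (simp_all add: 1 that)
    show "T.val (sc' m (x' 0)) = \<nu> m + T.val (x' 0)" if "NZ m" by (rule T.val_eqI) (simp_all add: 2 that)
    show "S.Z (sc m (x 0)) \<longleftrightarrow> \<not> NZ m"
      using 1[of "\<nu> m + S.val (x 0) + 1"] S.B_scale_not_NZ unfolding S.Z_def by (cases "NZ m") auto
    show "T.Z (sc' m (x' 0)) \<longleftrightarrow> \<not> NZ m"
      using 2[of "\<nu> m + T.val (x' 0) + 1"] T.B_scale_not_NZ unfolding T.Z_def by (cases "NZ m") auto
  qed
  show "S.leq c u w \<longleftrightarrow> T.leq c u' w'"
    unfolding a b S.leq_iff T.leq_iff Z by (auto simp: v)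
qed

end

context valued_module
begin

lemma trivial_val_eq_0:
  assumes "\<And>g x. B g x \<longleftrightarrow> g \<le> 0 \<or> Z x" "\<not> Z x"
  shows "val x = 0"
  using assms by (intro val_eqI) auto

text \<open>For \<open>g < 0\<close> the balls at \<open>g\<close> and \<open>g + 1\<close> both
  contain everything, for \<open>g > 0\<close> both contain just the null elements; either way there
  is one class.\<close>

lemma trivial_card_incongruent_le:
  assumes "\<And>g x. B g x \<longleftrightarrow> g \<le> 0 \<or> Z x" "g \<noteq> 0" "incongruent g X"
  shows "card X \<le> 1"
proof -
  have "x = y" if "x \<in> X" "y \<in> X" for x y
  proof (rule ccontr)
    assume "x \<noteq> y"
    then have *: "B g x" "B g y" "\<not> B (g + 1) (x - y)" using assms(3) that unfolding incongruent_def by auto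
    then have "\<not> Z (x - y)" "0 < g" using assms(2) unfolding assms(1)[of "g + 1"] by auto
    moreover have "Z x" "Z y" using * \<open>0 < g\<close> assms(1)[of g] by auto
    then have "Z (x - y)" unfolding Z_def using B_diff by blast
    ultimately show False by blast
  qed
  then show ?thesis using card_le_Suc0_iff_eq by (metis One_nat_def card.infinite zero_le)
qed

lemma incongruent_subset: "incongruent g X \<Longrightarrow> Y \<subseteq> X \<Longrightarrow> incongruent g Y"
  unfolding incongruent_def by blast

end

lemma seq_ball_trivial:
  assumes "place p 0 0"
  shows "seq_ball p 0 0 g c \<longleftrightarrow> g \<le> 0 \<or> valued_module.Z (seq_ball p 0 0) c"
proof -
  interpret valued_module seq_scale "seq_ball p 0 0" "nz p 0" "int_val p 0"
    by (rule valued_module_seq[OF assms])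
  show ?thesis unfolding Z_def unfolding seq_ball_def digit_val_def by auto
qed

lemma bounded_seq_lin:
  assumes "valued_module seq_scale B NZ \<nu>"
    and "\<And>j. j < m \<Longrightarrow> bounded_seq M (c j)" "f \<in> forms m G"
  shows "bounded_seq (m * G * M + M) (valued_module.lin seq_scale m f c)"
proof -
  interpret valued_module seq_scale B NZ \<nu> by fact
  have lin: "lin m f c k = (\<Sum>j<m. f j * c j k)" for k
    unfolding lin_def by (induction m) (auto simp: seq_scale_def)
  have "\<bar>lin m f c k\<bar> \<le> int (m * G * M)" for k
  proof -
    have "\<bar>\<Sum>j<m. f j * c j k\<bar> \<le> (\<Sum>j<m. \<bar>f j * c j k\<bar>)" by (rule sum_abs)
    also have "\<dots> \<le> (\<Sum>j<m. int G * int M)"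
      using assms(2,3) unfolding forms_def bounded_seq_def abs_mult by (intro sum_mono mult_mono) auto
    finally show ?thesis unfolding lin by simp
  qed
  moreover have "lin m f c k = 0" if "k \<ge> M" for k
    using assms(2) that unfolding lin bounded_seq_def by (intro sum.neutral) auto
  ultimately show ?thesis
    unfolding bounded_seq_def of_nat_add by (meson add_leD2 add_increasing2 of_nat_0_le_iff)
qed

section \<open>Fields with finitely many independent valuations\<close>

text \<open>\<open>B_all\<close> turns null forms into exact linear relations in the field, the same
  at every place. At a place with \<open>f i = 0\<close> the balls are trivial, and classes are
  supplied by \<open>infinite\<close> instead of being counted by \<open>p i ^ f i\<close>.\<close>

locale places =
  fixes n :: nat and p e f :: "nat \<Rightarrow> nat" and B :: "nat \<Rightarrow> int \<Rightarrow> 'a::field \<Rightarrow> bool"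
  assumes n_pos: "0 < n"
    and place: "i < n \<Longrightarrow> place (p i) (e i) (f i)"
    and vm: "i < n \<Longrightarrow> valued_module (\<lambda>m x. of_int m * x) (B i) (nz (p i) (e i)) (int_val (p i) (e i))"
    and B_all: "i < n \<Longrightarrow> (\<forall>g. B i g x) \<longleftrightarrow> x = 0"
    and nz_iff: "i < n \<Longrightarrow> nz (p i) (e i) m \<longleftrightarrow> (of_int m :: 'a) \<noteq> 0"
    and card_incongruent: "i < n \<Longrightarrow> 0 < f i \<Longrightarrow> valued_module.incongruent (B i) g X \<Longrightarrow> card X \<le> p i ^ f i"
    and incongruent_exists: "i < n \<Longrightarrow> 0 < f i \<Longrightarrow>
      \<exists>X. finite X \<and> valued_module.incongruent (B i) g X \<and> card X = p i ^ f i"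
    and trivial: "i < n \<Longrightarrow> f i = 0 \<Longrightarrow> B i g x \<longleftrightarrow> g \<le> 0 \<or> x = 0"
    and infinite: "infinite (UNIV :: 'a set)"
    and approximation: "\<exists>y. \<forall>i<n. B i g (y - s i)"
begin

abbreviation DB :: "nat \<Rightarrow> int \<Rightarrow> (nat \<Rightarrow> int) \<Rightarrow> bool" where
  "DB i \<equiv> seq_ball (p i) (e i) (f i)"

abbreviation fsc :: "int \<Rightarrow> 'a \<Rightarrow> 'a" where "fsc \<equiv> \<lambda>m x. of_int m * x"

abbreviation simFD where "simFD i \<equiv> valued_module_pair.sim (B i) (DB i)"
abbreviation simDF where "simDF i \<equiv> valued_module_pair.sim (DB i) (B i)"
abbreviation graphFD where "graphFD \<equiv> valued_module_pair.graph fsc seq_scale"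
abbreviation graphDF where "graphDF \<equiv> valued_module_pair.graph seq_scale fsc"
abbreviation flin where "flin \<equiv> valued_module.lin fsc"
abbreviation dlin where "dlin \<equiv> valued_module.lin seq_scale"
abbreviation DZ where "DZ i \<equiv> valued_module.Z (DB i)"

lemma vmD: "i < n \<Longrightarrow> valued_module seq_scale (DB i) (nz (p i) (e i)) (int_val (p i) (e i))"
  by (rule valued_module_seq[OF place])

lemma pairFD: "i < n \<Longrightarrow> valued_module_pair fsc (B i) seq_scale (DB i) (nz (p i) (e i)) (int_val (p i) (e i))"
  by (intro valued_module_pair.intro vm vmD)

lemma pairDF: "i < n \<Longrightarrow> valued_module_pair seq_scale (DB i) fsc (B i) (nz (p i) (e i)) (int_val (p i) (e i))"
  by (intro valued_module_pair.intro vm vmD)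

lemma FZ_iff: "i < n \<Longrightarrow> valued_module.Z (B i) x \<longleftrightarrow> x = 0"
  using B_all by (simp add: valued_module.Z_def[OF vm])

text \<open>A common multiple of all coefficients of height \<open>H\<close> that are nonzero in the
  field, and itself nonzero there. The factorial of \<open>H\<close> may vanish in positive
  characteristic, but still serves as a computable bound.\<close>

definition unit_prod :: "nat \<Rightarrow> int" where
  "unit_prod H = \<Prod>{b \<in> {1..int H}. (of_int b :: 'a) \<noteq> 0}"

lemma finite_units: "finite {b \<in> {1..int H}. (of_int b :: 'a) \<noteq> 0}"
  by (rule finite_subset[of _ "{1..int H}"]) auto

lemma unit_prod_pos: "unit_prod H > 0"
  unfolding unit_prod_def by (intro prod_pos) auto

lemma unit_prod_ne_0: "(of_int (unit_prod H) :: 'a) \<noteq> 0"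
  unfolding unit_prod_def of_int_prod prod_zero_iff[OF finite_units] by blast

lemma dvd_unit_prod:
  assumes "(of_int b :: 'a) \<noteq> 0" "\<bar>b\<bar> \<le> int H"
  shows "b dvd unit_prod H"
proof -
  have "b \<noteq> 0" using assms(1) by auto
  moreover have "(of_int \<bar>b\<bar> :: 'a) \<noteq> 0" using assms(1) by (auto simp: abs_if)
  ultimately have "\<bar>b\<bar> \<in> {b \<in> {1..int H}. (of_int b :: 'a) \<noteq> 0}" using assms(2) by auto
  from dvd_prodI[OF finite_units this, of "\<lambda>b. b"] have "\<bar>b\<bar> dvd unit_prod H"
    unfolding unit_prod_def .
  then show ?thesis by simp
qed

lemma unit_prod_le_fact: "unit_prod H \<le> fact H"
proof -
  have "unit_prod H \<le> \<Prod>{1..int H}"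
    unfolding unit_prod_def by (rule prod_mono2) auto
  also have "\<Prod>{1..int H} = (\<Prod>b\<in>int ` {1..H}. b)"
    by (rule prod.cong) (auto simp: image_int_atLeastAtMost)
  also have "\<dots> = fact H" by (subst prod.reindex) (auto simp: fact_prod)
  finally show ?thesis .
qed

lemma int_val_nonneg: "0 \<le> int_val q e' m" by (simp add: int_val_def)

lemma int_val_unit_prod_le:
  assumes "i < n" "e i \<le> E"
  shows "nat (int_val (p i) (e i) (unit_prod H)) \<le> E * fact H"
proof (cases "e i = 0")
  case False
  then have "prime (p i)" using place[OF assms(1)] unfolding place_def by auto
  moreover have "\<bar>unit_prod H\<bar> \<le> int (fact H)" using unit_prod_pos[of H] unit_prod_le_fact[of H] by simp
  ultimately have "multiplicity (int (p i)) (unit_prod H) \<le> fact H"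
    using unit_prod_pos[of H] by (intro multiplicity_le_abs) auto
  then show ?thesis using assms(2) unfolding int_val_def nat_int by (intro mult_le_mono)
qed (simp add: int_val_def)

definition unit_prod_mult :: "nat \<Rightarrow> nat" where "unit_prod_mult H = nat (unit_prod H) * H"

lemma unit_prod_mult_le: "unit_prod_mult H \<le> fact H * H"
  using unit_prod_le_fact[of H] unit_prod_pos[of H] unfolding unit_prod_mult_def
  by (intro mult_le_mono1) (simp add: nat_le_iff)

lemma int_unit_prod_mult: "int (unit_prod_mult H) = unit_prod H * int H"
  using unit_prod_pos[of H] unfolding unit_prod_mult_def by simp

lemma extendFD:
  assumes i: "i < n" and C': "C + nat (int_val (p i) (e i) (unit_prod H)) \<le> C'"
    and "simFD i C' (graphFD m H x c \<union> valued_module_pair.centers fsc seq_scale m (unit_prod_mult H) x c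
      (of_int (unit_prod H) * y) y')"
  shows "simFD i C (graphFD (Suc m) H (x(m := y)) ((\<lambda>j. seq_scale (unit_prod H) (c j))(m := y')))"
proof -
  interpret P: valued_module_pair fsc "B i" seq_scale "DB i" "nz (p i) (e i)" "int_val (p i) (e i)"
    by (rule pairFD[OF i])
  show ?thesis
  proof (rule P.sim_graph_Suc[where G = "unit_prod_mult H"])
    show "P.sim (C + nat (int_val (p i) (e i) (unit_prod H)))
      (P.graph m H x c \<union> P.centers m (unit_prod_mult H) x c (of_int (unit_prod H) * y) y')"
      using P.sim_mono[OF assms(3) C' order_refl] .
  qed (use unit_prod_pos unit_prod_ne_0 dvd_unit_prod nz_iff[OF i] nz_mult[OF place[OF i]]
      int_val_mult[OF place[OF i]] int_val_nonneg int_unit_prod_mult in auto)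
qed

lemma extendDF:
  assumes i: "i < n" and C': "C + nat (int_val (p i) (e i) (unit_prod H)) \<le> C'"
    and "simDF i C' (graphDF m H c x \<union> valued_module_pair.centers seq_scale fsc m (unit_prod_mult H) c x
      (seq_scale (unit_prod H) y) y')"
  shows "simDF i C (graphDF (Suc m) H (c(m := y)) ((\<lambda>j. of_int (unit_prod H) * x j)(m := y')))"
proof -
  interpret P: valued_module_pair seq_scale "DB i" fsc "B i" "nz (p i) (e i)" "int_val (p i) (e i)"
    by (rule pairDF[OF i])
  show ?thesis
  proof (rule P.sim_graph_Suc[where G = "unit_prod_mult H"])
    show "P.sim (C + nat (int_val (p i) (e i) (unit_prod H)))
      (P.graph m H c x \<union> P.centers m (unit_prod_mult H) c x (seq_scale (unit_prod H) y) y')"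
      using P.sim_mono[OF assms(3) C' order_refl] .
  qed (use unit_prod_pos unit_prod_ne_0 dvd_unit_prod nz_iff[OF i] nz_mult[OF place[OF i]]
      int_val_mult[OF place[OF i]] int_val_nonneg int_unit_prod_mult in auto)
qed

end

text \<open>
  If \<open>E\<close> bounds all \<open>p\<close>, \<open>e\<close>, \<open>f\<close> and \<open>M\<close> bounds the entries of the old sequences, a new sequence is
  a form in the old ones plus a representative of valuation at most \<open>next_val\<close> (see \<open>match_int\<close>).
\<close>

definition next_val :: "nat \<Rightarrow> nat \<Rightarrow> nat \<Rightarrow> nat \<Rightarrow> nat \<Rightarrow> nat" where
  "next_val E m H C M =
    E * (m * (2 * (fact H * H)) * M + M) + (m * (2 * (fact H * H)) * M + M) + (C + E * fact H) + 1"

definition next_bound :: "nat \<Rightarrow> nat \<Rightarrow> nat \<Rightarrow> nat \<Rightarrow> nat \<Rightarrow> nat" where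
  "next_bound E m H C M =
    fact H * M + (m * (2 * (fact H * H)) * M + M) +
    (E ^ Suc (next_val E m H C M) + (next_val E m H C M + 1) * E + (2 * (fact H * H) + 1) ^ m + 2)"

lemma bounded_seq_add: "bounded_seq M c \<Longrightarrow> bounded_seq N d \<Longrightarrow> bounded_seq (M + N) (c + d)"
  unfolding bounded_seq_def plus_fun_def of_nat_add
  by (intro conjI allI order_trans[OF abs_triangle_ineq] add_mono) auto

lemma bounded_seq_scale:
  assumes "bounded_seq M c" "0 < a" "a \<le> int A"
  shows "bounded_seq (A * M) (seq_scale a c)"
proof -
  have "\<bar>a * c k\<bar> \<le> int (A * M)" for k
    using assms unfolding bounded_seq_def abs_mult of_nat_mult by (intro mult_mono) auto
  moreover have "c k = 0" if "A * M \<le> k" for k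
  proof -
    have "M \<le> A * M" using assms(2,3) by (cases A) auto
    then have "M \<le> k" using that by (rule order_trans)
    then show ?thesis using assms(1) unfolding bounded_seq_def by blast
  qed
  ultimately show ?thesis unfolding bounded_seq_def seq_scale_def by simp
qed

text \<open>It selects the element at position 0, which is nonzero; so there is always a non-null
  form against which \<open>match_int\<close> can place the new valuation.\<close>

definition first_form :: "nat \<Rightarrow> int" where "first_form = (\<lambda>j. if j = 0 then 1 else 0)"

lemma first_form_in_forms: "0 < m \<Longrightarrow> 0 < H \<Longrightarrow> first_form \<in> forms m H"
  unfolding first_form_def forms_def by auto

lemma (in valued_module) lin_first_form: "0 < m \<Longrightarrow> lin m first_form x = x 0"
proof (induction m)
  case (Suc m)
  then show ?case by (cases m) (auto simp: lin_def first_form_def)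
qed simp

context places
begin

lemma B_of_int_mult: "i < n \<Longrightarrow> B i g y \<Longrightarrow> B i g (of_int a * y)"
proof -
  assume i: "i < n" and y: "B i g y"
  interpret valued_module fsc "B i" "nz (p i) (e i)" "int_val (p i) (e i)" by (rule vm[OF i])
  show ?thesis
  proof (cases "nz (p i) (e i) a")
    case True
    then have "B i (g + int_val (p i) (e i) a) (of_int a * y)" using B_scale y by simp
    then show ?thesis by (rule B_antimono) (simp add: int_val_nonneg)
  qed (simp add: B_scale_not_NZ)
qed

text \<open>The condition on \<open>y\<close> is v(y) \<ge> v(x 0). It makes the matched valuation
  nonnegative, as the valuation of a sequence has to be. The summand \<open>fact H * M\<close> of
  \<open>next_bound\<close> pays for rescaling the old sequences by
  \<open>unit_prod H\<close>.\<close>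

lemma stepFD:
  assumes mH: "0 < m" "0 < H"
    and sim: "\<And>i. i < n \<Longrightarrow> simFD i (2 * (C + E * fact H) + 1) (graphFD m (2 * (fact H * H)) x (c i))"
    and E: "\<And>i. i < n \<Longrightarrow> p i \<le> E \<and> e i \<le> E \<and> f i \<le> E"
    and bd: "\<And>i j. i < n \<Longrightarrow> j < m \<Longrightarrow> bounded_seq M (c i j)"
    and x0: "x 0 \<noteq> 0" and y: "\<And>i g. i < n \<Longrightarrow> B i g (x 0) \<Longrightarrow> B i g y"
  shows "\<exists>c'. \<forall>i<n. simFD i C (graphFD (Suc m) H (x(m := y)) (c' i)) \<and>
    (\<forall>j<Suc m. bounded_seq (next_bound E m H C M) (c' i j))"
proof -
  define a where "a = unit_prod H"
  define G where "G = unit_prod_mult H"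
  \<comment> \<open>The extra \<open>E * fact H\<close> bounds the valuation of \<open>a\<close>,
    the amount of tolerance lost in \<open>sim_graph_Suc\<close>.\<close>
  define C1 where "C1 = C + E * fact H"
  define L where "L = m * (2 * (fact H * H)) * M + M"
  define K where "K = next_val E m H C M"
  define Mz where "Mz = E ^ Suc K + (K + 1) * E + (2 * (fact H * H) + 1) ^ m + 2"
  have K: "K = E * L + L + C1 + 1" unfolding K_def next_val_def L_def C1_def by simp
  have N: "next_bound E m H C M = fact H * M + L + Mz"
    unfolding next_bound_def K_def[symmetric] Mz_def L_def ..
  have G: "G \<le> fact H * H" unfolding G_def by (rule unit_prod_mult_le)
  have G0: "0 < G" using unit_prod_pos[of H] mH unfolding G_def unit_prod_mult_def by simp
  have a: "0 < a" "a \<le> int (fact H)" unfolding a_def using unit_prod_pos unit_prod_le_fact by auto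
  have "\<exists>z. (simFD i C1 (graphFD m (2 * G) x (c i) \<union> valued_module_pair.centers fsc seq_scale m G x (c i)
      (of_int a * y) z)) \<and> bounded_seq (L + Mz) z" if i: "i < n" for i
  proof -
    interpret P: valued_module_pair fsc "B i" seq_scale "DB i" "nz (p i) (e i)" "int_val (p i) (e i)"
      by (rule pairFD[OF i])
    have FZ: "P.S.Z u \<longleftrightarrow> u = 0" for u by (rule FZ_iff[OF i])
    have simi: "P.sim (2 * C1 + 1) (P.graph m (2 * G) x (c i))"
      by (rule P.sim_mono[OF sim[OF i, folded C1_def] order_refl P.graph_mono]) (use G in simp)
    have bL: "bounded_seq L (P.T.lin m t (c i))" if "t \<in> forms m (2 * G)" for t
    proof -
      have "bounded_seq (m * (2 * G) * M + M) (P.T.lin m t (c i))"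
        by (rule bounded_seq_lin[OF vmD[OF i] bd[OF i] that])
      then show ?thesis
        by (rule bounded_seq_mono) (unfold L_def, intro add_mono mult_le_mono order_refl G)
    qed
    have GG: "forms m G \<subseteq> forms m (2 * G)" by (rule forms_mono) simp
    show ?thesis
    proof (cases "\<exists>s\<in>forms m G. of_int a * y = P.S.lin m s x")
      case True
      then obtain s where s: "s \<in> forms m G" "of_int a * y = P.S.lin m s x" by blast
      have "P.sim (2 * C1 + 1) (P.graph m (2 * G) x (c i) \<union> P.centers m G x (c i) (of_int a * y) (P.T.lin m s (c i)))"
        by (rule P.sim_centers_Z[OF simi s(1)]) (simp_all add: s(2) P.S.Z_def P.T.Z_def)
      then have "P.sim C1 (P.graph m (2 * G) x (c i) \<union> P.centers m G x (c i) (of_int a * y) (P.T.lin m s (c i)))"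
        by (rule P.sim_mono) auto
      moreover have "bounded_seq (L + Mz) (P.T.lin m s (c i))"
        using bL s(1) GG by (blast intro: bounded_seq_mono[OF _ le_add1])
      ultimately show ?thesis by blast
    next
      case False
      let ?R = "{z. bounded_seq Mz z}"
      have t0: "first_form \<in> forms m (2 * G)" using mH G0 by (intro first_form_in_forms) auto
      have lin0: "P.S.lin m first_form x = x 0" "P.T.lin m first_form (c i) = c i 0"
        using mH by (simp_all add: P.S.lin_first_form P.T.lin_first_form)
      have c0: "\<not> P.T.Z (c i 0)" using P.sim_graph_Z[OF simi t0] x0 by (simp add: lin0 FZ)
      have "\<exists>s\<in>forms m G. \<exists>z\<in>?R. \<exists>g'. \<forall>Y'. DB i g' (Y' - (P.T.lin m s (c i) + z)) \<longrightarrow>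
        P.sim C1 (P.graph m (2 * G) x (c i) \<union> P.centers m G x (c i) (of_int a * y) Y')"
      proof (rule P.sim_centers_not_Z[OF simi _ t0])
        show "\<not> P.S.Z (of_int a * y - P.S.lin m s x)" if "s \<in> forms m G" for s
          using False that by (simp add: FZ)
        show "\<not> P.S.Z (P.S.lin m first_form x)" using x0 by (simp add: lin0 FZ)
        fix g g' X t
        assume match: "\<And>t. t \<in> forms m (2 * G) \<Longrightarrow> \<not> P.S.Z (P.S.lin m t x) \<Longrightarrow>
            (P.S.val (P.S.lin m t x) \<le> g) = (P.T.val (P.T.lin m t (c i)) \<le> g') \<and>
            (g \<le> P.S.val (P.S.lin m t x)) = (g' \<le> P.T.val (P.T.lin m t (c i)))"
          and max: "\<And>s. s \<in> forms m G \<Longrightarrow> P.S.val (of_int a * y - P.S.lin m s x) \<le> g"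
          and t: "t \<in> forms m (2 * G)" "\<not> P.T.Z (P.T.lin m t (c i))"
          and g': "g' \<le> P.T.val (P.T.lin m t (c i)) + int C1 + 1"
          and X: "finite X" "P.S.incongruent g X" "card X \<le> card (forms m G) + 1"
        have m0: "P.S.val (x 0) \<le> g \<longleftrightarrow> P.T.val (c i 0) \<le> g'" "g \<le> P.S.val (x 0) \<longleftrightarrow> g' \<le> P.T.val (c i 0)"
          using match[OF t0] x0 by (simp_all add: lin0 FZ)
        show "\<exists>X'\<subseteq>?R. finite X' \<and> P.T.incongruent g' X' \<and> card X' = card X"
        proof (cases "f i = 0")
          case True
          then have e0: "e i = 0" using place[OF i] unfolding place_def by auto
          have trS: "B i g u \<longleftrightarrow> g \<le> 0 \<or> P.S.Z u" for g u using trivial[OF i True] FZ by simp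
          have trT: "DB i g u \<longleftrightarrow> g \<le> 0 \<or> P.T.Z u" for g u
            using seq_ball_trivial[of "p i" g u] place[OF i] unfolding True e0 by simp
          have v0: "P.S.val (x 0) = 0" "P.T.val (c i 0) = 0"
            using P.S.trivial_val_eq_0[OF trS] P.T.trivial_val_eq_0[OF trT] x0 c0 FZ by auto
          show ?thesis
          proof (cases "g = 0")
            case g0: True
            then have "g' = 0" using m0 v0 by auto
            obtain X' where X': "finite X'" "P.T.incongruent 0 X'" "card X' = card X" "\<forall>z\<in>X'. bounded_seq (card X + 1) z"
              using trivial_incongruent_representatives[OF place[OF i] e0 True, of "card X"] by blast
            \<comment> \<open>One class more than there are centers is wanted, and the bound on unit
              vectors adds another 1; the last two summands of \<open>Mz\<close> provide for
              this.\<close>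
            have "(2 * G + 1) ^ m \<le> (2 * (fact H * H) + 1) ^ m" using G by (intro power_mono) auto
            then have "card X + 1 \<le> Mz" using X(3) card_forms_le[of m G] unfolding Mz_def by linarith
            then have "X' \<subseteq> ?R" using X'(4) bounded_seq_mono by blast
            then show ?thesis using X' \<open>g' = 0\<close> by blast
          next
            case False
            then have "card X \<le> 1" using P.S.trivial_card_incongruent_le[OF trS _ X(2)] by blast
            then have "card X = card (if card X = 0 then {} else {0 :: nat \<Rightarrow> int})" by auto
            moreover have "P.T.incongruent g' (if card X = 0 then {} else {0})"
              by (auto simp: P.T.incongruent_def)
            moreover have "(if card X = 0 then {} else {0}) \<subseteq> ?R" by (auto simp: bounded_seq_def)
            ultimately show ?thesis by (metis finite.emptyI finite.insertI)
          qed
        next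
          case False
          then have pr: "prime (p i)" "0 < f i" using place[OF i] unfolding place_def by auto
          have cX: "card X \<le> p i ^ f i" by (rule card_incongruent[OF i pr(2) X(2)])
          \<comment> \<open>The zero form is a center too, so \<open>g\<close> is at least the
            valuation of \<open>a * y\<close> and hence of \<open>x 0\<close>. The comparison of
            \<open>g\<close> with \<open>x 0\<close> carries over to \<open>g'\<close> and
            \<open>c i 0\<close>.\<close>
          have "B i (P.S.val (x 0)) (x 0)" using P.S.B_iff_le_val x0 FZ by simp
          then have "B i (P.S.val (x 0)) (of_int a * y)" using y B_of_int_mult i by blast
          moreover have "\<not> P.S.Z (of_int a * y)"
            using \<open>\<not> (\<exists>s\<in>forms m G. of_int a * y = P.S.lin m s x)\<close> zero_in_forms[of m G] P.S.lin_zero[of m x] FZ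
            by metis
          ultimately have "P.S.val (x 0) \<le> P.S.val (of_int a * y)" by (simp add: P.S.B_iff_le_val)
          also have "\<dots> \<le> g" using max[OF zero_in_forms] by (simp add: P.S.lin_zero)
          finally have "0 \<le> g'" using m0 seq_val_nonneg[OF place[OF i] c0] by linarith
          then obtain k where k: "g' = int k" using nonneg_int_cases by blast
          have "P.T.val (P.T.lin m t (c i)) \<le> int (e i * L + L)"
            by (rule seq_val_le[OF place[OF i] t(2) bL[OF t(1)]])
          also have "\<dots> \<le> int (E * L + L)" using E[OF i] unfolding of_nat_le_iff by (intro add_mono mult_le_mono1) auto
          finally have "k \<le> K" using g' unfolding k K by linarith
          obtain X' where X': "finite X'" "P.T.incongruent (int k) X'" "card X' = card X"
            "\<forall>z\<in>X'. bounded_seq (p i ^ Suc k + (k + 1) * f i) z"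
            using incongruent_representatives[OF place[OF i] pr cX, of k] by blast
          have "p i ^ Suc k \<le> E ^ Suc k" using E[OF i] by (intro power_mono) auto
          also have "\<dots> \<le> E ^ Suc K"
            using \<open>k \<le> K\<close> E[OF i] prime_gt_0_nat[OF pr(1)] by (intro power_increasing) auto
          finally have "p i ^ Suc k + (k + 1) * f i \<le> Mz"
            unfolding Mz_def using mult_le_mono[of "k + 1" "K + 1" "f i" E] \<open>k \<le> K\<close> E[OF i] by linarith
          then have "X' \<subseteq> ?R" using X'(4) bounded_seq_mono by blast
          then show ?thesis using X' k by blast
        qed
      qed
      then obtain s z g' where s: "s \<in> forms m G" "bounded_seq Mz z"
        "\<And>Y'. DB i g' (Y' - (P.T.lin m s (c i) + z)) \<Longrightarrow>
        P.sim C1 (P.graph m (2 * G) x (c i) \<union> P.centers m G x (c i) (of_int a * y) Y')" by blast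
      have "bounded_seq (L + Mz) (P.T.lin m s (c i) + z)"
        using bL s(1,2) GG by (intro bounded_seq_add) auto
      moreover have "P.sim C1 (P.graph m (2 * G) x (c i) \<union> P.centers m G x (c i) (of_int a * y) (P.T.lin m s (c i) + z))"
        by (rule s(3)) simp
      ultimately show ?thesis by blast
    qed
  qed
  then obtain z where z: "\<And>i. i < n \<Longrightarrow> simFD i C1 (graphFD m (2 * G) x (c i) \<union>
      valued_module_pair.centers fsc seq_scale m G x (c i) (of_int a * y) (z i))"
    "\<And>i. i < n \<Longrightarrow> bounded_seq (L + Mz) (z i)" by metis
  have HG: "H \<le> 2 * G" using a unfolding G_def unit_prod_mult_def a_def[symmetric] by (cases "nat a") auto
  show ?thesis
  proof (intro exI[of _ "\<lambda>i. (\<lambda>j. seq_scale a (c i j))(m := z i)"] allI impI conjI)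
    fix i assume i: "i < n"
    interpret P: valued_module_pair fsc "B i" seq_scale "DB i" "nz (p i) (e i)" "int_val (p i) (e i)"
      by (rule pairFD[OF i])
    show "P.sim C (P.graph (Suc m) H (x(m := y)) ((\<lambda>j. seq_scale a (c i j))(m := z i)))"
      unfolding a_def
    proof (rule extendFD[OF i])
      show "C + nat (int_val (p i) (e i) (unit_prod H)) \<le> C1"
        unfolding C1_def using int_val_unit_prod_le[OF i] E[OF i] by simp
      show "P.sim C1 (P.graph m H x (c i) \<union> P.centers m (unit_prod_mult H) x (c i) (of_int (unit_prod H) * y) (z i))"
        using P.sim_mono[OF z(1)[OF i] order_refl] P.graph_mono[OF HG] unfolding a_def G_def by (meson Un_mono order_refl)
    qed
    fix j assume "j < Suc m"
    show "bounded_seq (next_bound E m H C M) (((\<lambda>j. seq_scale a (c i j))(m := z i)) j)"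
    proof (cases "j = m")
      case True
      then show ?thesis using bounded_seq_mono[OF z(2)[OF i]] unfolding N by simp
    next
      case False
      then have "bounded_seq (fact H * M) (seq_scale a (c i j))"
        using bounded_seq_scale[OF bd[OF i] a] \<open>j < Suc m\<close> by simp
      then show ?thesis using False unfolding N by (auto elim: bounded_seq_mono)
    qed
  qed
qed

text \<open>A relation found at one place determines \<open>y\<close> in the field and must then
  hold at all the others, which \<open>uniform\<close> secures. Without such a relation each place
  merely prescribes a ball for \<open>y\<close>, and approximation finds a common element. The
  height in \<open>uniform\<close> is the sum of the bounds \<open>fact H * H\<close> for the form
  \<open>s\<close> and \<open>fact H\<close> for the factor \<open>a\<close> in the relation between
  \<open>a * y\<close> and \<open>s\<close>.\<close>

lemma stepDF:
  assumes mH: "0 < m" "0 < H"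
    and sim: "\<And>i. i < n \<Longrightarrow> simDF i (2 * (C + E * fact H) + 1) (graphDF m (2 * (fact H * H)) (c i) x)"
    and E: "\<And>i. i < n \<Longrightarrow> e i \<le> E"
    and c0: "\<And>i. i < n \<Longrightarrow> \<not> DZ i (c i 0)" and x0: "x 0 \<noteq> 0"
    and uniform: "\<And>t. t \<in> forms (Suc m) (fact H * H + fact H) \<Longrightarrow>
      (\<forall>i<n. DZ i (dlin (Suc m) t (c i))) \<or> (\<forall>i<n. \<not> DZ i (dlin (Suc m) t (c i)))"
  shows "\<exists>y. \<forall>i<n. simDF i C (graphDF (Suc m) H (c i) ((\<lambda>j. of_int (unit_prod H) * x j)(m := y)))"
proof -
  define a where "a = unit_prod H"
  define G where "G = unit_prod_mult H"
  define C1 where "C1 = C + E * fact H"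
  have G: "G \<le> fact H * H" unfolding G_def by (rule unit_prod_mult_le)
  have G0: "0 < G" using unit_prod_pos[of H] mH unfolding G_def unit_prod_mult_def by simp
  have a: "0 < a" "a \<le> int (fact H)" unfolding a_def using unit_prod_pos unit_prod_le_fact by auto
  have simi: "simDF i (2 * C1 + 1) (graphDF m (2 * G) (c i) x)" if i: "i < n" for i
  proof -
    interpret P: valued_module_pair seq_scale "DB i" fsc "B i" "nz (p i) (e i)" "int_val (p i) (e i)"
      by (rule pairDF[OF i])
    show ?thesis
      by (rule P.sim_mono[OF sim[OF i, folded C1_def] order_refl P.graph_mono]) (use G in simp)
  qed
  have "\<exists>y. \<forall>i<n. simDF i C1 (graphDF m (2 * G) (c i) x \<union>
      valued_module_pair.centers seq_scale fsc m G (c i) x (seq_scale a (c i m)) y)"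
  proof (cases "\<exists>i<n. \<exists>s\<in>forms m G. DZ i (seq_scale a (c i m) - dlin m s (c i))")
    case True
    then obtain i0 s where s: "i0 < n" "s \<in> forms m G" "DZ i0 (seq_scale a (c i0 m) - dlin m s (c i0))" by blast
    define t where "t = (\<lambda>j. if j < m then - s j else if j = m then a else 0)"
    have t: "t \<in> forms (Suc m) (fact H * H + fact H)"
    proof -
      have "s \<in> forms m (fact H * H + fact H)" by (rule subsetD[OF forms_mono s(2)]) (use G in simp)
      then have "\<bar>s j\<bar> \<le> int (fact H * H + fact H)" for j unfolding forms_def by blast
      moreover have "\<bar>a\<bar> \<le> int (fact H * H + fact H)" using a by (simp add: add_increasing)
      ultimately show ?thesis unfolding forms_def t_def by (simp add: abs_minus_cancel)
    qed
    have lint: "dlin (Suc m) t (c i) = seq_scale a (c i m) - dlin m s (c i)" if i: "i < n" for i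
    proof -
      interpret valued_module seq_scale "DB i" "nz (p i) (e i)" "int_val (p i) (e i)" by (rule vmD[OF i])
      have "lin (Suc m) t (c i) = lin m (\<lambda>j. - 1 * s j) (c i) + seq_scale a (c i m)"
        by (simp add: lin_def t_def)
      then show ?thesis by (simp only: lin_scale) simp
    qed
    have Z: "DZ i (seq_scale a (c i m) - dlin m s (c i))" if "i < n" for i
      using uniform[OF t] s that by (auto simp: lint)
    show ?thesis
    proof (intro exI[of _ "flin m s x"] allI impI)
      fix i assume i: "i < n"
      interpret P: valued_module_pair seq_scale "DB i" fsc "B i" "nz (p i) (e i)" "int_val (p i) (e i)"
        by (rule pairDF[OF i])
      have "P.sim (2 * C1 + 1) (P.graph m (2 * G) (c i) x \<union> P.centers m G (c i) x (seq_scale a (c i m)) (P.T.lin m s x))"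
        by (rule P.sim_centers_Z[OF simi[OF i] s(2) Z[OF i]]) (simp add: P.T.Z_def)
      then show "P.sim C1 (P.graph m (2 * G) (c i) x \<union> P.centers m G (c i) x (seq_scale a (c i m)) (P.T.lin m s x))"
        by (rule P.sim_mono) auto
    qed
  next
    case False
    have "\<exists>w g. \<forall>y. B i g (y - w) \<longrightarrow> simDF i C1 (graphDF m (2 * G) (c i) x \<union>
      valued_module_pair.centers seq_scale fsc m G (c i) x (seq_scale a (c i m)) y)" if i: "i < n" for i
    proof -
      interpret P: valued_module_pair seq_scale "DB i" fsc "B i" "nz (p i) (e i)" "int_val (p i) (e i)"
        by (rule pairDF[OF i])
      have FZ: "P.T.Z u \<longleftrightarrow> u = 0" for u by (rule FZ_iff[OF i])
      have t0: "first_form \<in> forms m (2 * G)" using mH G0 by (intro first_form_in_forms) auto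
      have lin0: "P.S.lin m first_form (c i) = c i 0" "P.T.lin m first_form x = x 0"
        using mH by (simp_all add: P.S.lin_first_form P.T.lin_first_form)
      have "\<exists>s\<in>forms m G. \<exists>z\<in>UNIV. \<exists>g'. \<forall>Y'. B i g' (Y' - (P.T.lin m s x + z)) \<longrightarrow>
        P.sim C1 (P.graph m (2 * G) (c i) x \<union> P.centers m G (c i) x (seq_scale a (c i m)) Y')"
      proof (rule P.sim_centers_not_Z[OF simi[OF i] _ t0])
        show "\<not> P.S.Z (seq_scale a (c i m) - P.S.lin m s (c i))" if "s \<in> forms m G" for s
          using False that i by blast
        show "\<not> P.S.Z (P.S.lin m first_form (c i))" using c0[OF i] by (simp add: lin0)
        fix g g' X t
        assume match: "\<And>t. t \<in> forms m (2 * G) \<Longrightarrow> \<not> P.S.Z (P.S.lin m t (c i)) \<Longrightarrow>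
            (P.S.val (P.S.lin m t (c i)) \<le> g) = (P.T.val (P.T.lin m t x) \<le> g') \<and>
            (g \<le> P.S.val (P.S.lin m t (c i))) = (g' \<le> P.T.val (P.T.lin m t x))"
          and X: "finite X" "P.S.incongruent g X" "card X \<le> card (forms m G) + 1"
        show "\<exists>X'\<subseteq>UNIV. finite X' \<and> P.T.incongruent g' X' \<and> card X' = card X"
        proof (cases "f i = 0")
          case True
          then have e0: "e i = 0" using place[OF i] unfolding place_def by auto
          have trT: "B i g u \<longleftrightarrow> g \<le> 0 \<or> P.T.Z u" for g u using trivial[OF i True] FZ by simp
          have trS: "DB i g u \<longleftrightarrow> g \<le> 0 \<or> P.S.Z u" for g u
            using seq_ball_trivial[of "p i" g u] place[OF i] unfolding True e0 by simp
          have v0: "P.S.val (c i 0) = 0" "P.T.val (x 0) = 0"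
            using P.S.trivial_val_eq_0[OF trS] P.T.trivial_val_eq_0[OF trT] x0 c0[OF i] FZ by auto
          show ?thesis
          proof (cases "g = 0")
            case g0: True
            then have "g' = 0" using match[OF t0] c0[OF i] v0 by (simp add: lin0)
            obtain X' :: "'a set" where X': "finite X'" "card X' = card X"
              using infinite_arbitrarily_large[OF infinite] by blast
            have "P.T.incongruent g' X'" unfolding P.T.incongruent_def \<open>g' = 0\<close> by (auto simp: trT FZ)
            then show ?thesis using X' by blast
          next
            case False
            then have "card X \<le> 1" using P.S.trivial_card_incongruent_le[OF trS _ X(2)] by blast
            then have "card X = card (if card X = 0 then {} else {0 :: 'a})" by auto
            moreover have "P.T.incongruent g' (if card X = 0 then {} else {0})"
              by (auto simp: P.T.incongruent_def)
            ultimately show ?thesis by (metis finite.emptyI finite.insertI subset_UNIV)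
          qed
        next
          case False
          then have pr: "prime (p i)" "0 < f i" using place[OF i] unfolding place_def by auto
          have cX: "card X \<le> p i ^ f i" by (rule card_incongruent_le[OF place[OF i] pr X(2)])
          obtain X1 where X1: "finite X1" "P.T.incongruent g' X1" "card X1 = p i ^ f i"
            using incongruent_exists[OF i pr(2)] by blast
          obtain X' where X': "X' \<subseteq> X1" "card X' = card X"
            using obtain_subset_with_card_n cX X1(3) by metis
          show ?thesis
            using X' X1(1) finite_subset P.T.incongruent_subset[OF X1(2) X'(1)] by (intro exI[of _ X']) auto
        qed
      qed
      then show ?thesis by blast
    qed
    then obtain w g where w: "\<And>i y. i < n \<Longrightarrow> B i (g i) (y - w i) \<Longrightarrow> simDF i C1 (graphDF m (2 * G) (c i) x \<union>
      valued_module_pair.centers seq_scale fsc m G (c i) x (seq_scale a (c i m)) y)" by metis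
    define g0 where "g0 = Max (g ` {..<n})"
    have g0: "g i \<le> g0" if "i < n" for i unfolding g0_def using that by (intro Max_ge) auto
    obtain y where y: "\<forall>i<n. B i g0 (y - w i)" using approximation by blast
    have "B i (g i) (y - w i)" if "i < n" for i
      using y that valued_module.B_antimono[OF vm[OF that] _ g0[OF that]] by blast
    then show ?thesis using w by blast
  qed
  then obtain y where y: "\<forall>i<n. simDF i C1 (graphDF m (2 * G) (c i) x \<union>
      valued_module_pair.centers seq_scale fsc m G (c i) x (seq_scale a (c i m)) y)" by blast
  have HG: "H \<le> 2 * G" using a unfolding G_def unit_prod_mult_def a_def[symmetric] by (cases "nat a") auto
  show ?thesis
  proof (intro exI[of _ y] allI impI)
    fix i assume i: "i < n"
    interpret P: valued_module_pair seq_scale "DB i" fsc "B i" "nz (p i) (e i)" "int_val (p i) (e i)"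
      by (rule pairDF[OF i])
    have "P.sim C (P.graph (Suc m) H ((c i)(m := c i m)) ((\<lambda>j. of_int (unit_prod H) * x j)(m := y)))"
    proof (rule extendDF[OF i])
      show "C + nat (int_val (p i) (e i) (unit_prod H)) \<le> C1"
        unfolding C1_def using int_val_unit_prod_le[OF i E[OF i]] by simp
      show "P.sim C1 (P.graph m H (c i) x \<union> P.centers m (unit_prod_mult H) (c i) x (seq_scale (unit_prod H) (c i m)) y)"
        using P.sim_mono[OF y[rule_format, OF i] order_refl] P.graph_mono[OF HG] unfolding a_def G_def by (meson Un_mono order_refl)
    qed
    then show "P.sim C (P.graph (Suc m) H (c i) ((\<lambda>j. of_int (unit_prod H) * x j)(m := y)))" by simp
  qed
qed

end

text \<open>\<open>Hs H k\<close> and \<open>Cs E H k\<close> are the height and tolerance required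
  while \<open>k\<close> elements are still to be added, if height \<open>H\<close> and tolerance 0
  are wanted at the end; the recursions copy the hypotheses of \<open>stepFD\<close> and
  \<open>stepDF\<close>. \<open>Ms E H N m\<close> bounds entries after \<open>m\<close> of
  \<open>N\<close> steps, when \<open>N - m\<close> remain.\<close>

fun Hs :: "nat \<Rightarrow> nat \<Rightarrow> nat" where
  "Hs H 0 = H"
| "Hs H (Suc k) = 2 * (fact (Hs H k) * Hs H k)"

fun Cs :: "nat \<Rightarrow> nat \<Rightarrow> nat \<Rightarrow> nat" where
  "Cs E H 0 = 0"
| "Cs E H (Suc k) = 2 * (Cs E H k + E * fact (Hs H k)) + 1"

fun Ms :: "nat \<Rightarrow> nat \<Rightarrow> nat \<Rightarrow> nat \<Rightarrow> nat" where
  "Ms E H N 0 = 1"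
| "Ms E H N (Suc m) = next_bound E (Suc m) (Hs H (N - Suc m)) (Cs E H (N - Suc m)) (Ms E H N m)"

lemma Hs_pos: "0 < H \<Longrightarrow> 0 < Hs H k"
  by (induction k) auto

lemma Hs_Suc_ge: "Hs H k \<le> Hs H (Suc k)"
  using fact_ge_1[of "Hs H k", where 'a = nat] by (simp only: Hs.simps) (cases "fact (Hs H k) :: nat", auto)

lemma Hs_mono: "k \<le> l \<Longrightarrow> Hs H k \<le> Hs H l"
  by (induction rule: dec_induct) (use Hs_Suc_ge order_trans in blast)+

lemma (in valued_module) lin_forms_cong: "t \<in> forms m H \<Longrightarrow> m \<le> m' \<Longrightarrow> lin m' t x = lin m t x"
  unfolding lin_def by (rule sum.mono_neutral_right) (auto simp: forms_def)

lemma forms_subset: "m \<le> m' \<Longrightarrow> H \<le> H' \<Longrightarrow> forms m H \<subseteq> forms m' H'"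
  unfolding forms_def by (auto intro: order_trans)

text \<open>Homogenization of a term: position 0 holds the multiple of 1, position
  \<open>Suc v\<close> the coefficient of variable \<open>v\<close>.\<close>

fun tm_form :: "tm \<Rightarrow> nat \<Rightarrow> int" where
  "tm_form TZero = (\<lambda>_. 0)"
| "tm_form TOne = (\<lambda>j. if j = 0 then 1 else 0)"
| "tm_form (TVar v) = (\<lambda>j. if j = Suc v then 1 else 0)"
| "tm_form (TAdd s t) = (\<lambda>j. tm_form s j + tm_form t j)"

lemma prod_encode_ge_add: "a + b \<le> prod_encode (a, b)"
  by (cases "a + b") (auto simp: prod_encode_def)

lemma prod_encode_gt_snd: "0 < a \<Longrightarrow> b < prod_encode (a, b)"
  using prod_encode_ge_add[of a b] by linarith

text \<open>Codes dominate variables and, by \<open>tm_form_bounds\<close>, essentially the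
  coefficients. So one number above the code of the sentence bounds both the length and the height
  of its forms.\<close>

lemma tm_code_ge: "tm_code t \<ge> v" if "v \<in> tm_vars t"
  using that
proof (induction t)
  case (TVar i)
  then show ?case using prod_encode_ge_add[of 2 i] by simp
next
  case (TAdd s t)
  then show ?case
    using prod_encode_ge_add[of 3 "prod_encode (tm_code s, tm_code t)"] prod_encode_ge_add[of "tm_code s" "tm_code t"]
    by auto
qed auto

lemma tm_form_bounds: "0 \<le> tm_form t j \<and> tm_form t j \<le> int (tm_code t) + 1"
proof (induction t)
  case (TAdd s t)
  then show ?case
    using prod_encode_ge_add[of 3 "prod_encode (tm_code s, tm_code t)"] prod_encode_ge_add[of "tm_code s" "tm_code t"]
    by auto
qed auto

lemma tm_form_eq_0: "\<lbrakk>\<forall>v\<in>tm_vars t. v < N; N < j\<rbrakk> \<Longrightarrow> tm_form t j = 0"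
  by (induction t) auto

lemma tm_form_in_forms:
  assumes "tm_code t < N"
  shows "tm_form t \<in> forms (Suc N) N"
proof -
  have "\<forall>v\<in>tm_vars t. v < N" using tm_code_ge assms by (meson le_less_trans)
  then have "tm_form t j = 0" if "Suc N \<le> j" for j using tm_form_eq_0 that by simp
  moreover have "\<bar>tm_form t j\<bar> \<le> int N" for j using tm_form_bounds[of t j] assms by linarith
  ultimately show ?thesis unfolding forms_def by simp
qed

fun atoms :: "fm \<Rightarrow> (tm \<times> tm) set" where
  "atoms (Eq s t) = {(s, t)}"
| "atoms (Divides s t) = {(s, t)}"
| "atoms (Neg q) = atoms q"
| "atoms (And q r) = atoms q \<union> atoms r"
| "atoms (Or q r) = atoms q \<union> atoms r"
| "atoms (Exists v q) = atoms q"
| "atoms (Forall v q) = atoms q"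

lemma atoms_code_le: "(s, t) \<in> atoms q \<Longrightarrow> tm_code s \<le> fm_code q \<and> tm_code t \<le> fm_code q"
proof (induction q)
  case (Eq a b)
  then show ?case
    using prod_encode_ge_add[of 0 "prod_encode (tm_code a, tm_code b)"] prod_encode_ge_add[of "tm_code a" "tm_code b"]
    by auto
next
  case (Divides a b)
  then show ?case
    using prod_encode_ge_add[of 1 "prod_encode (tm_code a, tm_code b)"] prod_encode_ge_add[of "tm_code a" "tm_code b"]
    by auto
next
  case (Neg q)
  then show ?case using prod_encode_ge_add[of 2 "fm_code q"] by auto
next
  case (And q r)
  then show ?case
    using prod_encode_ge_add[of 3 "prod_encode (fm_code q, fm_code r)"] prod_encode_ge_add[of "fm_code q" "fm_code r"]
    by auto
next
  case (Or q r)
  then show ?case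
    using prod_encode_ge_add[of 4 "prod_encode (fm_code q, fm_code r)"] prod_encode_ge_add[of "fm_code q" "fm_code r"]
    by auto
next
  case (Exists v q)
  then show ?case
    using prod_encode_ge_add[of 5 "prod_encode (v, fm_code q)"] prod_encode_ge_add[of v "fm_code q"] by auto
next
  case (Forall v q)
  then show ?case
    using prod_encode_ge_add[of 6 "prod_encode (v, fm_code q)"] prod_encode_ge_add[of v "fm_code q"] by auto
qed

text \<open>Existential quantifiers are skipped here: only the matrix is evaluated.\<close>

fun matrix_sat :: "(tm \<Rightarrow> tm \<Rightarrow> bool) \<Rightarrow> (tm \<Rightarrow> tm \<Rightarrow> bool) \<Rightarrow> fm \<Rightarrow> bool" where
  "matrix_sat E D (Eq s t) \<longleftrightarrow> E s t"
| "matrix_sat E D (Divides s t) \<longleftrightarrow> D s t"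
| "matrix_sat E D (Neg q) \<longleftrightarrow> \<not> matrix_sat E D q"
| "matrix_sat E D (And q r) \<longleftrightarrow> matrix_sat E D q \<and> matrix_sat E D r"
| "matrix_sat E D (Or q r) \<longleftrightarrow> matrix_sat E D q \<or> matrix_sat E D r"
| "matrix_sat E D (Exists v q) \<longleftrightarrow> matrix_sat E D q"
| "matrix_sat E D (Forall v q) \<longleftrightarrow> False"

lemma matrix_sat_cong:
  "(\<And>s t. (s, t) \<in> atoms q \<Longrightarrow> (E s t \<longleftrightarrow> E' s t) \<and> (D s t \<longleftrightarrow> D' s t)) \<Longrightarrow>
    matrix_sat E D q \<longleftrightarrow> matrix_sat E' D' q"
  by (induction q) auto

abbreviation field_matrix_sat :: "'a::field set \<Rightarrow> (nat \<Rightarrow> 'a) \<Rightarrow> fm \<Rightarrow> bool" where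
  "field_matrix_sat R \<epsilon> \<equiv> matrix_sat (\<lambda>s t. tm_val \<epsilon> s = tm_val \<epsilon> t) (\<lambda>s t. \<exists>z\<in>R. tm_val \<epsilon> s * z = tm_val \<epsilon> t)"

lemma tm_val_cong: "(\<And>v. v \<in> tm_vars t \<Longrightarrow> \<epsilon> v = \<epsilon>' v) \<Longrightarrow> tm_val \<epsilon> t = tm_val \<epsilon>' t"
  by (induction t) auto

lemma quantifier_free_sat: "quantifier_free q \<Longrightarrow> sat R \<epsilon> q \<longleftrightarrow> field_matrix_sat R \<epsilon> q"
  by (induction q) auto

lemma quantifier_free_sat_cong:
  "quantifier_free q \<Longrightarrow> (\<And>v. v \<in> free_vars q \<Longrightarrow> \<epsilon> v = \<epsilon>' v) \<Longrightarrow> sat R \<epsilon> q \<longleftrightarrow> sat R \<epsilon>' q"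
proof (induction q)
  case (Eq s t)
  then show ?case using tm_val_cong[of s \<epsilon> \<epsilon>'] tm_val_cong[of t \<epsilon> \<epsilon>'] by simp
next
  case (Divides s t)
  then show ?case using tm_val_cong[of s \<epsilon> \<epsilon>'] tm_val_cong[of t \<epsilon> \<epsilon>'] by simp
qed auto

text \<open>As the quantifiers form a prefix, a single assignment can witness all of them. Variables
  quantified twice or not occurring also receive values in \<open>R\<close>, with 0 as
  default.\<close>

lemma existential_sat_iff:
  assumes "existential q" "0 \<in> R"
  shows "sat R \<epsilon> q \<longleftrightarrow> (\<exists>\<epsilon>'. (\<forall>v. if v \<in> free_vars q then \<epsilon>' v = \<epsilon> v else \<epsilon>' v \<in> R) \<and> field_matrix_sat R \<epsilon>' q)"
  using assms(1)
proof (induction arbitrary: \<epsilon>)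
  case (1 q)
  show ?case
  proof
    assume s: "sat R \<epsilon> q"
    let ?\<epsilon> = "\<lambda>v. if v \<in> free_vars q then \<epsilon> v else 0"
    have "sat R ?\<epsilon> q" using s quantifier_free_sat_cong[OF 1, of ?\<epsilon> \<epsilon>] by simp
    then have "field_matrix_sat R ?\<epsilon> q" using quantifier_free_sat[OF 1] by blast
    then show "\<exists>\<epsilon>'. (\<forall>v. if v \<in> free_vars q then \<epsilon>' v = \<epsilon> v else \<epsilon>' v \<in> R) \<and> field_matrix_sat R \<epsilon>' q"
      using assms(2) by (intro exI[of _ ?\<epsilon>]) auto
  next
    assume "\<exists>\<epsilon>'. (\<forall>v. if v \<in> free_vars q then \<epsilon>' v = \<epsilon> v else \<epsilon>' v \<in> R) \<and> field_matrix_sat R \<epsilon>' q"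
    then obtain \<epsilon>' where e: "\<forall>v. if v \<in> free_vars q then \<epsilon>' v = \<epsilon> v else \<epsilon>' v \<in> R" "field_matrix_sat R \<epsilon>' q" by blast
    have "\<epsilon>' v = \<epsilon> v" if "v \<in> free_vars q" for v using e(1)[rule_format, of v] that by simp
    then show "sat R \<epsilon> q" using quantifier_free_sat_cong[OF 1, of \<epsilon>' \<epsilon>] quantifier_free_sat[OF 1] e(2) by blast
  qed
next
  case (2 q i)
  show ?case
  proof
    assume "sat R \<epsilon> (Exists i q)"
    then obtain x where x: "x \<in> R" "sat R (\<epsilon>(i := x)) q" by auto
    then obtain \<epsilon>' where e: "\<forall>v. if v \<in> free_vars q then \<epsilon>' v = (\<epsilon>(i := x)) v else \<epsilon>' v \<in> R"
      "field_matrix_sat R \<epsilon>' q" using 2 by blast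
    have "if v \<in> free_vars (Exists i q) then \<epsilon>' v = \<epsilon> v else \<epsilon>' v \<in> R" for v
      using e(1)[rule_format, of v] x(1) by (auto split: if_splits)
    then show "\<exists>\<epsilon>'. (\<forall>v. if v \<in> free_vars (Exists i q) then \<epsilon>' v = \<epsilon> v else \<epsilon>' v \<in> R) \<and>
      field_matrix_sat R \<epsilon>' (Exists i q)" using e(2) by (intro exI[of _ \<epsilon>']) auto
  next
    assume "\<exists>\<epsilon>'. (\<forall>v. if v \<in> free_vars (Exists i q) then \<epsilon>' v = \<epsilon> v else \<epsilon>' v \<in> R) \<and>
      field_matrix_sat R \<epsilon>' (Exists i q)"
    then obtain \<epsilon>' where e: "\<forall>v. if v \<in> free_vars (Exists i q) then \<epsilon>' v = \<epsilon> v else \<epsilon>' v \<in> R"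
      "field_matrix_sat R \<epsilon>' q" by auto
    have "\<epsilon>' i \<in> R" using e(1)[rule_format, of i] by simp
    moreover have "if v \<in> free_vars q then \<epsilon>' v = (\<epsilon>(i := \<epsilon>' i)) v else \<epsilon>' v \<in> R" for v
      using e(1)[rule_format, of v] by (auto split: if_splits)
    then have "sat R (\<epsilon>(i := \<epsilon>' i)) q" unfolding 2 using e(2) by (intro exI[of _ \<epsilon>']) auto
    ultimately show "sat R \<epsilon> (Exists i q)" by auto
  qed
qed

lemma existential_sentence_holds_iff:
  assumes "existential_sentence q" "0 \<in> R"
  shows "holds_in R q \<longleftrightarrow> (\<exists>\<epsilon>. (\<forall>v. \<epsilon> v \<in> R) \<and> field_matrix_sat R \<epsilon> q)"
  using assms existential_sat_iff[of q R "\<lambda>_. 0"] unfolding existential_sentence_def holds_in_def by simp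

text \<open>\<open>B_mult\<close> is multiplicativity of the valuation, as a shift of balls by some
  \<open>h\<close>. It turns divisibility into a comparison of valuations and allows division by the
  homogeneous coordinate \<open>x 0\<close>.\<close>

locale multiplicative_places = places +
  assumes B_1: "i < n \<Longrightarrow> B i g 1 \<longleftrightarrow> g \<le> 0"
    and B_mult: "i < n \<Longrightarrow> x \<noteq> 0 \<Longrightarrow> \<exists>h. \<forall>g y. B i (g + h) (x * y) \<longleftrightarrow> B i g y"
begin

definition R :: "'a set" where "R = {x. \<forall>i<n. B i 0 x}"

abbreviation fleq where "fleq i \<equiv> valued_module.leq (B i)"
abbreviation dleq where "dleq i \<equiv> valued_module.leq (DB i)"

lemma zero_in_R: "0 \<in> R"
  unfolding R_def using valued_module.B_0[OF vm] by blast

lemma fleq_mult: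
  assumes "i < n" "x \<noteq> 0"
  shows "fleq i c (x * s) (x * t) \<longleftrightarrow> fleq i c s t"
proof -
  interpret valued_module fsc "B i" "nz (p i) (e i)" "int_val (p i) (e i)" by (rule vm[OF assms(1)])
  obtain h where h: "\<And>g y. B i (g + h) (x * y) \<longleftrightarrow> B i g y" using B_mult[OF assms] by blast
  have "leq c (x * s) (x * t) \<longleftrightarrow> leq (c + 0 - 0) s t" by (rule leq_shift[of h]) (simp_all add: h)
  then show ?thesis by simp
qed

lemma fleq_1: "i < n \<Longrightarrow> fleq i 0 1 t \<longleftrightarrow> B i 0 t"
  using B_1 valued_module.B_antimono[OF vm] by (auto simp: valued_module.leq_def[OF vm])

text \<open>For nonzero \<open>s\<close> the quotient has to be integral at every place. For
  \<open>s = 0\<close> both sides amount to \<open>t = 0\<close>, the right one because there is at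
  least one place.\<close>

lemma dvd_in_R_iff: "(\<exists>z\<in>R. s * z = t) \<longleftrightarrow> (\<forall>i<n. fleq i 0 s t)"
proof (cases "s = 0")
  case True
  have "fleq i 0 0 t \<longleftrightarrow> t = 0" if "i < n" for i
    using valued_module.leq_zero_left[OF vm[OF that]] FZ_iff[OF that] by simp
  then show ?thesis using True zero_in_R n_pos by auto
next
  case False
  have "(\<exists>z\<in>R. s * z = t) \<longleftrightarrow> t / s \<in> R" using False by (auto intro!: bexI[of _ "t / s"])
  also have "\<dots> \<longleftrightarrow> (\<forall>i<n. fleq i 0 1 (t / s))" unfolding R_def by (simp add: fleq_1)
  also have "\<dots> \<longleftrightarrow> (\<forall>i<n. fleq i 0 (s * 1) (s * (t / s)))" by (intro iff_allI imp_cong refl fleq_mult[OF _ False, symmetric])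
  finally show ?thesis using False by simp
qed

lemma flin_tm_form:
  assumes "\<And>v. v < N \<Longrightarrow> x (Suc v) = x 0 * \<epsilon> v" "\<forall>v\<in>tm_vars t. v < N"
  shows "flin (Suc N) (tm_form t) x = x 0 * tm_val \<epsilon> t"
proof -
  interpret valued_module fsc "B 0" "nz (p 0) (e 0)" "int_val (p 0) (e 0)" by (rule vm[OF n_pos])
  show ?thesis
    using assms(2)
  proof (induction t)
    case TOne
    have "(\<Sum>j<Suc N. of_int (if j = 0 then 1 else 0) * x j) = (\<Sum>j<Suc N. if j = 0 then x j else 0)"
      by (rule sum.cong) auto
    then show ?case by (simp add: lin_def del: sum.lessThan_Suc)
  next
    case (TVar v)
    have "(\<Sum>j<Suc N. of_int (if j = Suc v then 1 else 0) * x j) = (\<Sum>j<Suc N. if j = Suc v then x j else 0)"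
      by (rule sum.cong) auto
    then show ?case using TVar assms(1) by (simp add: lin_def del: sum.lessThan_Suc)
  qed (auto simp: lin_zero lin_add distrib_left)
qed

definition seq_eq :: "nat \<Rightarrow> (nat \<Rightarrow> nat \<Rightarrow> nat \<Rightarrow> int) \<Rightarrow> tm \<Rightarrow> tm \<Rightarrow> bool" where
  "seq_eq N c s t \<longleftrightarrow> (\<forall>i<n. DZ i (dlin (Suc N) (\<lambda>j. tm_form s j - tm_form t j) (c i)))"

definition seq_dvd :: "nat \<Rightarrow> (nat \<Rightarrow> nat \<Rightarrow> nat \<Rightarrow> int) \<Rightarrow> tm \<Rightarrow> tm \<Rightarrow> bool" where
  "seq_dvd N c s t \<longleftrightarrow> (\<forall>i<n. dleq i 0 (dlin (Suc N) (tm_form s) (c i)) (dlin (Suc N) (tm_form t) (c i)))"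

text \<open>
  \<open>c i 0\<close> plays the role of 1, which is harmless as all atoms are homogeneous. Linear relations
  between the sequences have to hold at all places or at none, as is the case in \<open>K\<close>.
\<close>

definition good :: "nat \<Rightarrow> nat \<Rightarrow> fm \<Rightarrow> (nat \<Rightarrow> nat \<Rightarrow> nat \<Rightarrow> int) \<Rightarrow> bool" where
  "good N U q c \<longleftrightarrow>
    (\<forall>i<n. \<not> DZ i (c i 0)) \<and> (\<forall>i<n. \<forall>j\<le>N. dleq i 0 (c i 0) (c i j)) \<and>
    (\<forall>t\<in>forms (Suc N) U. (\<forall>i<n. DZ i (dlin (Suc N) t (c i))) \<or> (\<forall>i<n. \<not> DZ i (dlin (Suc N) t (c i)))) \<and>
    matrix_sat (seq_eq N c) (seq_dvd N c) q"

text \<open>The start is the sequence with 1 at coordinate 0 only, a non-null partner for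
  \<open>x 0\<close>. Membership of the \<open>x j\<close> in \<open>R\<close> is the condition of
  \<open>stepFD\<close> on new elements, since \<open>x 0 = 1\<close>.\<close>

lemma iterateFD:
  assumes H: "0 < H" and x0: "x 0 = 1" and x: "\<And>j. x j \<in> R"
    and E: "\<And>i. i < n \<Longrightarrow> p i \<le> E \<and> e i \<le> E \<and> f i \<le> E"
    and m: "m \<le> N"
  shows "\<exists>c. \<forall>i<n. simFD i (Cs E H (N - m)) (graphFD (Suc m) (Hs H (N - m)) x (c i)) \<and>
    (\<forall>j<Suc m. bounded_seq (Ms E H N m) (c i j))"
  using m
proof (induction m)
  case 0
  let ?c = "\<lambda>i j k::nat. if k = 0 then 1 else 0 :: int"
  show ?case
  proof (intro exI[of _ ?c] allI impI conjI)
    fix i assume i: "i < n"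
    interpret P: valued_module_pair fsc "B i" seq_scale "DB i" "nz (p i) (e i)" "int_val (p i) (e i)"
      by (rule pairFD[OF i])
    have "(of_int 1 :: 'a) \<noteq> 0" by simp
    then have "nz (p i) (e i) 1" using nz_iff[OF i] by blast
    moreover have "e i = 0 \<or> 0 < f i" using place[OF i] unfolding place_def by auto
    ultimately have "live (p i) (e i) (f i) 0 1" "digit_val (p i) (e i) (f i) 0 1 = 0"
      unfolding live_def digit_val_def by auto
    then have "\<not> DB i 1 (?c i 0)" unfolding seq_ball_def not_all by (intro exI[of _ 0]) simp
    then have "\<not> P.T.Z (?c i 0)" unfolding P.T.Z_def by blast
    then show "P.sim (Cs E H (N - 0)) (P.graph (Suc 0) (Hs H (N - 0)) x (?c i))"
      using P.sim_graph_1[of x "?c i"] x0 FZ_iff[OF i] by simp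
  qed (auto simp: bounded_seq_def)
next
  case (Suc m)
  then obtain c where c: "\<And>i. i < n \<Longrightarrow> simFD i (Cs E H (N - m)) (graphFD (Suc m) (Hs H (N - m)) x (c i))"
    "\<And>i j. i < n \<Longrightarrow> j < Suc m \<Longrightarrow> bounded_seq (Ms E H N m) (c i j)" by auto
  have N: "N - m = Suc (N - Suc m)" using Suc by simp
  have "\<exists>c'. \<forall>i<n. simFD i (Cs E H (N - Suc m)) (graphFD (Suc (Suc m)) (Hs H (N - Suc m)) (x(Suc m := x (Suc m))) (c' i)) \<and>
    (\<forall>j<Suc (Suc m). bounded_seq (next_bound E (Suc m) (Hs H (N - Suc m)) (Cs E H (N - Suc m)) (Ms E H N m)) (c' i j))"
  proof (rule stepFD[where c = c])
    show "B i g (x (Suc m))" if "i < n" "B i g (x 0)" for i g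
      using that x0 B_1 x[of "Suc m"] valued_module.B_antimono[OF vm] unfolding R_def by auto
  qed (use c E x0 Hs_pos[OF H] in \<open>auto simp: N\<close>)
  then show ?case by simp
qed

text \<open>Uniformity at the top height \<open>Hs H N\<close> covers all steps, as the relations
  met on the way have at most that height and at most \<open>Suc N\<close> variables. Because of the
  rescaling, \<open>x 0\<close> need not remain 1.\<close>

lemma iterateDF:
  assumes H: "0 < H" and E: "\<And>i. i < n \<Longrightarrow> e i \<le> E"
    and c0: "\<And>i. i < n \<Longrightarrow> \<not> DZ i (c i 0)"
    and uniform: "\<And>t. t \<in> forms (Suc N) (Hs H N) \<Longrightarrow>
      (\<forall>i<n. DZ i (dlin (Suc N) t (c i))) \<or> (\<forall>i<n. \<not> DZ i (dlin (Suc N) t (c i)))"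
    and m: "m \<le> N"
  shows "\<exists>x. x 0 \<noteq> 0 \<and> (\<forall>i<n. simDF i (Cs E H (N - m)) (graphDF (Suc m) (Hs H (N - m)) (c i) x))"
  using m
proof (induction m)
  case 0
  have "simDF i (Cs E H (N - 0)) (graphDF (Suc 0) (Hs H (N - 0)) (c i) (\<lambda>_. 1))" if i: "i < n" for i
  proof -
    interpret P: valued_module_pair seq_scale "DB i" fsc "B i" "nz (p i) (e i)" "int_val (p i) (e i)"
      by (rule pairDF[OF i])
    show ?thesis using P.sim_graph_1[of "c i" "\<lambda>_. 1"] c0[OF i] FZ_iff[OF i] by simp
  qed
  then show ?case by (intro exI[of _ "\<lambda>_. 1"]) auto
next
  case (Suc m)
  then obtain x where x: "x 0 \<noteq> 0" "\<And>i. i < n \<Longrightarrow> simDF i (Cs E H (N - m)) (graphDF (Suc m) (Hs H (N - m)) (c i) x)" by auto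
  have N: "N - m = Suc (N - Suc m)" using Suc by simp
  let ?H = "Hs H (N - Suc m)"
  have H1: "0 < ?H" by (rule Hs_pos[OF H])
  have "\<exists>y. \<forall>i<n. simDF i (Cs E H (N - Suc m)) (graphDF (Suc (Suc m)) ?H (c i) ((\<lambda>j. of_int (unit_prod ?H) * x j)(Suc m := y)))"
  proof (rule stepDF)
    fix t assume t: "t \<in> forms (Suc (Suc m)) (fact ?H * ?H + fact ?H)"
    have "fact ?H * ?H + fact ?H \<le> Hs H (Suc (N - Suc m))" using H1 by (cases ?H) auto
    also have "\<dots> \<le> Hs H N" by (rule Hs_mono) (use Suc in simp)
    finally have "t \<in> forms (Suc N) (Hs H N)" using t forms_subset[of "Suc (Suc m)" "Suc N"] Suc.prems by auto
    moreover have "dlin (Suc N) t (c i) = dlin (Suc (Suc m)) t (c i)" if "i < n" for i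
      by (rule valued_module.lin_forms_cong[OF vmD[OF that] t]) (use Suc.prems in simp)
    ultimately show "(\<forall>i<n. DZ i (dlin (Suc (Suc m)) t (c i))) \<or> (\<forall>i<n. \<not> DZ i (dlin (Suc (Suc m)) t (c i)))"
      using uniform[of t] by metis
  qed (use x E c0 H1 in \<open>simp_all add: N\<close>)
  then obtain y where y: "\<forall>i<n. simDF i (Cs E H (N - Suc m))
      (graphDF (Suc (Suc m)) ?H (c i) ((\<lambda>j. of_int (unit_prod ?H) * x j)(Suc m := y)))" by blast
  have "((\<lambda>j. of_int (unit_prod ?H) * x j)(Suc m := y)) 0 \<noteq> 0"
    using x(1) unit_prod_ne_0[of ?H] by simp
  with y show ?case by blast
qed

text \<open>An equation is the vanishing of a difference of two forms of height \<open>N\<close>,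
  hence the height \<open>2 * N\<close>. The common factor \<open>x 0\<close> cancels from every
  atom.\<close>

lemma good_iff_aux:
  assumes N: "fm_code q < N"
    and x: "x 0 \<noteq> 0" "\<And>v. v < N \<Longrightarrow> x (Suc v) = x 0 * \<epsilon> v"
    and Z: "\<And>i t. i < n \<Longrightarrow> t \<in> forms (Suc N) (2 * N) \<Longrightarrow> DZ i (dlin (Suc N) t (c i)) \<longleftrightarrow> flin (Suc N) t x = 0"
    and leq: "\<And>i s t. i < n \<Longrightarrow> s \<in> forms (Suc N) (2 * N) \<Longrightarrow> t \<in> forms (Suc N) (2 * N) \<Longrightarrow>
      dleq i 0 (dlin (Suc N) s (c i)) (dlin (Suc N) t (c i)) \<longleftrightarrow> fleq i 0 (flin (Suc N) s x) (flin (Suc N) t x)"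
  shows "matrix_sat (seq_eq N c) (seq_dvd N c) q \<longleftrightarrow> field_matrix_sat R \<epsilon> q"
proof (rule matrix_sat_cong, rule conjI)
  fix s t assume st: "(s, t) \<in> atoms q"
  then have code: "tm_code s < N" "tm_code t < N" using atoms_code_le[OF st] N by auto
  then have vars: "\<forall>v\<in>tm_vars s. v < N" "\<forall>v\<in>tm_vars t. v < N" using tm_code_ge by (meson le_less_trans)+
  have val: "flin (Suc N) (tm_form s) x = x 0 * tm_val \<epsilon> s" "flin (Suc N) (tm_form t) x = x 0 * tm_val \<epsilon> t"
    by (rule flin_tm_form[OF x(2) vars(1)], simp, rule flin_tm_form[OF x(2) vars(2)], simp)
  have f: "tm_form s \<in> forms (Suc N) N" "tm_form t \<in> forms (Suc N) N" using tm_form_in_forms code by auto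
  then have f2: "tm_form s \<in> forms (Suc N) (2 * N)" "tm_form t \<in> forms (Suc N) (2 * N)"
    using forms_mono[of N "2 * N" "Suc N"] by auto
  have fd: "(\<lambda>j. tm_form s j - tm_form t j) \<in> forms (Suc N) (2 * N)"
    using forms_diff[OF f] by (simp add: mult_2)
  have "flin (Suc N) (\<lambda>j. tm_form s j - tm_form t j) x = x 0 * (tm_val \<epsilon> s - tm_val \<epsilon> t)"
    unfolding valued_module.lin_diff[OF vm[OF n_pos]] val by (simp add: right_diff_distrib)
  then show "seq_eq N c s t \<longleftrightarrow> tm_val \<epsilon> s = tm_val \<epsilon> t"
    unfolding seq_eq_def using Z[OF _ fd] x(1) n_pos by auto
  have "seq_dvd N c s t \<longleftrightarrow> (\<forall>i<n. fleq i 0 (x 0 * tm_val \<epsilon> s) (x 0 * tm_val \<epsilon> t))"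
    unfolding seq_dvd_def val[symmetric] by (intro iff_allI imp_cong refl leq f2)
  also have "\<dots> \<longleftrightarrow> (\<forall>i<n. fleq i 0 (tm_val \<epsilon> s) (tm_val \<epsilon> t))"
    by (intro iff_allI imp_cong refl fleq_mult x(1))
  finally show "seq_dvd N c s t \<longleftrightarrow> (\<exists>z\<in>R. tm_val \<epsilon> s * z = tm_val \<epsilon> t)" unfolding dvd_in_R_iff .
qed

definition unit_form :: "nat \<Rightarrow> nat \<Rightarrow> int" where "unit_form j = (\<lambda>k. if k = j then 1 else 0)"

lemma unit_form: "j \<le> N \<Longrightarrow> 0 < H \<Longrightarrow> unit_form j \<in> forms (Suc N) H"
  unfolding unit_form_def forms_def by auto

lemma flin_unit_form: "j \<le> N \<Longrightarrow> flin (Suc N) (unit_form j) x = x j"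
proof -
  assume j: "j \<le> N"
  have "(\<Sum>k<Suc N. of_int (if k = j then 1 else 0) * x k) = (\<Sum>k<Suc N. if k = j then x k else 0)"
    by (rule sum.cong) auto
  then show ?thesis using j by (simp add: valued_module.lin_def[OF vm[OF n_pos]] unit_form_def del: sum.lessThan_Suc)
qed

lemma dlin_unit_form: "j \<le> N \<Longrightarrow> dlin (Suc N) (unit_form j) x = x j"
proof -
  assume j: "j \<le> N"
  have "(\<Sum>k<Suc N. seq_scale (if k = j then 1 else 0) (x k)) = (\<Sum>k<Suc N. if k = j then x k else 0)"
    by (rule sum.cong) (auto simp: seq_scale_def)
  then show ?thesis using j by (simp add: valued_module.lin_def[OF vmD[OF n_pos]] unit_form_def del: sum.lessThan_Suc)
qed

text \<open>Recovering field elements requires agreement on forms of height \<open>2 * N\<close> at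
  the end, and thus uniformity up to \<open>U = Hs (2 * N) N\<close>. Sequences coming from the
  field must therefore agree with it on all forms of height \<open>U\<close>; this is why the entry
  bound is computed with \<open>U\<close> in place of \<open>2 * N\<close>.\<close>

theorem holds_in_R_iff:
  assumes q: "existential_sentence q" and N: "fm_code q < N"
    and E: "\<And>i. i < n \<Longrightarrow> p i \<le> E \<and> e i \<le> E \<and> f i \<le> E"
  shows "holds_in R q \<longleftrightarrow> (\<exists>c. (\<forall>i<n. \<forall>j\<le>N. bounded_seq (Ms E (Hs (2 * N) N) N N) (c i j)) \<and>
    good N (Hs (2 * N) N) q c)"
proof
  define U where "U = Hs (2 * N) N"
  have N0: "0 < 2 * N" using N by simp
  have U: "2 * N \<le> U" "0 < U" unfolding U_def using Hs_mono[of 0 N "2 * N"] Hs_pos[OF N0] by auto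
  assume "holds_in R q"
  then obtain \<epsilon> where \<epsilon>: "\<forall>v. \<epsilon> v \<in> R" "field_matrix_sat R \<epsilon> q"
    using existential_sentence_holds_iff[OF q zero_in_R] by blast
  define x where "x = (\<lambda>j. case j of 0 \<Rightarrow> 1 | Suc v \<Rightarrow> \<epsilon> v)"
  have one: "1 \<in> R" unfolding R_def using B_1 by auto
  have x: "x 0 = 1" "\<And>v. x (Suc v) = \<epsilon> v" "\<And>j. x j \<in> R"
    unfolding x_def using \<epsilon>(1) one by (auto split: nat.split)
  have "\<exists>c. \<forall>i<n. simFD i (Cs E U (N - N)) (graphFD (Suc N) (Hs U (N - N)) x (c i)) \<and>
    (\<forall>j<Suc N. bounded_seq (Ms E U N N) (c i j))"
    by (rule iterateFD[OF U(2)]) (use x E in simp_all)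
  then obtain c where c: "\<And>i. i < n \<Longrightarrow> simFD i 0 (graphFD (Suc N) U x (c i))"
    "\<And>i j. i < n \<Longrightarrow> j < Suc N \<Longrightarrow> bounded_seq (Ms E U N N) (c i j)"
    by auto
  have Z: "DZ i (dlin (Suc N) t (c i)) \<longleftrightarrow> flin (Suc N) t x = 0" if "i < n" "t \<in> forms (Suc N) U" for i t
    using valued_module_pair.sim_graph_Z[OF pairFD[OF that(1)] c(1)[OF that(1)] that(2)] FZ_iff[OF that(1)] by simp
  have leq: "dleq i 0 (dlin (Suc N) s (c i)) (dlin (Suc N) t (c i)) \<longleftrightarrow> fleq i 0 (flin (Suc N) s x) (flin (Suc N) t x)"
    if "i < n" "s \<in> forms (Suc N) U" "t \<in> forms (Suc N) U" for i s t
  proof -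
    interpret P: valued_module_pair fsc "B i" seq_scale "DB i" "nz (p i) (e i)" "int_val (p i) (e i)"
      by (rule pairFD[OF that(1)])
    have "(P.S.lin (Suc N) s x, P.T.lin (Suc N) s (c i)) \<in> P.graph (Suc N) U x (c i)"
      "(P.S.lin (Suc N) t x, P.T.lin (Suc N) t (c i)) \<in> P.graph (Suc N) U x (c i)"
      using that unfolding P.graph_def by blast+
    from P.simD[OF c(1)[OF that(1)] this] show ?thesis by simp
  qed
  have "good N U q c"
    unfolding good_def
  proof (intro conjI allI impI ballI)
    show "\<not> DZ i (c i 0)" if "i < n" for i
      using Z[OF that unit_form[of 0]] x(1) U by (simp add: flin_unit_form dlin_unit_form)
    show "dleq i 0 (c i 0) (c i j)" if "i < n" "j \<le> N" for i j
      using leq[OF that(1) unit_form[of 0] unit_form[OF that(2)]] U that x fleq_1[OF that(1)]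
      unfolding R_def by (simp add: flin_unit_form dlin_unit_form)
    show "(\<forall>i<n. DZ i (dlin (Suc N) t (c i))) \<or> (\<forall>i<n. \<not> DZ i (dlin (Suc N) t (c i)))"
      if "t \<in> forms (Suc N) U" for t using Z[OF _ that] by auto
    have UU: "forms (Suc N) (2 * N) \<subseteq> forms (Suc N) U" by (rule forms_mono[OF U(1)])
    have "matrix_sat (seq_eq N c) (seq_dvd N c) q \<longleftrightarrow> field_matrix_sat R \<epsilon> q"
    proof (rule good_iff_aux[OF N, of x])
      show "x 0 \<noteq> 0" "x (Suc v) = x 0 * \<epsilon> v" for v using x by auto
    qed (intro Z leq subsetD[OF UU]; assumption)+
    then show "matrix_sat (seq_eq N c) (seq_dvd N c) q" using \<epsilon>(2) by simp
  qed
  then show "\<exists>c. (\<forall>i<n. \<forall>j\<le>N. bounded_seq (Ms E (Hs (2 * N) N) N N) (c i j)) \<and> good N (Hs (2 * N) N) q c"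
    using c(2) unfolding U_def by (intro exI[of _ c]) auto
next
  have N0: "0 < 2 * N" using N by simp
  assume "\<exists>c. (\<forall>i<n. \<forall>j\<le>N. bounded_seq (Ms E (Hs (2 * N) N) N N) (c i j)) \<and> good N (Hs (2 * N) N) q c"
  then obtain c where c: "\<And>i. i < n \<Longrightarrow> \<not> DZ i (c i 0)" "\<And>i j. i < n \<Longrightarrow> j \<le> N \<Longrightarrow> dleq i 0 (c i 0) (c i j)"
    "\<And>t. t \<in> forms (Suc N) (Hs (2 * N) N) \<Longrightarrow>
      (\<forall>i<n. DZ i (dlin (Suc N) t (c i))) \<or> (\<forall>i<n. \<not> DZ i (dlin (Suc N) t (c i)))"
    "matrix_sat (seq_eq N c) (seq_dvd N c) q"
    unfolding good_def by blast
  have "\<exists>x. x 0 \<noteq> 0 \<and> (\<forall>i<n. simDF i (Cs E (2 * N) (N - N)) (graphDF (Suc N) (Hs (2 * N) (N - N)) (c i) x))"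
    by (rule iterateDF[OF N0]) (use c(1,3) E in simp_all)
  then obtain x where x: "x 0 \<noteq> 0" "\<And>i. i < n \<Longrightarrow> simDF i 0 (graphDF (Suc N) (2 * N) (c i) x)"
    by auto
  \<comment> \<open>Dehomogenization. Variables from \<open>N\<close> on do not occur in the
    sentence, and any element of \<open>R\<close> would do for them.\<close>
  define \<epsilon> where "\<epsilon> = (\<lambda>v. if v < N then x (Suc v) / x 0 else 0)"
  have Z: "DZ i (dlin (Suc N) t (c i)) \<longleftrightarrow> flin (Suc N) t x = 0" if "i < n" "t \<in> forms (Suc N) (2 * N)" for i t
    using valued_module_pair.sim_graph_Z[OF pairDF[OF that(1)] x(2)[OF that(1)] that(2)] FZ_iff[OF that(1)] by simp
  have leq: "dleq i 0 (dlin (Suc N) s (c i)) (dlin (Suc N) t (c i)) \<longleftrightarrow> fleq i 0 (flin (Suc N) s x) (flin (Suc N) t x)"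
    if "i < n" "s \<in> forms (Suc N) (2 * N)" "t \<in> forms (Suc N) (2 * N)" for i s t
  proof -
    interpret P: valued_module_pair seq_scale "DB i" fsc "B i" "nz (p i) (e i)" "int_val (p i) (e i)"
      by (rule pairDF[OF that(1)])
    have "(P.S.lin (Suc N) s (c i), P.T.lin (Suc N) s x) \<in> P.graph (Suc N) (2 * N) (c i) x"
      "(P.S.lin (Suc N) t (c i), P.T.lin (Suc N) t x) \<in> P.graph (Suc N) (2 * N) (c i) x"
      using that unfolding P.graph_def by blast+
    from P.simD[OF x(2)[OF that(1)] this] show ?thesis by simp
  qed
  have "\<epsilon> v \<in> R" for v
  proof (cases "v < N")
    case True
    have "B i 0 (\<epsilon> v)" if i: "i < n" for i
    proof -
      have "fleq i 0 (x 0) (x (Suc v))"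
        using leq[OF i unit_form[of 0] unit_form[of "Suc v"]] c(2)[OF i, of "Suc v"] True N0
        by (simp add: flin_unit_form dlin_unit_form)
      moreover have "x 0 = x 0 * 1" "x (Suc v) = x 0 * \<epsilon> v" using x(1) True unfolding \<epsilon>_def by auto
      ultimately have "fleq i 0 1 (\<epsilon> v)" using fleq_mult[OF i x(1), of 0 1 "\<epsilon> v"] by metis
      then show ?thesis by (simp add: fleq_1[OF i])
    qed
    then show ?thesis unfolding R_def by blast
  qed (simp add: \<epsilon>_def zero_in_R)
  moreover have "matrix_sat (seq_eq N c) (seq_dvd N c) q \<longleftrightarrow> field_matrix_sat R \<epsilon> q"
  proof (rule good_iff_aux[OF N, of x])
    show "x 0 \<noteq> 0" by (rule x(1))
    show "x (Suc v) = x 0 * \<epsilon> v" if "v < N" for v using x(1) that by (simp add: \<epsilon>_def)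
  qed (intro Z leq; assumption)+
  ultimately show "holds_in R q" using c(4) existential_sentence_holds_iff[OF q zero_in_R] by blast
qed

end

section \<open>Computability of the search\<close>

text \<open>Course-of-values recursion: \<open>course_hist G x n\<close> packs the values at \<open>n - 1, \<dots>, 0\<close>.\<close>

definition course_hist :: "(nat \<Rightarrow> nat \<Rightarrow> nat \<Rightarrow> nat) \<Rightarrow> nat \<Rightarrow> nat \<Rightarrow> nat" where
  "course_hist G x n = rec_nat 0 (\<lambda>k h. pair (G x k h) h) n"

definition course :: "(nat \<Rightarrow> nat \<Rightarrow> nat \<Rightarrow> nat) \<Rightarrow> nat \<Rightarrow> nat \<Rightarrow> nat" where
  "course G x n = G x n (course_hist G x n)"

text \<open>The latest value is outermost in a history of length \<open>n\<close>, so the value at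
  \<open>k\<close> is reached after \<open>n - Suc k\<close> second projections.\<close>

definition lookup :: "nat \<Rightarrow> nat \<Rightarrow> nat \<Rightarrow> nat" where
  "lookup h n k = pfst (rec_nat h (\<lambda>_ r. psnd r) (n - Suc k))"

lemma psnd_iterate_Suc: "rec_nat h (\<lambda>_ r. psnd r) (Suc m) = rec_nat (psnd h) (\<lambda>_ r. psnd r) m"
  by (induction m) auto

lemma lookup_course_hist: "k < n \<Longrightarrow> lookup (course_hist G x n) n k = course G x k"
proof (induction n)
  case (Suc n)
  have h: "course_hist G x (Suc n) = pair (course G x n) (course_hist G x n)"
    by (simp add: course_hist_def course_def)
  show ?case
  proof (cases "k = n")
    case True
    then show ?thesis by (simp add: lookup_def h)
  next
    case False
    then have "Suc n - Suc k = Suc (n - Suc k)" using Suc.prems by simp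
    then have "lookup (course_hist G x (Suc n)) (Suc n) k = lookup (course_hist G x n) n k"
      unfolding lookup_def h by (simp only: psnd_iterate_Suc psnd_pair)
    then show ?thesis using Suc False by simp
  qed
qed simp

lemma computable_course:
  assumes "computable3 G" "computable f" "computable g"
  shows "computable (\<lambda>x. course G (f x) (g x))"
proof -
  have "computable (\<lambda>x. rec_nat 0 (\<lambda>k h. (\<lambda>k h x. pair (G (f x) k h) h) k h x) (g x))"
    by (intro computable_rec computable_const assms)
      (auto simp: computable3_def intro!: computable_intros computable3D[OF assms(1)] computable_compose[OF assms(2)])
  then have "computable (\<lambda>x. course_hist G (f x) (g x))" by (simp add: course_hist_def)
  then show ?thesis unfolding course_def by (intro computable3D[OF assms(1)] assms)
qed

lemma computable_lookup:
  assumes "computable f" "computable g" "computable h"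
  shows "computable (\<lambda>x. lookup (f x) (g x) (h x))"
proof -
  have "computable (\<lambda>x. rec_nat (f x) (\<lambda>k r. (\<lambda>k r x. psnd r) k r x) (g x - Suc (h x)))"
    by (intro computable_rec computable_intros assms) (auto simp: computable3_def intro!: computable_intros)
  then show ?thesis unfolding lookup_def by (intro computable_pfst) simp
qed

text \<open>A positive constructor tag makes the code of a compound exceed the codes packed in it,
  so their values are already in the history. Tag 0 occurs only where nothing has to be looked
  up.\<close>

lemma lookup_pair_less:
  assumes "0 < a" "k \<le> b"
  shows "lookup (course_hist G x (pair a b)) (pair a b) k = course G x k"
  using prod_encode_gt_snd[OF assms(1), of b] assms(2) unfolding pair_def by (intro lookup_course_hist) auto

lemma pfst_le: "pfst b \<le> b" and psnd_le: "psnd b \<le> b"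
  using prod_encode_ge_add[of "pfst b" "psnd b"] unfolding pair_def[symmetric] by auto

definition coeff_step :: "nat \<Rightarrow> nat \<Rightarrow> nat \<Rightarrow> nat" where
  "coeff_step j m h =
    (if pfst m = 0 then 0 else if pfst m = 1 then of_bool (j = 0)
     else if pfst m = 2 then of_bool (j = Suc (psnd m))
     else lookup h m (pfst (psnd m)) + lookup h m (psnd (psnd m)))"

definition coeff_code :: "nat \<Rightarrow> nat \<Rightarrow> nat" where "coeff_code t j = course coeff_step j t"

lemma coeff_code: "int (coeff_code (tm_code t) j) = tm_form t j"
  unfolding coeff_code_def
proof (induction t)
  case (TAdd s t)
  let ?b = "pair (tm_code s) (tm_code t)"
  have c: "tm_code (TAdd s t) = pair 3 ?b" by (simp add: pair_def)
  have "course coeff_step j (pair 3 ?b) = course coeff_step j (tm_code s) + course coeff_step j (tm_code t)"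
    unfolding course_def[of _ _ "pair 3 ?b"] coeff_step_def[of _ "pair 3 ?b"]
    using pfst_le[of ?b] psnd_le[of ?b] by (simp add: lookup_pair_less)
  then show ?case using TAdd unfolding c by simp
qed (auto simp: course_def coeff_step_def pair_def[symmetric])

lemma computable_of_bool: "decidable P \<Longrightarrow> computable (\<lambda>x. of_bool (P x))"
  unfolding decidable_def .

lemma computable_coeff_code: "computable2 coeff_code"
proof -
  have "computable3 coeff_step"
    unfolding computable3_def coeff_step_def
    by (intro computable_If computable_intros computable_lookup computable_of_bool decidable_eq)
  then show ?thesis unfolding computable2_def coeff_code_def by (intro computable_course computable_intros)
qed

definition digit :: "nat \<Rightarrow> nat \<Rightarrow> nat \<Rightarrow> nat" where "digit b z k = z div b ^ k mod b"

lemma computable_digit: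
  "computable f \<Longrightarrow> computable g \<Longrightarrow> computable h \<Longrightarrow> computable (\<lambda>x. digit (f x) (g x) (h x))"
  unfolding digit_def by (intro computable_mod computable_div computable_power)

lemma digit_less: "0 < b \<Longrightarrow> digit b z k < b"
  unfolding digit_def by simp

lemma digits_exist:
  assumes "\<And>k. k < L \<Longrightarrow> g k < b" "0 < b"
  shows "\<exists>z<b ^ L. \<forall>k<L. digit b z k = g k"
  using assms(1)
proof (induction L arbitrary: g)
  case 0
  then show ?case by (intro exI[of _ 0]) simp
next
  case (Suc L)
  have "\<exists>z<b ^ L. \<forall>k<L. digit b z k = g (Suc k)" by (rule Suc.IH) (simp add: Suc.prems)
  then obtain z where z: "z < b ^ L" "\<forall>k<L. digit b z k = g (Suc k)" by blast
  have g0: "g 0 < b" using Suc.prems by simp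
  show ?case
  proof (intro exI[of _ "g 0 + b * z"] conjI allI impI)
    have "g 0 + b * z < b * Suc z" using g0 by simp
    also have "\<dots> \<le> b * b ^ L" using z(1) by (intro mult_le_mono2) simp
    finally show "g 0 + b * z < b ^ Suc L" by simp
    show "digit b (g 0 + b * z) k = g k" if "k < Suc L" for k
    proof (cases k)
      case 0
      then show ?thesis using g0 by (simp add: digit_def)
    next
      case (Suc l)
      have "(g 0 + b * z) div b = z" using g0 by simp
      then have "digit b (g 0 + b * z) (Suc l) = digit b z l"
        unfolding digit_def by (simp add: div_mult2_eq)
      then show ?thesis using z(2) that Suc by simp
    qed
  qed
qed

definition abs_diff :: "nat \<Rightarrow> nat \<Rightarrow> nat" where "abs_diff a b = (a - b) + (b - a)"

lemma int_abs_diff: "int (abs_diff a b) = \<bar>int a - int b\<bar>"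
  unfolding abs_diff_def by auto

definition nat_live :: "nat \<Rightarrow> nat \<Rightarrow> nat \<Rightarrow> nat \<Rightarrow> nat \<Rightarrow> bool" where
  "nat_live p e f k d \<longleftrightarrow> d \<noteq> 0 \<and> \<not> (e = 0 \<and> p dvd d) \<and> (e = 0 \<or> k < e * f)"

text \<open>The sum is the multiplicity of the prime \<open>p\<close> in \<open>d\<close>: no power
  beyond the \<open>d\<close>-th divides \<open>d > 0\<close>. Absolute values are enough, as
  liveness and valuation of a coordinate ignore signs.\<close>

definition nat_val :: "nat \<Rightarrow> nat \<Rightarrow> nat \<Rightarrow> nat \<Rightarrow> nat \<Rightarrow> nat" where
  "nat_val p e f k d = e * (\<Sum>r<d. of_bool (p ^ Suc r dvd d)) + k div f"

lemma nat_live: "nat_live p e f k (nat \<bar>d\<bar>) \<longleftrightarrow> live p e f k d"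
  unfolding nat_live_def live_def nz_def by (auto simp: nat_dvd_iff int_dvd_int_iff)

lemma sum_of_bool_dvd:
  fixes d :: int
  assumes "prime p" "d \<noteq> 0"
  shows "(\<Sum>r<nat \<bar>d\<bar>. of_bool (p ^ Suc r dvd nat \<bar>d\<bar>)) = multiplicity (int p) d"
proof -
  let ?D = "nat \<bar>d\<bar>" and ?m = "multiplicity (int p) d"
  have dvd: "p ^ Suc r dvd ?D \<longleftrightarrow> r < ?m" for r
  proof -
    have "p ^ Suc r dvd ?D \<longleftrightarrow> int p ^ Suc r dvd d"
      using int_dvd_int_iff[of "p ^ Suc r" ?D] by (simp del: power_Suc int_dvd_int_iff)
    also have "\<dots> \<longleftrightarrow> Suc r \<le> ?m"
      using assms by (intro power_dvd_iff_le_multiplicity) auto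
    finally show ?thesis by auto
  qed
  have "?m \<le> ?D" using multiplicity_le_abs[OF assms, of ?D] by simp
  then have "{..<?D} \<inter> {r. r < ?m} = {..<?m}" by auto
  then show ?thesis unfolding dvd by simp
qed

lemma nat_val:
  assumes "place p e f" "d \<noteq> 0"
  shows "nat_val p e f k (nat \<bar>d\<bar>) = digit_val p e f k d"
proof (cases "e = 0")
  case False
  then have "prime p" using assms(1) unfolding place_def by auto
  then show ?thesis unfolding nat_val_def digit_val_def using sum_of_bool_dvd assms(2) by simp
qed (simp add: nat_val_def digit_val_def)

lemma decidable_nat_live:
  "computable k \<Longrightarrow> computable d \<Longrightarrow> decidable (\<lambda>x. nat_live p e f (k x) (d x))"
  unfolding nat_live_def
  by (intro decidable_conj decidable_disj decidable_not decidable_eq decidable_less decidable_dvd decidable_const computable_const)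

lemma computable_nat_val:
  assumes "computable k" "computable d"
  shows "computable (\<lambda>x. nat_val p e f (k x) (d x))"
proof -
  have "computable (\<lambda>x. \<Sum>r<d x. (\<lambda>r x. of_bool (p ^ Suc r dvd d x)) r x :: nat)"
    unfolding computable2_def
    by (intro computable_sum assms(2)) (simp only: computable2_def, intro computable_of_bool decidable_dvd computable_intros' computable_compose[OF assms(2)])
  then show ?thesis unfolding nat_val_def by (intro computable_add computable_mult computable_div computable_const assms) simp
qed

text \<open>The valuation is the least \<open>digit_val\<close> of a live coordinate, and comparing
  two minima means finding for each term of one a smaller or equal term of the other. Null sequences
  need no separate treatment, and for finite supports the condition is a bounded search.\<close>

lemma seq_leq_iff:
  assumes "place p e f"
  shows "valued_module.leq (seq_ball p e f) 0 u w \<longleftrightarrow>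
    (\<forall>k. live p e f k (w k) \<longrightarrow> (\<exists>l. live p e f l (u l) \<and> digit_val p e f l (u l) \<le> digit_val p e f k (w k)))"
  unfolding valued_module.leq_def[OF valued_module_seq[OF assms]]
proof (intro iffI allI impI)
  fix k assume a: "\<forall>g. seq_ball p e f g u \<longrightarrow> seq_ball p e f (g + 0) w" and l: "live p e f k (w k)"
  have "\<not> seq_ball p e f (int (digit_val p e f k (w k)) + 1) w" using l unfolding seq_ball_def by force
  then have "\<not> seq_ball p e f (int (digit_val p e f k (w k)) + 1) u" using a by auto
  then show "\<exists>l. live p e f l (u l) \<and> digit_val p e f l (u l) \<le> digit_val p e f k (w k)"
    unfolding seq_ball_def by force
next
  fix g assume a: "\<forall>k. live p e f k (w k) \<longrightarrow> (\<exists>l. live p e f l (u l) \<and> digit_val p e f l (u l) \<le> digit_val p e f k (w k))"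
    and u: "seq_ball p e f g u"
  show "seq_ball p e f (g + 0) w"
    unfolding seq_ball_def
  proof (intro allI impI)
    fix k assume "live p e f k (w k)"
    then obtain l where "live p e f l (u l)" "digit_val p e f l (u l) \<le> digit_val p e f k (w k)" using a by blast
    then show "g + 0 \<le> int (digit_val p e f k (w k))" using u unfolding seq_ball_def by force
  qed
qed

lemma seq_Z_iff:
  assumes "place p e f"
  shows "valued_module.Z (seq_ball p e f) u \<longleftrightarrow> (\<forall>k. \<not> live p e f k (u k))"
  unfolding valued_module.Z_def[OF valued_module_seq[OF assms]]
proof (intro iffI allI notI)
  fix k assume a: "\<forall>g. seq_ball p e f g u" and l: "live p e f k (u k)"
  have "seq_ball p e f (int (digit_val p e f k (u k)) + 1) u" using a by blast
  then show False using l unfolding seq_ball_def by force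
qed (auto simp: seq_ball_def)

lemma computable_Hs:
  assumes "computable f" "computable g"
  shows "computable (\<lambda>x. Hs (f x) (g x))"
proof -
  have "computable (\<lambda>x. rec_nat (f x) (\<lambda>k r. (\<lambda>k r x. 2 * (fact r * r)) k r x) (g x))"
    by (intro computable_rec assms) (auto simp: computable3_def intro!: computable_intros')
  moreover have "rec_nat a (\<lambda>k r. 2 * (fact r * r)) b = Hs a b" for a b by (induction b) auto
  ultimately show ?thesis by simp
qed

lemma computable_Cs:
  assumes "computable f" "computable g"
  shows "computable (\<lambda>x. Cs E (f x) (g x))"
proof -
  have "computable (\<lambda>x. rec_nat 0 (\<lambda>k r. (\<lambda>k r x. 2 * (r + E * fact (Hs (f x) k)) + 1) k r x) (g x))"
    by (intro computable_rec assms computable_const)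
      (auto simp: computable3_def intro!: computable_intros' computable_Hs computable_compose[OF assms(1)])
  moreover have "rec_nat 0 (\<lambda>k r. 2 * (r + E * fact (Hs a k)) + 1) b = Cs E a b" for a b by (induction b) auto
  ultimately show ?thesis by simp
qed

lemma computable_next_bound:
  assumes "computable m" "computable H" "computable C" "computable M"
  shows "computable (\<lambda>x. next_bound E (m x) (H x) (C x) (M x))"
  unfolding next_bound_def next_val_def by (intro computable_intros' assms)

lemma computable_Ms:
  assumes "computable f" "computable g" "computable h"
  shows "computable (\<lambda>x. Ms E (f x) (g x) (h x))"
proof -
  have "computable (\<lambda>x. rec_nat 1 (\<lambda>k r. (\<lambda>k r x. next_bound E (Suc k) (Hs (f x) (g x - Suc k)) (Cs E (f x) (g x - Suc k)) r) k r x) (h x))"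
    by (intro computable_rec assms computable_const)
      (auto simp: computable3_def intro!: computable_intros' computable_next_bound computable_Hs computable_Cs
        computable_compose[OF assms(1)] computable_compose[OF assms(2)])
  moreover have "rec_nat 1 (\<lambda>k r. next_bound E (Suc k) (Hs a (b - Suc k)) (Cs E a (b - Suc k)) r) c = Ms E a b c" for a b c
    by (induction c) auto
  ultimately show ?thesis by simp
qed

text \<open>
  A family of sequences is coded by the base-\<open>b\<close> digits of a number \<open>z\<close>, each integer being a
  difference of two digits. The context \<open>y\<close> below packs \<open>z\<close> and the code \<open>q\<close> of the formula.
\<close>

definition num_vars :: "nat \<Rightarrow> nat" where "num_vars q = Suc q"
definition form_bound :: "nat \<Rightarrow> nat" where "form_bound q = Hs (2 * num_vars q) (num_vars q)"
definition entry_bound :: "nat \<Rightarrow> nat \<Rightarrow> nat" where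
  "entry_bound E q = Ms E (form_bound q) (num_vars q) (num_vars q)"

definition entry :: "nat \<Rightarrow> nat \<Rightarrow> nat \<Rightarrow> nat \<Rightarrow> nat \<Rightarrow> nat \<Rightarrow> nat" where
  "entry E i \<sigma> y j k = digit (Suc (entry_bound E (psnd y))) (pfst y) (pair i (pair j (pair k \<sigma>)))"

text \<open>The absolute value of coordinate \<open>k\<close> of the combination with coefficients
  \<open>cf u j - cf v j\<close>. Both factors being differences, the product is expanded and its
  positive and negative terms are collected apart, so that the arithmetic stays in the
  naturals.\<close>

definition coord :: "nat \<Rightarrow> (nat \<Rightarrow> nat \<Rightarrow> nat) \<Rightarrow> nat \<Rightarrow> nat \<Rightarrow> nat \<Rightarrow> nat \<Rightarrow> nat \<Rightarrow> nat" where
  "coord E cf i y u v k = abs_diff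
    (\<Sum>j<Suc (num_vars (psnd y)). cf u j * entry E i 0 y j k + cf v j * entry E i 1 y j k)
    (\<Sum>j<Suc (num_vars (psnd y)). cf u j * entry E i 1 y j k + cf v j * entry E i 0 y j k)"

text \<open>The code carries its own base, so that \<open>form_code\<close> has the same shape as
  \<open>coeff_code\<close> and either can be handed to \<open>coord\<close>.\<close>

definition form_code :: "nat \<Rightarrow> nat \<Rightarrow> nat" where
  "form_code h j = digit (pfst h) (psnd h) j"

definition var_code :: "nat \<Rightarrow> nat" where
  "var_code j = (if j = 0 then pair 1 0 else pair 2 (j - 1))"

lemma computable_num_vars: "computable f \<Longrightarrow> computable (\<lambda>x. num_vars (f x))"
  unfolding num_vars_def by (rule computable_Suc)

lemma computable_form_bound: "computable f \<Longrightarrow> computable (\<lambda>x. form_bound (f x))"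
  unfolding form_bound_def by (intro computable_Hs computable_num_vars computable_mult computable_const)

lemma computable_entry_bound: "computable f \<Longrightarrow> computable (\<lambda>x. entry_bound E (f x))"
  unfolding entry_bound_def by (intro computable_Ms computable_num_vars computable_form_bound)

lemma computable_entry:
  "computable f \<Longrightarrow> computable g \<Longrightarrow> computable h \<Longrightarrow> computable (\<lambda>x. entry E i \<sigma> (f x) (g x) (h x))"
  unfolding entry_def by (intro computable_digit computable_intros computable_entry_bound)

lemma computable_abs_diff: "computable f \<Longrightarrow> computable g \<Longrightarrow> computable (\<lambda>x. abs_diff (f x) (g x))"
  unfolding abs_diff_def by (intro computable_intros)

lemma computable_coord:
  assumes cf: "computable2 cf" and y: "computable y" and u: "computable u" and v: "computable v" and k: "computable k"
  shows "computable (\<lambda>x. coord E cf i (y x) (u x) (v x) (k x))"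
proof -
  have "computable (\<lambda>x. \<Sum>j<Suc (num_vars (psnd (y x))). (\<lambda>j x. cf (u x) j * entry E i \<sigma> (y x) j (k x) +
      cf (v x) j * entry E i \<tau> (y x) j (k x)) j x)" for \<sigma> \<tau>
    by (intro computable_sum computable_Suc computable_num_vars computable_psnd y)
      (simp only: computable2_def, intro computable_intros' computable2D[OF cf] computable_entry
        computable_compose[OF y] computable_compose[OF u] computable_compose[OF v] computable_compose[OF k])
  then show ?thesis unfolding coord_def by (intro computable_abs_diff) simp_all
qed

lemma computable_form_code: "computable2 form_code"
  unfolding computable2_def form_code_def by (intro computable_digit computable_intros)

definition test_zero where
  "test_zero E p e f cf i y u v \<longleftrightarrow>
    (\<forall>k<entry_bound E (psnd y). \<not> nat_live p e f k (coord E cf i y u v k))"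

definition test_leq where
  "test_leq E p e f i y s t \<longleftrightarrow>
    (\<forall>k<entry_bound E (psnd y). nat_live p e f k (coord E coeff_code i y t 0 k) \<longrightarrow>
      (\<exists>l<entry_bound E (psnd y). nat_live p e f l (coord E coeff_code i y s 0 l) \<and>
        nat_val p e f l (coord E coeff_code i y s 0 l) \<le> nat_val p e f k (coord E coeff_code i y t 0 k)))"

lemma decidable_test_zero:
  assumes cf: "computable2 cf" and y: "computable y" and u: "computable u" and v: "computable v"
  shows "decidable (\<lambda>x. test_zero E p e f cf i (y x) (u x) (v x))"
  unfolding test_zero_def
  by (rule decidable_All) (simp only: decidable2_def, intro decidable_not decidable_nat_live computable_coord cf
      computable_intros computable_compose[OF y] computable_compose[OF u] computable_compose[OF v],
      intro computable_entry_bound computable_psnd y)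

lemma decidable_test_leq:
  assumes y: "computable y" and s: "computable s" and t: "computable t"
  shows "decidable (\<lambda>x. test_leq E p e f i (y x) (s x) (t x))"
  unfolding test_leq_def
proof (rule decidable_All)
  show "computable (\<lambda>x. entry_bound E (psnd (y x)))" by (intro computable_entry_bound computable_psnd y)
  note c = computable_compose[OF y] computable_compose[OF s] computable_compose[OF t]
  show "decidable2 (\<lambda>k x. nat_live p e f k (coord E coeff_code i (y x) (t x) 0 k) \<longrightarrow>
      (\<exists>l<entry_bound E (psnd (y x)). nat_live p e f l (coord E coeff_code i (y x) (s x) 0 l) \<and>
        nat_val p e f l (coord E coeff_code i (y x) (s x) 0 l) \<le> nat_val p e f k (coord E coeff_code i (y x) (t x) 0 k)))"
    unfolding decidable2_def
  proof (rule decidable_imp)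
    show "decidable (\<lambda>z. nat_live p e f (pfst z) (coord E coeff_code i (y (psnd z)) (t (psnd z)) 0 (pfst z)))"
      by (intro decidable_nat_live computable_coord computable_coeff_code computable_intros c)
    show "decidable (\<lambda>z. \<exists>l<entry_bound E (psnd (y (psnd z))). nat_live p e f l (coord E coeff_code i (y (psnd z)) (s (psnd z)) 0 l) \<and>
        nat_val p e f l (coord E coeff_code i (y (psnd z)) (s (psnd z)) 0 l)
        \<le> nat_val p e f (pfst z) (coord E coeff_code i (y (psnd z)) (t (psnd z)) 0 (pfst z)))"
      by (rule decidable_Ex) (simp only: decidable2_def,
          intro decidable_conj decidable_le decidable_nat_live computable_nat_val computable_coord computable_coeff_code computable_intros c,
          intro computable_entry_bound computable_psnd computable_intros c)
  qed
qed

text \<open>All parameters are constants of the program to be built; quantifiers over places are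
  unrolled into finite conjunctions.\<close>

locale search =
  fixes n E :: nat and p e f :: "nat \<Rightarrow> nat"
begin

text \<open>The tags are those of \<open>fm_code\<close>, truth values are 0 and 1, and disjunction
  is expressed by De Morgan. Tag 6, the universal quantifier, ends in the default 0, in accordance
  with \<open>matrix_sat\<close>.\<close>

definition matrix_step :: "nat \<Rightarrow> nat \<Rightarrow> nat \<Rightarrow> nat" where
  "matrix_step y m h =
    (if pfst m = 0 then of_bool (\<forall>i\<in>set [0..<n]. test_zero E (p i) (e i) (f i) coeff_code i y (pfst (psnd m)) (psnd (psnd m)))
     else if pfst m = 1 then of_bool (\<forall>i\<in>set [0..<n]. test_leq E (p i) (e i) (f i) i y (pfst (psnd m)) (psnd (psnd m)))
     else if pfst m = 2 then 1 - lookup h m (psnd m)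
     else if pfst m = 3 then lookup h m (pfst (psnd m)) * lookup h m (psnd (psnd m))
     else if pfst m = 4 then 1 - (1 - lookup h m (pfst (psnd m))) * (1 - lookup h m (psnd (psnd m)))
     else if pfst m = 5 then lookup h m (psnd (psnd m))
     else 0)"

lemma computable_matrix_step: "computable3 matrix_step"
  unfolding computable3_def matrix_step_def
  by (intro computable_If computable_of_bool decidable_list_all decidable_test_zero decidable_test_leq
      computable_coeff_code computable_intros computable_mult computable_lookup decidable_eq)

lemma course_matrix_step:
  "course matrix_step y (fm_code q) = of_bool (matrix_sat
    (\<lambda>s t. \<forall>i<n. test_zero E (p i) (e i) (f i) coeff_code i y (tm_code s) (tm_code t))
    (\<lambda>s t. \<forall>i<n. test_leq E (p i) (e i) (f i) i y (tm_code s) (tm_code t)) q)"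
proof (induction q)
  case (Neg q)
  have "course matrix_step y (pair 2 (fm_code q)) = 1 - course matrix_step y (fm_code q)"
    unfolding course_def[of _ _ "pair 2 _"] matrix_step_def[of _ "pair 2 _"] by (simp add: lookup_pair_less)
  then show ?case using Neg by (simp add: pair_def)
next
  case (And q r)
  let ?b = "pair (fm_code q) (fm_code r)"
  have "course matrix_step y (pair 3 ?b) = course matrix_step y (fm_code q) * course matrix_step y (fm_code r)"
    unfolding course_def[of _ _ "pair 3 _"] matrix_step_def[of _ "pair 3 _"]
    using pfst_le[of ?b] psnd_le[of ?b] by (simp add: lookup_pair_less)
  then show ?case using And by (simp add: pair_def)
next
  case (Or q r)
  let ?b = "pair (fm_code q) (fm_code r)"
  have "course matrix_step y (pair 4 ?b) = 1 - (1 - course matrix_step y (fm_code q)) * (1 - course matrix_step y (fm_code r))"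
    unfolding course_def[of _ _ "pair 4 _"] matrix_step_def[of _ "pair 4 _"]
    using pfst_le[of ?b] psnd_le[of ?b] by (simp add: lookup_pair_less)
  then show ?case using Or by (simp add: pair_def)
next
  case (Exists v q)
  let ?b = "pair v (fm_code q)"
  have "course matrix_step y (pair 5 ?b) = course matrix_step y (fm_code q)"
    unfolding course_def[of _ _ "pair 5 _"] matrix_step_def[of _ "pair 5 _"]
    using psnd_le[of ?b] by (simp add: lookup_pair_less)
  then show ?case using Exists by (simp add: pair_def)
qed (auto simp: course_def matrix_step_def pair_def[symmetric])

text \<open>The clauses are those of \<open>good\<close>. In the first one the subtracted term has
  code 0, which is \<open>TZero\<close>. In the third, coefficients of either sign arise as
  differences of the digits of \<open>h\<close> and \<open>h'\<close>.\<close>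

definition check :: "nat \<Rightarrow> bool" where
  "check y \<longleftrightarrow>
    (\<forall>i\<in>set [0..<n]. \<not> test_zero E (p i) (e i) (f i) coeff_code i y (var_code 0) 0) \<and>
    (\<forall>j<Suc (num_vars (psnd y)). \<forall>i\<in>set [0..<n]. test_leq E (p i) (e i) (f i) i y (var_code 0) (var_code j)) \<and>
    (\<forall>h<Suc (form_bound (psnd y)) ^ Suc (num_vars (psnd y)). \<forall>h'<Suc (form_bound (psnd y)) ^ Suc (num_vars (psnd y)).
      (\<forall>i\<in>set [0..<n]. test_zero E (p i) (e i) (f i) form_code i y
        (pair (Suc (form_bound (psnd y))) h) (pair (Suc (form_bound (psnd y))) h')) \<or>
      (\<forall>i\<in>set [0..<n]. \<not> test_zero E (p i) (e i) (f i) form_code i y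
        (pair (Suc (form_bound (psnd y))) h) (pair (Suc (form_bound (psnd y))) h'))) \<and>
    course matrix_step y (psnd y) = 1"

text \<open>There must be a digit for each index \<open>pair i (pair j (pair k \<sigma>))\<close> in
  range; by monotonicity of pairing the exponent exceeds all of these indices.\<close>

definition code_bound :: "nat \<Rightarrow> nat" where
  "code_bound q = Suc (entry_bound E q) ^ Suc (pair n (pair (num_vars q) (pair (entry_bound E q) 1)))"

definition search :: "nat \<Rightarrow> bool" where
  "search q \<longleftrightarrow> (\<exists>z<code_bound q. check (pair z q))"

lemma computable_var_code: "computable g \<Longrightarrow> computable (\<lambda>x. var_code (g x))"
  unfolding var_code_def by (intro computable_If computable_intros decidable_eq)

lemma decidable_check: "computable g \<Longrightarrow> decidable (\<lambda>x. check (g x))"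
proof -
  have "decidable check"
    unfolding check_def
  proof (intro decidable_conj)
    show "decidable (\<lambda>y. \<forall>i\<in>set [0..<n]. \<not> test_zero E (p i) (e i) (f i) coeff_code i y (var_code 0) 0)"
      by (intro decidable_list_all decidable_not decidable_test_zero computable_coeff_code computable_intros)
    show "decidable (\<lambda>y. course matrix_step y (psnd y) = 1)"
      by (intro decidable_eq computable_course computable_matrix_step computable_intros)
    show "decidable (\<lambda>y. \<forall>j<Suc (num_vars (psnd y)). \<forall>i\<in>set [0..<n]. test_leq E (p i) (e i) (f i) i y (var_code 0) (var_code j))"
    proof (rule decidable_All)
      show "decidable2 (\<lambda>j y. \<forall>i\<in>set [0..<n]. test_leq E (p i) (e i) (f i) i y (var_code 0) (var_code j))"
        unfolding decidable2_def
        by (intro decidable_list_all decidable_test_leq computable_var_code computable_pfst computable_psnd computable_id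
            computable_const)
      show "computable (\<lambda>y. Suc (num_vars (psnd y)))"
        by (intro computable_Suc computable_num_vars computable_psnd computable_id)
    qed
    show "decidable (\<lambda>y. \<forall>h<Suc (form_bound (psnd y)) ^ Suc (num_vars (psnd y)). \<forall>h'<Suc (form_bound (psnd y)) ^ Suc (num_vars (psnd y)).
      (\<forall>i\<in>set [0..<n]. test_zero E (p i) (e i) (f i) form_code i y
        (pair (Suc (form_bound (psnd y))) h) (pair (Suc (form_bound (psnd y))) h')) \<or>
      (\<forall>i\<in>set [0..<n]. \<not> test_zero E (p i) (e i) (f i) form_code i y
        (pair (Suc (form_bound (psnd y))) h) (pair (Suc (form_bound (psnd y))) h')))"
    proof (rule decidable_All)
      show "computable (\<lambda>y. Suc (form_bound (psnd y)) ^ Suc (num_vars (psnd y)))"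
        by (intro computable_power computable_Suc computable_form_bound computable_num_vars computable_intros)
      show "decidable2 (\<lambda>h y. \<forall>h'<Suc (form_bound (psnd y)) ^ Suc (num_vars (psnd y)).
        (\<forall>i\<in>set [0..<n]. test_zero E (p i) (e i) (f i) form_code i y
          (pair (Suc (form_bound (psnd y))) h) (pair (Suc (form_bound (psnd y))) h')) \<or>
        (\<forall>i\<in>set [0..<n]. \<not> test_zero E (p i) (e i) (f i) form_code i y
          (pair (Suc (form_bound (psnd y))) h) (pair (Suc (form_bound (psnd y))) h')))"
        unfolding decidable2_def
        by (rule decidable_All) (simp only: decidable2_def,
          intro decidable_disj decidable_list_all decidable_not decidable_test_zero computable_form_code
            computable_intros computable_form_bound,
          intro computable_power computable_Suc computable_form_bound computable_num_vars computable_intros)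
    qed
  qed
  then show "computable g \<Longrightarrow> ?thesis" by (rule decidable_compose)
qed

lemma decidable_search: "decidable search"
  unfolding search_def code_bound_def
proof (rule decidable_Ex)
  show "decidable2 (\<lambda>z q. check (pair z q))"
    unfolding decidable2_def by (intro decidable_check computable_intros)
  show "computable (\<lambda>q. Suc (entry_bound E q) ^ Suc (pair n (pair (num_vars q) (pair (entry_bound E q) 1))))"
    by (intro computable_power computable_Suc computable_pair computable_entry_bound computable_num_vars
        computable_const computable_id)
qed

end

lemma pair_mono: "a \<le> a' \<Longrightarrow> b \<le> b' \<Longrightarrow> pair a b \<le> pair a' b'"
  unfolding pair_def prod_encode_def using triangle_mono[of "a + b" "a' + b'"] by simp

text \<open>The cut at the entry bound ensures that every number \<open>z\<close> decodes to bounded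
  sequences.\<close>

definition decode_seqs :: "nat \<Rightarrow> nat \<Rightarrow> nat \<Rightarrow> nat \<Rightarrow> nat \<Rightarrow> int" where
  "decode_seqs E y i j k =
    (if k < entry_bound E (psnd y) then int (entry E i 0 y j k) - int (entry E i 1 y j k) else 0)"

lemma coord_eq:
  assumes k: "k < entry_bound E (psnd y)"
    and w: "w = (\<Sum>j<Suc (num_vars (psnd y)). (int (cf u j) - int (cf v j)) * decode_seqs E y i j k)"
  shows "coord E cf i y u v k = nat \<bar>w\<bar>"
proof -
  let ?N = "Suc (num_vars (psnd y))"
  let ?P = "\<Sum>j<?N. cf u j * entry E i 0 y j k + cf v j * entry E i 1 y j k"
  let ?Q = "\<Sum>j<?N. cf u j * entry E i 1 y j k + cf v j * entry E i 0 y j k"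
  have "int ?P - int ?Q = w"
    unfolding w of_nat_sum sum_subtractf[symmetric]
    by (rule sum.cong) (use k in \<open>auto simp: decode_seqs_def algebra_simps\<close>)
  then have "int (abs_diff ?P ?Q) = \<bar>w\<bar>" by (simp only: int_abs_diff)
  then show ?thesis unfolding coord_def by linarith
qed

section \<open>Correctness of the search\<close>

context multiplicative_places
begin

lemma dlin_apply: "dlin m t c k = (\<Sum>j<m. t j * c j k)"
  unfolding valued_module.lin_def[OF vmD[OF n_pos]] by (induction m) (auto simp: seq_scale_def)

lemma coord_dlin:
  assumes "k < entry_bound E (psnd y)"
  shows "coord E cf i y u v k =
    nat \<bar>dlin (Suc (num_vars (psnd y))) (\<lambda>j. int (cf u j) - int (cf v j)) (decode_seqs E y i) k\<bar>"
  by (rule coord_eq[OF assms]) (simp only: dlin_apply)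

lemma dlin_decode_eq_0: "entry_bound E (psnd y) \<le> k \<Longrightarrow> dlin m t (decode_seqs E y i) k = 0"
  unfolding dlin_apply by (auto simp: decode_seqs_def)

lemma not_live_0: "\<not> live q e' f' k 0"
  unfolding live_def nz_def by simp

lemma test_zero_iff:
  assumes i: "i < n"
  shows "test_zero E (p i) (e i) (f i) cf i y u v \<longleftrightarrow>
    DZ i (dlin (Suc (num_vars (psnd y))) (\<lambda>j. int (cf u j) - int (cf v j)) (decode_seqs E y i))"
proof -
  let ?w = "dlin (Suc (num_vars (psnd y))) (\<lambda>j. int (cf u j) - int (cf v j)) (decode_seqs E y i)"
  have "nat_live (p i) (e i) (f i) k (coord E cf i y u v k) \<longleftrightarrow> live (p i) (e i) (f i) k (?w k)"
    if "k < entry_bound E (psnd y)" for k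
    unfolding coord_dlin[OF that] by (rule nat_live)
  moreover have "k < entry_bound E (psnd y)" if "live (p i) (e i) (f i) k (?w k)" for k
    by (rule ccontr) (use that in \<open>simp add: dlin_decode_eq_0 not_live_0\<close>)
  ultimately show ?thesis unfolding test_zero_def seq_Z_iff[OF place[OF i]] by blast
qed

lemma test_leq_iff:
  assumes i: "i < n"
  shows "test_leq E (p i) (e i) (f i) i y s t \<longleftrightarrow>
    dleq i 0 (dlin (Suc (num_vars (psnd y))) (\<lambda>j. int (coeff_code s j)) (decode_seqs E y i))
      (dlin (Suc (num_vars (psnd y))) (\<lambda>j. int (coeff_code t j)) (decode_seqs E y i))"
proof -
  let ?M = "entry_bound E (psnd y)"
  let ?u = "dlin (Suc (num_vars (psnd y))) (\<lambda>j. int (coeff_code s j)) (decode_seqs E y i)"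
  let ?w = "dlin (Suc (num_vars (psnd y))) (\<lambda>j. int (coeff_code t j)) (decode_seqs E y i)"
  have c0: "coeff_code 0 j = 0" for j
    using coeff_code[of TZero j] by (simp add: prod_encode_def)
  have co: "coord E coeff_code i y s 0 k = nat \<bar>?u k\<bar>" "coord E coeff_code i y t 0 k = nat \<bar>?w k\<bar>"
    if "k < ?M" for k by (simp_all add: coord_dlin[OF that] c0)
  have small: "live (p i) (e i) (f i) k (?u k) \<Longrightarrow> k < ?M" "live (p i) (e i) (f i) k (?w k) \<Longrightarrow> k < ?M" for k
    by (rule ccontr, simp add: dlin_decode_eq_0 not_live_0)+
  have val: "nat_val (p i) (e i) (f i) k (nat \<bar>d\<bar>) = digit_val (p i) (e i) (f i) k d"
    if "live (p i) (e i) (f i) k d" for k d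
    by (rule nat_val[OF place[OF i]]) (use that not_live_0 in blast)
  have "test_leq E (p i) (e i) (f i) i y s t \<longleftrightarrow>
    (\<forall>k<?M. live (p i) (e i) (f i) k (?w k) \<longrightarrow> (\<exists>l<?M. live (p i) (e i) (f i) l (?u l) \<and>
      digit_val (p i) (e i) (f i) l (?u l) \<le> digit_val (p i) (e i) (f i) k (?w k)))"
    unfolding test_leq_def by (simp add: co nat_live val cong: conj_cong)
  also have "\<dots> \<longleftrightarrow> (\<forall>k. live (p i) (e i) (f i) k (?w k) \<longrightarrow> (\<exists>l. live (p i) (e i) (f i) l (?u l) \<and>
      digit_val (p i) (e i) (f i) l (?u l) \<le> digit_val (p i) (e i) (f i) k (?w k)))"
    using small by blast
  finally show ?thesis unfolding seq_leq_iff[OF place[OF i]] .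
qed

lemma coeff_code_var_code: "(\<lambda>k. int (coeff_code (var_code j) k)) = unit_form j"
proof -
  have "var_code j = tm_code (if j = 0 then TOne else TVar (j - 1))"
    unfolding var_code_def by (simp add: pair_def)
  then show ?thesis by (auto simp: fun_eq_iff coeff_code unit_form_def)
qed

lemma matrix_sat_iff_atoms:
  assumes "\<And>s t. A s t \<longleftrightarrow> A' s t" "\<And>s t. D s t \<longleftrightarrow> D' s t"
  shows "matrix_sat A D q \<longleftrightarrow> matrix_sat A' D' q"
  by (rule matrix_sat_cong) (use assms in auto)

sublocale search n E p e f for E .

lemma check_iff_good:
  "check E (pair z (fm_code q)) \<longleftrightarrow>
    good (num_vars (fm_code q)) (form_bound (fm_code q)) q (decode_seqs E (pair z (fm_code q)))"
proof -
  define y where "y = pair z (fm_code q)"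
  define N where "N = num_vars (fm_code q)"
  define U where "U = form_bound (fm_code q)"
  define c where "c = decode_seqs E y"
  have y: "psnd y = fm_code q" unfolding y_def by simp
  have set: "(\<forall>i\<in>set [0..<n]. Q i) \<longleftrightarrow> (\<forall>i<n. Q i)" for Q by auto
  have v0: "coeff_code 0 j = 0" for j using coeff_code[of TZero j] by (simp add: prod_encode_def)
  have tz: "test_zero E (p i) (e i) (f i) cf i y u v \<longleftrightarrow> DZ i (dlin (Suc N) (\<lambda>j. int (cf u j) - int (cf v j)) (c i))"
    if "i < n" for i cf u v using test_zero_iff[OF that, of E cf y u v] unfolding y N_def c_def .
  have tl: "test_leq E (p i) (e i) (f i) i y s t \<longleftrightarrow>
    dleq i 0 (dlin (Suc N) (\<lambda>j. int (coeff_code s j)) (c i)) (dlin (Suc N) (\<lambda>j. int (coeff_code t j)) (c i))"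
    if "i < n" for i s t using test_leq_iff[OF that, of E y s t] unfolding y N_def c_def .
  have 1: "(\<forall>i\<in>set [0..<n]. \<not> test_zero E (p i) (e i) (f i) coeff_code i y (var_code 0) 0) \<longleftrightarrow> (\<forall>i<n. \<not> DZ i (c i 0))"
    unfolding set using coeff_code_var_code[of 0] by (auto simp: tz v0 dlin_unit_form)
  have 2: "(\<forall>j<Suc N. \<forall>i\<in>set [0..<n]. test_leq E (p i) (e i) (f i) i y (var_code 0) (var_code j)) \<longleftrightarrow>
    (\<forall>i<n. \<forall>j\<le>N. dleq i 0 (c i 0) (c i j))"
    unfolding set less_Suc_eq_le by (auto simp: tl coeff_code_var_code dlin_unit_form)
  have 3: "(\<forall>h<Suc U ^ Suc N. \<forall>h'<Suc U ^ Suc N.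
      (\<forall>i\<in>set [0..<n]. test_zero E (p i) (e i) (f i) form_code i y (pair (Suc U) h) (pair (Suc U) h')) \<or>
      (\<forall>i\<in>set [0..<n]. \<not> test_zero E (p i) (e i) (f i) form_code i y (pair (Suc U) h) (pair (Suc U) h'))) \<longleftrightarrow>
    (\<forall>t\<in>forms (Suc N) U. (\<forall>i<n. DZ i (dlin (Suc N) t (c i))) \<or> (\<forall>i<n. \<not> DZ i (dlin (Suc N) t (c i))))"
    (is "?L \<longleftrightarrow> ?R")
  proof -
    let ?u = "\<lambda>t. (\<forall>i<n. DZ i (dlin (Suc N) t (c i))) \<or> (\<forall>i<n. \<not> DZ i (dlin (Suc N) t (c i)))"
    let ?t = "\<lambda>h h' j. int (digit (Suc U) h j) - int (digit (Suc U) h' j)"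
    have L: "?L \<longleftrightarrow> (\<forall>h<Suc U ^ Suc N. \<forall>h'<Suc U ^ Suc N. ?u (?t h h'))"
      unfolding set by (auto simp: tz form_code_def)
    show ?thesis
      unfolding L
    proof (intro iffI ballI allI impI)
      fix t assume a: "\<forall>h<Suc U ^ Suc N. \<forall>h'<Suc U ^ Suc N. ?u (?t h h')" and t: "t \<in> forms (Suc N) U"
      have tU: "nat (t j) < Suc U" "nat (- t j) < Suc U" for j
      proof -
        have "\<bar>t j\<bar> \<le> int U" using t unfolding forms_def by blast
        then show "nat (t j) < Suc U" "nat (- t j) < Suc U" by linarith+
      qed
      obtain h where h: "h < Suc U ^ Suc N" "\<forall>j<Suc N. digit (Suc U) h j = nat (t j)"
        using digits_exist[of "Suc N" "\<lambda>j. nat (t j)" "Suc U"] tU by blast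
      obtain h' where h': "h' < Suc U ^ Suc N" "\<forall>j<Suc N. digit (Suc U) h' j = nat (- t j)"
        using digits_exist[of "Suc N" "\<lambda>j. nat (- t j)" "Suc U"] tU by blast
      have "dlin (Suc N) (?t h h') (c i) = dlin (Suc N) t (c i)" for i
        by (rule valued_module.lin_cong[OF vmD[OF n_pos]]) (use h h' in auto)
      moreover have "?u (?t h h')" using a h(1) h'(1) by blast
      ultimately show "?u t" by simp
    next
      fix h h' assume a: "\<forall>t\<in>forms (Suc N) U. ?u t"
      let ?s = "\<lambda>j. if j < Suc N then ?t h h' j else 0"
      have "\<bar>?t h h' j\<bar> \<le> int U" for j
        using digit_less[of "Suc U" h j] digit_less[of "Suc U" h' j] by auto
      then have s: "?s \<in> forms (Suc N) U" unfolding forms_def by auto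
      have eq: "dlin (Suc N) ?s (c i) = dlin (Suc N) (?t h h') (c i)" for i
        by (rule valued_module.lin_cong[OF vmD[OF n_pos]]) auto
      show "?u (?t h h')" using bspec[OF a s] unfolding eq .
    qed
  qed
  have 4: "course (matrix_step E) y (fm_code q) = 1 \<longleftrightarrow> matrix_sat (seq_eq N c) (seq_dvd N c) q"
  proof -
    have "matrix_sat (\<lambda>s t. \<forall>i<n. test_zero E (p i) (e i) (f i) coeff_code i y (tm_code s) (tm_code t))
      (\<lambda>s t. \<forall>i<n. test_leq E (p i) (e i) (f i) i y (tm_code s) (tm_code t)) q \<longleftrightarrow>
      matrix_sat (seq_eq N c) (seq_dvd N c) q"
      by (rule matrix_sat_iff_atoms) (auto simp: tz tl seq_eq_def seq_dvd_def coeff_code)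
    then show ?thesis unfolding course_matrix_step by simp
  qed
  show ?thesis
    unfolding check_def good_def y_def[symmetric] c_def[symmetric] y N_def[symmetric] U_def[symmetric] 1 2 3 4 by blast
qed

lemma decode_seqs_exist:
  assumes bd: "\<And>i j. i < n \<Longrightarrow> j \<le> num_vars q \<Longrightarrow> bounded_seq (entry_bound E q) (c i j)"
  shows "\<exists>z<code_bound E q. \<forall>i<n. \<forall>j\<le>num_vars q. decode_seqs E (pair z q) i j = c i j"
proof -
  define M where "M = entry_bound E q"
  define L where "L = Suc (pair n (pair (num_vars q) (pair M 1)))"
  define val where "val = (\<lambda>i j k \<sigma>::nat. nat (if \<sigma> = 0 then c i j k else - c i j k))"
  \<comment> \<open>The \<open>min\<close> matters only for indices outside the range in question,
    where nothing bounds the entries.\<close>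
  define g where "g = (\<lambda>m. min M (val (pfst m) (pfst (psnd m)) (pfst (psnd (psnd m))) (psnd (psnd (psnd m)))))"
  have "\<exists>z<Suc M ^ L. \<forall>m<L. digit (Suc M) z m = g m" by (rule digits_exist) (auto simp: g_def)
  then obtain z where z: "z < Suc M ^ L" "\<And>m. m < L \<Longrightarrow> digit (Suc M) z m = g m" by blast
  have en: "entry E i \<sigma> (pair z q) j k = val i j k \<sigma>"
    if "i < n" "j \<le> num_vars q" "k < M" "\<sigma> \<le> 1" for i j k \<sigma>
  proof -
    let ?m = "pair i (pair j (pair k \<sigma>))"
    have "?m < L" unfolding L_def using that by (intro le_imp_less_Suc pair_mono) auto
    moreover have "\<bar>c i j k\<bar> \<le> int M" using bd[OF that(1,2)] unfolding bounded_seq_def M_def by blast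
    then have "val i j k \<sigma> \<le> M" unfolding val_def by auto
    ultimately show ?thesis unfolding entry_def by (simp add: M_def[symmetric] z(2)) (simp add: g_def)
  qed
  have "decode_seqs E (pair z q) i j = c i j" if ij: "i < n" "j \<le> num_vars q" for i j
  proof
    fix k
    show "decode_seqs E (pair z q) i j k = c i j k"
    proof (cases "k < M")
      case True
      then show ?thesis using en[OF ij True, of 0] en[OF ij True, of 1]
        unfolding decode_seqs_def by (simp add: M_def[symmetric] val_def)
    next
      case False
      then show ?thesis using bd[OF ij] unfolding decode_seqs_def bounded_seq_def by (simp add: M_def)
    qed
  qed
  then show ?thesis using z(1) unfolding L_def M_def code_bound_def by blast
qed

lemma good_cong:
  assumes "\<And>i j. i < n \<Longrightarrow> j \<le> N \<Longrightarrow> c i j = c' i j"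
  shows "good N U q c \<longleftrightarrow> good N U q c'"
proof -
  have lin: "dlin (Suc N) t (c i) = dlin (Suc N) t (c' i)" if "i < n" for i t
    by (rule valued_module.lin_cong[OF vmD[OF n_pos]]) (use assms that in auto)
  have "seq_eq N c s t = seq_eq N c' s t" "seq_dvd N c s t = seq_dvd N c' s t" for s t
    unfolding seq_eq_def seq_dvd_def using lin by auto
  then have "seq_eq N c = seq_eq N c'" "seq_dvd N c = seq_dvd N c'" by (auto simp: fun_eq_iff)
  then show ?thesis unfolding good_def using lin assms by auto
qed

theorem existential_theory_decidable_R: "existential_theory_decidable R"
proof -
  define E where "E = Max ((\<lambda>i. p i + e i + f i) ` {..<n})"
  have E: "p i \<le> E \<and> e i \<le> E \<and> f i \<le> E" if "i < n" for i
  proof -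
    have "p i + e i + f i \<le> E" unfolding E_def using that by (intro Max_ge) auto
    then show ?thesis by linarith
  qed
  obtain r where r: "\<And>x. computes r [x] (of_bool (search E x))"
    using decidable_search unfolding decidable_def computable_def by blast
  have "search E (fm_code q) \<longleftrightarrow> holds_in R q" if q: "existential_sentence q" for q
  proof -
    let ?q = "fm_code q"
    have iff: "holds_in R q \<longleftrightarrow> (\<exists>c. (\<forall>i<n. \<forall>j\<le>num_vars ?q. bounded_seq (entry_bound E ?q) (c i j)) \<and>
      good (num_vars ?q) (form_bound ?q) q c)"
      unfolding entry_bound_def form_bound_def
      by (rule holds_in_R_iff[OF q _ E]) (simp_all add: num_vars_def)
    show ?thesis
    proof
      assume "search E ?q"
      then obtain z where z: "check E (pair z ?q)" unfolding search_def by blast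
      have "bounded_seq (entry_bound E ?q) (decode_seqs E (pair z ?q) i j)" for i j
      proof -
        have "entry E i \<sigma> (pair z ?q) j k < Suc (entry_bound E ?q)" for \<sigma> k
          unfolding entry_def by (simp add: digit_less)
        then have "\<bar>int (entry E i 0 (pair z ?q) j k) - int (entry E i 1 (pair z ?q) j k)\<bar> \<le> int (entry_bound E ?q)" for k
          by (smt (verit) less_Suc_eq_le of_nat_0_le_iff of_nat_le_iff)
        then show ?thesis unfolding bounded_seq_def decode_seqs_def by auto
      qed
      then show "holds_in R q" unfolding iff using z unfolding check_iff_good by blast
    next
      assume "holds_in R q"
      then obtain c where c: "\<And>i j. i < n \<Longrightarrow> j \<le> num_vars ?q \<Longrightarrow> bounded_seq (entry_bound E ?q) (c i j)"
        "good (num_vars ?q) (form_bound ?q) q c" unfolding iff by blast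
      obtain z where z: "z < code_bound E ?q" "\<forall>i<n. \<forall>j\<le>num_vars ?q. decode_seqs E (pair z ?q) i j = c i j"
        using decode_seqs_exist[of ?q E c, OF c(1)] by blast
      have "good (num_vars ?q) (form_bound ?q) q (decode_seqs E (pair z ?q))"
        using c(2) good_cong[of "num_vars ?q" "decode_seqs E (pair z ?q)" c] z(2) by blast
      then show "search E ?q" unfolding search_def using z(1) check_iff_good by blast
    qed
  qed
  then have "computes r [fm_code q] (if holds_in R q then 1 else 0)" if "existential_sentence q" for q
    using r[of "fm_code q"] that by (simp add: of_bool_def)
  then show ?thesis unfolding existential_theory_decidable_def by blast
qed

end

section \<open>Primes in the integral closure\<close>

text \<open>Gaussian elimination over a subfield given as a set, by induction on the equations: an
  unknown \<open>k0\<close> occurring in the equation \<open>b\<close> is eliminated from the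
  remaining ones.\<close>

lemma nontrivial_solution:
  fixes F :: "'a::field set" and c :: "'k \<Rightarrow> 'b \<Rightarrow> 'a"
  assumes F: "0 \<in> F" "1 \<in> F" "\<And>a b. a \<in> F \<Longrightarrow> b \<in> F \<Longrightarrow> a - b \<in> F" "\<And>a b. a \<in> F \<Longrightarrow> b \<in> F \<Longrightarrow> a * b \<in> F"
      "\<And>a b. a \<in> F \<Longrightarrow> b \<in> F \<Longrightarrow> a / b \<in> F"
    and "finite B" "finite K" "card B < card K" "\<And>k b. k \<in> K \<Longrightarrow> b \<in> B \<Longrightarrow> c k b \<in> F"
  shows "\<exists>a. (\<forall>k\<in>K. a k \<in> F) \<and> (\<exists>k\<in>K. a k \<noteq> 0) \<and> (\<forall>b\<in>B. (\<Sum>k\<in>K. a k * c k b) = 0)"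
  using assms(6-)
proof (induction B arbitrary: K c)
  case empty
  then have "K \<noteq> {}" by auto
  then show ?case using F(2) by (intro exI[of _ "\<lambda>_. 1"]) auto
next
  case (insert b B)
  show ?case
  proof (cases "\<forall>k\<in>K. c k b = 0")
    case True
    obtain a where "\<forall>k\<in>K. a k \<in> F" "\<exists>k\<in>K. a k \<noteq> 0" "\<forall>b\<in>B. (\<Sum>k\<in>K. a k * c k b) = 0"
      using insert.IH[of K c] insert.prems insert.hyps by auto
    then show ?thesis using True by (intro exI[of _ a]) auto
  next
    case False
    then obtain k0 where k0: "k0 \<in> K" "c k0 b \<noteq> 0" by blast
    let ?K = "K - {k0}"
    let ?q = "\<lambda>k. c k b / c k0 b"
    let ?c = "\<lambda>k b'. c k b' - ?q k * c k0 b'"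
    have q: "?q k \<in> F" if "k \<in> K" for k using F(5) insert.prems(3) that k0 by simp
    have "?c k b' \<in> F" if "k \<in> ?K" "b' \<in> B" for k b'
      using that k0(1) insert.prems(3) by (intro F(3,4) q) auto
    moreover have "card B < card ?K" using insert.prems(1,2) insert.hyps k0(1) by (simp add: card_Diff_singleton)
    ultimately obtain a where a: "\<forall>k\<in>?K. a k \<in> F" "\<exists>k\<in>?K. a k \<noteq> 0" "\<forall>b'\<in>B. (\<Sum>k\<in>?K. a k * ?c k b') = 0"
      using insert.IH[of ?K ?c] insert.prems(1) by blast
    have "finite ?K" using insert.prems by simp
    have sumF: "(\<Sum>k\<in>M. g k) \<in> F" if "finite M" "\<And>k. k \<in> M \<Longrightarrow> g k \<in> F" for M and g :: "'k \<Rightarrow> 'a"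
    proof -
      have neg: "- y \<in> F" if "y \<in> F" for y using F(3)[OF F(1) that] by simp
      have add: "x + y \<in> F" if "x \<in> F" "y \<in> F" for x y using F(3)[OF that(1) neg[OF that(2)]] by simp
      show ?thesis using that by (induction M) (auto intro: F(1) add)
    qed
    define a' where "a' = a(k0 := - (\<Sum>k\<in>?K. a k * ?q k))"
    have sum: "(\<Sum>k\<in>K. a' k * c k b') = (\<Sum>k\<in>?K. a k * ?c k b')" for b'
    proof -
      have "(\<Sum>k\<in>K. a' k * c k b') = a' k0 * c k0 b' + (\<Sum>k\<in>?K. a' k * c k b')"
        using insert.prems k0 by (intro sum.remove) auto
      also have "(\<Sum>k\<in>?K. a' k * c k b') = (\<Sum>k\<in>?K. a k * c k b')"
        by (rule sum.cong) (auto simp: a'_def)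
      also have "a' k0 * c k0 b' = (\<Sum>k\<in>?K. - (a k * ?q k * c k0 b'))"
        unfolding a'_def by (simp add: sum_distrib_right sum_negf)
      also have "\<dots> + (\<Sum>k\<in>?K. a k * c k b') = (\<Sum>k\<in>?K. a k * ?c k b')"
        unfolding sum.distrib[symmetric] by (rule sum.cong) (auto simp: algebra_simps)
      finally show ?thesis .
    qed
    have "(\<Sum>k\<in>K. a' k * c k b) = 0" unfolding sum using k0 by (intro sum.neutral) auto
    moreover have "\<forall>b'\<in>B. (\<Sum>k\<in>K. a' k * c k b') = 0" unfolding sum using a(3) .
    moreover have "(\<Sum>k\<in>?K. a k * ?q k) \<in> F" using a(1) \<open>finite ?K\<close>
      by (intro sumF F(4) q) auto
    then have "\<forall>k\<in>K. a' k \<in> F" using a(1) F(1) F(3)[of 0] unfolding a'_def by auto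
    moreover have "\<exists>k\<in>K. a' k \<noteq> 0" using a(2) unfolding a'_def by auto
    ultimately show ?thesis by (intro exI[of _ a']) auto
  qed
qed

lemma degree_unique: "coeff g k \<noteq> 0 \<Longrightarrow> (\<And>i. k < i \<Longrightarrow> coeff g i = 0) \<Longrightarrow> degree g = k"
  by (intro antisym degree_le le_degree) auto

text \<open>Common frame for the integers and the polynomials in \<open>t\<close>: Euclidean
  division, with finitely many elements below each size. Hence quotients by nonzero elements are
  finite, and repetitions among powers in finite quotients drive most arguments below.\<close>

locale base_ring =
  fixes A :: "'a::field set" and size :: "'a \<Rightarrow> nat"
  assumes one_A: "1 \<in> A"
    and diff_A: "a \<in> A \<Longrightarrow> b \<in> A \<Longrightarrow> a - b \<in> A"
    and mult_A: "a \<in> A \<Longrightarrow> b \<in> A \<Longrightarrow> a * b \<in> A"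
    and euclid: "a \<in> A \<Longrightarrow> b \<in> A \<Longrightarrow> b \<noteq> 0 \<Longrightarrow> \<exists>q\<in>A. a - q * b = 0 \<or> size (a - q * b) < size b"
    and finite_size: "finite {a \<in> A. size a < m}"
    and finite_over_A: "finite_over (fractions A)"
begin

lemma zero_A: "0 \<in> A" using diff_A[OF one_A one_A] by simp
lemma uminus_A: "a \<in> A \<Longrightarrow> - a \<in> A" using diff_A[OF zero_A, of a] by simp
lemma add_A: "a \<in> A \<Longrightarrow> b \<in> A \<Longrightarrow> a + b \<in> A" using diff_A[OF _ uminus_A, of a b] by simp
lemma sum_A: "finite M \<Longrightarrow> (\<And>k. k \<in> M \<Longrightarrow> g k \<in> A) \<Longrightarrow> sum g M \<in> A"
  by (induction M rule: finite_induct) (auto intro: zero_A add_A)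
lemma power_A: "a \<in> A \<Longrightarrow> a ^ k \<in> A"
  by (induction k) (auto intro: one_A mult_A)
lemma of_nat_A: "of_nat k \<in> A"
  by (induction k) (auto intro: zero_A one_A add_A)
lemma of_int_A: "of_int k \<in> A"
  by (cases k) (auto intro: of_nat_A uminus_A diff_A one_A)

lemma finite_reps_A:
  assumes "b \<in> A" "b \<noteq> 0"
  shows "\<exists>X. finite X \<and> X \<subseteq> A \<and> (\<forall>a\<in>A. \<exists>q\<in>A. a - q * b \<in> X)"
proof (intro exI[of _ "insert 0 {a \<in> A. size a < size b}"] conjI ballI)
  fix a assume a: "a \<in> A"
  obtain q where "q \<in> A" "a - q * b = 0 \<or> size (a - q * b) < size b" using euclid[OF a assms] by blast
  then show "\<exists>q\<in>A. a - q * b \<in> insert 0 {a \<in> A. size a < size b}"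
    using a assms mult_A diff_A by auto
qed (use finite_size zero_A in auto)

lemma fractions_closed:
  assumes "x \<in> fractions A" "y \<in> fractions A"
  shows "x - y \<in> fractions A" "x * y \<in> fractions A" "x / y \<in> fractions A"
proof -
  obtain a b c d where x: "x = a / b" "a \<in> A" "b \<in> A" "b \<noteq> 0" and y: "y = c / d" "c \<in> A" "d \<in> A" "d \<noteq> 0"
    using assms unfolding fractions_def by blast
  have "x - y = (a * d - c * b) / (b * d)" using x y by (simp add: field_simps)
  moreover have "a * d - c * b \<in> A" "b * d \<in> A" "b * d \<noteq> 0" using x y mult_A diff_A by auto
  ultimately show "x - y \<in> fractions A" unfolding fractions_def by blast
  have "x * y = (a * c) / (b * d)" using x y by simp
  moreover have "a * c \<in> A" using x y mult_A by auto
  ultimately show "x * y \<in> fractions A" unfolding fractions_def using \<open>b * d \<in> A\<close> \<open>b * d \<noteq> 0\<close> by blast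
  show "x / y \<in> fractions A"
  proof (cases "c = 0")
    case True
    then have "x / y = 0 / 1" using y by simp
    then show ?thesis unfolding fractions_def using zero_A one_A by force
  next
    case False
    have "x / y = (a * d) / (b * c)" by (simp add: x(1) y(1))
    moreover have "a * d \<in> A" "b * c \<in> A" "b * c \<noteq> 0" using x y False mult_A by auto
    ultimately show ?thesis unfolding fractions_def by blast
  qed
qed

lemma A_subset_fractions: "a \<in> A \<Longrightarrow> a \<in> fractions A"
  unfolding fractions_def using one_A by force

lemma common_denominator:
  assumes "finite K" "\<And>k. k \<in> K \<Longrightarrow> a k \<in> fractions A"
  shows "\<exists>D\<in>A. D \<noteq> 0 \<and> (\<forall>k\<in>K. D * a k \<in> A)"
  using assms
proof (induction K)
  case empty
  then show ?case using one_A by (intro bexI[of _ 1]) auto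
next
  case (insert k K)
  have "\<exists>D\<in>A. D \<noteq> 0 \<and> (\<forall>k\<in>K. D * a k \<in> A)" by (rule insert.IH) (use insert.prems in blast)
  then obtain D where D: "D \<in> A" "D \<noteq> 0" "\<forall>k\<in>K. D * a k \<in> A" by blast
  obtain x y where xy: "a k = x / y" "x \<in> A" "y \<in> A" "y \<noteq> 0" using insert.prems unfolding fractions_def by blast
  have "y * D * a j \<in> A" if "j \<in> insert k K" for j
  proof (cases "j = k")
    case True
    then have "y * D * a j = D * x" using xy by simp
    then show ?thesis using mult_A[OF D(1) xy(2)] by metis
  next
    case False
    then show ?thesis using D(3) that mult_A[OF xy(3), of "D * a j"] by (simp add: mult.assoc)
  qed
  then show ?case using D xy mult_A by (intro bexI[of _ "y * D"]) auto
qed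

text \<open>\<open>d\<close> is the size of a spanning set over the fraction field. Families rather
  than sets of elements are treated, so that the powers of an element qualify even if they
  repeat.\<close>

lemma dependent:
  obtains d where "\<And>K (x :: 'k \<Rightarrow> 'a). finite K \<Longrightarrow> d < card K \<Longrightarrow>
    \<exists>a. (\<forall>k\<in>K. a k \<in> A) \<and> (\<exists>k\<in>K. a k \<noteq> 0) \<and> (\<Sum>k\<in>K. a k * x k) = 0"
proof -
  obtain B where B: "finite B" "\<And>x. \<exists>c. (\<forall>b\<in>B. c b \<in> fractions A) \<and> x = (\<Sum>b\<in>B. c b * b)"
    using finite_over_A unfolding finite_over_def by blast
  show ?thesis
  proof (rule that[of "card B"])
    fix K :: "'k set" and x :: "'k \<Rightarrow> 'a"
    assume K: "finite K" "card B < card K"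
    have "\<forall>k. \<exists>c. (\<forall>b\<in>B. c b \<in> fractions A) \<and> x k = (\<Sum>b\<in>B. c b * b)" by (intro allI B(2))
    from choice[OF this] obtain c
      where c: "\<forall>k. (\<forall>b\<in>B. c k b \<in> fractions A) \<and> x k = (\<Sum>b\<in>B. c k b * b)" ..
    have "\<exists>a. (\<forall>k\<in>K. a k \<in> fractions A) \<and> (\<exists>k\<in>K. a k \<noteq> 0) \<and> (\<forall>b\<in>B. (\<Sum>k\<in>K. a k * c k b) = 0)"
    proof (rule nontrivial_solution)
      show "c k b \<in> fractions A" if "k \<in> K" "b \<in> B" for k b using c that by blast
    qed (use K B(1) in \<open>simp_all add: fractions_closed A_subset_fractions zero_A one_A\<close>)
    then obtain a where a: "\<forall>k\<in>K. a k \<in> fractions A" "\<exists>k\<in>K. a k \<noteq> 0" "\<forall>b\<in>B. (\<Sum>k\<in>K. a k * c k b) = 0"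
      by blast
    obtain D where D: "D \<in> A" "D \<noteq> 0" "\<forall>k\<in>K. D * a k \<in> A" using common_denominator[OF K(1)] a(1) by blast
    have "(\<Sum>k\<in>K. a k * x k) = (\<Sum>k\<in>K. \<Sum>b\<in>B. a k * c k b * b)"
      using c by (simp add: sum_distrib_left mult.assoc)
    also have "\<dots> = (\<Sum>b\<in>B. (\<Sum>k\<in>K. a k * c k b) * b)" by (subst sum.swap) (simp add: sum_distrib_right)
    also have "\<dots> = 0" using a(3) by simp
    finally have "(\<Sum>k\<in>K. D * a k * x k) = 0" by (simp add: mult.assoc sum_distrib_left[symmetric])
    then show "\<exists>a. (\<forall>k\<in>K. a k \<in> A) \<and> (\<exists>k\<in>K. a k \<noteq> 0) \<and> (\<Sum>k\<in>K. a k * x k) = 0"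
      using D a(2) by (intro exI[of _ "\<lambda>k. D * a k"]) auto
  qed
qed

abbreviation OK :: "'a set" where "OK \<equiv> integral_closure A"

lemma polys_over_iff: "g \<in> polys_over A \<longleftrightarrow> (\<forall>i. coeff g i \<in> A)"
  by (simp add: polys_over_def)

lemma polys_over_add: "g \<in> polys_over A \<Longrightarrow> h \<in> polys_over A \<Longrightarrow> g + h \<in> polys_over A"
  by (simp add: polys_over_iff add_A)

lemma polys_over_mult: "g \<in> polys_over A \<Longrightarrow> h \<in> polys_over A \<Longrightarrow> g * h \<in> polys_over A"
  by (auto simp: polys_over_iff coeff_mult intro!: sum_A mult_A)

lemma polys_over_pCons: "a \<in> A \<Longrightarrow> g \<in> polys_over A \<Longrightarrow> pCons a g \<in> polys_over A"
  by (auto simp: polys_over_iff coeff_pCons split: nat.split)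

lemma polys_over_0: "0 \<in> polys_over A"
  by (simp add: polys_over_iff zero_A)

lemma polys_over_pcompose:
  assumes "g \<in> polys_over A" "h \<in> polys_over A"
  shows "pcompose g h \<in> polys_over A"
  using assms(1)
proof (induction g)
  case 0
  then show ?case by (simp add: polys_over_0)
next
  case (pCons a g)
  have "a \<in> A" using pCons.prems unfolding polys_over_iff by (metis coeff_pCons_0)
  moreover have "g \<in> polys_over A" using pCons.prems unfolding polys_over_iff by (metis coeff_pCons_Suc)
  ultimately show ?case
    using pCons.IH assms(2) by (simp add: pcompose_pCons polys_over_add polys_over_mult polys_over_pCons polys_over_0)
qed

lemma A_subset_OK: "a \<in> A \<Longrightarrow> a \<in> OK"
  unfolding integral_closure_def
  by (auto intro!: bexI[of _ "[:-a, 1:]"] polys_over_pCons uminus_A one_A polys_over_0)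

text \<open>If \<open>l\<close> is the leading coefficient of a relation of degree
  \<open>Suc m\<close> for \<open>x\<close>, multiplying the relation by \<open>l ^ m\<close>
  produces a monic one for \<open>l * x\<close>.\<close>

lemma exists_integral_multiple:
  "\<exists>a\<in>A. a \<noteq> 0 \<and> a * x \<in> OK"
proof -
  obtain d where d: "\<And>K (x :: nat \<Rightarrow> 'a). finite K \<Longrightarrow> d < card K \<Longrightarrow>
    \<exists>a. (\<forall>k\<in>K. a k \<in> A) \<and> (\<exists>k\<in>K. a k \<noteq> 0) \<and> (\<Sum>k\<in>K. a k * x k) = 0"
    using dependent by blast
  obtain a where a: "\<forall>k<Suc d. a k \<in> A" "\<exists>k<Suc d. a k \<noteq> 0" "(\<Sum>k<Suc d. a k * x ^ k) = 0"
    using d[of "{..<Suc d}" "\<lambda>k. x ^ k"] by auto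
  define g where "g = (\<Sum>k<Suc d. monom (a k) k)"
  have co: "coeff g i = (if i < Suc d then a i else 0)" for i
    unfolding g_def coeff_sum by (auto simp: coeff_monom)
  have gA: "g \<in> polys_over A" unfolding polys_over_iff co using a(1) zero_A by auto
  have g0: "g \<noteq> 0" using a(2) co by (metis coeff_0)
  have gx: "poly g x = 0" unfolding g_def poly_sum using a(3) by (simp add: poly_monom)
  define l where "l = lead_coeff g"
  have l: "l \<in> A" "l \<noteq> 0" using gA g0 unfolding l_def polys_over_iff by auto
  show ?thesis
  proof (cases "degree g = 0")
    case True
    then obtain c where "g = [:c:]" by (meson degree_eq_zeroE)
    then show ?thesis using gx g0 by simp
  next
    case False
    define m where "m = degree g - 1"
    have m: "degree g = Suc m" unfolding m_def using False by simp
    define h where "h = monom 1 (Suc m) + (\<Sum>i\<le>m. monom (coeff g i * l ^ (m - i)) i)"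
    have coh: "coeff h i = (if i = Suc m then 1 else if i \<le> m then coeff g i * l ^ (m - i) else 0)" for i
      unfolding h_def coeff_add coeff_sum by (auto simp: coeff_monom)
    have "h \<in> polys_over A"
      unfolding polys_over_iff coh using gA l one_A zero_A by (auto simp: polys_over_iff intro!: mult_A power_A)
    moreover have "degree h = Suc m" by (rule degree_unique) (auto simp: coh)
    then have "lead_coeff h = 1" by (simp add: coh)
    moreover have "poly h (l * x) = 0"
    proof -
      have "poly h (l * x) = (l * x) ^ Suc m + (\<Sum>i\<le>m. coeff g i * l ^ (m - i) * (l * x) ^ i)"
        unfolding h_def by (simp add: poly_sum poly_monom)
      also have "(\<Sum>i\<le>m. coeff g i * l ^ (m - i) * (l * x) ^ i) = (\<Sum>i\<le>m. l ^ m * (coeff g i * x ^ i))"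
      proof (rule sum.cong)
        fix i assume "i \<in> {..m}"
        then have "l ^ m = l ^ (m - i) * l ^ i" by (simp add: power_add[symmetric])
        then show "coeff g i * l ^ (m - i) * (l * x) ^ i = l ^ m * (coeff g i * x ^ i)"
          by (simp add: power_mult_distrib)
      qed simp
      also have "(l * x) ^ Suc m + (\<Sum>i\<le>m. l ^ m * (coeff g i * x ^ i)) = l ^ m * (\<Sum>i\<le>Suc m. coeff g i * x ^ i)"
        unfolding sum_distrib_left[symmetric] by (simp add: l_def m power_mult_distrib algebra_simps)
      also have "(\<Sum>i\<le>Suc m. coeff g i * x ^ i) = 0" using gx by (simp add: poly_altdef m)
      finally show ?thesis by simp
    qed
    ultimately have "l * x \<in> OK" unfolding integral_closure_def by blast
    then show ?thesis using l by blast
  qed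
qed

text \<open>Composing a monic equation for the difference with the monic polynomial
  \<open>monom 1 j - monom 1 i\<close> gives a monic equation for \<open>x\<close>.\<close>

lemma integral_over_powers:
  assumes "x ^ j - x ^ i \<in> OK" "i < j"
  shows "x \<in> OK"
proof -
  obtain g where g: "g \<in> polys_over A" "lead_coeff g = 1" "poly g (x ^ j - x ^ i) = 0"
    using assms(1) unfolding integral_closure_def by blast
  let ?h = "monom 1 j - monom 1 i :: 'a poly"
  have co: "coeff ?h k = (if k = j then 1 else 0) - (if k = i then 1 else 0)" for k
    by (simp add: coeff_monom)
  have deg: "degree ?h = j" by (rule degree_unique) (use assms(2) in \<open>auto simp: co\<close>)
  have "lead_coeff ?h = 1" unfolding deg co using assms(2) by simp
  then have "lead_coeff (pcompose g ?h) = 1" using g(2) assms(2) deg by (simp add: lead_coeff_comp)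
  moreover have "?h \<in> polys_over A" unfolding polys_over_iff co using zero_A one_A diff_A by auto
  then have "pcompose g ?h \<in> polys_over A" using g(1) by (rule polys_over_pcompose[rotated])
  moreover have "poly (pcompose g ?h) x = 0" using g(3) by (simp add: poly_pcompose poly_monom)
  ultimately show ?thesis unfolding integral_closure_def by blast
qed

end

lemma pigeonhole_powers:
  fixes h :: "nat \<Rightarrow> 'b"
  assumes "finite X" "\<And>k. h k \<in> X"
  shows "\<exists>i j. i < j \<and> h i = h j"
proof -
  have "\<not> inj h" using finite_imageD[of h UNIV] assms by (metis finite_subset image_subsetI infinite_UNIV_nat)
  then obtain i j where "i \<noteq> j" "h i = h j" unfolding inj_def by blast
  then show ?thesis by (metis nat_neq_iff)
qed

section \<open>A nonzero prime, finiteness modulo \<open>pi\<close>, and a local generator\<close>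

locale prime_of_base = base_ring +
  fixes P :: "'a set"
  assumes primeideal_P: "primeideal P (ring_of_integers A)" and P_ne_0: "P \<noteq> {0}"
begin

abbreviation OR :: "'a ring" where "OR \<equiv> ring_of_integers A"

lemma OR_simps [simp]:
  "carrier OR = OK" "x \<otimes>\<^bsub>OR\<^esub> y = x * y" "\<one>\<^bsub>OR\<^esub> = 1" "\<zero>\<^bsub>OR\<^esub> = 0" "x \<oplus>\<^bsub>OR\<^esub> y = x + y"
  by (simp_all add: ring_of_integers_def)

sublocale P: primeideal P OR by (rule primeideal_P)

lemma add_OK: "x \<in> OK \<Longrightarrow> y \<in> OK \<Longrightarrow> x + y \<in> OK"
  using P.a_closed[of x y] by simp
lemma mult_OK: "x \<in> OK \<Longrightarrow> y \<in> OK \<Longrightarrow> x * y \<in> OK"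
  using P.m_closed[of x y] by simp
lemma one_OK: "1 \<in> OK" using P.one_closed by simp
lemma zero_OK: "0 \<in> OK" using P.zero_closed by simp
lemma uminus_OK: "x \<in> OK \<Longrightarrow> - x \<in> OK"
  using mult_OK[OF A_subset_OK[OF uminus_A[OF one_A]], of x] by simp
lemma diff_OK: "x \<in> OK \<Longrightarrow> y \<in> OK \<Longrightarrow> x - y \<in> OK"
  using add_OK[OF _ uminus_OK, of x y] by simp
lemma power_OK: "x \<in> OK \<Longrightarrow> x ^ k \<in> OK"
  by (induction k) (auto intro: one_OK mult_OK)
lemma sum_OK: "finite M \<Longrightarrow> (\<And>k. k \<in> M \<Longrightarrow> g k \<in> OK) \<Longrightarrow> sum g M \<in> OK"
  by (induction M rule: finite_induct) (auto intro: zero_OK add_OK)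

lemma P_subset: "x \<in> P \<Longrightarrow> x \<in> OK" using P.Icarr by simp
lemma zero_P: "0 \<in> P" using additive_subgroup.zero_closed[OF P.is_additive_subgroup] by simp
lemma add_P: "x \<in> P \<Longrightarrow> y \<in> P \<Longrightarrow> x + y \<in> P"
  using additive_subgroup.a_closed[OF P.is_additive_subgroup, of x y] by simp
lemma mult_P: "x \<in> P \<Longrightarrow> y \<in> OK \<Longrightarrow> x * y \<in> P"
  using P.I_r_closed[of x y] by simp
lemma mult_P_left: "x \<in> OK \<Longrightarrow> y \<in> P \<Longrightarrow> x * y \<in> P"
  using P.I_l_closed[of y x] by simp
lemma uminus_P: "x \<in> P \<Longrightarrow> - x \<in> P"
  using mult_P[OF _ uminus_OK[OF one_OK], of x] by simp
lemma diff_P: "x \<in> P \<Longrightarrow> y \<in> P \<Longrightarrow> x - y \<in> P"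
  using add_P[OF _ uminus_P, of x y] by simp
lemma prime_P: "x \<in> OK \<Longrightarrow> y \<in> OK \<Longrightarrow> x * y \<in> P \<Longrightarrow> x \<in> P \<or> y \<in> P"
  using P.I_prime[of x y] by simp
lemma one_notin_P: "1 \<notin> P"
proof
  assume "1 \<in> P"
  then have "P = OK" using mult_P[of 1] P_subset by auto
  then show False using P.I_notcarr by simp
qed
lemma notin_P_mult: "x \<in> OK - P \<Longrightarrow> y \<in> OK - P \<Longrightarrow> x * y \<in> OK - P"
  using prime_P mult_OK by blast
lemma notin_P_power: "x \<in> OK - P \<Longrightarrow> x ^ k \<in> OK - P"
  by (induction k) (use one_OK one_notin_P notin_P_mult in auto)

lemma power_mem_P: "x \<in> OK \<Longrightarrow> x ^ k \<in> P \<Longrightarrow> x \<in> P"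
  using notin_P_power by blast

lemma poly_in_OK: "g \<in> polys_over A \<Longrightarrow> y \<in> OK \<Longrightarrow> poly g y \<in> OK"
  unfolding poly_altdef polys_over_iff by (intro sum_OK) (auto intro: mult_OK power_OK A_subset_OK)

text \<open>A polynomial of least degree that kills \<open>y\<close> has nonzero constant
  coefficient, as \<open>y\<close> could be cancelled otherwise, and this coefficient is a multiple
  of \<open>y\<close>.\<close>

lemma multiple_in_A:
  assumes "y \<in> OK" "y \<noteq> 0"
  shows "\<exists>w\<in>OK. y * w \<in> A \<and> y * w \<noteq> 0"
proof -
  obtain g where g: "g \<in> polys_over A" "lead_coeff g = 1" "poly g y = 0"
    using assms(1) unfolding integral_closure_def by blast
  define Q where "Q = (\<lambda>m. \<exists>g. g \<in> polys_over A \<and> g \<noteq> 0 \<and> poly g y = 0 \<and> degree g = m)"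
  have "g \<noteq> 0" using g(2) by auto
  then have ex: "\<exists>m. Q m" using g unfolding Q_def by blast
  define m where "m = (LEAST m. Q m)"
  have "Q m" unfolding m_def using ex by (rule LeastI_ex)
  then obtain h where h: "h \<in> polys_over A" "h \<noteq> 0" "poly h y = 0" "degree h = m" unfolding Q_def by blast
  obtain c k where ck: "h = pCons c k" by (cases h)
  have cA: "c \<in> A" using h(1) unfolding ck polys_over_iff by (metis coeff_pCons_0)
  have kA: "k \<in> polys_over A" using h(1) unfolding ck polys_over_iff by (metis coeff_pCons_Suc)
  have yk: "c + y * poly k y = 0" using h(3) ck by simp
  have "c \<noteq> 0"
  proof
    assume c0: "c = 0"
    then have "poly k y = 0" "k \<noteq> 0" using yk assms(2) h(2) ck by auto
    moreover have "degree k < m" using h(4) ck c0 h(2) by auto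
    ultimately have "Q (degree k)" "degree k < (LEAST m. Q m)" using kA unfolding Q_def m_def by auto
    then show False using not_less_Least by blast
  qed
  moreover have "y * - poly k y = c" using yk by (simp add: add_eq_0_iff)
  ultimately show ?thesis using cA poly_in_OK[OF kA assms(1)] uminus_OK by metis
qed

text \<open>An element of least size generates \<open>P \<inter> A\<close> by Euclidean
  division.\<close>

definition pi :: 'a where
  "pi = (SOME a. a \<in> P \<inter> A \<and> a \<noteq> 0 \<and> (\<forall>b\<in>P \<inter> A. b \<noteq> 0 \<longrightarrow> size a \<le> size b))"

lemma pi: "pi \<in> P" "pi \<in> A" "pi \<noteq> 0" "\<And>b. b \<in> P \<Longrightarrow> b \<in> A \<Longrightarrow> b \<noteq> 0 \<Longrightarrow> size pi \<le> size b"
proof -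
  obtain y where y: "y \<in> P" "y \<noteq> 0" using P_ne_0 zero_P by blast
  obtain w where w: "w \<in> OK" "y * w \<in> A" "y * w \<noteq> 0" using multiple_in_A[OF P_subset[OF y(1)] y(2)] by blast
  let ?Q = "\<lambda>a. a \<in> P \<inter> A \<and> a \<noteq> 0"
  have "?Q (y * w)" using w mult_P y by auto
  then obtain a where a: "?Q a" "\<forall>b. ?Q b \<longrightarrow> size a \<le> size b"
    using ex_has_least_nat[of ?Q "y * w" size] by blast
  then have "\<exists>a. a \<in> P \<inter> A \<and> a \<noteq> 0 \<and> (\<forall>b\<in>P \<inter> A. b \<noteq> 0 \<longrightarrow> size a \<le> size b)"
    by (intro exI[of _ a]) simp
  from someI_ex[OF this, folded pi_def]
  show "pi \<in> P" "pi \<in> A" "pi \<noteq> 0" "\<And>b. b \<in> P \<Longrightarrow> b \<in> A \<Longrightarrow> b \<noteq> 0 \<Longrightarrow> size pi \<le> size b" by auto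
qed

lemma P_Int_A: "a \<in> A \<Longrightarrow> a \<in> P \<longleftrightarrow> (\<exists>q\<in>A. a = q * pi)"
proof
  assume a: "a \<in> A" "a \<in> P"
  obtain q where q: "q \<in> A" "a - q * pi = 0 \<or> size (a - q * pi) < size pi" using euclid[OF a(1) pi(2,3)] by blast
  have "a - q * pi \<in> P" "a - q * pi \<in> A"
    using a q pi by (auto intro!: diff_P mult_P_left diff_A mult_A A_subset_OK)
  then have "a - q * pi = 0" using q(2) pi(4) by (meson not_le)
  then show "\<exists>q\<in>A. a = q * pi" using q(1) by auto
qed (use pi mult_P_left A_subset_OK in blast)

text \<open>Two powers of \<open>pi\<close> agree modulo \<open>a\<close>. If every power of
  \<open>pi\<close> divided \<open>a\<close>, cancelling the smaller of the two would exhibit 1 as a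
  multiple of \<open>pi\<close>.\<close>

lemma pi_power_not_dvd:
  assumes a: "a \<in> A" "a \<noteq> 0"
  shows "\<exists>k. \<forall>b\<in>A. a \<noteq> pi ^ k * b"
proof (rule ccontr)
  assume "\<not> ?thesis"
  then obtain b where b: "\<And>k. b k \<in> A" "\<And>k. a = pi ^ k * b k" by metis
  obtain X where X: "finite X" "X \<subseteq> A" "\<forall>c\<in>A. \<exists>q\<in>A. c - q * a \<in> X" using finite_reps_A[OF a] by blast
  have "\<forall>k. \<exists>q. q \<in> A \<and> pi ^ k - q * a \<in> X" using X(3) power_A[OF pi(2)] by blast
  from choice[OF this] obtain q where q: "\<And>k. q k \<in> A" "\<And>k. pi ^ k - q k * a \<in> X" by blast
  obtain i j where ij: "i < j" "pi ^ i - q i * a = pi ^ j - q j * a"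
    using pigeonhole_powers[of X "\<lambda>k. pi ^ k - q k * a"] X(1) q(2) by blast
  obtain m where m: "j = i + Suc m" using less_imp_Suc_add[OF ij(1)] by auto
  have "pi ^ i * (1 - pi ^ Suc m) = (q i - q j) * a" using ij(2) unfolding m power_add by (simp add: algebra_simps)
  also have "\<dots> = pi ^ i * (pi * b (Suc i) * (q i - q j))" using b(2)[of "Suc i"] by (simp add: algebra_simps)
  finally have "1 - pi ^ Suc m = pi * b (Suc i) * (q i - q j)" using pi(3) by simp
  then have "1 = pi * (pi ^ m + b (Suc i) * (q i - q j))" by (simp add: algebra_simps)
  moreover have "pi ^ m + b (Suc i) * (q i - q j) \<in> A" using b q pi by (intro add_A mult_A power_A diff_A) auto
  ultimately have "1 \<in> P" using mult_P[OF pi(1) A_subset_OK] by metis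
  then show False using one_notin_P by blast
qed

text \<open>Powers of \<open>b\<close> repeat modulo \<open>pi\<close>; primality of
  \<open>P\<close> allows cancelling the smaller one, so some positive power of \<open>b\<close> is
  1 modulo \<open>pi\<close>.\<close>

lemma inverse_mod_pi:
  assumes "b \<in> A" "b \<notin> P"
  shows "\<exists>b'\<in>A. \<exists>c\<in>A. b' * b = 1 + c * pi"
proof -
  obtain X where X: "finite X" "X \<subseteq> A" "\<forall>c\<in>A. \<exists>q\<in>A. c - q * pi \<in> X" using finite_reps_A[OF pi(2,3)] by blast
  have "\<forall>k. \<exists>q. q \<in> A \<and> b ^ k - q * pi \<in> X" using X(3) power_A[OF assms(1)] by blast
  from choice[OF this] obtain q where q: "\<And>k. q k \<in> A" "\<And>k. b ^ k - q k * pi \<in> X" by blast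
  obtain i j where ij: "i < j" "b ^ i - q i * pi = b ^ j - q j * pi"
    using pigeonhole_powers[of X "\<lambda>k. b ^ k - q k * pi"] X(1) q(2) by blast
  obtain m where m: "j = i + Suc m" using less_imp_Suc_add[OF ij(1)] by auto
  have "b ^ i * (b ^ Suc m - 1) = (q j - q i) * pi" using ij(2) unfolding m power_add by (simp add: algebra_simps)
  moreover have "(q j - q i) * pi \<in> P" using q pi by (intro mult_P_left A_subset_OK diff_A) auto
  ultimately have "b ^ i * (b ^ Suc m - 1) \<in> P" by simp
  moreover have "b ^ i \<notin> P" using assms power_mem_P A_subset_OK by blast
  ultimately have "b ^ Suc m - 1 \<in> P"
    using prime_P[of "b ^ i" "b ^ Suc m - 1"] A_subset_OK[OF assms(1)] by (meson diff_OK one_OK power_OK)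
  moreover have "b ^ Suc m - 1 \<in> A" using assms one_A power_A diff_A by blast
  ultimately obtain c where "c \<in> A" "b ^ Suc m - 1 = c * pi" using P_Int_A by blast
  then have "b ^ m * b = 1 + c * pi" by (simp add: algebra_simps)
  then show ?thesis using \<open>c \<in> A\<close> power_A[OF assms(1)] by blast
qed

text \<open>
  A family in \<open>OK\<close> that is independent modulo \<open>pi\<close> is independent over \<open>A\<close>: divide a relation by
  the highest possible power of \<open>pi\<close>. Hence a maximal such family is finite, and it spans \<open>OK\<close> modulo \<open>pi\<close>.
\<close>

definition independent_mod :: "'a set \<Rightarrow> bool" where
  "independent_mod X \<longleftrightarrow> finite X \<and> X \<subseteq> OK \<and>
    (\<forall>a. (\<forall>x\<in>X. a x \<in> A) \<longrightarrow> (\<exists>z\<in>OK. (\<Sum>x\<in>X. a x * x) = pi * z) \<longrightarrow> (\<forall>x\<in>X. a x \<in> P))"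

lemma independent_mod_card:
  assumes d: "\<And>K (x :: 'a \<Rightarrow> 'a). finite K \<Longrightarrow> d < card K \<Longrightarrow>
      \<exists>a. (\<forall>k\<in>K. a k \<in> A) \<and> (\<exists>k\<in>K. a k \<noteq> 0) \<and> (\<Sum>k\<in>K. a k * x k) = 0"
    and X: "independent_mod X"
  shows "card X \<le> d"
proof (rule ccontr)
  assume "\<not> ?thesis"
  then obtain a where a: "\<forall>x\<in>X. a x \<in> A" "\<exists>x\<in>X. a x \<noteq> 0" "(\<Sum>x\<in>X. a x * x) = 0"
    using d[of X "\<lambda>x. x"] X unfolding independent_mod_def by auto
  obtain x0 where x0: "x0 \<in> X" "a x0 \<noteq> 0" using a(2) by blast
  let ?Q = "\<lambda>k. \<exists>x\<in>X. \<forall>b\<in>A. a x \<noteq> pi ^ k * b"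
  have ex: "\<exists>k. ?Q k" using pi_power_not_dvd[of "a x0"] a(1) x0 by blast
  define k where "k = (LEAST k. ?Q k)"
  have k: "?Q k" unfolding k_def using ex by (rule LeastI_ex)
  have k0: "k \<noteq> 0"
  proof
    assume "k = 0"
    then obtain x where "x \<in> X" "\<forall>b\<in>A. a x \<noteq> b" using k by auto
    then show False using a(1) by blast
  qed
  then obtain l where l: "k = Suc l" using not0_implies_Suc by blast
  have "\<not> ?Q l" using not_less_Least[of l ?Q] l unfolding k_def by simp
  then obtain b where b: "\<And>x. x \<in> X \<Longrightarrow> b x \<in> A" "\<And>x. x \<in> X \<Longrightarrow> a x = pi ^ l * b x" by metis
  have "pi ^ l * (\<Sum>x\<in>X. b x * x) = (\<Sum>x\<in>X. a x * x)"
    unfolding sum_distrib_left by (rule sum.cong) (auto simp: b(2) mult.assoc)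
  then have "(\<Sum>x\<in>X. b x * x) = 0" using a(3) pi(3) by simp
  then have "\<exists>z\<in>OK. (\<Sum>x\<in>X. b x * x) = pi * z" using zero_OK by (intro bexI[of _ 0]) auto
  then have bP: "\<forall>x\<in>X. b x \<in> P" using X b(1) unfolding independent_mod_def by blast
  obtain x where x: "x \<in> X" "\<forall>c\<in>A. a x \<noteq> pi ^ k * c" using k by blast
  obtain q where "q \<in> A" "b x = q * pi" using bP b(1) x(1) P_Int_A by blast
  then have "a x = pi ^ k * q" using b(2)[OF x(1)] l by simp
  then show False using x(2) \<open>q \<in> A\<close> by blast
qed

lemma spanning_mod: "\<exists>X. finite X \<and> X \<subseteq> OK \<and> (\<forall>y\<in>OK. \<exists>a z. (\<forall>x\<in>X. a x \<in> A) \<and> z \<in> OK \<and> y = (\<Sum>x\<in>X. a x * x) + pi * z)"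
proof -
  obtain d where d: "\<And>K (x :: 'a \<Rightarrow> 'a). finite K \<Longrightarrow> d < card K \<Longrightarrow>
    \<exists>a. (\<forall>k\<in>K. a k \<in> A) \<and> (\<exists>k\<in>K. a k \<noteq> 0) \<and> (\<Sum>k\<in>K. a k * x k) = 0"
    using dependent by blast
  have "independent_mod {}" unfolding independent_mod_def by simp
  moreover have "\<forall>X. independent_mod X \<longrightarrow> card X < Suc d"
    using independent_mod_card[OF d] by (simp add: less_Suc_eq_le)
  ultimately obtain X where X: "independent_mod X" "\<And>Y. independent_mod Y \<Longrightarrow> card Y \<le> card X"
    using ex_has_greatest_nat[of independent_mod "{}" card "Suc d"] by blast
  have fin: "finite X" "X \<subseteq> OK" using X(1) unfolding independent_mod_def by auto
  have "\<exists>a z. (\<forall>x\<in>X. a x \<in> A) \<and> z \<in> OK \<and> y = (\<Sum>x\<in>X. a x * x) + pi * z" if y: "y \<in> OK" for y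
  proof (cases "y \<in> X")
    case True
    have "(\<Sum>x\<in>X. (if x = y then 1 else 0) * x) = (\<Sum>x\<in>X. if x = y then x else 0)" by (rule sum.cong) auto
    then have "(\<Sum>x\<in>X. (if x = y then 1 else 0) * x) = y" using fin True by simp
    then show ?thesis using one_A zero_A zero_OK by (intro exI[of _ "\<lambda>x. if x = y then 1 else 0"] exI[of _ 0]) auto
  next
    case False
    then have "\<not> independent_mod (insert y X)" using X(2)[of "insert y X"] fin by auto
    then obtain a z x0 where a: "\<forall>x\<in>insert y X. a x \<in> A" "z \<in> OK" "(\<Sum>x\<in>insert y X. a x * x) = pi * z"
      "x0 \<in> insert y X" "a x0 \<notin> P"
      unfolding independent_mod_def using fin y by blast
    have eq: "a y * y + (\<Sum>x\<in>X. a x * x) = pi * z" using a(3) fin False by simp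
    \<comment> \<open>Otherwise the term of \<open>y\<close> is itself divisible by
      \<open>pi\<close> and can be moved to the right, which leaves a relation on \<open>X\<close>
      alone.\<close>
    have "a y \<notin> P"
    proof
      assume ayP: "a y \<in> P"
      then obtain q where q: "q \<in> A" "a y = q * pi" using a(1) P_Int_A by blast
      have "(\<Sum>x\<in>X. a x * x) = pi * (z - q * y)" using eq q by (simp add: algebra_simps)
      moreover have "z - q * y \<in> OK" using a(2) y A_subset_OK[OF q(1)] by (intro diff_OK mult_OK)
      ultimately have "\<forall>x\<in>X. a x \<in> P" using X(1) a(1) unfolding independent_mod_def by blast
      then show False using a(4,5) ayP by blast
    qed
    then obtain b c where b: "b \<in> A" "c \<in> A" "b * a y = 1 + c * pi" using inverse_mod_pi[of "a y"] a(1) by blast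
    have "b * (a y * y) = (1 + c * pi) * y" using b(3) by (metis mult.assoc)
    then have "y = b * (a y * y) - c * pi * y" by (simp add: algebra_simps)
    also have "a y * y = pi * z - (\<Sum>x\<in>X. a x * x)" using eq by (simp add: algebra_simps)
    also have "b * (pi * z - (\<Sum>x\<in>X. a x * x)) - c * pi * y = (\<Sum>x\<in>X. (- (b * a x)) * x) + pi * (b * z - c * y)"
      by (simp add: algebra_simps sum_distrib_left sum_negf)
    finally have "y = (\<Sum>x\<in>X. (- (b * a x)) * x) + pi * (b * z - c * y)" .
    moreover have "\<forall>x\<in>X. - (b * a x) \<in> A" using a(1) b(1) uminus_A mult_A by auto
    moreover have "b * z - c * y \<in> OK"
      using a(2) y A_subset_OK[OF b(1)] A_subset_OK[OF b(2)] by (intro diff_OK mult_OK)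
    ultimately show ?thesis by (intro exI[of _ "\<lambda>x. - (b * a x)"] exI[of _ "b * z - c * y"]) blast
  qed
  then show ?thesis using fin by blast
qed

lemma finite_reps_pi: "\<exists>Y. finite Y \<and> Y \<subseteq> OK \<and> (\<forall>y\<in>OK. \<exists>z\<in>OK. y - pi * z \<in> Y)"
proof -
  obtain X where X: "finite X" "X \<subseteq> OK"
    "\<forall>y\<in>OK. \<exists>a z. (\<forall>x\<in>X. a x \<in> A) \<and> z \<in> OK \<and> y = (\<Sum>x\<in>X. a x * x) + pi * z"
    using spanning_mod by blast
  obtain S where S: "finite S" "S \<subseteq> A" "\<forall>c\<in>A. \<exists>q\<in>A. c - q * pi \<in> S" using finite_reps_A[OF pi(2,3)] by blast
  define Y where "Y = (\<lambda>a. \<Sum>x\<in>X. a x * x) ` (\<Pi>\<^sub>E x\<in>X. S)"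
  have "finite Y" unfolding Y_def using X(1) S(1) by (intro finite_imageI finite_PiE) auto
  moreover have "Y \<subseteq> OK"
  proof
    fix y assume "y \<in> Y"
    then obtain a where a: "a \<in> (\<Pi>\<^sub>E x\<in>X. S)" "y = (\<Sum>x\<in>X. a x * x)" unfolding Y_def by blast
    have "a x * x \<in> OK" if "x \<in> X" for x
      using PiE_mem[OF a(1) that] S(2) X(2) that by (intro mult_OK) (auto intro: A_subset_OK)
    then show "y \<in> OK" unfolding a(2) by (intro sum_OK X(1))
  qed
  moreover have "\<exists>z\<in>OK. y - pi * z \<in> Y" if y: "y \<in> OK" for y
  proof -
    obtain a z where a: "\<forall>x\<in>X. a x \<in> A" "z \<in> OK" "y = (\<Sum>x\<in>X. a x * x) + pi * z" using X(3) y by blast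
    have "\<forall>x\<in>X. \<exists>q. q \<in> A \<and> a x - q * pi \<in> S" using S(3) a(1) by blast
    from bchoice[OF this] obtain q where q: "\<And>x. x \<in> X \<Longrightarrow> q x \<in> A" "\<And>x. x \<in> X \<Longrightarrow> a x - q x * pi \<in> S"
      by blast
    let ?z = "z + (\<Sum>x\<in>X. q x * x)"
    have 1: "y - pi * ?z = (\<Sum>x\<in>X. restrict (\<lambda>x. a x - q x * pi) X x * x)"
      using a(3) by (simp add: algebra_simps sum_subtractf sum_distrib_left)
    have 2: "restrict (\<lambda>x. a x - q x * pi) X \<in> (\<Pi>\<^sub>E x\<in>X. S)" using q(2) by simp
    have "y - pi * ?z \<in> Y" unfolding Y_def by (rule image_eqI[of _ "\<lambda>a. \<Sum>x\<in>X. a x * x", OF 1 2])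
    moreover have "?z \<in> OK" using a(2) q(1) X by (intro add_OK sum_OK mult_OK) (auto intro: A_subset_OK)
    ultimately show ?thesis by blast
  qed
  ultimately show ?thesis by blast
qed

lemma pigeonhole_mod_pi:
  assumes "\<And>k::nat. h k \<in> OK"
  shows "\<exists>i j z. i < j \<and> z \<in> OK \<and> h i - h j = pi * z"
proof -
  obtain Y where Y: "finite Y" "\<forall>y\<in>OK. \<exists>z\<in>OK. y - pi * z \<in> Y" using finite_reps_pi by blast
  have "\<forall>k. \<exists>z. z \<in> OK \<and> h k - pi * z \<in> Y" using Y(2) assms by blast
  from choice[OF this] obtain z where z: "\<And>k. z k \<in> OK" "\<And>k. h k - pi * z k \<in> Y" by blast
  obtain i j where ij: "i < j" "h i - pi * z i = h j - pi * z j"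
    using pigeonhole_powers[of Y "\<lambda>k. h k - pi * z k"] Y(1) z(2) by blast
  then have "h i - h j = pi * (z i - z j)" by (simp add: algebra_simps)
  then show ?thesis using ij(1) diff_OK z(1) by blast
qed

text \<open>Powers of \<open>r\<close> repeat modulo \<open>pi\<close>, and
  \<open>1 - r ^ Suc m\<close> is outside \<open>P\<close>. After localization at \<open>P\<close>,
  the elements of \<open>P\<close> are thus nilpotent modulo \<open>pi\<close>.\<close>

lemma power_absorb:
  assumes "r \<in> P"
  shows "\<exists>k. \<exists>w\<in>OK - P. \<exists>z\<in>OK. r ^ k * w = pi * z"
proof -
  obtain i j z where ij: "i < j" "z \<in> OK" "r ^ i - r ^ j = pi * z"
    using pigeonhole_mod_pi[of "\<lambda>k. r ^ k"] power_OK P_subset[OF assms] by blast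
  obtain m where m: "j = i + Suc m" using less_imp_Suc_add[OF ij(1)] by auto
  have "r ^ i * (1 - r ^ Suc m) = pi * z" using ij(3) unfolding m power_add by (simp add: algebra_simps)
  moreover have "1 - r ^ Suc m \<in> OK - P"
  proof -
    have "r ^ Suc m \<in> P" using assms mult_P power_OK P_subset by simp
    then show ?thesis using add_P[of "1 - r ^ Suc m" "r ^ Suc m"] one_notin_P one_OK diff_OK P_subset by auto
  qed
  ultimately show ?thesis using ij(2) by blast
qed

text \<open>A finite domain is a field, again by repetition of powers. In particular nonzero primes
  are maximal.\<close>

lemma inverse_mod_P:
  assumes "y \<in> OK - P"
  shows "\<exists>y'\<in>OK. 1 - y * y' \<in> P"
proof -
  obtain i j z where ij: "i < j" "z \<in> OK" "y ^ i - y ^ j = pi * z"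
    using pigeonhole_mod_pi[of "\<lambda>k. y ^ k"] power_OK assms by blast
  obtain m where m: "j = i + Suc m" using less_imp_Suc_add[OF ij(1)] by auto
  have "y ^ i * (1 - y * y ^ m) = pi * z" using ij(3) unfolding m power_add by (simp add: algebra_simps)
  moreover have "pi * z \<in> P" using pi ij(2) mult_P by blast
  moreover have "y ^ i \<in> OK - P" using notin_P_power assms by blast
  moreover have "1 - y * y ^ m \<in> OK" using assms by (intro diff_OK mult_OK one_OK power_OK) auto
  ultimately have "1 - y * y ^ m \<in> P" using prime_P[of "y ^ i" "1 - y * y ^ m"] by auto
  then show ?thesis using power_OK assms by blast
qed

text \<open>Locally at \<open>P\<close>, the element \<open>y\<close> is nonzero modulo
  \<open>pi\<close> but killed by \<open>X\<close>. In the induction step it is multiplied by the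
  highest power of \<open>r\<close> that does not kill it locally; by \<open>power_absorb\<close>
  some power does. The factor \<open>w\<close> outside \<open>P\<close> clears the
  denominator.\<close>

lemma annihilator:
  assumes "finite X" "X \<subseteq> P"
  shows "\<exists>y\<in>OK. (\<forall>s\<in>OK. (\<exists>z\<in>OK. s * y = pi * z) \<longrightarrow> s \<in> P) \<and> (\<forall>r\<in>X. \<exists>z\<in>OK. r * y = pi * z)"
  using assms
proof (induction X)
  case empty
  show ?case using one_OK mult_P[OF pi(1)] by (intro bexI[of _ 1]) auto
next
  case (insert r X)
  then obtain y where y: "y \<in> OK" "\<forall>s\<in>OK. (\<exists>z\<in>OK. s * y = pi * z) \<longrightarrow> s \<in> P" "\<forall>r\<in>X. \<exists>z\<in>OK. r * y = pi * z" by auto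
  have r: "r \<in> P" "r \<in> OK" using insert.prems P_subset by auto
  let ?Q = "\<lambda>k. \<exists>w\<in>OK - P. \<exists>z\<in>OK. r ^ k * w * y = pi * z"
  have "\<exists>k. ?Q k"
  proof -
    obtain k w z where "w \<in> OK - P" "z \<in> OK" "r ^ k * w = pi * z" using power_absorb[OF r(1)] by blast
    then have "r ^ k * w * y = pi * (z * y)" "z * y \<in> OK" using y(1) mult_OK by (auto simp: mult.assoc)
    then show ?thesis using \<open>w \<in> OK - P\<close> by blast
  qed
  define k where "k = (LEAST k. ?Q k)"
  have k: "?Q k" unfolding k_def using \<open>\<exists>k. ?Q k\<close> by (rule LeastI_ex)
  then obtain w where w: "w \<in> OK - P" "\<exists>z\<in>OK. r ^ k * w * y = pi * z" by blast
  have "k \<noteq> 0" using w y(2) by auto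
  then obtain l where l: "k = Suc l" using not0_implies_Suc by blast
  have nQ: "\<not> ?Q l" using not_less_Least[of l ?Q] l unfolding k_def by simp
  let ?y = "r ^ l * w * y"
  have yOK: "?y \<in> OK" using r w y by (intro mult_OK power_OK) auto
  have "s \<in> P" if s: "s \<in> OK" "\<exists>z\<in>OK. s * ?y = pi * z" for s
  proof (rule ccontr)
    assume "s \<notin> P"
    then have "s * w \<in> OK - P" using s w notin_P_mult by blast
    moreover have "r ^ l * (s * w) * y = s * ?y" by (simp add: ac_simps)
    ultimately show False using nQ s(2) by metis
  qed
  moreover have "\<exists>z\<in>OK. r' * ?y = pi * z" if r': "r' \<in> insert r X" for r'
  proof (cases "r' = r")
    case True
    have "r * ?y = r ^ k * w * y" unfolding l by (simp add: ac_simps)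
    then show ?thesis using w(2) unfolding True by metis
  next
    case False
    then obtain z where z: "z \<in> OK" "r' * y = pi * z" using r' y(3) by blast
    then have "r' * ?y = pi * (r ^ l * w * z)" by (metis mult.left_commute mult.assoc)
    moreover have "r ^ l * w * z \<in> OK" using r w z by (intro mult_OK power_OK) auto
    ultimately show ?thesis by blast
  qed
  ultimately show ?case using yOK by blast
qed

text \<open>The element \<open>x\<close> generates the inverse of \<open>P\<close> locally at \<open>P\<close>.\<close>

lemma local_inverse: "\<exists>x. x \<notin> OK \<and> (\<forall>r\<in>P. x * r \<in> OK)"
proof -
  obtain Y where Y: "finite Y" "\<forall>y\<in>OK. \<exists>z\<in>OK. y - pi * z \<in> Y" using finite_reps_pi by blast
  \<comment> \<open>Killing the finitely many representatives that lie in \<open>P\<close> is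
    enough: every element of \<open>P\<close> differs from one of them by a multiple of
    \<open>pi\<close>, and the difference stays in \<open>P\<close>.\<close>
  obtain y where y: "y \<in> OK" "\<forall>s\<in>OK. (\<exists>z\<in>OK. s * y = pi * z) \<longrightarrow> s \<in> P" "\<forall>r\<in>Y \<inter> P. \<exists>z\<in>OK. r * y = pi * z"
    using annihilator[of "Y \<inter> P"] Y(1) by blast
  have "y / pi \<notin> OK"
  proof
    assume a: "y / pi \<in> OK"
    have "1 * y = pi * (y / pi)" using pi(3) by simp
    then have "1 \<in> P" using y(2) one_OK a by blast
    then show False using one_notin_P by blast
  qed
  moreover have "y / pi * r \<in> OK" if r: "r \<in> P" for r
  proof -
    obtain z where z: "z \<in> OK" "r - pi * z \<in> Y" using Y(2) r P_subset by blast
    have "r - pi * z \<in> P" using r pi(1) z(1) by (intro diff_P mult_P)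
    then obtain z' where z': "z' \<in> OK" "(r - pi * z) * y = pi * z'" using y(3) z(2) by blast
    then have "r * y = pi * (z' + z * y)" by (simp add: algebra_simps)
    then have "y / pi * r = z' + z * y" using pi(3) by (simp add: field_simps)
    then show ?thesis using z z' y(1) by (simp add: add_OK mult_OK)
  qed
  ultimately show ?thesis by blast
qed

text \<open>If \<open>x\<close> mapped \<open>P\<close> into itself, all \<open>x ^ k * pi\<close>
  would be integral, two of them would agree modulo \<open>pi\<close>, and
  \<open>integral_over_powers\<close> would make \<open>x\<close> integral. So some
  \<open>t = x * u\<close> lies outside \<open>P\<close>, and the identity
  \<open>t * r = u * (x * r)\<close> shows that \<open>u\<close> generates \<open>P\<close>
  locally.\<close>

lemma uniformizer_exists: "\<exists>u\<in>P. \<exists>t\<in>OK - P. \<forall>r\<in>P. \<exists>z\<in>OK. t * r = u * z"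
proof -
  obtain x where x: "x \<notin> OK" "\<forall>r\<in>P. x * r \<in> OK" using local_inverse by blast
  have "\<exists>u\<in>P. x * u \<notin> P"
  proof (rule ccontr)
    assume "\<not> ?thesis"
    then have xP: "x * r \<in> P" if "r \<in> P" for r using that by blast
    have "x ^ k * pi \<in> P" for k by (induction k) (use pi xP in \<open>auto simp: mult.assoc\<close>)
    then have "\<exists>i j z. i < j \<and> z \<in> OK \<and> x ^ i * pi - x ^ j * pi = pi * z"
      by (intro pigeonhole_mod_pi) (use P_subset in blast)
    then obtain i j z where ij: "i < j" "z \<in> OK" "x ^ i * pi - x ^ j * pi = pi * z" by blast
    then have "pi * (x ^ i - x ^ j) = pi * z" by (simp add: algebra_simps)
    then have "x ^ i - x ^ j = z" using pi(3) mult_cancel_left by blast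
    then have "x ^ j - x ^ i = - z" by auto
    then have "x \<in> OK" using integral_over_powers[of x j i] ij(1,2) uminus_OK by simp
    then show False using x(1) by blast
  qed
  then obtain u where u: "u \<in> P" "x * u \<notin> P" by blast
  show ?thesis
  proof (rule bexI[of _ u], rule bexI[of _ "x * u"], rule ballI)
    fix r assume "r \<in> P"
    then show "\<exists>z\<in>OK. x * u * r = u * z" using x(2) by (intro bexI[of _ "x * r"]) (auto simp: ac_simps)
  qed (use u x in auto)
qed

end

section \<open>The valuation at a prime and its agreement with \<open>ord_at\<close>\<close>

context prime_of_base
begin

definition u :: 'a where
  "u = (SOME u. u \<in> P \<and> (\<exists>t\<in>OK - P. \<forall>r\<in>P. \<exists>z\<in>OK. t * r = u * z))"

lemma u_P: "u \<in> P" and u_divides: "\<exists>t\<in>OK - P. \<forall>r\<in>P. \<exists>z\<in>OK. t * r = u * z"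
proof -
  have "\<exists>u. u \<in> P \<and> (\<exists>t\<in>OK - P. \<forall>r\<in>P. \<exists>z\<in>OK. t * r = u * z)" using uniformizer_exists by blast
  from someI_ex[OF this, folded u_def]
  show "u \<in> P" "\<exists>t\<in>OK - P. \<forall>r\<in>P. \<exists>z\<in>OK. t * r = u * z" by auto
qed

lemma u_OK: "u \<in> OK" using u_P P_subset by blast

lemma notin_P_ne_0: "s \<in> OK - P \<Longrightarrow> s \<noteq> 0" using zero_P by auto

lemma one_unit: "1 \<in> OK - P" using one_OK one_notin_P by blast

lemma u_ne_0: "u \<noteq> 0"
proof
  assume "u = 0"
  then obtain t where "t \<in> OK - P" "t * pi = 0" using u_divides pi(1) by auto
  then show False using notin_P_ne_0 pi(3) by auto
qed

text \<open>Membership in the fractional ideal generated by \<open>u powi g\<close> in the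
  localization at \<open>P\<close>, with the denominator \<open>s\<close> made explicit instead of
  forming the localization.\<close>

definition ball_at :: "int \<Rightarrow> 'a \<Rightarrow> bool" where
  "ball_at g x \<longleftrightarrow> (\<exists>s\<in>OK - P. \<exists>z\<in>OK. s * x = u powi g * z)"

definition has_ord :: "'a \<Rightarrow> int \<Rightarrow> bool" where
  "has_ord x n \<longleftrightarrow> (\<exists>s\<in>OK - P. \<exists>w\<in>OK - P. s * x = u powi n * w)"

lemma has_ord_ne_0: "has_ord x n \<Longrightarrow> x \<noteq> 0"
  unfolding has_ord_def using notin_P_ne_0 u_ne_0 by auto

lemma has_ord_mult:
  assumes "has_ord x n" "has_ord y m"
  shows "has_ord (x * y) (n + m)"
proof -
  obtain s w where 1: "s \<in> OK - P" "w \<in> OK - P" "s * x = u powi n * w" using assms(1) unfolding has_ord_def by blast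
  obtain s' w' where 2: "s' \<in> OK - P" "w' \<in> OK - P" "s' * y = u powi m * w'" using assms(2) unfolding has_ord_def by blast
  have "(s * s') * (x * y) = (s * x) * (s' * y)" by (simp add: ac_simps)
  also have "\<dots> = u powi (n + m) * (w * w')" unfolding 1 2 using u_ne_0 by (simp add: power_int_add ac_simps)
  finally show ?thesis unfolding has_ord_def using 1 2 notin_P_mult by blast
qed

lemma has_ord_unit: "w \<in> OK - P \<Longrightarrow> has_ord w 0"
  unfolding has_ord_def by (intro bexI[of _ 1] bexI[of _ w] one_unit) auto

lemma has_ord_u_powi: "has_ord (u powi n) n"
  unfolding has_ord_def using one_unit by force

lemma ball_at_mult:
  assumes "ball_at g x" "ball_at h y"
  shows "ball_at (g + h) (x * y)"
proof -
  obtain s w where 1: "s \<in> OK - P" "w \<in> OK" "s * x = u powi g * w" using assms(1) unfolding ball_at_def by blast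
  obtain s' w' where 2: "s' \<in> OK - P" "w' \<in> OK" "s' * y = u powi h * w'" using assms(2) unfolding ball_at_def by blast
  have "(s * s') * (x * y) = (s * x) * (s' * y)" by (simp add: ac_simps)
  also have "\<dots> = u powi (g + h) * (w * w')" unfolding 1 2 using u_ne_0 by (simp add: power_int_add ac_simps)
  finally show ?thesis unfolding ball_at_def using 1 2 notin_P_mult mult_OK by blast
qed

lemma ball_at_OK: "x \<in> OK \<Longrightarrow> ball_at 0 x"
  unfolding ball_at_def by (intro bexI[of _ 1] bexI[of _ x] one_unit) auto

lemma ball_at_P: "x \<in> P \<Longrightarrow> ball_at 1 x"
proof -
  assume "x \<in> P"
  then obtain t z where "t \<in> OK - P" "z \<in> OK" "t * x = u * z" using u_divides by blast
  then show ?thesis unfolding ball_at_def by (intro bexI[of _ t] bexI[of _ z]) auto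
qed

lemma ball_at_P_iff: "x \<in> OK \<Longrightarrow> ball_at 1 x \<longleftrightarrow> x \<in> P"
proof
  assume x: "x \<in> OK" and "ball_at 1 x"
  then obtain s z where "s \<in> OK - P" "z \<in> OK" "s * x = u * z" unfolding ball_at_def by auto
  then have "s * x \<in> P" using mult_P[OF u_P] by simp
  then show "x \<in> P" using prime_P[of s x] x \<open>s \<in> OK - P\<close> by blast
qed (rule ball_at_P)

lemma ball_at_power_P: "x \<in> P \<Longrightarrow> ball_at (int k) (x ^ k)"
proof (induction k)
  case (Suc k)
  then show ?case using ball_at_mult[OF ball_at_P[of x], of "int k" "x ^ k"] by (simp add: add.commute)
qed (simp add: ball_at_OK one_OK)

lemma ball_at_0: "ball_at g 0"
  unfolding ball_at_def using one_unit zero_OK by (intro bexI[of _ 1] bexI[of _ 0]) auto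

lemma ball_at_diff:
  assumes "ball_at g x" "ball_at g y"
  shows "ball_at g (x - y)"
proof -
  obtain s w where 1: "s \<in> OK - P" "w \<in> OK" "s * x = u powi g * w" using assms(1) unfolding ball_at_def by blast
  obtain s' w' where 2: "s' \<in> OK - P" "w' \<in> OK" "s' * y = u powi g * w'" using assms(2) unfolding ball_at_def by blast
  have "(s * s') * (x - y) = s' * (s * x) - s * (s' * y)" by (simp add: algebra_simps)
  also have "\<dots> = u powi g * (s' * w - s * w')" unfolding 1 2 by (simp add: algebra_simps)
  finally have "(s * s') * (x - y) = u powi g * (s' * w - s * w')" .
  moreover have "s * s' \<in> OK - P" by (rule notin_P_mult[OF 1(1) 2(1)])
  moreover have "s' * w - s * w' \<in> OK" using 1 2 by (intro diff_OK mult_OK) auto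
  ultimately show ?thesis unfolding ball_at_def by blast
qed

lemma ball_at_antimono:
  assumes "ball_at h x" "g \<le> h"
  shows "ball_at g x"
proof -
  obtain s w where 1: "s \<in> OK - P" "w \<in> OK" "s * x = u powi h * w" using assms(1) unfolding ball_at_def by blast
  have "h = g + int (nat (h - g))" using assms(2) by simp
  then have "u powi h = u powi g * u ^ nat (h - g)" using u_ne_0 by (metis power_int_add power_int_of_nat)
  then have "s * x = u powi g * (u ^ nat (h - g) * w)" using 1 by (simp add: ac_simps)
  then show ?thesis unfolding ball_at_def using 1 mult_OK power_OK u_OK by blast
qed

lemma ball_at_1: "ball_at g 1 \<longleftrightarrow> g \<le> 0"
proof
  assume "ball_at g 1"
  show "g \<le> 0"
  proof (rule ccontr)
    assume "\<not> g \<le> 0"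
    then have "ball_at 1 1" using ball_at_antimono[OF \<open>ball_at g 1\<close>, of 1] by simp
    then show False using ball_at_P_iff[OF one_OK] one_notin_P by blast
  qed
qed (use ball_at_antimono ball_at_OK[OF one_OK] in blast)

lemma has_ord_ball_mult:
  assumes "has_ord x h"
  shows "ball_at (g + h) (x * y) \<longleftrightarrow> ball_at g y"
proof
  obtain s w where 1: "s \<in> OK - P" "w \<in> OK - P" "s * x = u powi h * w" using assms unfolding has_ord_def by blast
  {
    assume "ball_at (g + h) (x * y)"
    then obtain s' z where 2: "s' \<in> OK - P" "z \<in> OK" "s' * (x * y) = u powi (g + h) * z" unfolding ball_at_def by blast
    have "u powi h * ((w * s') * y) = s' * y * (s * x)" unfolding 1 by (simp add: ac_simps)
    also have "\<dots> = s * (s' * (x * y))" by (simp add: ac_simps)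
    also have "\<dots> = u powi h * (u powi g * (s * z))" unfolding 2 using u_ne_0 by (simp add: power_int_add ac_simps)
    finally have "(w * s') * y = u powi g * (s * z)" using u_ne_0 by simp
    then show "ball_at g y" unfolding ball_at_def using 1 2 notin_P_mult mult_OK by blast
  }
  assume "ball_at g y"
  moreover have "ball_at h x" unfolding ball_at_def using 1 by blast
  ultimately show "ball_at (g + h) (x * y)" using ball_at_mult by (metis add.commute mult.commute)
qed

lemma ball_at_iff_ord: "has_ord x h \<Longrightarrow> ball_at g x \<longleftrightarrow> g \<le> h"
  using has_ord_ball_mult[of x h "g - h" 1] by (simp add: ball_at_1)

lemma has_ord_unique: "has_ord x n \<Longrightarrow> has_ord x m \<Longrightarrow> n = m"
  using ball_at_iff_ord[of x n] ball_at_iff_ord[of x m] by (metis order_antisym order_refl)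

text \<open>A multiple of \<open>y\<close> in \<open>A\<close> is a power of \<open>pi\<close> times
  an element outside \<open>P\<close>, and \<open>pi\<close> divides a power of \<open>u\<close>
  locally. So some multiple of \<open>y\<close> is a power of \<open>u\<close> times an element
  outside \<open>P\<close>, and its exponent bounds the order of \<open>y\<close>.\<close>

lemma ball_at_bounded:
  assumes "y \<in> OK" "y \<noteq> 0"
  shows "\<exists>N. \<forall>g. ball_at g y \<longrightarrow> g \<le> int N"
proof -
  obtain w where w: "w \<in> OK" "y * w \<in> A" "y * w \<noteq> 0" using multiple_in_A[OF assms] by blast
  let ?c = "y * w"
  let ?Q = "\<lambda>k. \<forall>b\<in>A. ?c \<noteq> pi ^ k * b"
  define k where "k = (LEAST k. ?Q k)"
  have Qk: "?Q k" unfolding k_def using pi_power_not_dvd[OF w(2,3)] by (rule LeastI_ex)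
  have "k \<noteq> 0"
  proof
    assume "k = 0"
    then have "\<forall>b\<in>A. ?c \<noteq> b" using Qk by simp
    then show False using w(2) by blast
  qed
  then obtain l where l: "k = Suc l" using not0_implies_Suc by blast
  have "\<not> ?Q l" using not_less_Least[of l ?Q] l unfolding k_def by simp
  then obtain c' where c': "c' \<in> A" "?c = pi ^ l * c'" by blast
  have "c' \<notin> P"
  proof
    assume "c' \<in> P"
    then obtain q where "q \<in> A" "c' = q * pi" using P_Int_A c'(1) by blast
    then have "?c = pi ^ k * q" using c'(2) l by simp
    then show False using Qk \<open>q \<in> A\<close> by blast
  qed
  then have c'u: "c' \<in> OK - P" using A_subset_OK c'(1) by blast
  obtain i v z where vz: "v \<in> OK - P" "z \<in> OK" "u ^ i * v = pi * z" using power_absorb[OF u_P] by blast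
  have eq: "(y * w) * z ^ l = u ^ (i * l) * (v ^ l * c')"
  proof -
    have "(y * w) * z ^ l = (pi * z) ^ l * c'" unfolding c'(2) by (simp add: power_mult_distrib ac_simps)
    also have "\<dots> = (u ^ i * v) ^ l * c'" using vz(3) by simp
    finally show ?thesis by (simp add: power_mult_distrib power_mult[symmetric] ac_simps)
  qed
  have unit: "v ^ l * c' \<in> OK - P" using notin_P_mult[OF notin_P_power[OF vz(1)] c'u] .
  have "has_ord (u ^ (i * l) * (v ^ l * c')) (int (i * l) + 0)"
    using has_ord_mult[OF has_ord_u_powi[of "int (i * l)"] has_ord_unit[OF unit]] by (simp only: power_int_of_nat)
  then have ord: "has_ord (y * (w * z ^ l)) (int (i * l))" unfolding eq[symmetric] by (simp add: mult.assoc)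
  have "g \<le> int (i * l)" if "ball_at g y" for g
  proof -
    have "w * z ^ l \<in> OK" using w vz by (intro mult_OK power_OK)
    then have "ball_at (g + 0) (y * (w * z ^ l))" using that by (intro ball_at_mult ball_at_OK)
    then show ?thesis using ball_at_iff_ord[OF ord] by simp
  qed
  then show ?thesis by blast
qed

lemma has_ord_exists_OK:
  assumes "y \<in> OK" "y \<noteq> 0"
  shows "\<exists>n::nat. has_ord y (int n)"
proof -
  obtain N where N: "\<forall>g. ball_at g y \<longrightarrow> g \<le> int N" using ball_at_bounded[OF assms] by blast
  have b0: "ball_at (int 0) y" using ball_at_OK[OF assms(1)] by simp
  define n where "n = (GREATEST n. ball_at (int n) y)"
  have bd: "k \<le> N" if "ball_at (int k) y" for k using N that by auto
  have n: "ball_at (int n) y" unfolding n_def by (rule GreatestI_nat[of _ 0 N]) (use b0 bd in auto)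
  have nn: "\<not> ball_at (int (Suc n)) y"
  proof
    assume "ball_at (int (Suc n)) y"
    then have "Suc n \<le> n" unfolding n_def by (rule Greatest_le_nat[of _ _ N]) (rule bd)
    then show False by simp
  qed
  obtain s z where sz: "s \<in> OK - P" "z \<in> OK" "s * y = u powi int n * z" using n unfolding ball_at_def by blast
  have "z \<notin> P"
  proof
    assume "z \<in> P"
    then have "ball_at (int n + 1) (u powi int n * z)"
      using has_ord_ball_mult[OF has_ord_u_powi, of 1 "int n" z] ball_at_P by (simp add: add.commute)
    then have "ball_at (int n + 1 + 0) (s * y)" using sz(3) by simp
    then have "ball_at (int n + 1) y" using has_ord_ball_mult[OF has_ord_unit[OF sz(1)]] by blast
    then show False using nn by (simp add: add.commute)
  qed
  then show ?thesis using sz unfolding has_ord_def by blast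
qed

lemma has_ord_divide:
  assumes "has_ord x n" "has_ord y m"
  shows "has_ord (x / y) (n - m)"
proof -
  obtain s w where 1: "s \<in> OK - P" "w \<in> OK - P" "s * x = u powi n * w" using assms(1) unfolding has_ord_def by blast
  obtain s' w' where 2: "s' \<in> OK - P" "w' \<in> OK - P" "s' * y = u powi m * w'" using assms(2) unfolding has_ord_def by blast
  have y0: "y \<noteq> 0" using has_ord_ne_0[OF assms(2)] .
  have "u powi m * ((s * w') * (x / y)) = (s * x) * (u powi m * w') / y" by simp
  also have "\<dots> = (s * x) * s'" using y0 by (simp flip: 2(3))
  also have "\<dots> = u powi m * (u powi (n - m) * (w * s'))" unfolding 1
    using u_ne_0 by (simp add: power_int_diff)
  finally have "(s * w') * (x / y) = u powi (n - m) * (w * s')"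
    using u_ne_0 mult_left_cancel[of "u powi m"] by (metis power_int_eq_0_iff)
  then show ?thesis unfolding has_ord_def using 1 2 notin_P_mult by blast
qed

lemma fraction_OK: "\<exists>a\<in>OK. \<exists>b\<in>OK. b \<noteq> 0 \<and> x = a / b"
proof -
  obtain b where "b \<in> A" "b \<noteq> 0" "b * x \<in> OK" using exists_integral_multiple by blast
  then show ?thesis using A_subset_OK by (intro bexI[of _ "b * x"] bexI[of _ b]) auto
qed

lemma has_ord_exists:
  assumes "x \<noteq> 0"
  shows "\<exists>n. has_ord x n"
proof -
  obtain a b where ab: "a \<in> OK" "b \<in> OK" "b \<noteq> 0" "x = a / b" using fraction_OK by blast
  then have "a \<noteq> 0" using assms by auto
  then show ?thesis using has_ord_divide has_ord_exists_OK ab by blast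
qed

lemma ball_at_all_iff: "(\<forall>g. ball_at g x) \<longleftrightarrow> x = 0"
proof
  assume a: "\<forall>g. ball_at g x"
  show "x = 0"
  proof (rule ccontr)
    assume "x \<noteq> 0"
    then obtain n where "has_ord x n" using has_ord_exists by blast
    then show False using a ball_at_iff_ord[of x n "n + 1"] by simp
  qed
qed (simp add: ball_at_0)

lemma ball_at_exists: "\<exists>g. ball_at g x"
  using has_ord_exists[of x] ball_at_iff_ord ball_at_0 by (cases "x = 0") blast+

text \<open>A condition at \<open>P\<close> alone describes the global ideal power. If
  \<open>s * y = u ^ Suc n * z\<close> with \<open>s\<close> outside \<open>P\<close>, an inverse
  \<open>s'\<close> of \<open>s\<close> modulo \<open>P\<close> gives
  \<open>(1 - s * s') ^ Suc n = 1 - s * r\<close>, which lies in the power. Then \<open>y\<close> is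
  the sum of its multiples by \<open>1 - s * r\<close> and by \<open>s * r\<close>, and the latter
  is \<open>u ^ Suc n * (z * r)\<close>.\<close>

lemma ideal_power:
  "P [^]\<^bsub>ideals_set OR\<^esub> (n::nat) = {y \<in> OK. ball_at (int n) y} \<and> ideal (P [^]\<^bsub>ideals_set OR\<^esub> n) OR"
proof (induction n)
  case 0
  have "P [^]\<^bsub>ideals_set OR\<^esub> (0::nat) = OK" by (simp add: nat_pow_def ideals_set_def)
  then show ?case using ball_at_OK P.oneideal by auto
next
  case (Suc n)
  let ?I = "P [^]\<^bsub>ideals_set OR\<^esub> n"
  have S: "P [^]\<^bsub>ideals_set OR\<^esub> Suc n = ideal_prod OR ?I P" by (simp add: nat_pow_def ideals_set_def)
  have I: "ideal (ideal_prod OR ?I P) OR"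
    using P.ideal_prod_is_ideal[of ?I P] Suc P.is_ideal by blast
  have sub: "y \<in> OK \<and> ball_at (int (Suc n)) y" if "y \<in> ideal_prod OR ?I P" for y
    using that
  proof (induction y rule: ideal_prod.induct)
    case (prod i j)
    then have "i \<in> OK" "ball_at (int n) i" "j \<in> OK" "ball_at 1 j" using Suc P_subset ball_at_P by auto
    then show ?case using mult_OK ball_at_mult[of "int n" i 1 j] by (simp add: add.commute)
  next
    case (sum x y)
    then have "ball_at (int (Suc n)) (x - (0 - y))" using ball_at_diff ball_at_0 by blast
    then show ?case using sum add_OK by simp
  qed
  have sup: "y \<in> ideal_prod OR ?I P" if y: "y \<in> OK" "ball_at (int (Suc n)) y" for y
  proof -
    let ?J = "ideal_prod OR ?I P"
    have J_mult: "x * z \<in> ?J" if "x \<in> ?J" "z \<in> OK" for x z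
      using ideal.I_r_closed[OF I, of x z] that by simp
    have J_add: "x + z \<in> ?J" if "x \<in> ?J" "z \<in> ?J" for x z
      using additive_subgroup.a_closed[OF ideal.axioms(1)[OF I], of x z] that by simp
    have pow: "x ^ Suc n \<in> ?J" if "x \<in> P" for x
    proof -
      have "x ^ n \<in> ?I" using Suc ball_at_power_P[OF that] power_OK P_subset that by auto
      from ideal_prod.prod[OF this that, of OR] show ?thesis by (simp add: mult.commute)
    qed
    obtain s z where sz: "s \<in> OK - P" "z \<in> OK" "s * y = u powi int (Suc n) * z" using y(2) unfolding ball_at_def by blast
    obtain s' where s': "s' \<in> OK" "1 - s * s' \<in> P" using inverse_mod_P[OF sz(1)] by blast
    have "\<exists>r\<in>OK. (1 - s * s') ^ k = 1 - s * r" for k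
    proof (induction k)
      case 0
      then show ?case using zero_OK by (intro bexI[of _ 0]) auto
    next
      case (Suc k)
      then obtain r where r: "r \<in> OK" "(1 - s * s') ^ k = 1 - s * r" by blast
      have "(1 - s * s') ^ Suc k = 1 - s * (s' + r - s * s' * r)"
        unfolding power_Suc r(2) by (simp add: algebra_simps)
      moreover have "s' + r - s * s' * r \<in> OK" using r(1) s' sz by (intro diff_OK add_OK mult_OK) auto
      ultimately show ?case by blast
    qed
    then obtain r where r: "r \<in> OK" "(1 - s * s') ^ Suc n = 1 - s * r" by blast
    have "(1 - s * s') ^ Suc n * y \<in> ?J" using J_mult[OF pow[OF s'(2)] y(1)] .
    moreover have "u ^ Suc n * (z * r) \<in> ?J" using J_mult[OF pow[OF u_P]] mult_OK sz(2) r(1) by blast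
    moreover have "y = (1 - s * s') ^ Suc n * y + u ^ Suc n * (z * r)"
    proof -
      have "u ^ Suc n * z = s * y" using sz(3) by (simp only: power_int_of_nat)
      then have eq: "u ^ Suc n * (z * r) = s * r * y" by (metis mult.assoc mult.commute)
      show ?thesis unfolding r(2) eq by (simp add: algebra_simps)
    qed
    ultimately show ?thesis using J_add by metis
  qed
  have "ideal_prod OR ?I P = {y \<in> OK. ball_at (int (Suc n)) y}" using sub sup by blast
  then show ?case unfolding S using I by simp
qed

lemma ord_int_eq:
  assumes "y \<in> OK" "has_ord y (int n)"
  shows "ord_int A P y = n"
proof -
  have "y \<in> P [^]\<^bsub>ideals_set OR\<^esub> (k::nat) \<longleftrightarrow> k \<le> n" for k
    using ideal_power[of k] assms ball_at_iff_ord[OF assms(2)] by auto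
  then show ?thesis unfolding ord_int_def by (simp add: Greatest_equality)
qed

text \<open>All representations of \<open>x\<close> as a fraction give the same difference, by
  uniqueness of orders and \<open>has_ord_divide\<close>; this justifies the \<open>THE\<close> in
  \<open>ord_at\<close>.\<close>

lemma ord_at_eq:
  assumes "has_ord x n"
  shows "ord_at A P x = Fin n"
proof -
  let ?Q = "\<lambda>m. \<exists>a b. a \<in> OK \<and> b \<in> OK \<and> a \<noteq> 0 \<and> b \<noteq> 0 \<and> x = a / b \<and>
      m = int (ord_int A P a) - int (ord_int A P b)"
  have uniq: "m = n" if Q: "?Q m" for m
  proof -
    obtain a b where ab: "a \<in> OK" "b \<in> OK" "a \<noteq> 0" "b \<noteq> 0" "x = a / b"
      "m = int (ord_int A P a) - int (ord_int A P b)" using Q by blast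
    obtain i j where ij: "has_ord a (int i)" "has_ord b (int j)" using has_ord_exists_OK ab by metis
    have "has_ord x (int i - int j)" unfolding ab(5) by (rule has_ord_divide[OF ij])
    then have "n = int i - int j" using has_ord_unique[OF assms] by blast
    then show ?thesis using ab(6) ord_int_eq[OF ab(1) ij(1)] ord_int_eq[OF ab(2) ij(2)] by simp
  qed
  have "x \<noteq> 0" using has_ord_ne_0[OF assms] .
  obtain a b where ab: "a \<in> OK" "b \<in> OK" "b \<noteq> 0" "x = a / b" using fraction_OK by blast
  then have "a \<noteq> 0" using \<open>x \<noteq> 0\<close> by auto
  then have "?Q (int (ord_int A P a) - int (ord_int A P b))" using ab by blast
  then have "?Q n" using uniq by blast
  then have "(THE m. ?Q m) = n" using uniq by (rule the_equality)
  then show ?thesis unfolding ord_at_def using \<open>x \<noteq> 0\<close> by simp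
qed

lemma ord_at_nonneg_iff: "0 \<le> ord_at A P x \<longleftrightarrow> ball_at 0 x"
proof (cases "x = 0")
  case True
  then show ?thesis by (simp add: ord_at_def ball_at_0)
next
  case False
  then obtain n where n: "has_ord x n" using has_ord_exists by blast
  then show ?thesis by (simp add: ord_at_eq ball_at_iff_ord zero_extended_def)
qed

end

text \<open>The demands of \<open>places\<close> on a single nontrivial place, bundled so that
  \<open>p\<close>, \<open>e\<close> and \<open>f\<close> can be chosen at finitely many primes at
  once.\<close>

definition discrete_place :: "(int \<Rightarrow> 'a::field \<Rightarrow> bool) \<Rightarrow> nat \<Rightarrow> nat \<Rightarrow> nat \<Rightarrow> bool" where
  "discrete_place B p e f \<longleftrightarrow> prime p \<and> 0 < f \<and>
    valued_module (\<lambda>m x. of_int m * x) B (nz p e) (int_val p e) \<and>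
    (\<forall>m. nz p e m \<longleftrightarrow> (of_int m :: 'a) \<noteq> 0) \<and>
    (\<forall>g X. valued_module.incongruent B g X \<longrightarrow> card X \<le> p ^ f) \<and>
    (\<forall>g. \<exists>X. finite X \<and> valued_module.incongruent B g X \<and> card X = p ^ f)"

section \<open>Ramification index and residue field at a prime\<close>

context prime_of_base
begin

lemma of_nat_OK: "of_nat k \<in> OK" by (rule A_subset_OK[OF of_nat_A])
lemma of_int_OK: "of_int k \<in> OK" by (rule A_subset_OK[OF of_int_A])

text \<open>Primality of \<open>P\<close> forces the least positive integer in it to be
  prime.\<close>

lemma residue_char:
  assumes "0 < m" "of_nat m \<in> P"
  shows "\<exists>p. prime p \<and> of_nat p \<in> P"
proof -
  let ?Q = "\<lambda>m. 0 < m \<and> of_nat m \<in> P"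
  define p where "p = (LEAST m. ?Q m)"
  have p: "0 < p" "of_nat p \<in> P" using LeastI[of ?Q m] assms unfolding p_def by auto
  have least: "p \<le> k" if "0 < k" "of_nat k \<in> P" for k unfolding p_def by (rule Least_le) (use that in blast)
  have "p \<noteq> 1" using p one_notin_P by auto
  moreover have "d = 1 \<or> d = p" if d: "d dvd p" for d
  proof -
    obtain k where k: "p = d * k" using d by (rule dvdE)
    have pos: "0 < d" "0 < k" using k p(1) by auto
    have "(of_nat d :: 'a) * of_nat k \<in> P" using p(2) k by simp
    then have "of_nat d \<in> P \<or> of_nat k \<in> P" using prime_P of_nat_OK by blast
    then have "p \<le> d \<or> p \<le> k" using least pos by blast
    then show ?thesis using k pos p(1) by (cases d; cases k) auto
  qed
  ultimately have "prime p" using p(1) unfolding prime_nat_iff by auto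
  then show ?thesis using p by blast
qed

context
  fixes p :: nat
  assumes p: "prime p" "of_nat p \<in> P"
begin

lemma of_int_notin_P:
  assumes "\<not> int p dvd m"
  shows "of_int m \<in> OK - P"
proof -
  have "coprime (int p) m" using p(1) assms by (simp add: prime_imp_coprime)
  then obtain a b where ab: "a * int p + b * m = 1" using bezout_int[of "int p" m] by auto
  have "of_int m \<notin> P"
  proof
    assume m: "of_int m \<in> P"
    have "(of_int a * of_nat p + of_int b * of_int m :: 'a) = of_int (a * int p + b * m)" by simp
    then have "(of_int a * of_nat p + of_int b * of_int m :: 'a) = 1" unfolding ab by simp
    moreover have "(of_int a * of_nat p + of_int b * of_int m :: 'a) \<in> P"
      using m p(2) by (intro add_P mult_P_left of_int_OK)
    ultimately show False using one_notin_P by simp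
  qed
  then show ?thesis using of_int_OK by blast
qed

lemma int_prime_decomp:
  assumes "m \<noteq> 0"
  obtains m' where "m = int p ^ multiplicity (int p) m * m'" "\<not> int p dvd m'"
  using multiplicity_decompose'[of m "int p"] assms p(1)
  by (metis not_prime_unit prime_nat_int_transfer)

text \<open>\<open>e\<close> is the order of \<open>p\<close>, or 0 if \<open>p\<close> vanishes in
  the field. Integers not divisible by \<open>p\<close> are outside \<open>P\<close> by
  Bezout.\<close>

lemma ord_of_int:
  "\<exists>e. \<forall>m. (nz p e m \<longleftrightarrow> (of_int m :: 'a) \<noteq> 0) \<and> ((of_int m :: 'a) \<noteq> 0 \<longrightarrow> has_ord (of_int m) (int_val p e m))"
proof (cases "(of_nat p :: 'a) = 0")
  case True
  have "(of_int m :: 'a) = 0" if pm: "int p dvd m" for m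
  proof -
    obtain k where "m = int p * k" using pm by (rule dvdE)
    then show ?thesis using True by simp
  qed
  moreover have "has_ord (of_int m) 0" "(of_int m :: 'a) \<noteq> 0" if "\<not> int p dvd m" for m
    using has_ord_unit[OF of_int_notin_P[OF that]] has_ord_ne_0 by auto
  ultimately show ?thesis by (intro exI[of _ 0]) (auto simp: nz_def int_val_def)
next
  case False
  obtain e where e: "has_ord (of_nat p) (int e)" using has_ord_exists_OK[OF of_nat_OK False] by blast
  have "1 \<le> int e" using ball_at_iff_ord[OF e] ball_at_P[OF p(2)] by blast
  then have e0: "e \<noteq> 0" by auto
  have pow: "has_ord (of_nat p ^ k) (int (e * k))" for k
  proof (induction k)
    case 0
    then show ?case using has_ord_unit[OF one_unit] by simp
  next
    case (Suc k)
    then show ?case using has_ord_mult[OF e Suc] by simp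
  qed
  have ord: "has_ord (of_int m) (int_val p e m)" if m: "m \<noteq> 0" for m
  proof -
    obtain m' where m': "m = int p ^ multiplicity (int p) m * m'" "\<not> int p dvd m'" using int_prime_decomp[OF m] .
    have "(of_int m :: 'a) = of_nat p ^ multiplicity (int p) m * of_int m'" by (subst m'(1)) simp
    then show ?thesis
      using has_ord_mult[OF pow has_ord_unit[OF of_int_notin_P[OF m'(2)]], of "multiplicity (int p) m"]
      unfolding int_val_def by simp
  qed
  show ?thesis
  proof (intro exI[of _ e] allI conjI impI)
    fix m
    show "nz p e m \<longleftrightarrow> (of_int m :: 'a) \<noteq> 0" using e0 ord has_ord_ne_0 unfolding nz_def by auto
    show "has_ord (of_int m) (int_val p e m)" if "(of_int m :: 'a) \<noteq> 0" by (rule ord) (use that in auto)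
  qed
qed

text \<open>Residue systems closed under addition; a maximal one has \<open>p ^ f\<close> elements and exhausts \<open>OK / P\<close>.\<close>

definition additive_system :: "'a set \<Rightarrow> nat \<Rightarrow> bool" where
  "additive_system S k \<longleftrightarrow> finite S \<and> S \<subseteq> OK \<and> card S = p ^ k \<and> 0 \<in> S \<and>
    (\<forall>x\<in>S. \<forall>y\<in>S. x \<noteq> y \<longrightarrow> x - y \<notin> P) \<and> (\<forall>x\<in>S. \<forall>y\<in>S. \<exists>z\<in>S. x + y - z \<in> P)"

text \<open>The union \<open>T\<close> of the classes of \<open>S\<close> is a subgroup, and
  \<open>x\<close> has order \<open>p\<close> modulo \<open>T\<close>. So the sums of elements of
  \<open>S\<close> and multiples of \<open>x\<close> by \<open>c < p\<close> represent a group
  \<open>p\<close> times as large.\<close>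

lemma additive_system_extend:
  assumes S: "additive_system S k" and x: "x \<in> OK" "\<And>s. s \<in> S \<Longrightarrow> x - s \<notin> P"
  shows "\<exists>S'. additive_system S' (Suc k)"
proof -
  define T where "T = {y \<in> OK. \<exists>s\<in>S. y - s \<in> P}"
  have SO: "finite S" "S \<subseteq> OK" "card S = p ^ k" "0 \<in> S"
    and inc: "\<And>x y. x \<in> S \<Longrightarrow> y \<in> S \<Longrightarrow> x - y \<in> P \<Longrightarrow> x = y"
    and cl: "\<And>x y. x \<in> S \<Longrightarrow> y \<in> S \<Longrightarrow> \<exists>z\<in>S. x + y - z \<in> P"
    using S unfolding additive_system_def by blast+
  have ST: "s \<in> T" if "s \<in> S" for s unfolding T_def using that SO zero_P by (auto intro!: bexI[of _ s])
  have PT: "y \<in> T" if "y \<in> P" for y unfolding T_def using that SO(4) P_subset by (auto intro!: bexI[of _ 0])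
  have T_add: "y + y' \<in> T" if y: "y \<in> T" "y' \<in> T" for y y'
  proof -
    obtain s s' where s: "s \<in> S" "y - s \<in> P" "s' \<in> S" "y' - s' \<in> P" using y unfolding T_def by blast
    obtain z where z: "z \<in> S" "s + s' - z \<in> P" using cl s by blast
    have "y + y' - z = (y - s) + (y' - s') + (s + s' - z)" by simp
    then have "y + y' - z \<in> P" using s z by (metis add_P)
    then show ?thesis using z(1) y add_OK unfolding T_def by blast
  qed
  have T_nat: "of_nat m * y \<in> T" if "y \<in> T" for m y
    by (induction m) (use that ST[OF SO(4)] T_add in \<open>auto simp: distrib_right\<close>)
  \<comment> \<open>Adding \<open>p - 1\<close> times \<open>y\<close> and \<open>p\<close> times
    \<open>- y\<close>, the latter an element of \<open>P\<close>, yields \<open>- y\<close>;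
    closure under sums is therefore enough.\<close>
  have T_minus: "- y \<in> T" if y: "y \<in> T" for y
  proof -
    have "of_nat p * (- y) \<in> P" using p(2) y uminus_OK unfolding T_def by (intro mult_P) auto
    then have "of_nat (p - 1) * y + of_nat p * (- y) \<in> T" using T_add[OF T_nat[OF y] PT] by blast
    moreover have "(of_nat (p - 1) :: 'a) = of_nat p - 1" using prime_gt_0_nat[OF p(1)] by (simp add: of_nat_diff)
    then have "of_nat (p - 1) * y + of_nat p * (- y) = - y" by (simp only: left_diff_distrib) simp
    ultimately show ?thesis by (simp only:)
  qed
  have T_int: "of_int m * y \<in> T" if "y \<in> T" for m y
  proof (cases m)
    case (nonneg a)
    then show ?thesis using T_nat[OF that, of a] by simp
  next
    case (neg a)
    have "(of_int m * y) = - (of_nat (Suc a) * y)" unfolding neg by (simp add: algebra_simps)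
    then show ?thesis using T_minus[OF T_nat[OF that, of "Suc a"]] by (simp only:)
  qed
  have xT: "x \<notin> T" unfolding T_def using x(2) by blast
  have mxT: "of_int m * x \<notin> T" if "\<not> int p dvd m" for m
  proof
    assume m: "of_int m * x \<in> T"
    have "coprime (int p) m" using p(1) that by (simp add: prime_imp_coprime)
    then obtain a b where ab: "a * int p + b * m = 1" using bezout_int[of "int p" m] by auto
    have "of_int a * (of_nat p * x) + of_int b * (of_int m * x) = of_int (a * int p + b * m) * x"
      by (simp add: algebra_simps)
    moreover have "of_nat p * x \<in> T" by (intro PT mult_P p x)
    ultimately have "of_int (a * int p + b * m) * x \<in> T" using T_add[OF T_int T_int] m by metis
    then show False using xT unfolding ab by simp
  qed
  define h where "h = (\<lambda>(s, c::nat). s + of_nat c * x)"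
  have key: "s = s' \<and> c = c'" if "s \<in> S" "s' \<in> S" "c < p" "c' < p" "h (s, c) - h (s', c') \<in> P" for s s' c c'
  proof -
    have eq: "of_int (int c - int c') * x = (h (s, c) - h (s', c')) + (s' + - s)"
      unfolding h_def by (simp add: algebra_simps)
    have "of_int (int c - int c') * x \<in> T" unfolding eq by (intro T_add PT T_minus ST that)
    then have "int p dvd int c - int c'" using mxT by blast
    then have "int c mod int p = int c' mod int p" by (simp add: mod_eq_dvd_iff)
    then have c: "c = c'" using that by simp
    then have "s - s' \<in> P" using that(5) unfolding h_def by simp
    then show ?thesis using inc that c by blast
  qed
  define S' where "S' = h ` (S \<times> {..<p})"
  have "inj_on h (S \<times> {..<p})"
  proof (rule inj_onI)
    fix a b assume ab: "a \<in> S \<times> {..<p}" "b \<in> S \<times> {..<p}" "h a = h b"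
    obtain s c where a: "a = (s, c)" by (cases a)
    obtain s' c' where b: "b = (s', c')" by (cases b)
    have "h (s, c) - h (s', c') \<in> P" using ab(3) zero_P unfolding a b by simp
    then show "a = b" using key[of s s' c c'] ab(1,2) unfolding a b by simp
  qed
  then have "card S' = p ^ Suc k" unfolding S'_def using SO by (simp add: card_image)
  moreover have "finite S'" "S' \<subseteq> OK"
    unfolding S'_def h_def using SO x by (auto intro!: add_OK mult_OK of_nat_OK)
  moreover have "0 \<in> S'"
    unfolding S'_def h_def using SO(4) prime_gt_0_nat[OF p(1)] by (intro image_eqI[of _ _ "(0, 0)"]) auto
  moreover have "y = y'" if y: "y \<in> S'" "y' \<in> S'" "y - y' \<in> P" for y y'
  proof -
    obtain s c where s: "y = h (s, c)" "s \<in> S" "c < p" using y(1) unfolding S'_def by auto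
    obtain s' c' where s': "y' = h (s', c')" "s' \<in> S" "c' < p" using y(2) unfolding S'_def by auto
    show ?thesis using key[of s s' c c'] s s' y(3) by simp
  qed
  moreover have "\<exists>z\<in>S'. y + y' - z \<in> P" if y: "y \<in> S'" "y' \<in> S'" for y y'
  proof -
    obtain s c s' c' where s: "y = h (s, c)" "y' = h (s', c')" "s \<in> S" "s' \<in> S" using y unfolding S'_def by auto
    obtain z where z: "z \<in> S" "s + s' - z \<in> P" using cl s by blast
    let ?r = "(c + c') mod p" and ?q = "(c + c') div p"
    have cc: "(of_nat c + of_nat c' :: 'a) = of_nat ?q * of_nat p + of_nat ?r"
      by (metis div_mult_mod_eq of_nat_add of_nat_mult)
    have "y + y' - h (z, ?r) = (s + s' - z) + ((of_nat c + of_nat c') - of_nat ?r) * x"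
      unfolding s h_def by (simp add: algebra_simps)
    also have "\<dots> = (s + s' - z) + of_nat p * (of_nat ?q * x)" unfolding cc by (simp add: algebra_simps)
    finally have "y + y' - h (z, ?r) \<in> P" using z(2) p(2) x(1) by (simp add: add_P mult_P mult_OK of_nat_OK)
    moreover have "h (z, ?r) \<in> S'" unfolding S'_def using z(1) prime_gt_0_nat[OF p(1)] by auto
    ultimately show ?thesis by blast
  qed
  ultimately have "additive_system S' (Suc k)" unfolding additive_system_def by blast
  then show ?thesis by blast
qed

text \<open>Additive systems remain incongruent modulo \<open>pi\<close>, so their sizes are bounded
  and a largest one exists; by \<open>additive_system_extend\<close> it meets every class. Its
  exponent is positive because 1 is not in \<open>P\<close>.\<close>

lemma residue_system:
  "\<exists>f S. 0 < f \<and> finite S \<and> S \<subseteq> OK \<and> card S = p ^ f \<and>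
    (\<forall>x\<in>S. \<forall>y\<in>S. x \<noteq> y \<longrightarrow> x - y \<notin> P) \<and> (\<forall>y\<in>OK. \<exists>s\<in>S. y - s \<in> P)"
proof -
  obtain Y where Y: "finite Y" "\<forall>y\<in>OK. \<exists>z\<in>OK. y - pi * z \<in> Y" using finite_reps_pi by blast
  have bound: "k < Suc (card Y)" if ex: "\<exists>S. additive_system S k" for k
  proof -
    obtain S where S: "additive_system S k" using ex by blast
    have "\<forall>y\<in>S. \<exists>z. z \<in> OK \<and> y - pi * z \<in> Y" using Y(2) S unfolding additive_system_def by blast
    from bchoice[OF this] obtain z where z: "\<And>y. y \<in> S \<Longrightarrow> z y \<in> OK \<and> y - pi * z y \<in> Y" by blast
    have "inj_on (\<lambda>y. y - pi * z y) S"
    proof (rule inj_onI, rule ccontr)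
      fix x y assume xy: "x \<in> S" "y \<in> S" "x - pi * z x = y - pi * z y" "x \<noteq> y"
      then have "x - y = pi * (z x - z y)" by (simp add: algebra_simps)
      moreover have "z x - z y \<in> OK" using z xy diff_OK by blast
      ultimately have "x - y \<in> P" using mult_P[OF pi(1)] by simp
      then show False using S xy unfolding additive_system_def by blast
    qed
    then have "p ^ k \<le> card Y" using S z Y(1) unfolding additive_system_def
      by (metis (no_types, lifting) card_inj_on_le image_subsetI)
    moreover have "k < p ^ k" using less_exp[of k] power_mono[of 2 p k] prime_ge_2_nat[OF p(1)] by linarith
    ultimately show ?thesis by simp
  qed
  have "additive_system {0} 0" unfolding additive_system_def using zero_OK zero_P by simp
  then have "\<exists>f. (\<exists>S. additive_system S f) \<and> (\<forall>k. (\<exists>S. additive_system S k) \<longrightarrow> k \<le> f)"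
    using ex_has_greatest_nat[of "\<lambda>k. \<exists>S. additive_system S k" 0 "\<lambda>k. k" "Suc (card Y)"] bound by blast
  then obtain f S where S: "additive_system S f" "\<And>k. (\<exists>S. additive_system S k) \<Longrightarrow> k \<le> f" by blast
  have full: "\<exists>s\<in>S. y - s \<in> P" if "y \<in> OK" for y
    using additive_system_extend[OF S(1) that] S(2)[of "Suc f"] by force
  have "f \<noteq> 0"
  proof
    assume "f = 0"
    then obtain s where s: "S = {s}" using S(1) unfolding additive_system_def by (auto simp: card_Suc_eq)
    then have "s = 0" using S(1) unfolding additive_system_def by auto
    then have "1 \<in> P" using full[OF one_OK] s by simp
    then show False using one_notin_P by blast
  qed
  then show ?thesis using S(1) full unfolding additive_system_def by (intro exI[of _ f] exI[of _ S]) blast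
qed

end

text \<open>Denominators outside \<open>P\<close> are invertible modulo \<open>P\<close>, so the
  localization has no more residue classes than \<open>OK\<close> has.\<close>

lemma ball_at_approx:
  assumes "ball_at 0 x"
  shows "\<exists>y\<in>OK. ball_at 1 (x - y)"
proof -
  obtain s z where sz: "s \<in> OK - P" "z \<in> OK" "s * x = z" using assms unfolding ball_at_def by auto
  obtain s' where s': "s' \<in> OK" "1 - s * s' \<in> P" using inverse_mod_P[OF sz(1)] by blast
  have "s * (x - s' * z) = (1 - s * s') * z" using sz(3) by (simp add: algebra_simps)
  then have "ball_at 1 (s * (x - s' * z))" using ball_at_P mult_P s' sz by metis
  then have "ball_at 1 (x - s' * z)" using has_ord_ball_mult[OF has_ord_unit[OF sz(1)], of 1] by simp
  then show ?thesis using s' sz mult_OK by blast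
qed

lemma valued_module_ball_at:
  assumes "\<And>m. (nz p e m \<longleftrightarrow> (of_int m :: 'a) \<noteq> 0) \<and> ((of_int m :: 'a) \<noteq> 0 \<longrightarrow> has_ord (of_int m) (int_val p e m))"
  shows "valued_module (\<lambda>m x. of_int m * x) ball_at (nz p e) (int_val p e)"
proof (unfold_locales, goal_cases)
  case (9 m g x)
  then show ?case using assms has_ord_ball_mult by blast
next
  case (10 m g x)
  then show ?case using assms[of m] ball_at_0 by simp
qed (use ball_at_0 ball_at_diff ball_at_antimono ball_at_exists in \<open>auto simp: algebra_simps\<close>)

text \<open>Multiplication by \<open>u powi (- g)\<close> carries the quotient of the balls at
  \<open>g\<close> and \<open>g + 1\<close> to the residue field, whose classes are represented by
  \<open>S\<close>; both counts follow.\<close>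

lemma place_at_P:
  assumes "\<exists>m>0. of_nat m \<in> P"
  shows "\<exists>p e f. discrete_place ball_at p e f"
proof -
  obtain p where p: "prime p" "of_nat p \<in> P" using residue_char assms by blast
  obtain e where e: "\<And>m. (nz p e m \<longleftrightarrow> (of_int m :: 'a) \<noteq> 0) \<and> ((of_int m :: 'a) \<noteq> 0 \<longrightarrow> has_ord (of_int m) (int_val p e m))"
    using ord_of_int[OF p] by blast
  obtain f S where S: "0 < f" "finite S" "S \<subseteq> OK" "card S = p ^ f"
    "\<forall>x\<in>S. \<forall>y\<in>S. x \<noteq> y \<longrightarrow> x - y \<notin> P" "\<forall>y\<in>OK. \<exists>s\<in>S. y - s \<in> P"
    using residue_system[OF p] by (elim exE conjE)
  have vm: "valued_module (\<lambda>m x. of_int m * x) ball_at (nz p e) (int_val p e)" by (rule valued_module_ball_at[OF e])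
  interpret V: valued_module "\<lambda>m x. of_int m * x" ball_at "nz p e" "int_val p e" by (rule vm)
  have scale: "ball_at (h - g) (u powi (- g) * x) \<longleftrightarrow> ball_at h x" for g h x
    using has_ord_ball_mult[OF has_ord_u_powi, of h "- g" x] by simp
  have up: "card X \<le> p ^ f" if X: "V.incongruent g X" for g X
  proof -
    have "\<exists>s\<in>S. ball_at 1 (u powi (- g) * x - s)" if "x \<in> X" for x
    proof -
      have "ball_at 0 (u powi (- g) * x)" using X that scale[of g g x] unfolding V.incongruent_def by simp
      then obtain y where y: "y \<in> OK" "ball_at 1 (u powi (- g) * x - y)" using ball_at_approx by blast
      obtain s where s: "s \<in> S" "y - s \<in> P" using S(6) y(1) by blast
      have "ball_at 1 ((u powi (- g) * x - y) + (y - s))" using V.B_add[OF y(2) ball_at_P[OF s(2)]] .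
      then show ?thesis using s(1) by auto
    qed
    then obtain \<phi> where \<phi>: "\<And>x. x \<in> X \<Longrightarrow> \<phi> x \<in> S \<and> ball_at 1 (u powi (- g) * x - \<phi> x)" by metis
    have "inj_on \<phi> X"
    proof (rule inj_onI, rule ccontr)
      fix x y assume xy: "x \<in> X" "y \<in> X" "\<phi> x = \<phi> y" "x \<noteq> y"
      have "ball_at 1 ((u powi (- g) * x - \<phi> x) - (u powi (- g) * y - \<phi> y))" 
        by (rule ball_at_diff[OF conjunct2[OF \<phi>[OF xy(1)]] conjunct2[OF \<phi>[OF xy(2)]]])
      then have "ball_at 1 (u powi (- g) * (x - y))" using xy(3) by (simp add: algebra_simps)
      then have "ball_at (g + 1) (x - y)" using scale[of "g + 1" g "x - y"] by simp
      then show False using X xy unfolding V.incongruent_def by blast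
    qed
    then have "card X \<le> card S" using \<phi> S(2) by (intro card_inj_on_le) auto
    then show ?thesis using S(4) by simp
  qed
  have low: "\<exists>X. finite X \<and> V.incongruent g X \<and> card X = p ^ f" for g
  proof -
    have up: "ball_at (g + h) (u powi g * x) \<longleftrightarrow> ball_at h x" for h x
      using has_ord_ball_mult[OF has_ord_u_powi, of h g x] by (simp add: add.commute)
    have "inj_on (\<lambda>s. u powi g * s) S" using u_ne_0 by (auto intro: inj_onI)
    then have "card ((\<lambda>s. u powi g * s) ` S) = p ^ f" using S(4) by (simp add: card_image)
    moreover have "V.incongruent g ((\<lambda>s. u powi g * s) ` S)"
      unfolding V.incongruent_def
    proof (intro conjI ballI impI)
      fix x assume "x \<in> (\<lambda>s. u powi g * s) ` S"
      then obtain s where s: "s \<in> S" "x = u powi g * s" by blast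
      show "ball_at g x" using up[of 0 s] ball_at_OK S(3) s by auto
      fix y assume "y \<in> (\<lambda>s. u powi g * s) ` S" and ne: "x \<noteq> y"
      then obtain s' where s': "s' \<in> S" "y = u powi g * s'" by blast
      have "s - s' \<notin> P" using S(5) s s' ne by auto
      then have "\<not> ball_at 1 (s - s')" using ball_at_P_iff[OF diff_OK] S(3) s s' by blast
      then show "\<not> ball_at (g + 1) (x - y)" using up[of 1 "s - s'"] s s' by (simp add: right_diff_distrib)
    qed
    ultimately show ?thesis using S(2) by blast
  qed
  have "discrete_place ball_at p e f"
    unfolding discrete_place_def using p(1) S(1) vm e up low by blast
  then show ?thesis by blast
qed

end

text \<open>Maximality of nonzero primes provides \<open>c i\<close> congruent to 1 modulo
  \<open>Q i\<close> and to 0 modulo the other primes. Then \<open>1 - (1 - c i ^ N) ^ N\<close>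
  satisfies both congruences to order \<open>N\<close>, and the combination of the
  \<open>s j\<close> with these weights is close to each \<open>s i\<close> once \<open>N\<close>
  outweighs all poles.\<close>

lemma (in base_ring) strong_approximation:
  fixes Q :: "nat \<Rightarrow> 'a set"
  assumes Q: "\<And>i. i < n \<Longrightarrow> prime_of_base A size (Q i)" and inj: "inj_on Q {..<n}"
  shows "\<exists>y. \<forall>i<n. prime_of_base.ball_at A (Q i) g (y - s i)"
proof -
  let ?B = "\<lambda>i. prime_of_base.ball_at A (Q i)"
  have sep: "\<exists>b\<in>Q j. b \<notin> Q i" if "i < n" "j < n" "i \<noteq> j" for i j
  proof (rule ccontr)
    assume "\<not> ?thesis"
    then have sub: "Q j \<subseteq> Q i" by blast
    interpret I: prime_of_base A size "Q i" using Q that by blast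
    interpret J: prime_of_base A size "Q j" using Q that by blast
    have "Q j \<noteq> Q i" using inj that unfolding inj_on_def by auto
    then obtain x where x: "x \<in> Q i" "x \<notin> Q j" using sub by blast
    then have "x \<in> OK - Q j" using I.P_subset by blast
    then obtain x' where x': "x' \<in> OK" "1 - x * x' \<in> Q j" using J.inverse_mod_P by blast
    have "(1 - x * x') + x * x' \<in> Q i" using x' x(1) sub by (intro I.add_P I.mult_P) auto
    then show False using I.one_notin_P by simp
  qed
  have idem: "\<exists>c. 1 - c \<in> Q i \<and> (\<forall>j<n. j \<noteq> i \<longrightarrow> c \<in> Q j) \<and> c \<in> OK" if i: "i < n" for i
  proof -
    interpret I: prime_of_base A size "Q i" using Q i by blast
    have "\<forall>j\<in>{..<n} - {i}. \<exists>b. b \<in> Q j \<and> b \<notin> Q i" using sep i by blast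
    from bchoice[OF this] obtain b where b: "\<And>j. j < n \<Longrightarrow> j \<noteq> i \<Longrightarrow> b j \<in> Q j \<and> b j \<notin> Q i" by auto
    have bO: "b j \<in> OK" if "j < n" "j \<noteq> i" for j
    proof -
      interpret J: prime_of_base A size "Q j" using Q that by blast
      show ?thesis using b[OF that] J.P_subset by blast
    qed
    have prod: "(\<Prod>j\<in>M. b j) \<in> OK - Q i \<and> (\<forall>j\<in>M. (\<Prod>j\<in>M. b j) \<in> Q j)" if "finite M" "M \<subseteq> {..<n} - {i}" for M
      using that
    proof (induction M)
      case empty
      then show ?case using I.one_unit by simp
    next
      case (insert j M)
      then have IH: "(\<Prod>j\<in>M. b j) \<in> OK - Q i" "\<forall>j\<in>M. (\<Prod>j\<in>M. b j) \<in> Q j" by auto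
      have j: "j < n" "j \<noteq> i" using insert.prems by auto
      have "b j \<in> OK - Q i" using b[OF j] bO[OF j] by blast
      then have "b j * (\<Prod>j\<in>M. b j) \<in> OK - Q i" using IH(1) I.notin_P_mult by blast
      moreover have "b j * (\<Prod>j\<in>M. b j) \<in> Q k" if "k \<in> insert j M" for k
      proof -
        have "k < n" using that insert.prems by auto
        then interpret K: prime_of_base A size "Q k" using Q by blast
        show ?thesis
        proof (cases "k = j")
          case True
          then show ?thesis using b[OF j] IH(1) K.mult_P[of "b j"] by blast
        next
          case False
          then show ?thesis using that IH(2) bO[OF j] K.mult_P_left[of "b j"] by blast
        qed
      qed
      ultimately show ?case using insert.hyps by simp
    qed
    let ?b = "\<Prod>j\<in>{..<n} - {i}. b j"
    have pb: "?b \<in> OK - Q i" "\<forall>j\<in>{..<n} - {i}. ?b \<in> Q j" using prod[of "{..<n} - {i}"] by auto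
    obtain b' where b': "b' \<in> OK" "1 - ?b * b' \<in> Q i" using I.inverse_mod_P[OF pb(1)] by blast
    have "?b * b' \<in> Q j" if "j < n" "j \<noteq> i" for j
    proof -
      interpret J: prime_of_base A size "Q j" using Q that by blast
      show ?thesis using pb(2) that b' by (intro J.mult_P) auto
    qed
    then show ?thesis using b' pb(1) I.mult_OK by blast
  qed
  have "\<forall>i\<in>{..<n}. \<exists>c. 1 - c \<in> Q i \<and> (\<forall>j<n. j \<noteq> i \<longrightarrow> c \<in> Q j) \<and> c \<in> OK" using idem by blast
  from bchoice[OF this] obtain c where c: "\<And>i. i < n \<Longrightarrow> 1 - c i \<in> Q i \<and> (\<forall>j<n. j \<noteq> i \<longrightarrow> c i \<in> Q j) \<and> c i \<in> OK" by auto
  \<comment> \<open>\<open>h (i, j)\<close> bounds the order of \<open>s j\<close> at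
    \<open>Q i\<close> from below and may be negative.\<close>
  have "\<forall>ij. \<exists>h. fst ij < n \<longrightarrow> ?B (fst ij) h (s (snd ij))"
    using prime_of_base.ball_at_exists[OF Q] by blast
  from choice[OF this] obtain h where h: "\<And>i j. i < n \<Longrightarrow> ?B i (h (i, j)) (s j)" by force
  define N where "N = Max ((\<lambda>ij. nat (g - h ij)) ` ({..<n} \<times> {..<n}))"
  have N: "g \<le> int N + h (i, j)" if "i < n" "j < n" for i j
  proof -
    have "nat (g - h (i, j)) \<le> N" unfolding N_def using that by (intro Max_ge) auto
    then show ?thesis by linarith
  qed
  define d where "d = (\<lambda>i. 1 - (1 - c i ^ N) ^ N)"
  have d1: "?B i (int N) (1 - d i)" if i: "i < n" for i
  proof -
    interpret I: prime_of_base A size "Q i" using Q i by blast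
    have cI: "1 - c i \<in> Q i" "c i \<in> OK" using c[OF i] by auto
    have "1 - c i ^ k \<in> Q i" for k
    proof (induction k)
      case (Suc k)
      have "1 - c i ^ Suc k = (1 - c i) + c i * (1 - c i ^ k)" by (simp add: algebra_simps)
      then show ?case using I.add_P[OF cI(1) I.mult_P_left[OF cI(2) Suc]] by (simp only:)
    qed (simp add: I.zero_P)
    then show ?thesis using I.ball_at_power_P[of "1 - c i ^ N" N] unfolding d_def by simp
  qed
  have d0: "?B j (int N) (d i)" if i: "i < n" "j < n" "j \<noteq> i" for i j
  proof -
    interpret J: prime_of_base A size "Q j" using Q i by blast
    have cJ: "c i \<in> Q j" "c i \<in> OK" using c[OF i(1)] i by auto
    have "\<exists>r\<in>OK. 1 - (1 - c i ^ N) ^ k = c i ^ N * r" for k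
    proof (induction k)
      case 0
      then show ?case using J.zero_OK by (intro bexI[of _ 0]) auto
    next
      case (Suc k)
      then obtain r where r: "r \<in> OK" "1 - (1 - c i ^ N) ^ k = c i ^ N * r" by blast
      have pk: "(1 - c i ^ N) ^ k = 1 - c i ^ N * r" unfolding r(2)[symmetric] by simp
      have "1 - (1 - c i ^ N) ^ Suc k = c i ^ N * (1 + r - c i ^ N * r)"
        unfolding power_Suc pk by (simp add: algebra_simps)
      moreover have "1 + r - c i ^ N * r \<in> OK" using r cJ J.one_OK by (intro J.diff_OK J.add_OK J.mult_OK J.power_OK)
      ultimately show ?case by blast
    qed
    then obtain r where r: "r \<in> OK" "d i = c i ^ N * r" unfolding d_def by blast
    show ?thesis using J.ball_at_mult[OF J.ball_at_power_P[OF cJ(1), of N] J.ball_at_OK[OF r(1)]] r(2) by simp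
  qed
  show ?thesis
  proof (intro exI[of _ "\<Sum>j<n. d j * s j"] allI impI)
    fix i assume i: "i < n"
    interpret I: prime_of_base A size "Q i" using Q i by blast
    have sum: "I.ball_at g (\<Sum>j\<in>M. F j)" if "finite M" "\<And>j. j \<in> M \<Longrightarrow> I.ball_at g (F j)" for M and F :: "nat \<Rightarrow> 'a"
      using that
    proof (induction M)
      case (insert j M)
      then have "I.ball_at g (F j)" "I.ball_at g (sum F M)" by auto
      from I.ball_at_diff[OF this(1) I.ball_at_diff[OF I.ball_at_0 this(2)]]
      show ?case using insert.hyps by simp
    qed (simp add: I.ball_at_0)
    have "(\<Sum>j<n. d j * s j) - s i = (\<Sum>j<n. (if j = i then d i - 1 else d j) * s j)"
    proof -
      have "(\<Sum>j<n. (if j = i then d i - 1 else d j) * s j) = (\<Sum>j<n. d j * s j - (if j = i then s i else 0))"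
        by (rule sum.cong) (auto simp: algebra_simps)
      then show ?thesis using i by (simp add: sum_subtractf)
    qed
    moreover have "I.ball_at g ((if j = i then d i - 1 else d j) * s j)" if j: "j < n" for j
    proof -
      have "I.ball_at (int N) (if j = i then d i - 1 else d j)"
        using d1[OF i] d0[OF j i] I.ball_at_diff[OF I.ball_at_0 d1[OF i]] by auto
      then have "I.ball_at (int N + h (i, j)) ((if j = i then d i - 1 else d j) * s j)"
        using h[OF i] by (rule I.ball_at_mult)
      then show ?thesis using N[OF i j] I.ball_at_antimono by blast
    qed
    ultimately show "I.ball_at g ((\<Sum>j<n. d j * s j) - s i)" using sum[of "{..<n}"] by simp
  qed
qed

section \<open>The two kinds of base rings\<close>

lemma Ints_eq: "x \<in> \<int> \<longleftrightarrow> (\<exists>k. x = of_int k)"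
  by (auto simp: Ints_def)

lemma base_ring_Ints:
  assumes "number_field TYPE('a::field)"
  shows "\<exists>size. base_ring (\<int> :: 'a set) size"
proof -
  have char: "CHAR('a) = 0" and fin: "finite_over (fractions (\<int> :: 'a set))"
    using assms unfolding number_field_def by auto
  have inj: "(of_int a :: 'a) = of_int b \<longleftrightarrow> a = b" for a b
    using of_int_eq_0_iff_char_dvd[of "a - b", where 'a = 'a] char by simp
  define size where "size = (\<lambda>x::'a. nat \<bar>THE k. x = of_int k\<bar>)"
  have size: "size (of_int k) = nat \<bar>k\<bar>" for k unfolding size_def by (simp add: inj)
  have "base_ring (\<int> :: 'a set) size"
  proof
    fix a b :: 'a assume "a \<in> \<int>" "b \<in> \<int>" "b \<noteq> 0"
    then obtain i j where ij: "a = of_int i" "b = of_int j" unfolding Ints_eq by blast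
    have j0: "j \<noteq> 0" using ij(2) \<open>b \<noteq> 0\<close> by auto
    have eq: "a - of_int (i div j) * b = of_int (i mod j)" unfolding ij by (simp flip: of_int_mult of_int_diff add: minus_div_mult_eq_mod)
    have "size (a - of_int (i div j) * b) < size b"
      unfolding eq unfolding ij size using abs_mod_less[OF j0, of i] j0 by simp
    then show "\<exists>q\<in>\<int>. a - q * b = 0 \<or> size (a - q * b) < size b" by (intro bexI[of _ "of_int (i div j)"]) auto
  next
    fix m :: nat
    have "{a \<in> \<int>. size a < m} \<subseteq> of_int ` {- int m..int m}"
      unfolding Ints_eq by (auto simp: size intro!: imageI)
    then show "finite {a \<in> \<int>. size a < m}" by (rule finite_subset) simp
  qed (use fin in auto)
  then show ?thesis by blast
qed

lemma infinite_number_field: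
  assumes "number_field TYPE('a::field)"
  shows "infinite (UNIV :: 'a set)"
proof -
  have "inj (of_int :: int \<Rightarrow> 'a)"
  proof (rule injI)
    fix a b :: int assume "(of_int a :: 'a) = of_int b"
    then show "a = b"
      using of_int_eq_0_iff_char_dvd[of "a - b", where 'a = 'a] assms unfolding number_field_def by simp
  qed
  then have "infinite (range (of_int :: int \<Rightarrow> 'a))" by (simp add: finite_image_iff)
  then show ?thesis by (rule infinite_super[OF subset_UNIV])
qed

context
  fixes t :: "'a::field"
  assumes ff: "function_field t"
begin

lemma prime_char: "prime CHAR('a)" using ff unfolding function_field_def by blast

lemma of_int_eq_0: "(of_int m :: 'a) = 0 \<longleftrightarrow> int CHAR('a) dvd m"
  by (rule of_int_eq_0_iff_char_dvd)

lemma inverse_Ints: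
  assumes "x \<in> (\<int> :: 'a set)"
  shows "inverse x \<in> \<int>"
proof (cases "x = 0")
  case False
  obtain m where m: "x = of_int m" using assms unfolding Ints_eq by blast
  then have "\<not> int CHAR('a) dvd m" using False of_int_eq_0 by auto
  then have "coprime (int CHAR('a)) m" using prime_char by (simp add: prime_imp_coprime)
  then obtain a b where ab: "a * int CHAR('a) + b * m = 1" using bezout_int[of "int CHAR('a)" m] by auto
  have "(of_int (a * int CHAR('a) + b * m) :: 'a) = of_int b * x" using m by simp
  then have "of_int b * x = 1" unfolding ab by simp
  then have "inverse x = of_int b" by (metis inverse_unique mult.commute)
  then show ?thesis by simp
qed simp

lemma finite_Ints: "finite (\<int> :: 'a set)"
proof -
  have "x \<in> of_int ` {0..<int CHAR('a)}" if x: "x \<in> (\<int> :: 'a set)" for x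
  proof -
    obtain m where m: "x = of_int m" using x unfolding Ints_eq by blast
    let ?r = "m mod int CHAR('a)"
    have "int CHAR('a) dvd m - ?r" by (simp add: mod_eq_dvd_iff[symmetric])
    then have "(of_int (m - ?r) :: 'a) = 0" using of_int_eq_0 by blast
    then have "x = of_int ?r" using m by simp
    moreover have "?r \<in> {0..<int CHAR('a)}" using prime_gt_0_nat[OF prime_char] by simp
    ultimately show ?thesis by blast
  qed
  then have "(\<int> :: 'a set) \<subseteq> of_int ` {0..<int CHAR('a)}" by blast
  then show ?thesis by (rule finite_subset) simp
qed

lemma polys_Ints_diff: "f \<in> polys_over \<int> \<Longrightarrow> g \<in> polys_over \<int> \<Longrightarrow> f - g \<in> polys_over (\<int> :: 'a set)"
  by (simp add: polys_over_def)

lemma sum_Ints: "(\<And>k. k \<in> M \<Longrightarrow> h k \<in> (\<int> :: 'a set)) \<Longrightarrow> sum h M \<in> \<int>"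
  by (induction M rule: infinite_finite_induct) auto

lemma polys_Ints_mult: "f \<in> polys_over \<int> \<Longrightarrow> g \<in> polys_over \<int> \<Longrightarrow> f * g \<in> polys_over (\<int> :: 'a set)"
  by (auto simp: polys_over_def coeff_mult intro!: sum_Ints)

lemma polys_Ints_monom: "c \<in> \<int> \<Longrightarrow> monom c k \<in> polys_over (\<int> :: 'a set)"
  by (simp add: polys_over_def)

lemma polys_Ints_0: "0 \<in> polys_over (\<int> :: 'a set)"
  by (simp add: polys_over_def)

text \<open>Long division in which the quotient keeps coefficients in the prime field
  \<open>\<int>\<close>, because leading coefficients are inverted there.\<close>

lemma poly_division:
  assumes g: "g \<in> polys_over (\<int> :: 'a set)" "g \<noteq> 0" and f: "f \<in> polys_over (\<int> :: 'a set)"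
  shows "\<exists>q\<in>polys_over (\<int> :: 'a set). f - q * g = 0 \<or> degree (f - q * g) < degree g"
  using f
proof (induction "degree f" arbitrary: f rule: less_induct)
  case less
  show ?case
  proof (cases "f = 0 \<or> degree f < degree g")
    case True
    then show ?thesis using polys_Ints_0 by (intro bexI[of _ 0]) auto
  next
    case False
    define c where "c = lead_coeff f * inverse (lead_coeff g)"
    have c: "c \<in> \<int>" unfolding c_def
      using less.prems g(1) inverse_Ints[of "lead_coeff g"] unfolding polys_over_def by (auto intro: Ints_mult)
    define m where "m = monom c (degree f - degree g)"
    have m: "m \<in> polys_over \<int>" unfolding m_def by (rule polys_Ints_monom[OF c])
    define h where "h = f - m * g"
    have h: "h \<in> polys_over \<int>" unfolding h_def by (intro polys_Ints_diff polys_Ints_mult less.prems m g)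
    have "c \<noteq> 0" unfolding c_def using False g(2) by simp
    then have dm: "degree (m * g) = degree f" unfolding m_def using g(2) False by (simp add: degree_mult_eq degree_monom_eq)
    have "lead_coeff m = c" unfolding m_def using \<open>c \<noteq> 0\<close> by (simp add: degree_monom_eq)
    then have "lead_coeff (m * g) = lead_coeff f" unfolding lead_coeff_mult using g(2) by (simp add: c_def)
    then have "coeff h (degree f) = 0" unfolding h_def using dm by simp
    moreover have "degree h \<le> degree f" unfolding h_def using dm by (intro degree_diff_le) auto
    ultimately have hd: "h = 0 \<or> degree h < degree f"
      by (metis leading_coeff_0_iff le_neq_implies_less)
    have "\<exists>q\<in>polys_over (\<int> :: 'a set). h - q * g = 0 \<or> degree (h - q * g) < degree g"
    proof (cases "h = 0")
      case True
      then show ?thesis using polys_Ints_0 by (intro bexI[of _ 0]) auto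
    next
      case False
      then show ?thesis using hd less.hyps[OF _ h] by blast
    qed
    then obtain q where q: "q \<in> polys_over \<int>" "h - q * g = 0 \<or> degree (h - q * g) < degree g" by blast
    have "f - (q + m) * g = h - q * g" unfolding h_def by (simp add: algebra_simps)
    moreover have "q + m \<in> polys_over \<int>" using q(1) m by (simp add: polys_over_def)
    ultimately show ?thesis using q(2) by (intro bexI[of _ "q + m"]) auto
  qed
qed

lemma poly_t_inj:
  assumes "f \<in> polys_over \<int>" "g \<in> polys_over \<int>" "poly f t = poly g t"
  shows "f = g"
proof -
  have "poly (f - g) t = 0" using assms by simp
  then have "f - g = 0" using ff polys_Ints_diff[OF assms(1,2)] unfolding function_field_def by blast
  then show ?thesis by simp
qed

text \<open>The size is the degree in \<open>t\<close>, well defined since \<open>t\<close> is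
  transcendental; few elements are small because the prime field is finite. Nonzero constants have
  the same size as 0, which is why \<open>euclid\<close> lists a vanishing remainder
  separately.\<close>

lemma base_ring_polys_in: "\<exists>size. base_ring (polys_in t) size"
proof -
  define size where "size = (\<lambda>x. degree (THE f. f \<in> polys_over \<int> \<and> x = poly f t))"
  have size: "size (poly f t) = degree f" if "f \<in> polys_over \<int>" for f
  proof -
    have "(THE g. g \<in> polys_over \<int> \<and> poly f t = poly g t) = f"
      using that poly_t_inj by (intro the_equality) auto
    then show ?thesis unfolding size_def by simp
  qed
  have inI: "poly f t \<in> polys_in t" if "f \<in> polys_over \<int>" for f using that unfolding polys_in_def by blast
  have "base_ring (polys_in t) size"
  proof
    have "(1 :: 'a poly) \<in> polys_over \<int>" by (auto simp: polys_over_def coeff_1)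
    from inI[OF this] show "1 \<in> polys_in t" by simp
    show "a - b \<in> polys_in t" "a * b \<in> polys_in t" if ab: "a \<in> polys_in t" "b \<in> polys_in t" for a b
    proof -
      obtain f g where fg: "f \<in> polys_over \<int>" "g \<in> polys_over \<int>" "a = poly f t" "b = poly g t"
        using ab unfolding polys_in_def by blast
      show "a - b \<in> polys_in t" using inI[OF polys_Ints_diff[OF fg(1,2)]] fg by simp
      show "a * b \<in> polys_in t" using inI[OF polys_Ints_mult[OF fg(1,2)]] fg by simp
    qed
    show "\<exists>q\<in>polys_in t. a - q * b = 0 \<or> size (a - q * b) < size b"
      if ab: "a \<in> polys_in t" "b \<in> polys_in t" "b \<noteq> 0" for a b
    proof -
      obtain f g where fg: "f \<in> polys_over \<int>" "g \<in> polys_over \<int>" "a = poly f t" "b = poly g t"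
        using ab unfolding polys_in_def by blast
      have "g \<noteq> 0" using ab(3) fg by auto
      then obtain q where q: "q \<in> polys_over \<int>" "f - q * g = 0 \<or> degree (f - q * g) < degree g"
        using poly_division[OF fg(2) _ fg(1)] by blast
      have r: "f - q * g \<in> polys_over \<int>" by (intro polys_Ints_diff polys_Ints_mult fg q)
      have "a - poly q t * b = poly (f - q * g) t" using fg by simp
      then have "a - poly q t * b = 0 \<or> size (a - poly q t * b) < size b"
        using q(2) size[OF r] size[OF fg(2)] fg(4) by auto
      then show ?thesis using inI[OF q(1)] by blast
    qed
    show "finite {a \<in> polys_in t. size a < m}" for m
    proof -
      have "{a \<in> polys_in t. size a < m} \<subseteq> (\<lambda>c. \<Sum>i<m. c i * t ^ i) ` (\<Pi>\<^sub>E i\<in>{..<m}. \<int>)"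
      proof
        fix a assume "a \<in> {a \<in> polys_in t. size a < m}"
        then obtain f where f: "f \<in> polys_over \<int>" "a = poly f t" "degree f < m"
          using size unfolding polys_in_def by auto
        have "a = (\<Sum>i\<le>degree f. coeff f i * t ^ i)" using f(2) by (simp add: poly_altdef)
        also have "\<dots> = (\<Sum>i<m. coeff f i * t ^ i)"
          by (rule sum.mono_neutral_left) (use f(3) in \<open>auto simp: coeff_eq_0\<close>)
        also have "\<dots> = (\<Sum>i<m. restrict (coeff f) {..<m} i * t ^ i)" by simp
        finally have 1: "a = (\<Sum>i<m. restrict (coeff f) {..<m} i * t ^ i)" .
        have 2: "restrict (coeff f) {..<m} \<in> (\<Pi>\<^sub>E i\<in>{..<m}. \<int>)"
          using f(1) unfolding polys_over_def by simp
        show "a \<in> (\<lambda>c. \<Sum>i<m. c i * t ^ i) ` (\<Pi>\<^sub>E i\<in>{..<m}. \<int>)"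
          by (rule image_eqI[of _ "\<lambda>c. \<Sum>i<m. c i * t ^ i", OF 1 2])
      qed
      then show ?thesis by (rule finite_subset) (intro finite_imageI finite_PiE finite_Ints, simp)
    qed
    show "finite_over (fractions (polys_in t))" using ff unfolding function_field_def by blast
  qed
  then show ?thesis by blast
qed

lemma infinite_function_field: "infinite (UNIV :: 'a set)"
proof -
  have "inj (\<lambda>k::nat. t ^ k)"
  proof (rule injI)
    fix k l :: nat assume kl: "t ^ k = t ^ l"
    have "monom (1 :: 'a) k = monom 1 l"
      by (rule poly_t_inj) (use kl in \<open>auto intro: polys_Ints_monom simp: poly_monom\<close>)
    then show "k = l" by (simp add: monom_eq_iff')
  qed
  then have "infinite (range (\<lambda>k::nat. t ^ k))" by (simp add: finite_image_iff)
  then show ?thesis by (rule infinite_super[OF subset_UNIV])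
qed

end

text \<open>When no prime imposes a condition, this place makes \<open>R\<close> the whole field and
  keeps the number of places positive.\<close>

lemma multiplicative_places_trivial:
  assumes "infinite (UNIV :: 'a::field set)" "prime CHAR('a) \<or> CHAR('a) = 0"
  shows "multiplicative_places 1 (\<lambda>_. CHAR('a)) (\<lambda>_. 0) (\<lambda>_. 0) (\<lambda>_ g x :: 'a. g \<le> 0 \<or> x = 0)"
proof -
  have nz: "nz CHAR('a) 0 m \<longleftrightarrow> (of_int m :: 'a) \<noteq> 0" for m
    unfolding nz_def by (auto simp: of_int_eq_0_iff_char_dvd)
  have vm: "valued_module (\<lambda>m x. of_int m * x) (\<lambda>g x :: 'a. g \<le> 0 \<or> x = 0) (nz CHAR('a) 0) (int_val CHAR('a) 0)"
  proof (unfold_locales, goal_cases)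
    case (8 x)
    show ?case by (intro exI[of _ 0]) simp
  qed (auto simp: algebra_simps nz int_val_def)
  show ?thesis
  proof (intro multiplicative_places.intro places.intro multiplicative_places_axioms.intro, goal_cases)
    case (2 i)
    then show ?case using assms(2) unfolding place_def by auto
  next
    case (3 i)
    then show ?case using vm by simp
  next
    case (4 i x)
    have "\<not> (1 :: int) \<le> 0" by simp
    then show ?case by blast
  next
    case (10 g s)
    show ?case by (intro exI[of _ "s 0"]) auto
  next
    case (12 i x)
    then show ?case by (intro exI[of _ 0]) auto
  qed (use assms nz in auto)
qed

text \<open>Positivity of residue characteristics enters as \<open>res\<close>, since its reason
  differs for the two base rings.\<close>

lemma existential_theory_decidable_base:
  fixes A :: "'a::field set" and S :: "'a set set" and size :: "'a \<Rightarrow> nat"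
  assumes base: "base_ring A size" and inf: "infinite (UNIV :: 'a set)"
    and char: "prime CHAR('a) \<or> CHAR('a) = 0"
    and res: "\<And>P. primeideal P (ring_of_integers A) \<Longrightarrow> P \<noteq> {0} \<Longrightarrow> \<exists>m>0. of_nat m \<in> P"
    and fin: "finite (prime_ideals A - S)"
  shows "existential_theory_decidable (S_integers A S)"
proof -
  interpret base_ring A size by (rule base)
  \<comment> \<open>The zero ideal is prime as well and may lie outside \<open>S\<close>; it imposes
    no condition.\<close>
  define T where "T = {P \<in> prime_ideals A. P \<noteq> {0} \<and> P \<notin> S}"
  have finT: "finite T" by (rule finite_subset[OF _ fin]) (auto simp: T_def)
  show ?thesis
  proof (cases "T = {}")
    case True
    interpret M: multiplicative_places 1 "\<lambda>_. CHAR('a)" "\<lambda>_. 0" "\<lambda>_. 0" "\<lambda>_ g x :: 'a. g \<le> 0 \<or> x = 0"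
      by (rule multiplicative_places_trivial[OF inf char])
    have "S_integers A S = M.R" using True unfolding S_integers_def M.R_def T_def by auto
    then show ?thesis using M.existential_theory_decidable_R by simp
  next
    case False
    define n where "n = card T"
    have n0: "0 < n" unfolding n_def using False finT by (simp add: card_gt_0_iff)
    obtain Q where Q: "bij_betw Q {0..<n} T" using ex_bij_betw_nat_finite[OF finT] unfolding n_def by blast
    have QT: "Q i \<in> T" if "i < n" for i using bij_betwE[OF Q] that by simp
    have QT': "T = Q ` {..<n}" using Q unfolding bij_betw_def by (simp add: atLeast0LessThan)
    have inj: "inj_on Q {..<n}" using Q unfolding bij_betw_def by (simp add: atLeast0LessThan)
    have pr: "prime_of_base A size (Q i)" if "i < n" for i
      using QT[OF that] base unfolding T_def prime_ideals_def
      by (intro prime_of_base.intro prime_of_base_axioms.intro) auto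
    let ?B = "\<lambda>i. prime_of_base.ball_at A (Q i)"
    have "\<forall>i\<in>{..<n}. \<exists>d. discrete_place (?B i) (fst d) (fst (snd d)) (snd (snd d))"
    proof
      fix i assume "i \<in> {..<n}"
      then interpret I: prime_of_base A size "Q i" by (intro pr) simp
      obtain p e f where "discrete_place I.ball_at p e f"
        using I.place_at_P[OF res[OF I.primeideal_P I.P_ne_0]] by blast
      then show "\<exists>d. discrete_place I.ball_at (fst d) (fst (snd d)) (snd (snd d))"
        by (intro exI[of _ "(p, e, f)"]) simp
    qed
    from bchoice[OF this] obtain d
      where d: "\<forall>i\<in>{..<n}. discrete_place (?B i) (fst (d i)) (fst (snd (d i))) (snd (snd (d i)))" ..
    define p e f where "p = (\<lambda>i. fst (d i))" and "e = (\<lambda>i. fst (snd (d i)))" and "f = (\<lambda>i. snd (snd (d i)))"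
    then have pef: "discrete_place (?B i) (p i) (e i) (f i)" if "i < n" for i using d that by simp
    note pef = pef[unfolded discrete_place_def]
    interpret M: multiplicative_places n p e f ?B
    proof (intro multiplicative_places.intro places.intro multiplicative_places_axioms.intro, goal_cases)
      case 1
      show ?case by (rule n0)
    next
      case (2 i)
      then show ?case using pef unfolding place_def by blast
    next
      case (3 i)
      then show ?case using pef by blast
    next
      case (4 i x)
      then show ?case using prime_of_base.ball_at_all_iff[OF pr] by blast
    next
      case (5 i m)
      then show ?case using pef by blast
    next
      case (6 i g X)
      then show ?case using pef by blast
    next
      case (7 i g)
      then show ?case using pef by blast
    next
      case (8 i g x)
      then show ?case using pef[of i] by simp
    next
      case 9
      show ?case by (rule inf)
    next
      case (10 g s)
      show ?case by (rule strong_approximation[OF pr inj])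
    next
      case (11 i g)
      then show ?case using prime_of_base.ball_at_1[OF pr] by blast
    next
      case (12 i x)
      interpret I: prime_of_base A size "Q i" by (rule pr[OF 12(1)])
      obtain h where "I.has_ord x h" using I.has_ord_exists[OF 12(2)] by blast
      then show ?case using I.has_ord_ball_mult by blast
    qed
    have "x \<in> S_integers A S \<longleftrightarrow> x \<in> M.R" for x
    proof -
      have "x \<in> S_integers A S \<longleftrightarrow> (\<forall>P\<in>T. 0 \<le> ord_at A P x)" unfolding S_integers_def T_def by auto
      also have "\<dots> \<longleftrightarrow> (\<forall>i<n. 0 \<le> ord_at A (Q i) x)" unfolding QT' by auto
      also have "\<dots> \<longleftrightarrow> (\<forall>i<n. ?B i 0 x)" using prime_of_base.ord_at_nonneg_iff[OF pr] by blast
      finally show ?thesis unfolding M.R_def by simp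
    qed
    then have "S_integers A S = M.R" by blast
    then show ?thesis using M.existential_theory_decidable_R by simp
  qed
qed

theorem theorem1p1:
  fixes A :: "'a::field set" and S :: "'a set set"
  assumes "(number_field TYPE('a) \<and> A = \<int>) \<or> (\<exists>t. function_field t \<and> A = polys_in t)"
    and "S \<subseteq> prime_ideals A" and "finite (prime_ideals A - S)"
  shows "existential_theory_decidable (S_integers A S)"
  using assms(1)
proof (elim disjE exE conjE)
  assume nf: "number_field TYPE('a)" and A: "A = \<int>"
  obtain size where base: "base_ring A size" using base_ring_Ints[OF nf] unfolding A by blast
  \<comment> \<open>The generator \<open>pi\<close> of \<open>P \<inter> \<int>\<close> is the image
    of a nonzero integer, whose absolute value lies in \<open>P\<close> too.\<close>
  have res: "\<exists>m>0. of_nat m \<in> P" if "primeideal P (ring_of_integers A)" "P \<noteq> {0}" for P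
  proof -
    interpret prime_of_base A size P
      using base that by (intro prime_of_base.intro prime_of_base_axioms.intro)
    obtain k where k: "pi = of_int k" using pi(2) unfolding A Ints_eq by blast
    have "k \<noteq> 0" using k pi(3) by auto
    moreover have "of_nat (nat \<bar>k\<bar>) = (if 0 \<le> k then pi else - pi)" unfolding k by (simp add: of_nat_nat)
    then have "of_nat (nat \<bar>k\<bar>) \<in> P" using pi(1) uminus_P by simp
    ultimately show ?thesis by (intro exI[of _ "nat \<bar>k\<bar>"]) auto
  qed
  have "prime CHAR('a) \<or> CHAR('a) = 0" using nf unfolding number_field_def by simp
  from existential_theory_decidable_base[OF base infinite_number_field[OF nf] this res assms(3)]
  show ?thesis .
next
  fix t assume ff: "function_field t" and A: "A = polys_in t"
  obtain size where base: "base_ring A size" using base_ring_polys_in[OF ff] unfolding A by blast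
  \<comment> \<open>The characteristic is a positive integer whose image 0 lies in
    \<open>P\<close>.\<close>
  have res: "\<exists>m>0. of_nat m \<in> P" if "primeideal P (ring_of_integers A)" "P \<noteq> {0}" for P
  proof -
    interpret prime_of_base A size P
      using base that by (intro prime_of_base.intro prime_of_base_axioms.intro)
    show ?thesis
      using prime_gt_0_nat[OF prime_char[OF ff]] zero_P by (intro exI[of _ "CHAR('a)"]) simp
  qed
  have "prime CHAR('a) \<or> CHAR('a) = 0" using prime_char[OF ff] by simp
  from existential_theory_decidable_base[OF base infinite_function_field[OF ff] this res assms(3)]
  show ?thesis .
qed

end
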